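(* Let $\beta\in(\pi,2\pi]$, let $K\subset\mathbb{R}^2$ be an unbounded convex set and let $\Lambda$ be a sector of opening angle $\beta$ (a rotated and translated copy of $\Lambda_\beta$) whose vertex lies in the interior of $K$. Assume $\partial K\cap\partial\Lambda=\emptyset$. Then the Hardy constant of $\Omega=K\cap\Lambda$ equals $c_\beta$.
   Context: The Hardy constant of a domain $\Omega\subset\mathbb{R}^2$ is the largest $c\ge0$ such that $\int_\Omega|\nabla u|^2\ge c\int_\Omega u^2/d^2$ for all $u\in C_c^\infty(\Omega)$, $d(x)=\mathrm{dist}(x,\partial\Omega)$. For $\beta\in[\pi,2\pi]$, $\Lambda_\beta=\{(r\cos\theta,r\sin\theta): r>0,\ 0<\theta<\beta\}$ and $c_\beta$ is the Hardy constant of $\Lambda_\beta$. It is known that $c_\beta\in(0,1/4]$; $c_\beta=1/4$ for $\pi\le\beta\le\beta_{cr}$, where $\beta_{cr}\in(\pi,2\pi)$ is the unique solution in $(\pi,2\pi)$ of $\tan\big(\frac{\beta_{cr}-\pi}{4}\big)=4\big(\Gamma(3/4)/\Gamma(1/4)\big)^2$; for $\beta_{cr}\le\beta<2\pi$, $c_\beta$ is the unique solution of $\sqrt{c}\tan\big(\sqrt{c}\,\frac{\beta-\pi}{2}\big)=2\Big(\frac{\Gamma(\frac{3+\sqrt{1-4c}}{4})}{\Gamma(\frac{1+\sqrt{1-4c}}{4})}\Big)^2$. *)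

theory Defs
  imports "HOL-Analysis.Analysis"
begin

fun iter_pderiv :: "(real^2) list \<Rightarrow> (real^2 \<Rightarrow> real) \<Rightarrow> real^2 \<Rightarrow> real" where
  "iter_pderiv [] f = f"
| "iter_pderiv (b # bs) f = (\<lambda>x. frechet_derivative (iter_pderiv bs f) (at x) b)"

definition smooth_fun :: "(real^2 \<Rightarrow> real) \<Rightarrow> bool" where
  "smooth_fun f \<longleftrightarrow> (\<forall>bs. set bs \<subseteq> Basis \<longrightarrow> (\<forall>x. iter_pderiv bs f differentiable (at x)))"

definition test_functions :: "(real^2) set \<Rightarrow> (real^2 \<Rightarrow> real) set" where
  "test_functions \<Omega> = {u. smooth_fun u \<and> compact (closure {x. u x \<noteq> 0})
                              \<and> closure {x. u x \<noteq> 0} \<subseteq> \<Omega>}"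

definition grad_sq :: "(real^2 \<Rightarrow> real) \<Rightarrow> real^2 \<Rightarrow> real" where
  "grad_sq u x = (\<Sum>b\<in>Basis. (frechet_derivative u (at x) b)\<^sup>2)"

definition bdist :: "(real^2) set \<Rightarrow> real^2 \<Rightarrow> real" where
  "bdist \<Omega> x = infdist x (frontier \<Omega>)"

definition hardy_constant :: "(real^2) set \<Rightarrow> real" where
  "hardy_constant \<Omega> = Sup {c. c \<ge> 0 \<and> (\<forall>u\<in>test_functions \<Omega>.
      (LINT x:\<Omega>|lborel. grad_sq u x) \<ge> c * (LINT x:\<Omega>|lborel. (u x)\<^sup>2 / (bdist \<Omega> x)\<^sup>2))}"

definition model_sector :: "real \<Rightarrow> (real^2) set" where
  "model_sector \<beta> = {vector [r * cos \<theta>, r * sin \<theta>] | r \<theta>. r > 0 \<and> 0 < \<theta> \<and> \<theta> < \<beta>}"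

definition rot2 :: "real \<Rightarrow> real^2 \<Rightarrow> real^2" where
  "rot2 \<phi> x = vector [cos \<phi> * x$1 - sin \<phi> * x$2, sin \<phi> * x$1 + cos \<phi> * x$2]"

definition sector :: "real^2 \<Rightarrow> real \<Rightarrow> real \<Rightarrow> (real^2) set" where
  "sector v \<phi> \<beta> = (\<lambda>x. v + rot2 \<phi> x) ` model_sector \<beta>"

definition c_beta :: "real \<Rightarrow> real" where
  "c_beta \<beta> = hardy_constant (model_sector \<beta>)"

end

theory Submission
  imports Defs "HOL-Real_Asymp.Real_Asymp"
begin

text \<open>Both Hardy constants reduce to the same one-dimensional inequality
  \<open>\<integral> A'\<^sup>2 \<ge> c \<integral> A\<^sup>2 / \<delta>\<^sup>2\<close> on \<open>(0, \<beta>)\<close>, where \<open>\<delta> \<theta>\<close> is the distance of the point \<open>(1, \<theta>)\<close> to the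
  boundary of the model sector. Since \<open>v\<close> is interior to \<open>K\<close>, the set \<open>\<Omega>\<close> coincides with the sector near \<open>v\<close>; the
  functions \<open>Z(ln r) A(\<theta>)\<close>, with a slowly varying \<open>Z\<close> supported far to the left, show that \<open>c\<close> valid on \<open>\<Omega>\<close> is
  valid in dimension one.

  Conversely, the one-dimensional inequality for \<open>c = \<alpha>(1 - \<alpha>)\<close>, \<open>1/2 < \<alpha> < 1\<close>, forces a lower bound on the
  slope of the solution of \<open>\<psi>'' = - c \<psi> / sin\<^sup>2\<close> that behaves like \<open>\<theta>\<^sup>\<alpha>\<close> at the edge. Hence there is a Riccati
  solution \<open>w\<close> on \<open>(0, \<beta>)\<close>, odd about \<open>\<beta>/2\<close> and small where \<open>\<delta> = 1\<close>, and \<open>F = - w \<nabla>\<theta>\<close> satisfies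
  \<open>div F - |F|\<^sup>2 = c / dist(x, \<partial>\<Lambda>)\<^sup>2\<close>. As \<open>\<partial>K\<close> and \<open>\<partial>\<Lambda>\<close> are disjoint, \<open>K\<close> contains both edges of the sector, so the
  outer normal of every supporting half-plane of \<open>K\<close> makes an angle at least \<open>\<pi>/2\<close> with both edges; in a half-plane
  with boundary distance \<open>m\<close> one uses \<open>- \<alpha> \<nabla>m / m\<close>. On the support of a test function, finitely many half-planes together
  with the sector determine \<open>d\<close> up to \<open>\<epsilon>\<close>. Blending the fields with soft-minimum weights only adds terms of
  the right sign, because the flux jumps across the interfaces are favourable: this is the angle condition together
  with the smallness of \<open>w\<close>.\<close>

section \<open>Log-polar coordinates\<close>

text \<open>Two facts make one dimension decide: the Dirichlet integral is conformally invariant,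
  hence unweighted in log-polar coordinates, and the distance to the boundary of a sector is the
  radius times a function of the angle. The model sector is the case where K is the whole plane, so
  no value of the constant is ever computed; both constants are the supremum of one set.

  The obstacle is the distance to the boundary of \<Omega>: it is a minimum over pieces, its ridges
  are uncontrolled, and each field F suits only one piece. Soft-minimum weights keep the blend
  differentiable, so that integrating divergences of compactly supported fields suffices, and the
  ridges appear only as algebraic pair terms. Their sign could fail for a large w in the middle of
  the sector. There w = k tan(k(\<beta>/2 - \<theta>)) with k = sqrt c \<le> 1/2, and this 1/2 is
  the source of the bound used in the pair estimate.

  The value c = 1/4, where \<alpha> = 1/2, escapes the cut-off argument, whose cost
  \<epsilon>^(2\<alpha> - 1) does not decay there; it is reached as a limit of smaller
  constants.\<close>

lemma vector2_eq_sum: "(vector [a, b] :: real^2) = a *\<^sub>R axis 1 1 + b *\<^sub>R axis 2 1"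
  by (simp add: vec_eq_iff forall_2 axis_def)

lemma vector2_inner: "(vector [a, b] :: real^2) \<bullet> x = a * x$1 + b * x$2"
  by (simp add: inner_vec_def sum_2)

lemma vector2_eta: "vector [x$1, x$2] = (x :: real^2)"
  by (simp add: vec_eq_iff forall_2)

lemma Basis_real2: "(Basis :: (real^2) set) = {axis 1 1, axis 2 1}"
  by (auto simp: Basis_vec_def UNIV_2)

lemma sum_Basis_real2: "(\<Sum>b\<in>(Basis::(real^2) set). f b) = f (axis 1 1) + f (axis 2 1)"
proof -
  have "axis 1 1 \<noteq> (axis 2 1 :: real^2)" by (simp add: axis_eq_axis)
  then show ?thesis by (simp add: Basis_real2)
qed

lemma continuous_on_vector2 [continuous_intros]:
  assumes "continuous_on S f" "continuous_on S g"
  shows "continuous_on S (\<lambda>x. vector [f x, g x] :: real^2)"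
  unfolding vector2_eq_sum by (intro continuous_intros assms)

lemma has_derivative_vector2 [derivative_intros]:
  assumes "(f has_derivative f') F" "(g has_derivative g') F"
  shows "((\<lambda>x. vector [f x, g x] :: real^2) has_derivative (\<lambda>h. vector [f' h, g' h])) F"
  unfolding vector2_eq_sum by (intro derivative_intros assms)

lemma borel_measurable_vector2:
  "(\<lambda>p. vector [fst p, snd p] :: real^2) \<in> borel_measurable (borel :: (real \<times> real) measure)"
  by (intro borel_measurable_continuous_onI continuous_intros)

text \<open>The domains live in \<open>real^2\<close>, where the change of variables is carried out,
  while Fubini is applied to pairs. The two Lebesgue measures correspond because they give boxes the
  same volume.\<close>

lemma lborel_real2:
  "(lborel :: (real^2) measure) = distr (lborel :: (real \<times> real) measure) borel (\<lambda>p. vector [fst p, snd p])"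
proof (rule lborel_eqI)
  show "sets (distr lborel borel (\<lambda>p::real\<times>real. vector [fst p, snd p] :: real^2)) = sets borel" by simp
  fix l u :: "real^2"
  assume le: "\<And>b. b \<in> Basis \<Longrightarrow> l \<bullet> b \<le> u \<bullet> b"
  have le': "l$1 \<le> u$1" "l$2 \<le> u$2"
    using le[of "axis 1 1"] le[of "axis 2 1"] by (auto simp: Basis_real2 inner_axis)
  have pre: "(\<lambda>p. vector [fst p, snd p] :: real^2) -` box l u \<inter> space lborel
      = box (l$1, l$2) (u$1, u$2)"
    by (auto simp: mem_box Basis_real2 inner_axis Basis_prod_def)
  have "emeasure (distr lborel borel (\<lambda>p::real\<times>real. vector [fst p, snd p] :: real^2)) (box l u)
      = emeasure lborel (box (l$1, l$2) (u$1, u$2))"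
    by (subst emeasure_distr) (use borel_measurable_vector2 pre in auto)
  also have "\<dots> = ennreal (\<Prod>b\<in>Basis. ((u$1, u$2) - (l$1, l$2)) \<bullet> b)"
    by (rule emeasure_lborel_box) (use le' in \<open>auto simp: Basis_prod_def\<close>)
  also have "(\<Prod>b\<in>Basis. ((u$1, u$2) - (l$1, l$2)) \<bullet> b) = (u$1 - l$1) * (u$2 - l$2)"
    by (simp add: Basis_prod_def)
  also have "\<dots> = (\<Prod>b\<in>Basis. (u - l) \<bullet> b)"
  proof -
    have "axis 1 1 \<noteq> (axis 2 1 :: real^2)" by (simp add: axis_eq_axis)
    then show ?thesis by (simp add: Basis_real2 inner_axis)
  qed
  finally show "emeasure (distr lborel borel (\<lambda>p::real\<times>real. vector [fst p, snd p] :: real^2)) (box l u) =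
    ennreal (\<Prod>b\<in>Basis. (u - l) \<bullet> b)" .
qed

lemma integral_lborel_real2:
  fixes f :: "real^2 \<Rightarrow> real"
  assumes "f \<in> borel_measurable borel"
  shows "(LINT x|lborel. f x) = (LINT p|lborel. f (vector [fst p, snd p]))"
    and "integrable lborel f \<longleftrightarrow> integrable lborel (\<lambda>p. f (vector [fst p, snd p]))"
proof -
  have m: "(\<lambda>p. vector [fst p, snd p] :: real^2) \<in> lborel \<rightarrow>\<^sub>M borel"
    using borel_measurable_vector2 by simp
  show "(LINT x|lborel. f x) = (LINT p|lborel. f (vector [fst p, snd p]))"
    by (subst lborel_real2, subst integral_distr[OF m assms]) simp
  show "integrable lborel f \<longleftrightarrow> integrable lborel (\<lambda>p. f (vector [fst p, snd p]))"
    by (subst lborel_real2, subst integrable_distr_eq[OF m assms]) simp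
qed

section \<open>Compactly supported integrands\<close>

lemma integrable_compact_support:
  fixes f :: "'a::euclidean_space \<Rightarrow> real"
  assumes "compact C" "continuous_on C f" "\<And>x. x \<notin> C \<Longrightarrow> f x = 0"
  shows "integrable lborel f"
proof -
  have "set_integrable lborel C f"
    unfolding set_integrable_def using borel_integrable_compact[OF assms(1,2)] by simp
  moreover have "(\<lambda>x. indicator C x *\<^sub>R f x) = f"
    using assms(3) by (auto simp: indicator_def fun_eq_iff)
  ultimately show ?thesis unfolding set_integrable_def by simp
qed

text \<open>S and the complement of C are open and cover the space, so continuity can be checked on
  each. This is how functions that are meaningful only on a strip or a sector become globally
  continuous.\<close>

lemma continuous_zero_extend:
  fixes f :: "'a::euclidean_space \<Rightarrow> 'b::real_normed_vector"
  assumes "compact C" "open S" "C \<subseteq> S" "continuous_on S f" "\<And>x. x \<notin> C \<Longrightarrow> f x = 0"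
  shows "continuous_on UNIV f"
proof -
  have "continuous_on (- C) f"
    by (rule continuous_on_eq[of _ "\<lambda>_. 0"]) (auto simp: assms(5))
  with assms have "continuous_on (S \<union> (- C)) f"
    by (intro continuous_on_open_Un) (auto simp: compact_imp_closed)
  moreover have "S \<union> - C = UNIV" using assms(3) by auto
  ultimately show ?thesis by simp
qed

text \<open>Translation invariance makes every difference quotient integrate to zero.\<close>

lemma integral_directional_derivative_0:
  fixes f f' :: "'a::euclidean_space \<Rightarrow> real" and e :: 'a
  assumes C: "compact C" and f0: "\<And>x. x \<notin> C \<Longrightarrow> f x = 0"
    and f'0: "\<And>x. x \<notin> C \<Longrightarrow> f' x = 0"
    and cf: "continuous_on UNIV f" and cf': "continuous_on UNIV f'"
    and der: "\<And>x. ((\<lambda>s. f (x + s *\<^sub>R e)) has_real_derivative f' x) (at 0)"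
  shows "(LINT x|lborel. f' x) = 0"
proof -
  define s :: "nat \<Rightarrow> real" where "s n = 1 / Suc n" for n
  have s0: "s n > 0" "s n \<le> 1" for n by (auto simp: s_def)
  have slim: "s \<longlonglongrightarrow> 0" unfolding s_def by (rule LIMSEQ_Suc[OF lim_1_over_n])
  define q where "q n x = (f (x + s n *\<^sub>R e) - f x) / s n" for n x
  have der': "((\<lambda>r. f (x + r *\<^sub>R e)) has_real_derivative f' (x + t *\<^sub>R e)) (at t)" for x t
    using der[of "x + t *\<^sub>R e"] DERIV_shift[of "\<lambda>s. f (x + t *\<^sub>R e + (s - t) *\<^sub>R e)" "f' (x + t *\<^sub>R e)" 0 t]
      DERIV_shift[of "\<lambda>s. f (x + s *\<^sub>R e)" "f' (x + t *\<^sub>R e)" 0 t]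
    by (simp add: algebra_simps)
  obtain B where B: "\<And>x. \<bar>f' x\<bar> \<le> B"
  proof -
    have "bounded (f' ` C)"
      by (intro compact_imp_bounded compact_continuous_image C) (use cf' continuous_on_subset in blast)
    then obtain B where "\<And>x. x \<in> C \<Longrightarrow> \<bar>f' x\<bar> \<le> B" unfolding bounded_iff by auto
    then have "\<bar>f' x\<bar> \<le> max B 0" for x
      by (cases "x \<in> C") (auto simp: f'0 intro: le_max_iff_disj[THEN iffD2])
    then show ?thesis using that by blast
  qed
  obtain R where R: "\<And>x. x \<in> C \<Longrightarrow> norm x \<le> R" using compact_imp_bounded[OF C] unfolding bounded_iff by auto
  \<comment> \<open>The steps \<open>s n\<close> are at most 1, so a ball with radius enlarged by
    \<open>norm e\<close> contains the supports of all difference quotients; this yields one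
    integrable majorant.\<close>
  define D where "D = cball (0::'a) (R + norm e)"
  have qD: "q n x = 0" if "x \<notin> D" for n x
  proof -
    have nx: "norm x > R + norm e" using that by (auto simp: D_def)
    have "norm (s n *\<^sub>R e) \<le> norm e" using s0[of n] by (simp add: mult_left_le_one_le)
    then have "norm (x + s n *\<^sub>R e) > R" using nx norm_triangle_ineq2[of x "- (s n *\<^sub>R e)"] by simp
    moreover have "norm x > R" using nx by (smt (verit) norm_ge_zero)
    ultimately show ?thesis using R f0 unfolding q_def by (metis diff_self div_0 not_le)
  qed
  \<comment> \<open>The mean value theorem turns the bound on \<open>f'\<close> into a bound on all
    quotients at once.\<close>
  have qB: "\<bar>q n x\<bar> \<le> B" for n x
  proof -
    obtain z where "f (x + s n *\<^sub>R e) - f (x + 0 *\<^sub>R e) = (s n - 0) * f' (x + z *\<^sub>R e)"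
      using MVT2[of 0 "s n" "\<lambda>r. f (x + r *\<^sub>R e)" "\<lambda>t. f' (x + t *\<^sub>R e)"] s0 der' by blast
    then have "q n x = f' (x + z *\<^sub>R e)" using s0[of n] by (simp add: q_def field_simps)
    then show ?thesis using B by simp
  qed
  have fint: "integrable lborel f"
    by (rule integrable_compact_support[OF C _ f0]) (use cf continuous_on_subset in blast)
  have fsint: "integrable lborel (\<lambda>x. f (x + y))" and
       fseq: "(LINT x|lborel. f (x + y)) = (LINT x|lborel. f x)" for y
  proof -
    have m: "(\<lambda>x. y + x) \<in> lborel \<rightarrow>\<^sub>M (borel :: 'a measure)" by simp
    have fm: "f \<in> borel_measurable borel" using cf borel_measurable_continuous_onI by blast
    have d: "distr lborel borel (\<lambda>x. y + x) = (lborel :: 'a measure)"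
      by (simp add: lborel_distr_plus)
    show "integrable lborel (\<lambda>x. f (x + y))"
      using integrable_distr_eq[OF m fm] fint d by (simp add: add.commute)
    show "(LINT x|lborel. f (x + y)) = (LINT x|lborel. f x)"
      using integral_distr[OF m fm] d by (simp add: add.commute)
  qed
  have q_int: "(LINT x|lborel. q n x) = 0" for n
    unfolding q_def using fsint fint fseq by simp
  have "(\<lambda>n. LINT x|lborel. q n x) \<longlonglongrightarrow> (LINT x|lborel. f' x)"
  proof (rule integral_dominated_convergence[where w = "\<lambda>x. B * indicator D x"])
    show "f' \<in> borel_measurable lborel" using cf' borel_measurable_continuous_onI by simp blast
    have "continuous_on UNIV (q n)" for n
      unfolding q_def using s0[of n] 
      by (intro continuous_intros continuous_on_compose2[OF cf]) (auto intro!: cf continuous_intros)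
    then show "q n \<in> borel_measurable lborel" for n by (simp add: borel_measurable_continuous_onI)
    have "integrable lborel (\<lambda>x. indicator D x *\<^sub>R B)"
      using borel_integrable_compact[of D "\<lambda>_. B"] unfolding D_def set_integrable_def by simp
    then show "integrable lborel (\<lambda>x. B * indicator D x)" by (simp add: mult.commute)
    show "AE x in lborel. (\<lambda>n. q n x) \<longlonglongrightarrow> f' x"
    proof (rule AE_I2)
      fix x
      have "((\<lambda>h. (f (x + (0 + h) *\<^sub>R e) - f (x + 0 *\<^sub>R e)) / h) \<longlongrightarrow> f' x) (at 0)"
        using der[of x] unfolding DERIV_def by simp
      moreover have "filterlim s (at 0) sequentially"
        unfolding filterlim_at using slim s0(1) by (auto intro: always_eventually simp: less_imp_neq[symmetric] dest!: less_imp_neq)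
      ultimately have "((\<lambda>n. (f (x + (0 + s n) *\<^sub>R e) - f (x + 0 *\<^sub>R e)) / s n) \<longlongrightarrow> f' x) sequentially"
        by (rule filterlim_compose)
      then show "(\<lambda>n. q n x) \<longlonglongrightarrow> f' x" by (simp add: q_def)
    qed
    show "AE x in lborel. norm (q n x) \<le> B * indicator D x" for n
      using qB qD by (intro AE_I2) (auto simp: indicator_def)
  qed
  then show ?thesis unfolding q_int by (simp add: LIMSEQ_const_iff)
qed

section \<open>Unit directions and the conformal log-polar map\<close>

definition dir :: "real \<Rightarrow> real^2" where
  "dir \<theta> = vector [cos \<theta>, sin \<theta>]"

text \<open>The radius is \<open>exp t\<close> because the map is then conformal: its two partial
  derivatives are orthogonal and both of length \<open>exp t\<close>, so squared gradients scale
  exactly like the Jacobian. \<open>v\<close> is the vertex and \<open>\<phi>\<close> the direction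
  of the first edge.\<close>

definition logpolar :: "real^2 \<Rightarrow> real \<Rightarrow> real \<Rightarrow> real \<Rightarrow> real^2" where
  "logpolar v \<phi> t \<theta> = v + exp t *\<^sub>R dir (\<phi> + \<theta>)"

lemma inner_dir: "dir a \<bullet> dir b = cos (a - b)"
  by (simp add: dir_def vector2_inner cos_diff)

lemma norm_dir [simp]: "norm (dir a) = 1"
  by (simp add: norm_eq_sqrt_inner inner_dir)

lemma dir_quarter: "dir (a + pi/2) = vector [- sin a, cos a]"
  by (simp add: dir_def cos_add sin_add)

lemma continuous_on_dir [continuous_intros]:
  fixes f :: "'a::t2_space \<Rightarrow> real"
  shows "continuous_on S f \<Longrightarrow> continuous_on S (\<lambda>x. dir (f x))"
  unfolding dir_def by (intro continuous_intros)

lemma has_derivative_dir: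
  assumes "(f has_derivative f') (at x within S)"
  shows "((\<lambda>x. dir (f x)) has_derivative (\<lambda>h. f' h *\<^sub>R dir (f x + pi/2))) (at x within S)"
  unfolding dir_quarter unfolding dir_def
  by (rule has_derivative_eq_rhs, (rule derivative_intros assms)+)
     (auto simp: fun_eq_iff vec_eq_iff forall_2)

lemma dir_inj:
  assumes "dir a = dir b" "\<bar>a - b\<bar> < 2 * pi"
  shows "a = b"
proof -
  have "cos (a - b) = 1" using assms(1) inner_dir[of a b] inner_dir[of b b] by simp
  then obtain n :: int where n: "a - b = of_int n * 2 * pi" using cos_one_2pi_int by auto
  have "\<bar>of_int n :: real\<bar> < 1"
    using assms(2) unfolding n by (simp add: abs_mult)
  then have "n = 0" by linarith
  with n show ?thesis by simp
qed

lemma sector_eq_logpolar: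
  "sector v \<phi> \<beta> = (\<lambda>p. logpolar v \<phi> (fst p) (snd p)) ` (UNIV \<times> {0<..<\<beta>})"
proof -
  have *: "v + rot2 \<phi> (vector [r * cos \<theta>, r * sin \<theta>]) = v + r *\<^sub>R dir (\<phi> + \<theta>)" for r \<theta>
    by (simp add: rot2_def dir_def vec_eq_iff forall_2 cos_add sin_add algebra_simps)
  have "sector v \<phi> \<beta> = {v + r *\<^sub>R dir (\<phi> + \<theta>) | r \<theta>. 0 < r \<and> 0 < \<theta> \<and> \<theta> < \<beta>}"
    unfolding sector_def model_sector_def by (auto simp: *[symmetric])
  also have "\<dots> = (\<lambda>p. logpolar v \<phi> (fst p) (snd p)) ` (UNIV \<times> {0<..<\<beta>})"
  proof (intro equalityI subsetI)
    fix x assume "x \<in> {v + r *\<^sub>R dir (\<phi> + \<theta>) | r \<theta>. 0 < r \<and> 0 < \<theta> \<and> \<theta> < \<beta>}"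
    then obtain r \<theta> where "x = v + r *\<^sub>R dir (\<phi> + \<theta>)" "0 < r" "0 < \<theta>" "\<theta> < \<beta>" by blast
    then show "x \<in> (\<lambda>p. logpolar v \<phi> (fst p) (snd p)) ` (UNIV \<times> {0<..<\<beta>})"
      by (intro image_eqI[of _ _ "(ln r, \<theta>)"]) (auto simp: logpolar_def)
  qed (force simp: logpolar_def)
  finally show ?thesis .
qed

lemma logpolar_inj:
  assumes "logpolar v \<phi> t \<theta> = logpolar v \<phi> s \<eta>" "\<bar>\<theta> - \<eta>\<bar> < 2 * pi"
  shows "t = s \<and> \<theta> = \<eta>"
proof -
  have *: "exp t *\<^sub>R dir (\<phi> + \<theta>) = exp s *\<^sub>R dir (\<phi> + \<eta>)" using assms(1) by (simp add: logpolar_def)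
  then have "norm (exp t *\<^sub>R dir (\<phi> + \<theta>)) = norm (exp s *\<^sub>R dir (\<phi> + \<eta>))" by simp
  then have "t = s" by simp
  with * dir_inj[of "\<phi> + \<theta>" "\<phi> + \<eta>"] assms(2) show ?thesis by simp
qed

text \<open>The branch of the angle starts at an arbitrary \<open>b\<close>, so that the complement
  of a sector can later be described by a single interval of angles.\<close>

lemma logpolar_polar:
  assumes "x \<noteq> v"
  obtains t \<theta> where "x = logpolar v \<phi> t \<theta>" "b \<le> \<theta>" "\<theta> < b + 2 * pi"
proof -
  define y where "y = (1 / norm (x - v)) *\<^sub>R (x - v)"
  have "norm y = 1" using assms by (simp add: y_def)
  then have "(y$1)\<^sup>2 + (y$2)\<^sup>2 = 1"
    by (simp add: norm_eq_sqrt_inner inner_vec_def sum_2 power2_eq_square)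
  then obtain s where s: "y$1 = cos s" "y$2 = sin s" using sincos_total_2pi by metis
  define n where "n = \<lfloor>(s - \<phi> - b) / (2 * pi)\<rfloor>"
  define \<theta> where "\<theta> = s - \<phi> - 2 * pi * of_int n"
  have "of_int n \<le> (s - \<phi> - b) / (2 * pi)" "(s - \<phi> - b) / (2 * pi) < of_int n + 1"
    unfolding n_def by linarith+
  then have b: "b \<le> \<theta>" "\<theta> < b + 2 * pi" by (auto simp: \<theta>_def field_simps)
  have "cos (\<phi> + \<theta>) = cos s" "sin (\<phi> + \<theta>) = sin s"
    using cos_int_2pin[of n] sin_int_2pin[of n]
    by (auto simp: \<theta>_def cos_diff sin_diff mult.commute mult.left_commute)
  then have "dir (\<phi> + \<theta>) = y" by (simp add: dir_def s[symmetric] vector2_eta)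
  then have "x = logpolar v \<phi> (ln (norm (x - v))) \<theta>"
    using assms by (simp add: logpolar_def y_def)
  then show ?thesis using that b by blast
qed

lemma has_derivative_logpolar:
  assumes "(f has_derivative f') (at x within S)" "(g has_derivative g') (at x within S)"
  shows "((\<lambda>x. logpolar v \<phi> (f x) (g x)) has_derivative
    (\<lambda>h. exp (f x) *\<^sub>R (f' h *\<^sub>R dir (\<phi> + g x) + g' h *\<^sub>R dir (\<phi> + g x + pi/2)))) (at x within S)"
proof -
  have d: "((\<lambda>x. \<phi> + g x) has_derivative g') (at x within S)"
    by (rule has_derivative_eq_rhs, (rule derivative_intros assms)+) simp
  show ?thesis unfolding logpolar_def
    by (rule has_derivative_eq_rhs, (rule derivative_intros has_derivative_dir[OF d] assms)+)
       (auto simp: fun_eq_iff algebra_simps)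
qed

lemma continuous_on_logpolar [continuous_intros]:
  fixes f g :: "'a::t2_space \<Rightarrow> real"
  shows "continuous_on S f \<Longrightarrow> continuous_on S g \<Longrightarrow> continuous_on S (\<lambda>x. logpolar v \<phi> (f x) (g x))"
  unfolding logpolar_def by (intro continuous_intros)

text \<open>The Jacobian is \<open>exp (2 * t)\<close>, and \<beta> \<le> 2 pi makes the map
  injective on the strip. The substitution is done in \<open>real^2\<close>; the passage to pairs at
  the end prepares the product integrals.\<close>

lemma logpolar_integral:
  fixes f :: "real^2 \<Rightarrow> real"
  assumes \<beta>: "\<beta> \<le> 2 * pi" and f: "integrable lborel f" and f0: "\<And>x. x \<notin> sector v \<phi> \<beta> \<Longrightarrow> f x = 0"
  shows "integrable lborel (\<lambda>p. indicator (UNIV \<times> {0<..<\<beta>}) p * (exp (2 * fst p) * f (logpolar v \<phi> (fst p) (snd p))))"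
    and "(LINT x|lborel. f x) =
      (LINT p|lborel. indicator (UNIV \<times> {0<..<\<beta>}) p * (exp (2 * fst p) * f (logpolar v \<phi> (fst p) (snd p))))"
proof -
  define S where "S = {x::real^2. 0 < x$2 \<and> x$2 < \<beta>}"
  define g where "g x = logpolar v \<phi> (x$1) (x$2)" for x :: "real^2"
  define g' where "g' x h = exp (x$1) *\<^sub>R (h$1 *\<^sub>R dir (\<phi> + x$2) + h$2 *\<^sub>R dir (\<phi> + x$2 + pi/2))" for x h :: "real^2"
  have oS: "open S" unfolding S_def
    by (intro open_Collect_conj open_Collect_less continuous_intros)
  have der: "(g has_derivative g' x) (at x within S)" for x
    unfolding g_def g'_def
    by (rule has_derivative_logpolar) (auto intro!: derivative_eq_intros bounded_linear.has_derivative[OF bounded_linear_vec_nth])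
  have inj: "inj_on g S"
  proof (rule inj_onI)
    fix x y assume "x \<in> S" "y \<in> S" "g x = g y"
    then show "x = y"
      using logpolar_inj[of v \<phi> "x$1" "x$2" "y$1" "y$2"] \<beta> by (auto simp: S_def g_def vec_eq_iff forall_2)
  qed
  have img: "g ` S = sector v \<phi> \<beta>"
  proof -
    have "S = (\<lambda>p. vector [fst p, snd p]) ` (UNIV \<times> {0<..<\<beta>})"
      by (force simp: S_def image_iff vec_eq_iff forall_2 vector2_eta intro!: exI)
    then show ?thesis by (simp add: sector_eq_logpolar image_image g_def)
  qed
  have det: "det (matrix (g' x)) = exp (2 * x$1)" for x
  proof -
    have "det (matrix (g' x)) = exp (x$1) * exp (x$1) * ((cos (\<phi> + x$2))\<^sup>2 + (sin (\<phi> + x$2))\<^sup>2)"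
      unfolding det_2 matrix_def g'_def dir_quarter unfolding dir_def by (simp add: axis_def power2_eq_square algebra_simps del: sin_cos_squared_add sin_cos_squared_add2 sin_cos_squared_add3)
    then show ?thesis by (simp add: exp_add[symmetric])
  qed
  have fm: "f \<in> borel_measurable borel" using f by auto
  have fl: "f absolutely_integrable_on UNIV"
    using f by (simp add: set_integrable_def integrable_completion)
  \<comment> \<open>The change of variables theorem speaks of functions with values in a Cartesian
    space, hence the detour through \<open>real^1\<close>.\<close>
  have vf: "(\<lambda>x. vec (f x) :: real^1) absolutely_integrable_on g ` S"
  proof -
    have "sector v \<phi> \<beta> \<in> sets lebesgue"
    proof -
      have "open (g ` S)"
      proof (rule invariance_of_domain[OF _ oS inj])
        show "continuous_on S g" using der has_derivative_continuous_on by blast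
      qed
      then show ?thesis unfolding img by simp
    qed
    then have "f absolutely_integrable_on g ` S"
      unfolding img using fl set_integrable_subset by blast
    then show ?thesis by (simp add: absolutely_integrable_on_1_iff)
  qed
  have cv: "(\<lambda>x. \<bar>det (matrix (g' x))\<bar> *\<^sub>R (vec (f (g x)) :: real^1)) absolutely_integrable_on S \<and>
     integral S (\<lambda>x. \<bar>det (matrix (g' x))\<bar> *\<^sub>R (vec (f (g x)) :: real^1)) = integral (g ` S) (\<lambda>x. vec (f x) :: real^1)"
    using has_absolute_integral_change_of_variables[OF _ der inj, of "\<lambda>x. vec (f x) :: real^1"] oS vf by simp
  define F where "F x = indicator S x * (exp (2 * x$1) * f (g x))" for x
  have Fm: "F \<in> borel_measurable borel"
  proof -
    have "continuous_on UNIV g" using der unfolding g_def by (intro continuous_intros)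
    then have "g \<in> borel_measurable borel" by (rule borel_measurable_continuous_onI)
    then have "(\<lambda>x. f (g x)) \<in> borel_measurable borel" using fm by (rule measurable_compose)
    moreover have "(\<lambda>x::real^2. exp (2 * x$1)) \<in> borel_measurable borel"
      by (intro borel_measurable_continuous_onI continuous_intros)
    ultimately show ?thesis unfolding F_def using oS by simp
  qed
  have vecn: "(\<lambda>x. \<bar>det (matrix (g' x))\<bar> *\<^sub>R (vec (f (g x)) :: real^1)) = (\<lambda>x. vec (exp (2 * x$1) * f (g x)))"
    by (simp add: det fun_eq_iff vec_eq_iff)
  have ai: "(\<lambda>x. exp (2 * x$1) * f (g x)) absolutely_integrable_on S"
    using cv unfolding vecn by (simp add: absolutely_integrable_on_1_iff)
  have Fi: "integrable lborel F"
    using ai Fm unfolding set_integrable_def F_def[abs_def] by (simp add: integrable_completion)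
  have "integral S (\<lambda>x. vec (exp (2 * x$1) * f (g x)) :: real^1) = vec (integral S (\<lambda>x. exp (2 * x$1) * f (g x)))"
    using ai by (simp add: integral_on_1_eq absolutely_integrable_on_def vec_eq_iff)
  moreover have "integral (g ` S) (\<lambda>x. vec (f x) :: real^1) = vec (integral (g ` S) f)"
    using vf by (simp add: integral_on_1_eq absolutely_integrable_on_def vec_eq_iff)
  ultimately have eq: "integral S (\<lambda>x. exp (2 * x$1) * f (g x)) = integral (g ` S) f"
    using cv unfolding vecn by (simp add: vec_eq_iff)
  have "integral (g ` S) f = integral UNIV f"
  proof -
    have "integral (g ` S) f = integral UNIV (\<lambda>x. if x \<in> g ` S then f x else 0)"
      by (simp add: integral_restrict_UNIV)
    also have "(\<lambda>x. if x \<in> g ` S then f x else 0) = f" using f0 unfolding img by auto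
    finally show ?thesis .
  qed
  also have "\<dots> = (LINT x|lborel. f x)" using integral_lborel[OF f] .
  finally have 1: "integral (g ` S) f = (LINT x|lborel. f x)" .
  have "integral S (\<lambda>x. exp (2 * x$1) * f (g x)) = integral UNIV F"
  proof -
    have "integral S (\<lambda>x. exp (2 * x$1) * f (g x)) = integral UNIV (\<lambda>x. if x \<in> S then exp (2 * x$1) * f (g x) else 0)"
      by (simp add: integral_restrict_UNIV)
    also have "(\<lambda>x. if x \<in> S then exp (2 * x$1) * f (g x) else 0) = F" by (auto simp: F_def)
    finally show ?thesis .
  qed
  also have "\<dots> = (LINT x|lborel. F x)" using integral_lborel[OF Fi] .
  finally have 2: "(LINT x|lborel. f x) = (LINT x|lborel. F x)" using eq 1 by simp
  have Fp: "F (vector [fst p, snd p]) = indicator (UNIV \<times> {0<..<\<beta>}) p * (exp (2 * fst p) * f (logpolar v \<phi> (fst p) (snd p)))" for p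
    by (cases p) (auto simp: F_def S_def g_def indicator_def)
  show "integrable lborel (\<lambda>p. indicator (UNIV \<times> {0<..<\<beta>}) p * (exp (2 * fst p) * f (logpolar v \<phi> (fst p) (snd p))))"
    using Fi integral_lborel_real2(2)[OF Fm] Fp by simp
  show "(LINT x|lborel. f x) =
      (LINT p|lborel. indicator (UNIV \<times> {0<..<\<beta>}) p * (exp (2 * fst p) * f (logpolar v \<phi> (fst p) (snd p))))"
    using 2 integral_lborel_real2(1)[OF Fm] Fp by simp
qed

text \<open>Invariance of domain gives openness without an explicit inverse of the log-polar
  map.\<close>

lemma open_sector:
  assumes "\<beta> \<le> 2 * pi"
  shows "open (sector v \<phi> \<beta>)"
proof -
  define S where "S = {x::real^2. 0 < x$2 \<and> x$2 < \<beta>}"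
  have "S = (\<lambda>p. vector [fst p, snd p]) ` (UNIV \<times> {0<..<\<beta>})"
      by (force simp: S_def image_iff vec_eq_iff forall_2 vector2_eta intro!: exI)
  then have "(\<lambda>x. logpolar v \<phi> (x$1) (x$2)) ` S = sector v \<phi> \<beta>" 
    by (simp add: sector_eq_logpolar image_image)
  moreover have "open ((\<lambda>x. logpolar v \<phi> (x$1) (x$2)) ` S)"
  proof (rule invariance_of_domain)
    show "continuous_on S (\<lambda>x. logpolar v \<phi> (x$1) (x$2))" by (intro continuous_intros)
    show "open S" unfolding S_def by (intro open_Collect_conj open_Collect_less continuous_intros)
    show "inj_on (\<lambda>x. logpolar v \<phi> (x$1) (x$2)) S"
    proof (rule inj_onI)
      fix x y assume "x \<in> S" "y \<in> S" "logpolar v \<phi> (x$1) (x$2) = logpolar v \<phi> (y$1) (y$2)"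
      then show "x = y"
        using logpolar_inj[of v \<phi> "x$1" "x$2" "y$1" "y$2"] assms by (auto simp: S_def vec_eq_iff forall_2)
    qed
  qed
  ultimately show ?thesis by simp
qed

section \<open>Blending vector fields with soft-minimum weights\<close>

text \<open>Symmetrisation: a covariance under a probability weight is half the mean product of the
  increments between two independent indices. Applied to \<nabla>m and F, it turns the derivatives
  of the weights into a sum over pairs whose signs can be inspected one by one.\<close>

lemma weighted_covariance:
  fixes \<omega> a b :: "'k \<Rightarrow> real"
  assumes "(\<Sum>k\<in>J. \<omega> k) = 1"
  shows "(\<Sum>k\<in>J. \<omega> k * (a k * b k)) - (\<Sum>k\<in>J. \<omega> k * a k) * (\<Sum>k\<in>J. \<omega> k * b k)
    = (\<Sum>k\<in>J. \<Sum>l\<in>J. \<omega> k * \<omega> l * ((a k - a l) * (b k - b l))) / 2"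
proof -
  have "(\<Sum>k\<in>J. \<Sum>l\<in>J. \<omega> k * \<omega> l * ((a k - a l) * (b k - b l)))
     = (\<Sum>k\<in>J. \<Sum>l\<in>J. (\<omega> k * (a k * b k)) * \<omega> l - (\<omega> k * a k) * (\<omega> l * b l)
          - (\<omega> k * b k) * (\<omega> l * a l) + \<omega> k * (\<omega> l * (a l * b l)))"
    by (intro sum.cong refl) (simp add: algebra_simps)
  also have "\<dots> = (\<Sum>k\<in>J. \<omega> k * (a k * b k)) * (\<Sum>l\<in>J. \<omega> l) - (\<Sum>k\<in>J. \<omega> k * a k) * (\<Sum>l\<in>J. \<omega> l * b l)
     - (\<Sum>k\<in>J. \<omega> k * b k) * (\<Sum>l\<in>J. \<omega> l * a l) + (\<Sum>k\<in>J. \<omega> k) * (\<Sum>l\<in>J. \<omega> l * (a l * b l))"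
    by (simp add: sum.distrib sum_subtractf sum_product)
  also have "\<dots> = 2 * ((\<Sum>k\<in>J. \<omega> k * (a k * b k)) - (\<Sum>k\<in>J. \<omega> k * a k) * (\<Sum>k\<in>J. \<omega> k * b k))"
    using assms by (simp add: algebra_simps)
  finally show ?thesis by simp
qed

text \<open>Nonnegativity of the variance. It bounds |F|^2 of a blend by the blend of the
  squares.\<close>

lemma weighted_square_le:
  fixes \<omega> a :: "'k \<Rightarrow> real"
  assumes "(\<Sum>k\<in>J. \<omega> k) = 1" "\<And>k. k \<in> J \<Longrightarrow> \<omega> k \<ge> 0"
  shows "(\<Sum>k\<in>J. \<omega> k * a k)\<^sup>2 \<le> (\<Sum>k\<in>J. \<omega> k * (a k)\<^sup>2)"
proof -
  have "0 \<le> (\<Sum>k\<in>J. \<Sum>l\<in>J. \<omega> k * \<omega> l * ((a k - a l) * (a k - a l))) / 2"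
    using assms(2) by (intro divide_nonneg_nonneg sum_nonneg mult_nonneg_nonneg[OF mult_nonneg_nonneg zero_le_square]) auto
  then show ?thesis
    using weighted_covariance[OF assms(1), of a a] by (simp add: power2_eq_square)
qed

text \<open>The estimate \<open>|\<nabla>u|\<^sup>2 \<ge> -div(u\<^sup>2F) + u\<^sup>2(div F - |F|\<^sup>2)\<close> for a blend \<open>F = \<Sum> \<omega>\<^sub>k F\<^sub>k\<close> of fields with soft-minimum
  weights \<open>\<omega>\<^sub>k \<sim> exp(-p m\<^sub>k)\<close>. Convexity takes care of \<open>|F|\<^sup>2\<close>; the derivatives of the weights produce the
  pair terms, which are the smoothed form of the flux jumps across the interfaces \<open>m\<^sub>k = m\<^sub>l\<close>.\<close>

lemma softmin_field_pointwise:
  fixes g m1 m2 F1 F2 D Q :: "'k \<Rightarrow> real"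
  assumes J: "finite J" "J \<noteq> {}" and g: "\<And>k. k \<in> J \<Longrightarrow> g k = exp (- (p * m k))" and p: "p \<ge> 0" and B: "B \<ge> 0"
    and Q: "\<And>k. k \<in> J \<Longrightarrow> D k - (F1 k)\<^sup>2 - (F2 k)\<^sup>2 \<ge> Q k"
    and pair: "\<And>k l. k \<in> J \<Longrightarrow> l \<in> J \<Longrightarrow> (m1 k - m1 l) * (F1 k - F1 l) + (m2 k - m2 l) * (F2 k - F2 l) \<le> 0 \<or>
       \<bar>m k - m l\<bar> \<ge> \<eta> \<and> (m1 k - m1 l) * (F1 k - F1 l) + (m2 k - m2 l) * (F2 k - F2 l) \<le> B"
  defines "Z \<equiv> \<Sum>k\<in>J. g k"
  shows "(\<Sum>k\<in>J. g k * (D k - p * (m1 k * F1 k + m2 k * F2 k))) / Z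
     + p * ((\<Sum>k\<in>J. g k * F1 k) * (\<Sum>k\<in>J. g k * m1 k) + (\<Sum>k\<in>J. g k * F2 k) * (\<Sum>k\<in>J. g k * m2 k)) / Z\<^sup>2
     - ((\<Sum>k\<in>J. g k * F1 k) / Z)\<^sup>2 - ((\<Sum>k\<in>J. g k * F2 k) / Z)\<^sup>2
     \<ge> (\<Sum>k\<in>J. g k * Q k) / Z - p * B * (real (card J))\<^sup>2 * exp (- (p * \<eta>))"
proof -
  define \<omega> where "\<omega> k = g k / Z" for k
  have gp: "g k > 0" if "k \<in> J" for k using g[OF that] by simp
  have Z: "Z > 0" unfolding Z_def using J gp by (simp add: sum_pos)
  have \<omega>1: "(\<Sum>k\<in>J. \<omega> k) = 1" unfolding \<omega>_def using Z by (simp add: sum_divide_distrib[symmetric] Z_def[symmetric])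
  have \<omega>0: "\<omega> k \<ge> 0" if "k \<in> J" for k using gp[OF that] Z by (simp add: \<omega>_def)
  have \<omega>s: "(\<Sum>k\<in>J. g k * f k) / Z = (\<Sum>k\<in>J. \<omega> k * f k)" for f
    by (simp add: \<omega>_def sum_divide_distrib)
  let ?P = "\<lambda>k l. (m1 k - m1 l) * (F1 k - F1 l) + (m2 k - m2 l) * (F2 k - F2 l)"
  \<comment> \<open>Either the pair term has the favourable sign, or the two distances differ by at
    least \<open>\<eta>\<close> and the product of the two weights is exponentially small in
    \<open>p\<close>.\<close>
  have trm: "\<omega> k * \<omega> l * ?P k l \<le> B * exp (- (p * \<eta>))" if kl: "k \<in> J" "l \<in> J" for k l
  proof (cases "?P k l \<le> 0")
    case True
    then have "\<omega> k * \<omega> l * ?P k l \<le> 0" using \<omega>0 kl by (simp add: mult_nonneg_nonpos)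
    then show ?thesis using B by (smt (verit) exp_ge_zero mult_nonneg_nonneg)
  next
    case False
    then have e: "\<bar>m k - m l\<bar> \<ge> \<eta>" "?P k l \<le> B" using pair[OF kl] by auto
    have gZ: "g i \<le> Z" if "i \<in> J" for i unfolding Z_def using that J gp by (intro member_le_sum) (auto intro: less_imp_le)
    \<comment> \<open>The product is \<open>g i / g j\<close> times the square of a weight, and
      weights are at most 1.\<close>
    have le: "\<omega> i * \<omega> j \<le> exp (- (p * (m i - m j)))" if "i \<in> J" "j \<in> J" for i j
    proof -
      have "\<omega> i * \<omega> j = (g i / g j) * (\<omega> j * \<omega> j)" using gp[OF that(2)] by (simp add: \<omega>_def)
      also have "\<dots> \<le> (g i / g j) * 1"
        using gp that gZ Z by (intro mult_left_mono mult_le_one) (auto simp: \<omega>_def intro: less_imp_le)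
      also have "\<dots> = exp (- (p * (m i - m j)))"
        using g that by (simp add: exp_diff[symmetric] algebra_simps)
      finally show ?thesis .
    qed
    have "\<omega> k * \<omega> l \<le> exp (- (p * \<bar>m k - m l\<bar>))"
      using le[OF kl] le[OF kl(2,1)] by (cases "m k \<ge> m l") (auto simp: mult.commute)
    also have "\<dots> \<le> exp (- (p * \<eta>))" using e(1) p by (simp add: mult_left_mono)
    finally have "\<omega> k * \<omega> l \<le> exp (- (p * \<eta>))" .
    then have "\<omega> k * \<omega> l * ?P k l \<le> exp (- (p * \<eta>)) * B"
      using e(2) False \<omega>0 kl by (intro mult_mono) auto
    then show ?thesis by (simp add: mult.commute)
  qed
  have "(\<Sum>k\<in>J. \<Sum>l\<in>J. \<omega> k * \<omega> l * ?P k l) \<le> (\<Sum>k\<in>J. \<Sum>l\<in>J. B * exp (- (p * \<eta>)))"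
    by (intro sum_mono trm)
  also have "\<dots> = B * (real (card J))\<^sup>2 * exp (- (p * \<eta>))" by (simp add: power2_eq_square)
  finally have cov: "(\<Sum>k\<in>J. \<Sum>l\<in>J. \<omega> k * \<omega> l * ?P k l) / 2 \<le> B * (real (card J))\<^sup>2 * exp (- (p * \<eta>))"
    using B by (smt (verit) exp_ge_zero field_sum_of_halves mult_nonneg_nonneg zero_le_power2 divide_nonpos_nonneg half_gt_zero_iff)
  have covE: "(\<Sum>k\<in>J. \<omega> k * (m1 k * F1 k + m2 k * F2 k)) - (\<Sum>k\<in>J. \<omega> k * F1 k) * (\<Sum>k\<in>J. \<omega> k * m1 k)
       - (\<Sum>k\<in>J. \<omega> k * F2 k) * (\<Sum>k\<in>J. \<omega> k * m2 k) = (\<Sum>k\<in>J. \<Sum>l\<in>J. \<omega> k * \<omega> l * ?P k l) / 2"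
  proof -
    have "(\<Sum>k\<in>J. \<Sum>l\<in>J. \<omega> k * \<omega> l * ?P k l) = (\<Sum>k\<in>J. \<Sum>l\<in>J. \<omega> k * \<omega> l * ((m1 k - m1 l) * (F1 k - F1 l)))
       + (\<Sum>k\<in>J. \<Sum>l\<in>J. \<omega> k * \<omega> l * ((m2 k - m2 l) * (F2 k - F2 l)))"
      unfolding sum.distrib[symmetric] distrib_left ..
    moreover have "(\<Sum>k\<in>J. \<omega> k * (m1 k * F1 k + m2 k * F2 k)) = (\<Sum>k\<in>J. \<omega> k * (m1 k * F1 k)) + (\<Sum>k\<in>J. \<omega> k * (m2 k * F2 k))"
      unfolding sum.distrib[symmetric] distrib_left ..
    ultimately show ?thesis
      using weighted_covariance[OF \<omega>1, of m1 F1] weighted_covariance[OF \<omega>1, of m2 F2]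
      by (simp add: add_divide_distrib mult.commute)
  qed
  have sq: "(\<Sum>k\<in>J. \<omega> k * F1 k)\<^sup>2 \<le> (\<Sum>k\<in>J. \<omega> k * (F1 k)\<^sup>2)" "(\<Sum>k\<in>J. \<omega> k * F2 k)\<^sup>2 \<le> (\<Sum>k\<in>J. \<omega> k * (F2 k)\<^sup>2)"
    by (rule weighted_square_le[OF \<omega>1 \<omega>0]; assumption)+
  have "(\<Sum>k\<in>J. \<omega> k * Q k) \<le> (\<Sum>k\<in>J. \<omega> k * (D k - (F1 k)\<^sup>2 - (F2 k)\<^sup>2))"
    using Q \<omega>0 by (intro sum_mono mult_left_mono)
  also have "\<dots> = (\<Sum>k\<in>J. \<omega> k * D k) - (\<Sum>k\<in>J. \<omega> k * (F1 k)\<^sup>2) - (\<Sum>k\<in>J. \<omega> k * (F2 k)\<^sup>2)"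
    by (simp add: algebra_simps sum_subtractf sum.distrib)
  finally have Qs: "(\<Sum>k\<in>J. \<omega> k * Q k) \<le> (\<Sum>k\<in>J. \<omega> k * D k) - (\<Sum>k\<in>J. \<omega> k * F1 k)\<^sup>2 - (\<Sum>k\<in>J. \<omega> k * F2 k)\<^sup>2"
    using sq by linarith
  have "(\<Sum>k\<in>J. \<omega> k * (D k - p * (m1 k * F1 k + m2 k * F2 k))) 
      = (\<Sum>k\<in>J. \<omega> k * D k) - p * (\<Sum>k\<in>J. \<omega> k * (m1 k * F1 k + m2 k * F2 k))"
    by (simp add: algebra_simps sum_subtractf sum_distrib_left sum.distrib)
  moreover have "p * ((\<Sum>k\<in>J. g k * F1 k) * (\<Sum>k\<in>J. g k * m1 k) + (\<Sum>k\<in>J. g k * F2 k) * (\<Sum>k\<in>J. g k * m2 k)) / Z\<^sup>2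
      = p * ((\<Sum>k\<in>J. \<omega> k * F1 k) * (\<Sum>k\<in>J. \<omega> k * m1 k) + (\<Sum>k\<in>J. \<omega> k * F2 k) * (\<Sum>k\<in>J. \<omega> k * m2 k))"
    unfolding \<omega>s[symmetric] using Z by (simp add: power2_eq_square field_simps)
  moreover have "p * ((\<Sum>k\<in>J. \<Sum>l\<in>J. \<omega> k * \<omega> l * ?P k l) / 2) \<le> p * (B * (real (card J))\<^sup>2 * exp (- (p * \<eta>)))"
    using cov p by (intro mult_left_mono)
  ultimately show ?thesis
    using Qs unfolding \<omega>s covE[symmetric] by (simp add: algebra_simps)
qed

text \<open>Integrated form of the pointwise estimate: the divergence of U^2 F integrates to 0
  because U has compact support, and the cross term with \<nabla>U disappears by completing the
  square. Each coordinate direction is integrated separately, which is why the assumptions speak of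
  derivatives along the two axes.\<close>

lemma softmin_field_inequality:
  fixes U Ut Us :: "real \<times> real \<Rightarrow> real" and m m1 m2 F1 F2 F11 F22 Q :: "'k \<Rightarrow> real \<times> real \<Rightarrow> real"
  assumes J: "finite J" "J \<noteq> {}" and p: "p \<ge> 0" and B: "B \<ge> 0"
    and C: "compact C" "open S" "C \<subseteq> S"
    and U0: "\<And>x. x \<notin> C \<Longrightarrow> U x = 0 \<and> Ut x = 0 \<and> Us x = 0"
    and cU: "continuous_on UNIV U" "continuous_on UNIV Ut" "continuous_on UNIV Us"
    and dU: "\<And>x. ((\<lambda>s. U (x + s *\<^sub>R (1, 0))) has_real_derivative Ut x) (at 0)"
            "\<And>x. ((\<lambda>s. U (x + s *\<^sub>R (0, 1))) has_real_derivative Us x) (at 0)"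
    and cm: "\<And>k. k \<in> J \<Longrightarrow> continuous_on S (m k)" "\<And>k. k \<in> J \<Longrightarrow> continuous_on S (m1 k)" "\<And>k. k \<in> J \<Longrightarrow> continuous_on S (m2 k)"
    and cF: "\<And>k. k \<in> J \<Longrightarrow> continuous_on S (F1 k)" "\<And>k. k \<in> J \<Longrightarrow> continuous_on S (F2 k)"
            "\<And>k. k \<in> J \<Longrightarrow> continuous_on S (F11 k)" "\<And>k. k \<in> J \<Longrightarrow> continuous_on S (F22 k)"
    and cQ: "\<And>k. k \<in> J \<Longrightarrow> continuous_on S (Q k)"
    and dm: "\<And>k x. k \<in> J \<Longrightarrow> x \<in> S \<Longrightarrow> ((\<lambda>s. m k (x + s *\<^sub>R (1, 0))) has_real_derivative m1 k x) (at 0)"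
            "\<And>k x. k \<in> J \<Longrightarrow> x \<in> S \<Longrightarrow> ((\<lambda>s. m k (x + s *\<^sub>R (0, 1))) has_real_derivative m2 k x) (at 0)"
    and dF: "\<And>k x. k \<in> J \<Longrightarrow> x \<in> S \<Longrightarrow> ((\<lambda>s. F1 k (x + s *\<^sub>R (1, 0))) has_real_derivative F11 k x) (at 0)"
            "\<And>k x. k \<in> J \<Longrightarrow> x \<in> S \<Longrightarrow> ((\<lambda>s. F2 k (x + s *\<^sub>R (0, 1))) has_real_derivative F22 k x) (at 0)"
    and Q: "\<And>k x. k \<in> J \<Longrightarrow> x \<in> C \<Longrightarrow> F11 k x + F22 k x - (F1 k x)\<^sup>2 - (F2 k x)\<^sup>2 \<ge> Q k x"
    and pair: "\<And>k l x. k \<in> J \<Longrightarrow> l \<in> J \<Longrightarrow> x \<in> C \<Longrightarrow>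
       (m1 k x - m1 l x) * (F1 k x - F1 l x) + (m2 k x - m2 l x) * (F2 k x - F2 l x) \<le> 0 \<or>
       \<bar>m k x - m l x\<bar> \<ge> \<eta> \<and> (m1 k x - m1 l x) * (F1 k x - F1 l x) + (m2 k x - m2 l x) * (F2 k x - F2 l x) \<le> B"
  shows "(LINT x|lborel. (Ut x)\<^sup>2 + (Us x)\<^sup>2) \<ge>
    (LINT x|lborel. (U x)\<^sup>2 * ((\<Sum>k\<in>J. exp (- (p * m k x)) * Q k x) / (\<Sum>k\<in>J. exp (- (p * m k x)))
        - p * B * (real (card J))\<^sup>2 * exp (- (p * \<eta>))))"
proof -
  define g where "g k x = exp (- (p * m k x))" for k x
  define Z where "Z x = (\<Sum>k\<in>J. g k x)" for x
  define N1 where "N1 x = (\<Sum>k\<in>J. g k x * F1 k x)" for x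
  define N2 where "N2 x = (\<Sum>k\<in>J. g k x * F2 k x)" for x
  \<comment> \<open>With the blend F = N / Z, \<open>R1\<close> is the first partial derivative of
    U^2 F1 and \<open>R2\<close> the second partial derivative of U^2 F2.\<close>
  define R1 where "R1 x = 2 * U x * Ut x * (N1 x / Z x) + (U x)\<^sup>2 *
     ((\<Sum>k\<in>J. g k x * (F11 k x - p * (m1 k x * F1 k x))) / Z x + p * (N1 x * (\<Sum>k\<in>J. g k x * m1 k x)) / (Z x)\<^sup>2)" for x
  define R2 where "R2 x = 2 * U x * Us x * (N2 x / Z x) + (U x)\<^sup>2 *
     ((\<Sum>k\<in>J. g k x * (F22 k x - p * (m2 k x * F2 k x))) / Z x + p * (N2 x * (\<Sum>k\<in>J. g k x * m2 k x)) / (Z x)\<^sup>2)" for x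
  define E where "E x = (\<Sum>k\<in>J. g k x * Q k x) / Z x - p * B * (real (card J))\<^sup>2 * exp (- (p * \<eta>))" for x
  have Zpos: "Z x > 0" for x unfolding Z_def g_def using J by (simp add: sum_pos)
  have Znz: "Z x \<noteq> 0" for x using Zpos[of x] by simp
  note cUS = cU[THEN continuous_on_subset[OF _ subset_UNIV]]
  have cg: "continuous_on S (g k)" if "k \<in> J" for k
    unfolding g_def using cm(1)[OF that] by (intro continuous_intros)
  have cs: "continuous_on S (\<lambda>x. \<Sum>k\<in>J. g k x * f k x)" if "\<And>k. k \<in> J \<Longrightarrow> continuous_on S (f k)" for f
    using that cg by (intro continuous_on_sum continuous_on_mult)
  have cZ: "continuous_on S Z" unfolding Z_def using cg by (intro continuous_on_sum)
  have cN: "continuous_on S N1" "continuous_on S N2"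
    unfolding N1_def N2_def by (intro cs cF; assumption)+
  have cs1: "continuous_on S (\<lambda>x. \<Sum>k\<in>J. g k x * (F11 k x - p * (m1 k x * F1 k x)))"
    and cs2: "continuous_on S (\<lambda>x. \<Sum>k\<in>J. g k x * (F22 k x - p * (m2 k x * F2 k x)))"
    by (intro cs continuous_on_diff continuous_on_mult continuous_on_const cF cm; assumption)+
  have ZS: "\<forall>x\<in>S. Z x \<noteq> 0" "\<forall>x\<in>S. (Z x)\<^sup>2 \<noteq> 0" using Znz by auto
  have cR1: "continuous_on S R1" and cR2: "continuous_on S R2"
    unfolding R1_def R2_def
    by (intro continuous_on_add continuous_on_mult continuous_on_divide continuous_on_power continuous_on_const
      cs1 cs2 cs[OF cm(2)] cs[OF cm(3)] cZ cN cUS ZS; assumption)+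
  have cE: "continuous_on S E"
    unfolding E_def by (intro continuous_on_diff continuous_on_divide continuous_on_const cs[OF cQ] cZ ZS; assumption)
  have ext: "continuous_on UNIV f" if "continuous_on S f" "\<And>x. x \<notin> C \<Longrightarrow> f x = 0" for f :: "real \<times> real \<Rightarrow> real"
    using continuous_zero_extend[OF C that] .
  have R1z: "R1 x = 0" and R2z: "R2 x = 0" if "x \<notin> C" for x using that by (auto simp: R1_def R2_def U0)
  have cR1U: "continuous_on UNIV R1" and cR2U: "continuous_on UNIV R2"
    using ext[OF cR1 R1z] ext[OF cR2 R2z] by auto
  have nhds: "\<exists>e>0. \<forall>s::real. \<bar>s\<bar> < e \<longrightarrow> x + s *\<^sub>R d \<in> T" if T: "open T" "x \<in> T" "norm d = 1" for T :: "(real \<times> real) set" and x d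
  proof -
    obtain e where "e > 0" "ball x e \<subseteq> T" using openE[OF T(1,2)] by metis
    moreover have "x + s *\<^sub>R d \<in> ball x e" if "\<bar>s\<bar> < e" for s using that \<open>norm d = 1\<close> by (simp add: dist_norm)
    ultimately show ?thesis by blast
  qed
  \<comment> \<open>The complement of C is open, so a function vanishing there vanishes on a whole
    segment around the point, whatever the fields do outside S.\<close>
  have der0: "((\<lambda>s. f (x + s *\<^sub>R d)) has_real_derivative 0) (at 0)"
    if f: "\<And>y. y \<notin> C \<Longrightarrow> f y = 0" "x \<notin> C" "norm d = 1" for f :: "real \<times> real \<Rightarrow> real" and x d
  proof -
    obtain e where e: "e > 0" "\<And>s. \<bar>s\<bar> < e \<Longrightarrow> x + s *\<^sub>R d \<in> - C"
      using nhds[OF open_Compl[OF compact_imp_closed[OF C(1)]], of x d] f(2,3) by auto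
    have "((\<lambda>s::real. 0) has_real_derivative 0) (at 0)" by simp
    then show ?thesis
    proof (rule DERIV_cong_ev[THEN iffD1, rotated 3])
      show "\<forall>\<^sub>F s in nhds 0. 0 = f (x + s *\<^sub>R d)"
        unfolding eventually_nhds_metric using e f(1) by (intro exI[of _ e]) (auto simp: dist_norm)
    qed auto
  qed
  have [simp]: "y + (0, 0) = y" for y :: "real \<times> real" by (metis add_0_right zero_prod_def)
  have I1: "(LINT x|lborel. R1 x) = 0"
  proof (rule integral_directional_derivative_0[where f="\<lambda>x. (U x)\<^sup>2 * (N1 x / Z x)" and e="(1,0)" and C=C])
    show "continuous_on UNIV (\<lambda>x. (U x)\<^sup>2 * (N1 x / Z x))"
      using Znz by (intro ext continuous_intros cZ cN cUS) (auto simp: U0)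
    show "((\<lambda>s. (U (x + s *\<^sub>R (1, 0)))\<^sup>2 * (N1 (x + s *\<^sub>R (1, 0)) / Z (x + s *\<^sub>R (1, 0)))) has_real_derivative R1 x) (at 0)" for x
    proof (cases "x \<in> C")
      case False
      then show ?thesis using der0[of "\<lambda>x. (U x)\<^sup>2 * (N1 x / Z x)" x "(1,0)"] by (simp add: R1_def U0 norm_Pair)
    next
      case True
      then have xS: "x \<in> S" using C by auto
      have dg: "((\<lambda>s. g k (x + s *\<^sub>R (1, 0))) has_real_derivative - (p * m1 k x) * g k x) (at 0)" if "k \<in> J" for k
        unfolding g_def by (rule derivative_eq_intros dm(1)[OF that xS] | simp)+
      have dZ: "((\<lambda>s. Z (x + s *\<^sub>R (1, 0))) has_real_derivative (\<Sum>k\<in>J. - (p * m1 k x) * g k x)) (at 0)"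
        unfolding Z_def by (intro DERIV_sum dg)
      have dN: "((\<lambda>s. N1 (x + s *\<^sub>R (1, 0))) has_real_derivative (\<Sum>k\<in>J. g k x * (F11 k x - p * (m1 k x * F1 k x)))) (at 0)"
        unfolding N1_def
      proof (intro DERIV_sum)
        fix k assume k: "k \<in> J"
        show "((\<lambda>s. g k (x + s *\<^sub>R (1, 0)) * F1 k (x + s *\<^sub>R (1, 0))) has_real_derivative g k x * (F11 k x - p * (m1 k x * F1 k x))) (at 0)"
          by (rule derivative_eq_intros dg[OF k] dF(1)[OF k xS] | simp add: algebra_simps)+
      qed
      have sZ: "(\<Sum>k\<in>J. - (p * m1 k x) * g k x) = - p * (\<Sum>k\<in>J. g k x * m1 k x)"
        by (simp add: sum_distrib_left algebra_simps sum_negf)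
      show ?thesis unfolding R1_def
        by (rule derivative_eq_intros dZ[unfolded sZ] dN dU(1) Znz refl)+
           (use Znz[of x] in \<open>simp add: field_simps power2_eq_square\<close>)
    qed
  qed (use C(1) cR1U in \<open>auto simp: R1z U0\<close>)
  have I2: "(LINT x|lborel. R2 x) = 0"
  proof (rule integral_directional_derivative_0[where f="\<lambda>x. (U x)\<^sup>2 * (N2 x / Z x)" and e="(0,1)" and C=C])
    show "continuous_on UNIV (\<lambda>x. (U x)\<^sup>2 * (N2 x / Z x))"
      using Znz by (intro ext continuous_intros cZ cN cUS) (auto simp: U0)
    show "((\<lambda>s. (U (x + s *\<^sub>R (0, 1)))\<^sup>2 * (N2 (x + s *\<^sub>R (0, 1)) / Z (x + s *\<^sub>R (0, 1)))) has_real_derivative R2 x) (at 0)" for x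
    proof (cases "x \<in> C")
      case False
      then show ?thesis using der0[of "\<lambda>x. (U x)\<^sup>2 * (N2 x / Z x)" x "(0,1)"] by (simp add: R2_def U0 norm_Pair)
    next
      case True
      then have xS: "x \<in> S" using C by auto
      have dg: "((\<lambda>s. g k (x + s *\<^sub>R (0, 1))) has_real_derivative - (p * m2 k x) * g k x) (at 0)" if "k \<in> J" for k
        unfolding g_def by (rule derivative_eq_intros dm(2)[OF that xS] | simp)+
      have dZ: "((\<lambda>s. Z (x + s *\<^sub>R (0, 1))) has_real_derivative (\<Sum>k\<in>J. - (p * m2 k x) * g k x)) (at 0)"
        unfolding Z_def by (intro DERIV_sum dg)
      have dN: "((\<lambda>s. N2 (x + s *\<^sub>R (0, 1))) has_real_derivative (\<Sum>k\<in>J. g k x * (F22 k x - p * (m2 k x * F2 k x)))) (at 0)"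
        unfolding N2_def
      proof (intro DERIV_sum)
        fix k assume k: "k \<in> J"
        show "((\<lambda>s. g k (x + s *\<^sub>R (0, 1)) * F2 k (x + s *\<^sub>R (0, 1))) has_real_derivative g k x * (F22 k x - p * (m2 k x * F2 k x))) (at 0)"
          by (rule derivative_eq_intros dg[OF k] dF(2)[OF k xS] | simp add: algebra_simps)+
      qed
      have sZ: "(\<Sum>k\<in>J. - (p * m2 k x) * g k x) = - p * (\<Sum>k\<in>J. g k x * m2 k x)"
        by (simp add: sum_distrib_left algebra_simps sum_negf)
      show ?thesis unfolding R2_def
        by (rule derivative_eq_intros dZ[unfolded sZ] dN dU(2) Znz refl)+
           (use Znz[of x] in \<open>simp add: field_simps power2_eq_square\<close>)
    qed
  qed (use C(1) cR2U in \<open>auto simp: R2z U0\<close>)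
  have intg: "integrable lborel f" if "continuous_on UNIV f" "\<And>x. x \<notin> C \<Longrightarrow> f x = 0" for f :: "real \<times> real \<Rightarrow> real"
    using integrable_compact_support[OF C(1) continuous_on_subset[OF that(1)] that(2)] by auto
  have iR: "integrable lborel R1" "integrable lborel R2"
    using intg[OF cR1U R1z] intg[OF cR2U R2z] by auto
  have iG: "integrable lborel (\<lambda>x. (Ut x)\<^sup>2)" "integrable lborel (\<lambda>x. (Us x)\<^sup>2)"
    by (intro intg continuous_intros cUS; simp add: U0)+
  have iE: "integrable lborel (\<lambda>x. (U x)\<^sup>2 * E x)"
    by (intro intg ext continuous_intros cUS cE) (auto simp: U0)
  \<comment> \<open>The difference of |\<nabla>U|^2 + div(U^2 F) and U^2 (div F - |F|^2) is the
    square |\<nabla>U + U F|^2.\<close>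
  have pw: "(U x)\<^sup>2 * E x \<le> (Ut x)\<^sup>2 + (Us x)\<^sup>2 + R1 x + R2 x" for x
  proof (cases "x \<in> C")
    case False then show ?thesis by (simp add: U0 R1_def R2_def)
  next
    case True
    have s: "(\<Sum>k\<in>J. g k x * (F11 k x - p * (m1 k x * F1 k x))) + (\<Sum>k\<in>J. g k x * (F22 k x - p * (m2 k x * F2 k x)))
      = (\<Sum>k\<in>J. g k x * ((F11 k x + F22 k x) - p * (m1 k x * F1 k x + m2 k x * F2 k x)))"
      unfolding sum.distrib[symmetric] by (intro sum.cong) (auto simp: algebra_simps)
    have "E x \<le> (\<Sum>k\<in>J. g k x * ((F11 k x + F22 k x) - p * (m1 k x * F1 k x + m2 k x * F2 k x))) / Z x
     + p * (N1 x * (\<Sum>k\<in>J. g k x * m1 k x) + N2 x * (\<Sum>k\<in>J. g k x * m2 k x)) / (Z x)\<^sup>2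
     - (N1 x / Z x)\<^sup>2 - (N2 x / Z x)\<^sup>2"
      unfolding E_def Z_def N1_def N2_def
      by (rule softmin_field_pointwise[OF J _ p B, where m = "\<lambda>k. m k x"])
         (simp add: g_def, rule Q[OF _ True], assumption, rule pair[OF _ _ True], assumption+)
    then have "(U x)\<^sup>2 * E x \<le> (U x)\<^sup>2 * ((\<Sum>k\<in>J. g k x * ((F11 k x + F22 k x) - p * (m1 k x * F1 k x + m2 k x * F2 k x))) / Z x
     + p * (N1 x * (\<Sum>k\<in>J. g k x * m1 k x) + N2 x * (\<Sum>k\<in>J. g k x * m2 k x)) / (Z x)\<^sup>2
     - (N1 x / Z x)\<^sup>2 - (N2 x / Z x)\<^sup>2)" by (intro mult_left_mono) auto
    also have "\<dots> = R1 x + R2 x - 2 * U x * Ut x * (N1 x / Z x) - 2 * U x * Us x * (N2 x / Z x)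
         - (U x)\<^sup>2 * (N1 x / Z x)\<^sup>2 - (U x)\<^sup>2 * (N2 x / Z x)\<^sup>2"
      unfolding R1_def R2_def s[symmetric] by (simp add: algebra_simps add_divide_distrib)
    also have "\<dots> = R1 x + R2 x + (Ut x)\<^sup>2 + (Us x)\<^sup>2 - (Ut x + U x * (N1 x / Z x))\<^sup>2 - (Us x + U x * (N2 x / Z x))\<^sup>2"
      by (simp add: power2_eq_square algebra_simps)
    finally show ?thesis by (smt (verit) zero_le_power2)
  qed
  have "(LINT x|lborel. (U x)\<^sup>2 * E x) \<le> (LINT x|lborel. (Ut x)\<^sup>2 + (Us x)\<^sup>2 + R1 x + R2 x)"
    using iR iG by (intro integral_mono iE Bochner_Integration.integrable_add pw)
  also have "\<dots> = (LINT x|lborel. (Ut x)\<^sup>2 + (Us x)\<^sup>2)"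
    using iR iG I1 I2 by simp
  finally show ?thesis unfolding E_def Z_def g_def by simp
qed

text \<open>The limit p to infinity. On C some m is at most \<delta>, so an index with m > \<delta>
  + \<epsilon> has weight at most exp(-p \<epsilon>) and drops out, while every other index carries
  at least the desired potential. The shift \<epsilon> makes this rate uniform on C.\<close>

lemma softmin_hardy_inequality:
  fixes U Ut Us :: "real \<times> real \<Rightarrow> real" and m m1 m2 F1 F2 F11 F22 :: "'k \<Rightarrow> real \<times> real \<Rightarrow> real"
    and c \<epsilon> \<eta> :: real and W \<delta> :: "real \<times> real \<Rightarrow> real"
  assumes J: "finite J" "J \<noteq> {}" and B: "B \<ge> 0"
    and C: "compact C" "open S" "C \<subseteq> S"
    and U0: "\<And>x. x \<notin> C \<Longrightarrow> U x = 0 \<and> Ut x = 0 \<and> Us x = 0"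
    and cU: "continuous_on UNIV U" "continuous_on UNIV Ut" "continuous_on UNIV Us"
    and dU: "\<And>x. ((\<lambda>s. U (x + s *\<^sub>R (1, 0))) has_real_derivative Ut x) (at 0)"
            "\<And>x. ((\<lambda>s. U (x + s *\<^sub>R (0, 1))) has_real_derivative Us x) (at 0)"
    and cm: "\<And>k. k \<in> J \<Longrightarrow> continuous_on S (m k)" "\<And>k. k \<in> J \<Longrightarrow> continuous_on S (m1 k)" "\<And>k. k \<in> J \<Longrightarrow> continuous_on S (m2 k)"
    and cF: "\<And>k. k \<in> J \<Longrightarrow> continuous_on S (F1 k)" "\<And>k. k \<in> J \<Longrightarrow> continuous_on S (F2 k)"
            "\<And>k. k \<in> J \<Longrightarrow> continuous_on S (F11 k)" "\<And>k. k \<in> J \<Longrightarrow> continuous_on S (F22 k)"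
    and dm: "\<And>k x. k \<in> J \<Longrightarrow> x \<in> S \<Longrightarrow> ((\<lambda>s. m k (x + s *\<^sub>R (1, 0))) has_real_derivative m1 k x) (at 0)"
            "\<And>k x. k \<in> J \<Longrightarrow> x \<in> S \<Longrightarrow> ((\<lambda>s. m k (x + s *\<^sub>R (0, 1))) has_real_derivative m2 k x) (at 0)"
    and dF: "\<And>k x. k \<in> J \<Longrightarrow> x \<in> S \<Longrightarrow> ((\<lambda>s. F1 k (x + s *\<^sub>R (1, 0))) has_real_derivative F11 k x) (at 0)"
            "\<And>k x. k \<in> J \<Longrightarrow> x \<in> S \<Longrightarrow> ((\<lambda>s. F2 k (x + s *\<^sub>R (0, 1))) has_real_derivative F22 k x) (at 0)"
    and Q: "\<And>k x. k \<in> J \<Longrightarrow> x \<in> C \<Longrightarrow> F11 k x + F22 k x - (F1 k x)\<^sup>2 - (F2 k x)\<^sup>2 \<ge> c * (W x / (m k x)\<^sup>2)"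
    and pair: "\<And>k l x. k \<in> J \<Longrightarrow> l \<in> J \<Longrightarrow> x \<in> C \<Longrightarrow>
       (m1 k x - m1 l x) * (F1 k x - F1 l x) + (m2 k x - m2 l x) * (F2 k x - F2 l x) \<le> 0 \<or>
       \<bar>m k x - m l x\<bar> \<ge> \<eta> \<and> (m1 k x - m1 l x) * (F1 k x - F1 l x) + (m2 k x - m2 l x) * (F2 k x - F2 l x) \<le> B"
    and c: "c \<ge> 0" and W: "continuous_on S W" "\<And>x. x \<in> S \<Longrightarrow> W x \<ge> 0"
    and mpos: "\<And>k x. k \<in> J \<Longrightarrow> x \<in> S \<Longrightarrow> m k x > 0"
    and \<delta>: "continuous_on S \<delta>" "\<And>x. x \<in> S \<Longrightarrow> \<delta> x \<ge> 0" "\<And>x. x \<in> C \<Longrightarrow> \<exists>k\<in>J. m k x \<le> \<delta> x"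
    and \<epsilon>: "\<epsilon> > 0" and \<eta>: "\<eta> > 0"
  shows "(LINT x|lborel. (Ut x)\<^sup>2 + (Us x)\<^sup>2) \<ge> c * (LINT x|lborel. (U x)\<^sup>2 * (W x / (\<delta> x + \<epsilon>)\<^sup>2))"
proof -
  define N where "N = real (card J)"
  define q where "q x = c * (W x / (\<delta> x + \<epsilon>)\<^sup>2)" for x
  define err where "err p = p * B * N\<^sup>2 * exp (- (p * \<eta>))" for p
  define \<Phi> where "\<Phi> p x = (\<Sum>k\<in>J. exp (- (p * m k x)) * (c * (W x / (m k x)\<^sup>2))) / (\<Sum>k\<in>J. exp (- (p * m k x)))" for p x
  have cQ: "continuous_on S (\<lambda>x. c * (W x / (m k x)\<^sup>2))" if "k \<in> J" for k
    using mpos[OF that] by (intro continuous_on_mult continuous_on_divide continuous_on_power continuous_on_const W cm(1)[OF that]) force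
  have q0: "q x \<ge> 0" if "x \<in> S" for x using c W that by (simp add: q_def)
  have cq: "continuous_on S q"
    unfolding q_def using \<delta>(2) \<epsilon> by (intro continuous_on_mult continuous_on_divide continuous_on_power continuous_on_add continuous_on_const W \<delta>(1)) force
  note cUS = cU[THEN continuous_on_subset[OF _ subset_UNIV]]
  have intg: "integrable lborel (\<lambda>x. (U x)\<^sup>2 * f x)" if "continuous_on S f" for f :: "real \<times> real \<Rightarrow> real"
  proof (rule integrable_compact_support[OF C(1)])
    show "continuous_on C (\<lambda>x. (U x)\<^sup>2 * f x)"
      using continuous_on_subset[OF that C(3)] by (intro continuous_on_mult continuous_on_power cUS)
  qed (simp add: U0)
  have sumpos: "(\<Sum>k\<in>J. exp (- (p * m k x))) > 0" for p x using J by (intro sum_pos) auto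
  have c\<Phi>: "continuous_on S (\<Phi> p)" for p
    unfolding \<Phi>_def using sumpos
    by (intro continuous_on_divide continuous_on_sum continuous_on_mult continuous_on_exp continuous_on_minus continuous_on_const cQ cm(1))
       (auto simp: less_imp_neq[symmetric] dest: less_imp_neq)
  have main: "(LINT x|lborel. (Ut x)\<^sup>2 + (Us x)\<^sup>2) \<ge> (LINT x|lborel. (U x)\<^sup>2 * (\<Phi> p x - err p))" if "p \<ge> 0" for p
    unfolding \<Phi>_def err_def N_def
    by (rule softmin_field_inequality[OF J that B C U0 cU dU cm cF cQ dm dF Q pair]; assumption)
  have \<Phi>q: "\<Phi> p x \<ge> q x - N * exp (- (p * \<epsilon>)) * q x" if x: "x \<in> C" and p: "p \<ge> 0" for p x
  proof -
    have xS: "x \<in> S" using x C by auto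
    define Z where "Z = (\<Sum>k\<in>J. exp (- (p * m k x)))"
    obtain k0 where k0: "k0 \<in> J" "m k0 x \<le> \<delta> x" using \<delta>(3)[OF x] by auto
    have "exp (- (p * \<delta> x)) \<le> exp (- (p * m k0 x))" using k0 p by (simp add: mult_left_mono)
    also have "\<dots> \<le> Z" unfolding Z_def using J k0 by (intro member_le_sum) auto
    finally have Z: "exp (- (p * \<delta> x)) \<le> Z" .
    have Z0: "Z > 0" unfolding Z_def by (rule sumpos)
    have le: "exp (- (p * m k x)) / Z * (c * (W x / (m k x)\<^sup>2)) \<ge> exp (- (p * m k x)) / Z * q x - exp (- (p * \<epsilon>)) * q x" if k: "k \<in> J" for k
    proof (cases "m k x \<le> \<delta> x + \<epsilon>")
      case True
      have "W x / (\<delta> x + \<epsilon>)\<^sup>2 \<le> W x / (m k x)\<^sup>2"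
        using True mpos[OF k xS] W(2)[OF xS] by (intro divide_left_mono power_mono mult_pos_pos) auto
      then have "q x \<le> c * (W x / (m k x)\<^sup>2)" unfolding q_def using c by (intro mult_left_mono)
      then have "exp (- (p * m k x)) / Z * q x \<le> exp (- (p * m k x)) / Z * (c * (W x / (m k x)\<^sup>2))"
        using Z0 by (intro mult_left_mono) auto
      moreover have "exp (- (p * \<epsilon>)) * q x \<ge> 0" using q0[OF xS] by simp
      ultimately show ?thesis by linarith
    next
      case False
      have "exp (- (p * m k x)) / Z \<le> exp (- (p * (\<delta> x + \<epsilon>))) / exp (- (p * \<delta> x))"
        using False p Z by (intro frac_le) (auto intro: mult_left_mono)
      also have "\<dots> = exp (- (p * \<epsilon>))" by (simp add: exp_diff[symmetric] algebra_simps)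
      finally have "exp (- (p * m k x)) / Z * q x \<le> exp (- (p * \<epsilon>)) * q x" using q0[OF xS] by (intro mult_right_mono)
      moreover have "exp (- (p * m k x)) / Z * (c * (W x / (m k x)\<^sup>2)) \<ge> 0" using Z0 c W(2)[OF xS] by simp
      ultimately show ?thesis by linarith
    qed
    have "q x - N * exp (- (p * \<epsilon>)) * q x = (\<Sum>k\<in>J. exp (- (p * m k x)) / Z * q x - exp (- (p * \<epsilon>)) * q x)"
      using Z0 by (simp add: sum_subtractf sum_distrib_right[symmetric] sum_divide_distrib[symmetric] Z_def[symmetric] N_def)
    also have "\<dots> \<le> (\<Sum>k\<in>J. exp (- (p * m k x)) / Z * (c * (W x / (m k x)\<^sup>2)))" by (intro sum_mono le)
    also have "\<dots> = \<Phi> p x" by (simp add: \<Phi>_def Z_def sum_divide_distrib mult_ac)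
    finally show ?thesis .
  qed
  define I0 where "I0 = (LINT x|lborel. (U x)\<^sup>2)"
  define I1 where "I1 = (LINT x|lborel. (U x)\<^sup>2 * q x)"
  have lower: "I1 - N * exp (- (p * \<epsilon>)) * I1 - err p * I0 \<le> (LINT x|lborel. (Ut x)\<^sup>2 + (Us x)\<^sup>2)" if p: "p \<ge> 0" for p
  proof -
    have "I1 - N * exp (- (p * \<epsilon>)) * I1 - err p * I0 = (LINT x|lborel. (U x)\<^sup>2 * q x - N * exp (- (p * \<epsilon>)) * ((U x)\<^sup>2 * q x) - err p * (U x)\<^sup>2)"
      unfolding I0_def I1_def using intg[OF cq] intg[of "\<lambda>_. 1"] by simp
    also have "\<dots> \<le> (LINT x|lborel. (U x)\<^sup>2 * (\<Phi> p x - err p))"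
    proof (rule integral_mono)
      show "integrable lborel (\<lambda>x. (U x)\<^sup>2 * q x - N * exp (- (p * \<epsilon>)) * ((U x)\<^sup>2 * q x) - err p * (U x)\<^sup>2)"
        using intg[OF cq] intg[of "\<lambda>_. 1"] by simp
      show "integrable lborel (\<lambda>x. (U x)\<^sup>2 * (\<Phi> p x - err p))"
        by (intro intg continuous_on_diff c\<Phi> continuous_on_const)
      show "(U x)\<^sup>2 * q x - N * exp (- (p * \<epsilon>)) * ((U x)\<^sup>2 * q x) - err p * (U x)\<^sup>2 \<le> (U x)\<^sup>2 * (\<Phi> p x - err p)" for x
      proof (cases "x \<in> C")
        case True
        have "(U x)\<^sup>2 * (q x - N * exp (- (p * \<epsilon>)) * q x - err p) \<le> (U x)\<^sup>2 * (\<Phi> p x - err p)"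
          using \<Phi>q[OF True p] by (intro mult_left_mono) auto
        then show ?thesis by (simp add: algebra_simps)
      qed (simp add: U0)
    qed
    also have "\<dots> \<le> (LINT x|lborel. (Ut x)\<^sup>2 + (Us x)\<^sup>2)" by (rule main[OF p])
    finally show ?thesis .
  qed
  \<comment> \<open>Two errors remain, from the far indices and from the unfavourable pairs; both
    are exponentially small, the second up to a factor p.\<close>
  have "((\<lambda>p. I1 - N * exp (- (p * \<epsilon>)) * I1 - err p * I0) \<longlongrightarrow> I1 - N * 0 * I1 - 0 * I0) at_top"
  proof (intro tendsto_intros)
    show "((\<lambda>p. exp (- (p * \<epsilon>))) \<longlongrightarrow> 0) at_top" using \<epsilon> by real_asymp
    have "((\<lambda>p. p * exp (- (p * \<eta>))) \<longlongrightarrow> 0) at_top" using \<eta> by real_asymp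
    then have "((\<lambda>p. B * N\<^sup>2 * (p * exp (- (p * \<eta>)))) \<longlongrightarrow> B * N\<^sup>2 * 0) at_top" by (intro tendsto_intros)
    then show "(err \<longlongrightarrow> 0) at_top" unfolding err_def[abs_def] by (simp add: mult_ac)
  qed
  then have "I1 - N * 0 * I1 - 0 * I0 \<le> (LINT x|lborel. (Ut x)\<^sup>2 + (Us x)\<^sup>2)"
    by (rule tendsto_upperbound) (use lower in \<open>auto intro!: eventually_at_top_linorderI[of 0]\<close>)
  moreover have "I1 = c * (LINT x|lborel. (U x)\<^sup>2 * (W x / (\<delta> x + \<epsilon>)\<^sup>2))"
    unfolding I1_def q_def mult.left_commute[of _ c] by (rule integral_mult_right_zero)
  ultimately show ?thesis by simp
qed

section \<open>Interaction of the sector with half-planes\<close>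

text \<open>\<open>sector_gap \<beta> \<theta>\<close> is the distance of the point with polar coordinates \<open>(1, \<theta>)\<close> to the boundary of the model sector.\<close>

definition sector_gap :: "real \<Rightarrow> real \<Rightarrow> real" where
  "sector_gap \<beta> \<theta> = (if \<theta> \<le> pi/2 then sin \<theta> else if \<theta> \<le> \<beta> - pi/2 then 1 else sin (\<beta> - \<theta>))"

definition sector_gap_deriv :: "real \<Rightarrow> real \<Rightarrow> real" where
  "sector_gap_deriv \<beta> \<theta> = (if \<theta> \<le> pi/2 then cos \<theta> else if \<theta> \<le> \<beta> - pi/2 then 0 else - cos (\<beta> - \<theta>))"

text \<open>The one-sided derivatives agree at the joint. A branch has to be differentiable at x
  only if x lies on its side, so formulas with a limited range of validity can be glued.\<close>

lemma DERIV_if_glue: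
  fixes f g f' g' :: "real \<Rightarrow> real"
  assumes "x \<le> a \<Longrightarrow> (f has_real_derivative f' x) (at x)" "x \<ge> a \<Longrightarrow> (g has_real_derivative g' x) (at x)"
    and "x = a \<Longrightarrow> f a = g a" "x = a \<Longrightarrow> f' a = g' a"
  shows "((\<lambda>x. if x \<le> a then f x else g x) has_real_derivative (if x \<le> a then f' x else g' x)) (at x)"
proof -
  consider "x < a" | "x > a" | "x = a" by linarith
  then show ?thesis
  proof cases
    case 1
    have "\<forall>\<^sub>F y in nhds x. y < a" using 1 by (intro eventually_nhds_in_open[of "{..<a}", simplified]) auto
    then have "\<forall>\<^sub>F y in nhds x. f y = (if y \<le> a then f y else g y)" by eventually_elim auto
    from DERIV_cong_ev[OF refl this refl] show ?thesis using assms(1) 1 by simp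
  next
    case 2
    have "\<forall>\<^sub>F y in nhds x. y > a" using 2 by (intro eventually_nhds_in_open[of "{a<..}", simplified]) auto
    then have "\<forall>\<^sub>F y in nhds x. g y = (if y \<le> a then f y else g y)" by eventually_elim auto
    from DERIV_cong_ev[OF refl this refl] show ?thesis using assms(2) 2 by simp
  next
    case 3
    have fa: "(f has_real_derivative f' a) (at a within {..a})" and ga: "(g has_real_derivative f' a) (at a within {a..})"
      using assms 3 by (auto intro: has_field_derivative_at_within)
    have l: "((\<lambda>x. if x \<le> a then f x else g x) has_real_derivative f' a) (at a within {..a})"
      by (rule has_field_derivative_transform_within[OF fa zero_less_one]) auto
    have r: "((\<lambda>x. if x \<le> a then f x else g x) has_real_derivative f' a) (at a within {a..})"
      by (rule has_field_derivative_transform_within[OF ga zero_less_one]) (use assms(3) 3 in auto)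
    have "((\<lambda>x. if x \<le> a then f x else g x) has_real_derivative f' a) (at a within ({..a} \<union> {a..}))"
      using l r unfolding has_field_derivative_iff by (auto simp: Lim_within_Un)
    moreover have "{..a} \<union> {a..} = UNIV" by auto
    ultimately show ?thesis using 3 by simp
  qed
qed

context
  fixes \<beta> :: real
  assumes \<beta>: "pi < \<beta>" "\<beta> \<le> 2 * pi"
begin

lemma sector_gap_has_deriv: "(sector_gap \<beta> has_real_derivative sector_gap_deriv \<beta> \<theta>) (at \<theta>)"
proof -
  have 1: "((\<lambda>\<theta>. if \<theta> \<le> \<beta> - pi/2 then 1 else sin (\<beta> - \<theta>)) has_real_derivative
      (if \<theta> \<le> \<beta> - pi/2 then 0 else - cos (\<beta> - \<theta>))) (at \<theta>)"
    by (rule DERIV_if_glue) (auto intro!: derivative_eq_intros)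
  show ?thesis unfolding sector_gap_def[abs_def] sector_gap_deriv_def
    by (rule DERIV_if_glue[where f' = cos and g' = "\<lambda>\<theta>. if \<theta> \<le> \<beta> - pi/2 then 0 else - cos (\<beta> - \<theta>)", OF _ 1]) (use \<beta> in \<open>auto intro!: derivative_eq_intros\<close>)
qed

lemma continuous_on_sector_gap: "continuous_on UNIV (sector_gap \<beta>)"
  using sector_gap_has_deriv DERIV_isCont continuous_at_imp_continuous_on by blast

lemma continuous_on_sector_gap_deriv: "continuous_on UNIV (sector_gap_deriv \<beta>)"
proof -
  have c: "continuous_on UNIV (\<lambda>\<theta>::real. if \<theta> \<le> \<beta> - pi/2 then 0 else - cos (\<beta> - \<theta>))"
  proof -
    have "(\<lambda>\<theta>::real. if \<theta> \<le> \<beta> - pi/2 then 0 else - cos (\<beta> - \<theta>)) = (\<lambda>\<theta>. - cos (\<beta> - max \<theta> (\<beta> - pi/2)))"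
      by (auto simp: fun_eq_iff max_def)
    then show ?thesis by (simp only:) (intro continuous_intros)
  qed
  have "sector_gap_deriv \<beta> = (\<lambda>\<theta>. cos (min \<theta> (pi/2)) + (if \<theta> \<le> \<beta> - pi/2 then 0 else - cos (\<beta> - \<theta>)))"
    using \<beta> by (auto simp: fun_eq_iff sector_gap_deriv_def min_def)
  then show ?thesis by (simp only:) (intro continuous_intros c)
qed

lemma sector_gap_pos: "0 < \<theta> \<Longrightarrow> \<theta> < \<beta> \<Longrightarrow> sector_gap \<beta> \<theta> > 0"
  using \<beta> by (auto simp: sector_gap_def intro!: sin_gt_zero)

lemma sector_gap_le_1: "sector_gap \<beta> \<theta> \<le> 1"
  by (auto simp: sector_gap_def)

lemma sector_gap_symm: "sector_gap \<beta> (\<beta> - \<theta>) = sector_gap \<beta> \<theta>"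
  and sector_gap_deriv_symm: "sector_gap_deriv \<beta> (\<beta> - \<theta>) = - sector_gap_deriv \<beta> \<theta>"
proof -
  consider "\<theta> < pi/2" | "\<theta> = pi/2" | "\<theta> > pi/2" "\<theta> < \<beta> - pi/2" | "\<theta> = \<beta> - pi/2" | "\<theta> > \<beta> - pi/2" by linarith
  then have "sector_gap \<beta> (\<beta> - \<theta>) = sector_gap \<beta> \<theta> \<and> sector_gap_deriv \<beta> (\<beta> - \<theta>) = - sector_gap_deriv \<beta> \<theta>"
  proof cases
    case 2
    show ?thesis unfolding 2 sector_gap_def sector_gap_deriv_def using \<beta> by simp
  next
    case 4
    show ?thesis unfolding 4 sector_gap_def sector_gap_deriv_def using \<beta> by simp
  qed (use \<beta> in \<open>simp_all add: sector_gap_def sector_gap_deriv_def\<close>)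
  then show "sector_gap \<beta> (\<beta> - \<theta>) = sector_gap \<beta> \<theta>" "sector_gap_deriv \<beta> (\<beta> - \<theta>) = - sector_gap_deriv \<beta> \<theta>" by auto
qed

text \<open>Up to the factor \<open>exp t\<close>, \<open>- Y\<close> is the pair term of the sector
  with a half-plane whose outer normal has angle \<open>a\<close> and whose boundary is at scaled
  distance \<open>r\<close>. The sign matters only near the interface of the two distances; the
  scaled gap is at most 1, so r \<ge> 2 is far from it and a crude bound is enough there.\<close>

lemma edge_pair_left:
  assumes \<theta>: "0 < \<theta>" "\<theta> \<le> \<beta> / 2" and a: "pi/2 \<le> a" "a \<le> \<beta> - pi/2" and \<alpha>: "1/2 \<le> \<alpha>"
    and r: "r > 0" and w: "0 \<le> w" "pi/2 \<le> \<theta> \<Longrightarrow> w \<le> tan ((\<beta>/2 - \<theta>) / 2) / 2"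
  defines "\<gamma> \<equiv> \<theta> - a"
  defines "Y \<equiv> w * (sector_gap_deriv \<beta> \<theta> - sin \<gamma>) + \<alpha> / r * (1 + sector_gap \<beta> \<theta> * cos \<gamma> - sector_gap_deriv \<beta> \<theta> * sin \<gamma>)"
  shows "Y \<ge> 0 \<or> r \<ge> 2 \<and> Y \<ge> - 1"
proof (cases "\<theta> \<le> pi/2")
  case True
  \<comment> \<open>Near the edge w can be arbitrarily large, so the coefficient of w must itself be
    nonnegative. It is a sum of two sines with half-sum in [0, pi] and half-difference in
    [-pi/2, pi/2]; this is where the angle condition enters.\<close>
  have "sin (pi/2 - \<theta>) + sin (a - \<theta>) = 2 * sin ((pi/2 - \<theta> + (a - \<theta>)) / 2) * cos ((pi/2 - \<theta> - (a - \<theta>)) / 2)"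
    by (rule sin_plus_sin)
  moreover have "sin ((pi/2 - \<theta> + (a - \<theta>)) / 2) \<ge> 0" using True \<theta> a \<beta> by (intro sin_ge_zero) auto
  moreover have "cos ((pi/2 - \<theta> - (a - \<theta>)) / 2) \<ge> 0" using True \<theta> a \<beta> by (intro cos_ge_zero) auto
  ultimately have "cos \<theta> + sin (a - \<theta>) \<ge> 0" by (simp add: cos_sin_eq)
  moreover have "sin (a - \<theta>) = - sin \<gamma>" unfolding \<gamma>_def by (metis minus_diff_eq sin_minus)
  ultimately have 1: "cos \<theta> - sin \<gamma> \<ge> 0" by simp
  have "sin \<theta> * cos \<gamma> - cos \<theta> * sin \<gamma> = sin (\<theta> - \<gamma>)" by (simp add: sin_diff)
  then have 2: "1 + sin \<theta> * cos \<gamma> - cos \<theta> * sin \<gamma> \<ge> 0" using sin_ge_minus_one[of "\<theta> - \<gamma>"] by linarith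
  have "Y \<ge> 0" unfolding Y_def sector_gap_def sector_gap_deriv_def using True w 1 2 \<alpha> r by simp
  then show ?thesis ..
next
  case False
  have Y: "Y = - w * sin \<gamma> + \<alpha> / r * (1 + cos \<gamma>)"
    unfolding Y_def sector_gap_def sector_gap_deriv_def using False \<theta> \<beta> by simp
  have "1 + cos \<gamma> \<ge> 0" using cos_ge_minus_one[of \<gamma>] by linarith
  then have pos: "\<alpha> / r * (1 + cos \<gamma>) \<ge> 0" using \<alpha> r by (intro mult_nonneg_nonneg divide_nonneg_nonneg) auto
  show ?thesis
  proof (cases "sin \<gamma> \<le> 0")
    case True
    then have "- w * sin \<gamma> \<ge> 0" using w by (simp add: mult_nonneg_nonpos)
    then show ?thesis using pos Y by simp
  next
    case s: False
    have \<gamma>: "\<gamma> \<le> pi/2" "\<gamma> > - pi" using \<theta> a \<beta> False unfolding \<gamma>_def by auto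
    have \<gamma>0: "\<gamma> > 0"
    proof (rule ccontr)
      assume "\<not> \<gamma> > 0"
      then have "sin (- \<gamma>) \<ge> 0" using \<gamma> by (intro sin_ge_zero) auto
      then show False using s by simp
    qed
    have cg: "cos \<gamma> \<ge> 0" using \<gamma> \<gamma>0 by (intro cos_ge_zero) auto
    \<comment> \<open>Since \<beta>/2 \<le> pi \<le> a + pi/2, the bound on w can be rewritten in
      terms of \<gamma> alone.\<close>
    have t1: "tan ((\<beta>/2 - \<theta>) / 2) \<le> tan (pi/4 - \<gamma>/2)"
    proof (rule tan_mono_le)
      show "- (pi/2) < (\<beta>/2 - \<theta>) / 2" 
        by (rule less_le_trans[of _ 0]) (use \<theta>(2) in simp_all)
      show "(\<beta>/2 - \<theta>) / 2 \<le> pi/4 - \<gamma>/2" using \<beta> a unfolding \<gamma>_def by (simp add: field_simps)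
      show "pi/4 - \<gamma>/2 < pi/2" using \<gamma>0 pi_gt_zero by linarith
    qed
    have t2: "tan (pi/4 - \<gamma>/2) = cos \<gamma> / (1 + sin \<gamma>)"
    proof -
      have "2 * (pi/4 - \<gamma>/2) = pi/2 - \<gamma>" by simp
      then have "tan (pi/4 - \<gamma>/2) = sin (pi/2 - \<gamma>) / (cos (pi/2 - \<gamma>) + 1)" using tan_half[of "pi/4 - \<gamma>/2"] by metis
      also have "sin (pi/2 - \<gamma>) = cos \<gamma>" by (simp add: sin_diff)
      also have "cos (pi/2 - \<gamma>) = sin \<gamma>" by (simp add: cos_diff)
      finally show ?thesis by simp
    qed
    have p1: "1 + sin \<gamma> > 0" using s by simp
    have "2 * w \<le> tan ((\<beta>/2 - \<theta>) / 2)" using w(2) False by simp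
    with t1 t2 have "2 * w \<le> cos \<gamma> / (1 + sin \<gamma>)" by simp
    then have "2 * w * (1 + sin \<gamma>) \<le> cos \<gamma>" using p1 by (simp only: pos_le_divide_eq)
    moreover have "w * sin \<gamma> \<le> w * 1" using w(1) sin_le_one by (intro mult_left_mono)
    \<comment> \<open>Adding 2 w (1 + sin \<gamma>) \<le> cos \<gamma> and w sin \<gamma> \<le> w
      produces the factor 1/4. It matches \<alpha>/r \<ge> 1/4, valid for \<alpha> \<ge> 1/2 and r <
      2.\<close>
    ultimately have ws: "w * sin \<gamma> \<le> cos \<gamma> / 4" by (simp add: algebra_simps)
    show ?thesis
    proof (cases "r \<ge> 2")
      case True
      have "w * sin \<gamma> \<le> 1" using ws cos_le_one[of \<gamma>] by linarith
      then show ?thesis using True pos Y by simp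
    next
      case False
      have "\<alpha> / r \<ge> 1/4" using False r \<alpha> by (simp add: field_simps)
      then have A: "\<alpha> / r * (1 + cos \<gamma>) \<ge> 1/4 * (1 + cos \<gamma>)" using cg by (intro mult_right_mono) auto
      have nn: "0 \<le> - x + A" if "A \<ge> 1/4 * (1 + z)" "x \<le> z / 4" for A x z :: real using that by simp
      have "0 \<le> Y" using nn[OF A ws] unfolding Y by (simp only: mult_minus_left)
      then show ?thesis ..
    qed
  qed
qed

text \<open>The reflection of \<theta> to \<beta> - \<theta> and of a to \<beta> - a changes the
  signs of w, of the derivative of the gap and of sin \<gamma>. All products in \<open>Y\<close> are
  preserved, so the left half suffices.\<close>

lemma edge_pair:
  assumes \<theta>: "0 < \<theta>" "\<theta> < \<beta>" and a: "pi/2 \<le> a" "a \<le> \<beta> - pi/2" and \<alpha>: "1/2 \<le> \<alpha>"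
    and r: "r > 0"
    and w0: "\<And>\<theta>. 0 < \<theta> \<Longrightarrow> \<theta> \<le> \<beta>/2 \<Longrightarrow> w \<theta> \<ge> 0"
    and wmid: "\<And>\<theta>. pi/2 \<le> \<theta> \<Longrightarrow> \<theta> \<le> \<beta>/2 \<Longrightarrow> w \<theta> \<le> tan ((\<beta>/2 - \<theta>) / 2) / 2"
    and wsymm: "\<And>\<theta>. 0 < \<theta> \<Longrightarrow> \<theta> < \<beta> \<Longrightarrow> w (\<beta> - \<theta>) = - w \<theta>"
  defines "\<gamma> \<equiv> \<theta> - a"
  defines "Y \<equiv> w \<theta> * (sector_gap_deriv \<beta> \<theta> - sin \<gamma>) + \<alpha> / r * (1 + sector_gap \<beta> \<theta> * cos \<gamma> - sector_gap_deriv \<beta> \<theta> * sin \<gamma>)"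
  shows "Y \<ge> 0 \<or> r \<ge> 2 \<and> Y \<ge> - 1"
proof (cases "\<theta> \<le> \<beta>/2")
  case True
  show ?thesis unfolding Y_def \<gamma>_def
    by (rule edge_pair_left[OF \<theta>(1) True a \<alpha> r w0[OF \<theta>(1) True] wmid[OF _ True]])
next
  case False
  have m: "\<beta> - \<theta> - (\<beta> - a) = - \<gamma>" by (simp add: \<gamma>_def)
  have "Y = w (\<beta> - \<theta>) * (sector_gap_deriv \<beta> (\<beta> - \<theta>) - sin (\<beta> - \<theta> - (\<beta> - a)))
     + \<alpha> / r * (1 + sector_gap \<beta> (\<beta> - \<theta>) * cos (\<beta> - \<theta> - (\<beta> - a)) - sector_gap_deriv \<beta> (\<beta> - \<theta>) * sin (\<beta> - \<theta> - (\<beta> - a)))"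
    unfolding Y_def sector_gap_symm sector_gap_deriv_symm m wsymm[OF \<theta>] sin_minus cos_minus by (simp add: algebra_simps)
  moreover have c: "0 < \<beta> - \<theta>" "\<beta> - \<theta> \<le> \<beta>/2" "pi/2 \<le> \<beta> - a" "\<beta> - a \<le> \<beta> - pi/2"
    using False \<theta> a by auto
  ultimately show ?thesis
    using edge_pair_left[OF c \<alpha> r w0[OF c(1,2)] wmid[OF _ c(2)]] by simp
qed

end

text \<open>Both gradients have length E and both fields are -\<alpha> \<nabla>m/m, so the pair term
  is -\<alpha> (E^2 - G)(1/x + 1/y), where G is the inner product of the two gradients. By equality
  of the lengths, E^2 - G is half the squared norm of their difference.\<close>

lemma edge_edge_pair:
  fixes E x x' y y' s s' :: real
  assumes "E > 0" "x > 0" "y > 0" "s\<^sup>2 + x'\<^sup>2 = E\<^sup>2" "s'\<^sup>2 + y'\<^sup>2 = E\<^sup>2" "\<alpha> \<ge> 0"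
  shows "(- s - - s') * (\<alpha> * s / x - \<alpha> * s' / y) + (x' - y') * (- \<alpha> * x' / x - - \<alpha> * y' / y) \<le> 0"
proof -
  have "(- s - - s') * (\<alpha> * s / x - \<alpha> * s' / y) + (x' - y') * (- \<alpha> * x' / x - - \<alpha> * y' / y)
     = - \<alpha> * (((s\<^sup>2 + x'\<^sup>2) - (s * s' + x' * y')) / x + ((s'\<^sup>2 + y'\<^sup>2) - (s * s' + x' * y')) / y)"
    using assms(2,3) by (simp add: field_simps power2_eq_square)
  also have "\<dots> = - \<alpha> * ((E\<^sup>2 - (s * s' + x' * y')) * (1 / x + 1 / y))" unfolding assms(4,5) by (simp add: distrib_left)
  also have "\<dots> \<le> 0"
  proof -
    have "0 \<le> (s - s')\<^sup>2 + (x' - y')\<^sup>2" by simp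
    also have "\<dots> = (s\<^sup>2 + x'\<^sup>2) + (s'\<^sup>2 + y'\<^sup>2) - 2 * (s * s' + x' * y')" by (simp add: power2_eq_square algebra_simps)
    finally have "E\<^sup>2 - (s * s' + x' * y') \<ge> 0" unfolding assms(4,5) by simp
    then show ?thesis using assms by simp
  qed
  finally show ?thesis .
qed

text \<open>The distance m to a line is harmonic, and in log-polar coordinates its gradient has
  length E; hence F = -\<alpha> \<nabla>m/m satisfies div F - |F|^2 = (\<alpha> - \<alpha>^2)
  E^2/m^2. The terms \<alpha> s/x stem from the second derivatives of m and cancel.\<close>

lemma edge_field_divergence:
  fixes x s y \<alpha> :: real
  assumes "x > 0" "s\<^sup>2 + y\<^sup>2 = E\<^sup>2"
  shows "(\<alpha> * s / x + \<alpha> * s\<^sup>2 / x\<^sup>2) + (\<alpha> * y\<^sup>2 / x\<^sup>2 - \<alpha> * s / x) - (\<alpha> * s / x)\<^sup>2 - (- \<alpha> * y / x)\<^sup>2 = \<alpha> * (1 - \<alpha>) * (E\<^sup>2 / x\<^sup>2)"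
proof -
  have "(\<alpha> * s / x + \<alpha> * s\<^sup>2 / x\<^sup>2) + (\<alpha> * y\<^sup>2 / x\<^sup>2 - \<alpha> * s / x) - (\<alpha> * s / x)\<^sup>2 - (- \<alpha> * y / x)\<^sup>2
     = \<alpha> * (1 - \<alpha>) * ((s\<^sup>2 + y\<^sup>2) / x\<^sup>2)"
    using assms(1) by (simp add: field_simps power2_eq_square)
  then show ?thesis unfolding assms(2) .
qed

text \<open>\<open>w\<close> is the logarithmic derivative of a positive angular solution of
  \<psi>'' = -c \<psi> / \<open>sector_gap\<close>^2, kept in Riccati form because only F = -w
  enters. The bound \<open>w_mid\<close> concerns the angles where the gap is 1; closer to the edge
  the angle condition on the half-planes does its work.\<close>

locale hardy_supersolution =
  fixes \<beta> \<alpha> c :: real and w :: "real \<Rightarrow> real"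
  assumes \<beta>: "pi < \<beta>" "\<beta> \<le> 2 * pi" and \<alpha>: "1/2 \<le> \<alpha>" "\<alpha> \<le> 1" and c: "c = \<alpha> * (1 - \<alpha>)"
    and w_deriv: "\<And>\<theta>. 0 < \<theta> \<Longrightarrow> \<theta> < \<beta> \<Longrightarrow> (w has_real_derivative (- (w \<theta>)\<^sup>2 - c / (sector_gap \<beta> \<theta>)\<^sup>2)) (at \<theta>)"
    and w_nonneg: "\<And>\<theta>. 0 < \<theta> \<Longrightarrow> \<theta> \<le> \<beta>/2 \<Longrightarrow> w \<theta> \<ge> 0"
    and w_mid: "\<And>\<theta>. pi/2 \<le> \<theta> \<Longrightarrow> \<theta> \<le> \<beta>/2 \<Longrightarrow> w \<theta> \<le> tan ((\<beta>/2 - \<theta>) / 2) / 2"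
    and w_symm: "\<And>\<theta>. 0 < \<theta> \<Longrightarrow> \<theta> < \<beta> \<Longrightarrow> w (\<beta> - \<theta>) = - w \<theta>"
begin

text \<open>The soft-minimum inequality for the sector together with finitely many half-planes. A
  pair \<open>(a, H)\<close> is the half-plane with outer normal at angle \<open>a\<close> and
  offset \<open>H\<close> from the vertex; \<open>S\<close> is the part of the strip inside all of
  them, so every distance in the blend is positive there.\<close>

lemma strip_inequality:
  fixes U Ut Us \<delta> :: "real \<times> real \<Rightarrow> real" and I :: "(real \<times> real) set"
  defines "S \<equiv> {x. 0 < snd x \<and> snd x < \<beta> \<and> (\<forall>(a, H)\<in>I. exp (fst x) * cos (snd x - a) < H)}"
  assumes I: "finite I" and aI: "\<And>a H. (a, H) \<in> I \<Longrightarrow> pi/2 \<le> a \<and> a \<le> \<beta> - pi/2"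
    and C: "compact C" "C \<subseteq> S"
    and U0: "\<And>x. x \<notin> C \<Longrightarrow> U x = 0 \<and> Ut x = 0 \<and> Us x = 0"
    and cU: "continuous_on UNIV U" "continuous_on UNIV Ut" "continuous_on UNIV Us"
    and dU: "\<And>x. ((\<lambda>s. U (x + s *\<^sub>R (1, 0))) has_real_derivative Ut x) (at 0)"
            "\<And>x. ((\<lambda>s. U (x + s *\<^sub>R (0, 1))) has_real_derivative Us x) (at 0)"
    and \<delta>: "continuous_on UNIV \<delta>" "\<And>x. x \<in> S \<Longrightarrow> \<delta> x \<ge> 0"
      "\<And>t \<theta>. (t, \<theta>) \<in> C \<Longrightarrow> exp t * sector_gap \<beta> \<theta> \<le> \<delta> (t, \<theta>) \<or> (\<exists>(a, H)\<in>I. H - exp t * cos (\<theta> - a) \<le> \<delta> (t, \<theta>))"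
    and \<epsilon>: "\<epsilon> > 0"
  shows "c * (LINT x|lborel. (U x)\<^sup>2 * (exp (2 * fst x) / (\<delta> x + \<epsilon>)\<^sup>2)) \<le> (LINT x|lborel. (Ut x)\<^sup>2 + (Us x)\<^sup>2)"
proof -
  define ell where "ell k x = snd k - exp (fst x) * cos (snd x - fst k)" for k x :: "real \<times> real"
  define E where "E x = exp (fst x)" for x :: "real \<times> real"
  define \<gamma> where "\<gamma> k x = snd x - fst k" for k x :: "real \<times> real"
  \<comment> \<open>\<open>None\<close> stands for the sector and \<open>Some k\<close> for a
    half-plane. \<open>m1\<close> and \<open>m2\<close> are the partial derivatives of
    \<open>m\<close>; \<open>F11\<close> and \<open>F22\<close> are the two terms of the
    divergence.\<close>
  define m where "m k x = (case k of None \<Rightarrow> E x * sector_gap \<beta> (snd x) | Some k \<Rightarrow> ell k x)" for k x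
  define m1 where "m1 k x = (case k of None \<Rightarrow> E x * sector_gap \<beta> (snd x) | Some k \<Rightarrow> - (E x * cos (\<gamma> k x)))" for k x
  define m2 where "m2 k x = (case k of None \<Rightarrow> E x * sector_gap_deriv \<beta> (snd x) | Some k \<Rightarrow> E x * sin (\<gamma> k x))" for k x
  define F1 where "F1 k x = (case k of None \<Rightarrow> 0 | Some k \<Rightarrow> \<alpha> * (E x * cos (\<gamma> k x)) / ell k x)" for k x
  define F2 where "F2 k x = (case k of None \<Rightarrow> - w (snd x) | Some k \<Rightarrow> - \<alpha> * (E x * sin (\<gamma> k x)) / ell k x)" for k x
  define F11 where "F11 k x = (case k of None \<Rightarrow> 0 | Some k \<Rightarrow> \<alpha> * (E x * cos (\<gamma> k x)) / ell k x + \<alpha> * (E x * cos (\<gamma> k x))\<^sup>2 / (ell k x)\<^sup>2)" for k x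
  define F22 where "F22 k x = (case k of None \<Rightarrow> (w (snd x))\<^sup>2 + c / (sector_gap \<beta> (snd x))\<^sup>2 | Some k \<Rightarrow> \<alpha> * (E x * sin (\<gamma> k x))\<^sup>2 / (ell k x)\<^sup>2 - \<alpha> * (E x * cos (\<gamma> k x)) / ell k x)" for k x
  define J where "J = insert None (Some ` I)"
  have oS: "open S"
  proof -
    have "S = {x. 0 < snd x} \<inter> {x. snd x < \<beta>} \<inter> (\<Inter>k\<in>I. {x. exp (fst x) * cos (snd x - fst k) < snd k})"
      unfolding S_def case_prod_unfold by auto
    also have "open \<dots>"
      using I by (intro open_Int open_INT open_Collect_less continuous_intros ballI)
    finally show ?thesis .
  qed
  have S\<theta>: "0 < snd x" "snd x < \<beta>" if "x \<in> S" for x using that by (auto simp: S_def)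
  have ellpos: "ell k x > 0" if "k \<in> I" "x \<in> S" for k x using that unfolding S_def case_prod_unfold by (auto simp: ell_def)
  have Epos: "E x > 0" for x by (simp add: E_def)
  have gappos: "sector_gap \<beta> (snd x) > 0" if "x \<in> S" for x
    by (rule sector_gap_pos[OF \<beta> S\<theta>[OF that]])
  have cE: "continuous_on S E" unfolding E_def by (intro continuous_intros)
  have cell: "continuous_on S (ell k)" and c\<gamma>: "continuous_on S (\<gamma> k)" for k
    unfolding ell_def \<gamma>_def by (intro continuous_intros)+
  have cgap: "continuous_on S (\<lambda>x. sector_gap \<beta> (snd x))" "continuous_on S (\<lambda>x. sector_gap_deriv \<beta> (snd x))"
    by (rule continuous_on_compose2[OF continuous_on_sector_gap[OF \<beta>]], intro continuous_intros, simp,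
        rule continuous_on_compose2[OF continuous_on_sector_gap_deriv[OF \<beta>]], intro continuous_intros, simp)
  have cw: "continuous_on S (\<lambda>x. w (snd x))"
  proof -
    have "continuous_on {0<..<\<beta>} w"
      using w_deriv by (auto intro!: continuous_at_imp_continuous_on DERIV_isCont)
    then show ?thesis by (rule continuous_on_compose2) (use S\<theta> in \<open>force intro!: continuous_intros\<close>)+
  qed
  have nzI: "\<forall>x\<in>S. ell k x \<noteq> 0" "\<forall>x\<in>S. (ell k x)\<^sup>2 \<noteq> 0" if "k \<in> I" for k using ellpos[OF that] by force+
  have nzg: "\<forall>x\<in>S. (sector_gap \<beta> (snd x))\<^sup>2 \<noteq> 0" using gappos by force
  note ci = continuous_on_add continuous_on_mult continuous_on_divide continuous_on_power continuous_on_diff continuous_on_minus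
     continuous_on_const continuous_on_cos continuous_on_sin cE cell c\<gamma> cgap cw nzI nzg
  have cont: "continuous_on S (m k)" "continuous_on S (m1 k)" "continuous_on S (m2 k)" "continuous_on S (F1 k)"
    "continuous_on S (F2 k)" "continuous_on S (F11 k)" "continuous_on S (F22 k)" if k: "k \<in> J" for k
  proof -
    have "continuous_on S (m k) \<and> continuous_on S (m1 k) \<and> continuous_on S (m2 k) \<and> continuous_on S (F1 k)
        \<and> continuous_on S (F2 k) \<and> continuous_on S (F11 k) \<and> continuous_on S (F22 k)"
    proof (cases k)
      case None
      show ?thesis unfolding m_def m1_def m2_def F1_def F2_def F11_def F22_def None option.case
        by (intro conjI ci)
    next
      case (Some i)
      then have i: "i \<in> I" using k by (auto simp: J_def)
      show ?thesis unfolding m_def m1_def m2_def F1_def F2_def F11_def F22_def Some option.case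
        by (intro conjI ci i)
    qed
    then show "continuous_on S (m k)" "continuous_on S (m1 k)" "continuous_on S (m2 k)" "continuous_on S (F1 k)"
    "continuous_on S (F2 k)" "continuous_on S (F11 k)" "continuous_on S (F22 k)" by auto
  qed
  have dE: "((\<lambda>s. E (x + s *\<^sub>R (1, 0))) has_real_derivative E x) (at 0)" for x
    unfolding E_def by (auto intro!: derivative_eq_intros)
  have E01: "E (x + s *\<^sub>R (0, 1)) = E x" for x s by (simp add: E_def)
  have \<gamma>10: "\<gamma> k (x + s *\<^sub>R (1, 0)) = \<gamma> k x" and \<gamma>01: "\<gamma> k (x + s *\<^sub>R (0, 1)) = \<gamma> k x + s" for k x s by (auto simp: \<gamma>_def)
  have dell1: "((\<lambda>s. ell k (x + s *\<^sub>R (1, 0))) has_real_derivative - (E x * cos (\<gamma> k x))) (at 0)" for k x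
    unfolding ell_def E_def \<gamma>_def by (auto intro!: derivative_eq_intros)
  have dell2: "((\<lambda>s. ell k (x + s *\<^sub>R (0, 1))) has_real_derivative E x * sin (\<gamma> k x)) (at 0)" for k x
    unfolding ell_def E_def \<gamma>_def by (auto intro!: derivative_eq_intros)
  have shift: "((\<lambda>s. f (snd x + s)) has_real_derivative f') (at 0)" if "(f has_real_derivative f') (at (snd x))" for f f' and x :: "real \<times> real"
    using that DERIV_shift[of f f' 0 "snd x"] by (simp add: add.commute)
  have [simp]: "y + (0, 0) = y" for y :: "real \<times> real" by (metis add_0_right zero_prod_def)
  have der: "((\<lambda>s. m k (x + s *\<^sub>R (1, 0))) has_real_derivative m1 k x) (at 0)"
     "((\<lambda>s. m k (x + s *\<^sub>R (0, 1))) has_real_derivative m2 k x) (at 0)"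
     "((\<lambda>s. F1 k (x + s *\<^sub>R (1, 0))) has_real_derivative F11 k x) (at 0)"
     "((\<lambda>s. F2 k (x + s *\<^sub>R (0, 1))) has_real_derivative F22 k x) (at 0)" if k: "k \<in> J" and x: "x \<in> S" for k x
  proof -
    have "((\<lambda>s. m k (x + s *\<^sub>R (1, 0))) has_real_derivative m1 k x) (at 0) \<and>
     ((\<lambda>s. m k (x + s *\<^sub>R (0, 1))) has_real_derivative m2 k x) (at 0) \<and>
     ((\<lambda>s. F1 k (x + s *\<^sub>R (1, 0))) has_real_derivative F11 k x) (at 0) \<and>
     ((\<lambda>s. F2 k (x + s *\<^sub>R (0, 1))) has_real_derivative F22 k x) (at 0)"
    proof (cases k)
      case None
      have 1: "((\<lambda>s. E (x + s *\<^sub>R (1, 0)) * sector_gap \<beta> (snd x)) has_real_derivative E x * sector_gap \<beta> (snd x)) (at 0)"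
        by (rule DERIV_cmult_right[OF dE])
      have 2: "((\<lambda>s. E x * sector_gap \<beta> (snd x + s)) has_real_derivative E x * sector_gap_deriv \<beta> (snd x)) (at 0)"
        by (intro DERIV_cmult shift sector_gap_has_deriv \<beta>)
      have 3: "((\<lambda>s. - w (snd x + s)) has_real_derivative (w (snd x))\<^sup>2 + c / (sector_gap \<beta> (snd x))\<^sup>2) (at 0)"
        using DERIV_minus[OF shift[OF w_deriv[OF S\<theta>[OF x]]]] by (simp add: add.commute)
      show ?thesis using 1 2 3 unfolding m_def m1_def m2_def F1_def F2_def F11_def F22_def None option.case E01 by simp
    next
      case (Some i)
      then have i: "i \<in> I" using k by (auto simp: J_def)
      have p: "ell i x \<noteq> 0" using ellpos[OF i x] by simp
      have 1: "((\<lambda>s. \<alpha> * (E (x + s *\<^sub>R (1, 0)) * cos (\<gamma> i x)) / ell i (x + s *\<^sub>R (1, 0))) has_real_derivative F11 (Some i) x) (at 0)"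
        unfolding F11_def option.case
        by (rule derivative_eq_intros dE dell1 refl | simp add: p)+ (use p in \<open>simp add: field_simps power2_eq_square\<close>)
      have 2: "((\<lambda>s. - \<alpha> * (E x * sin (\<gamma> i x + s)) / ell i (x + s *\<^sub>R (0, 1))) has_real_derivative F22 (Some i) x) (at 0)"
        unfolding F22_def option.case
        by (rule derivative_eq_intros dell2 refl | simp add: p)+ (use p in \<open>simp add: field_simps power2_eq_square\<close>)
      show ?thesis using 1 2 dell1[of i x] dell2[of i x] unfolding m_def m1_def m2_def F1_def F2_def Some option.case E01 \<gamma>10 \<gamma>01 by simp
    qed
    then show "((\<lambda>s. m k (x + s *\<^sub>R (1, 0))) has_real_derivative m1 k x) (at 0)"
     "((\<lambda>s. m k (x + s *\<^sub>R (0, 1))) has_real_derivative m2 k x) (at 0)"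
     "((\<lambda>s. F1 k (x + s *\<^sub>R (1, 0))) has_real_derivative F11 k x) (at 0)"
     "((\<lambda>s. F2 k (x + s *\<^sub>R (0, 1))) has_real_derivative F22 k x) (at 0)" by auto
  qed
  have trig: "(E x * cos (\<gamma> k x))\<^sup>2 + (E x * sin (\<gamma> k x))\<^sup>2 = (E x)\<^sup>2" for k x
    by (simp add: power_mult_distrib distrib_left[symmetric])
  have mpos: "m k x > 0" if "k \<in> J" "x \<in> S" for k x
    using that unfolding J_def m_def by (auto intro!: mult_pos_pos ellpos gappos Epos)
  have Q: "F11 k x + F22 k x - (F1 k x)\<^sup>2 - (F2 k x)\<^sup>2 \<ge> c * ((E x)\<^sup>2 / (m k x)\<^sup>2)" if k: "k \<in> J" and x: "x \<in> C" for k x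
  proof -
    have xS: "x \<in> S" using x C by auto
    show ?thesis
    proof (cases k)
      case None
      have "E x * sector_gap \<beta> (snd x) > 0" using Epos gappos[OF xS] by simp
      then show ?thesis unfolding m_def F1_def F2_def F11_def F22_def None option.case using Epos[of x] by (simp add: power_mult_distrib)
    next
      case (Some i)
      then have i: "i \<in> I" using k by (auto simp: J_def)
      show ?thesis unfolding m_def F1_def F2_def F11_def F22_def Some option.case
        using edge_field_divergence[OF ellpos[OF i xS] trig[of x i], of \<alpha>] unfolding c by simp
    qed
  qed
  \<comment> \<open>On the compact set C the scale \<open>exp t\<close> stays between
    \<open>exp (- T)\<close> and \<open>exp T\<close>. These become the separation and the bound for
    unfavourable pairs: r \<ge> 2 means that the two distances differ by at least
    \<open>exp t\<close>.\<close>
  obtain T where T: "\<And>x. x \<in> C \<Longrightarrow> \<bar>fst x\<bar> \<le> T"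
  proof -
    have "bounded (fst ` C)" by (intro compact_imp_bounded compact_continuous_image C continuous_intros)
    then show ?thesis using that unfolding bounded_iff by auto
  qed
  have ET: "exp (- T) \<le> E x" "E x \<le> exp T" if "x \<in> C" for x using T[OF that] by (auto simp: E_def)
  have edge: "(m1 None x - m1 (Some i) x) * (F1 None x - F1 (Some i) x) + (m2 None x - m2 (Some i) x) * (F2 None x - F2 (Some i) x) \<le> 0 \<or>
       \<bar>m None x - m (Some i) x\<bar> \<ge> exp (- T) \<and> (m1 None x - m1 (Some i) x) * (F1 None x - F1 (Some i) x) + (m2 None x - m2 (Some i) x) * (F2 None x - F2 (Some i) x) \<le> exp T"
    if i: "i \<in> I" and x: "x \<in> C" for i x
  proof -
    have xS: "x \<in> S" using x C by auto
    define r where "r = ell i x / E x"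
    have r: "r > 0" using ellpos[OF i xS] Epos by (simp add: r_def)
    have er: "ell i x = r * E x" using Epos[of x] by (simp add: r_def)
    define Y where "Y = w (snd x) * (sector_gap_deriv \<beta> (snd x) - sin (\<gamma> i x)) + \<alpha> / r * (1 + sector_gap \<beta> (snd x) * cos (\<gamma> i x) - sector_gap_deriv \<beta> (snd x) * sin (\<gamma> i x))"
    have ai: "pi/2 \<le> fst i" "fst i \<le> \<beta> - pi/2" using aI[of "fst i" "snd i"] i by auto
    have Y: "Y \<ge> 0 \<or> r \<ge> 2 \<and> Y \<ge> - 1"
      unfolding Y_def \<gamma>_def
      by (rule edge_pair[OF \<beta> S\<theta>[OF xS] ai \<alpha>(1) r w_nonneg w_mid w_symm]; assumption)
    have "(m1 None x - m1 (Some i) x) * (F1 None x - F1 (Some i) x) + (m2 None x - m2 (Some i) x) * (F2 None x - F2 (Some i) x)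
      = - E x * (w (snd x) * (sector_gap_deriv \<beta> (snd x) - sin (\<gamma> i x)) + \<alpha> / r * (((cos (\<gamma> i x))\<^sup>2 + (sin (\<gamma> i x))\<^sup>2) + sector_gap \<beta> (snd x) * cos (\<gamma> i x) - sector_gap_deriv \<beta> (snd x) * sin (\<gamma> i x)))"
      unfolding m1_def m2_def F1_def F2_def option.case er using Epos[of x] r
      by (simp add: field_simps power2_eq_square del: sin_cos_squared_add3)
    also have "\<dots> = - E x * Y" by (simp add: Y_def)
    finally have eq: "(m1 None x - m1 (Some i) x) * (F1 None x - F1 (Some i) x) + (m2 None x - m2 (Some i) x) * (F2 None x - F2 (Some i) x) = - E x * Y" .
    from Y show ?thesis
    proof
      assume "Y \<ge> 0"
      then show ?thesis unfolding eq using Epos[of x] by (simp add: mult_nonneg_nonneg less_imp_le)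
    next
      assume Y2: "r \<ge> 2 \<and> Y \<ge> - 1"
      have "E x * (- Y) \<le> E x * 1" using Y2 Epos[of x] by (intro mult_left_mono) auto
      then have 1: "- E x * Y \<le> exp T" using ET(2)[OF x] by simp
      have "2 * E x \<le> r * E x" using Y2 Epos[of x] by (intro mult_right_mono) auto
      moreover have "E x * sector_gap \<beta> (snd x) \<le> E x * 1" using Epos[of x] sector_gap_le_1[OF \<beta>] by (intro mult_left_mono) auto
      ultimately have "exp (- T) \<le> \<bar>m None x - m (Some i) x\<bar>" using ET(1)[OF x] unfolding m_def option.case er by linarith
      then show ?thesis unfolding eq using 1 by blast
    qed
  qed
  have pair: "(m1 k x - m1 l x) * (F1 k x - F1 l x) + (m2 k x - m2 l x) * (F2 k x - F2 l x) \<le> 0 \<or>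
       \<bar>m k x - m l x\<bar> \<ge> exp (- T) \<and> (m1 k x - m1 l x) * (F1 k x - F1 l x) + (m2 k x - m2 l x) * (F2 k x - F2 l x) \<le> exp T"
    if k: "k \<in> J" and l: "l \<in> J" and x: "x \<in> C" for k l x
  proof -
    have xS: "x \<in> S" using x C by auto
    have swap: "(a - b) * (d - e) = (b - a) * (e - d)" for a b d e :: real by (simp add: algebra_simps)
    show ?thesis
    proof (cases k; cases l)
      fix i j assume kl: "k = Some i" "l = Some j"
      then have ij: "i \<in> I" "j \<in> I" using k l by (auto simp: J_def)
      have "(- (E x * cos (\<gamma> i x)) - - (E x * cos (\<gamma> j x))) * (\<alpha> * (E x * cos (\<gamma> i x)) / ell i x - \<alpha> * (E x * cos (\<gamma> j x)) / ell j x)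
        + (E x * sin (\<gamma> i x) - E x * sin (\<gamma> j x)) * (- \<alpha> * (E x * sin (\<gamma> i x)) / ell i x - - \<alpha> * (E x * sin (\<gamma> j x)) / ell j x) \<le> 0"
        using \<alpha> by (intro edge_edge_pair[OF Epos ellpos[OF ij(1) xS] ellpos[OF ij(2) xS] trig trig]) auto
      then show ?thesis unfolding m1_def m2_def F1_def F2_def kl option.case by blast
    next
      fix i assume kl: "k = None" "l = Some i"
      then have "i \<in> I" using l by (auto simp: J_def)
      from edge[OF this x] show ?thesis unfolding kl .
    next
      fix i assume kl: "k = Some i" "l = None"
      then have "i \<in> I" using k by (auto simp: J_def)
      from edge[OF this x] show ?thesis unfolding kl
        by (simp only: swap[of "m1 (Some i) x" "m1 None x" "F1 (Some i) x" "F1 None x"]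
            swap[of "m2 (Some i) x" "m2 None x" "F2 (Some i) x" "F2 None x"] abs_minus_commute[of "m (Some i) x" "m None x"])
    qed simp
  qed
  have W: "continuous_on S (\<lambda>x. (E x)\<^sup>2)" by (intro continuous_on_power cE)
  have E2: "(E x)\<^sup>2 = exp (2 * fst x)" for x by (simp add: E_def exp_double)
  have \<delta>J: "\<exists>k\<in>J. m k x \<le> \<delta> x" if x: "x \<in> C" for x
  proof -
    obtain t \<theta> where xt: "x = (t, \<theta>)" by force
    from \<delta>(3)[of t \<theta>] x xt consider "exp t * sector_gap \<beta> \<theta> \<le> \<delta> x" | i where "i \<in> I" "snd i - exp t * cos (\<theta> - fst i) \<le> \<delta> x" by force
    then show ?thesis
      by cases (auto simp: J_def m_def ell_def E_def xt)
  qed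
  have "c * (LINT x|lborel. (U x)\<^sup>2 * ((E x)\<^sup>2 / (\<delta> x + \<epsilon>)\<^sup>2)) \<le> (LINT x|lborel. (Ut x)\<^sup>2 + (Us x)\<^sup>2)"
  proof (rule softmin_hardy_inequality[where J = J and S = S and C = C and m = m and ?m1.0 = m1 and ?m2.0 = m2 and ?F1.0 = F1 and ?F2.0 = F2
       and ?F11.0 = F11 and ?F22.0 = F22 and B = "exp T" and \<eta> = "exp (- T)"])
    show "finite J" "J \<noteq> {}" using I by (auto simp: J_def)
    show "0 \<le> c" using c \<alpha> by simp
    show "continuous_on S \<delta>" using \<delta>(1) continuous_on_subset by blast
  qed (use C oS U0 cU dU cont der Q pair W mpos \<delta> \<delta>J \<epsilon> in auto)
  then show ?thesis unfolding E2 .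
qed

end

section \<open>The edge solution\<close>

text \<open>Coefficients of the hypergeometric series F(\<alpha>, \<alpha>; \<alpha> + 1/2; z). It
  arises when \<psi>'' = -\<alpha>(1 - \<alpha>) \<psi> / sin^2 is solved by \<psi> = sin^\<alpha>
  f(z) with z = (1 - cos \<theta>)/2.\<close>

fun gauss_coeff :: "real \<Rightarrow> nat \<Rightarrow> real" where
  "gauss_coeff \<alpha> 0 = 1"
| "gauss_coeff \<alpha> (Suc k) = gauss_coeff \<alpha> k * (k + \<alpha>)\<^sup>2 / ((k + 1) * (k + \<alpha> + 1/2))"

lemma gauss_coeff_pos: "\<alpha> > 0 \<Longrightarrow> gauss_coeff \<alpha> k > 0"
  by (induction k) (auto intro!: divide_pos_pos mult_pos_pos add_nonneg_pos)

text \<open>Every quotient of consecutive coefficients is at most 1. The geometric series is then a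
  majorant on the whole open disc, and the radius of convergence never has to be computed.\<close>

lemma gauss_coeff_le_1:
  assumes "1/2 \<le> \<alpha>" "\<alpha> \<le> 1"
  shows "gauss_coeff \<alpha> k \<le> 1"
proof (induction k)
  case (Suc k)
  have "\<alpha>\<^sup>2 \<le> 1" using assms by (simp add: power_le_one)
  have 1: "\<alpha> * real k \<le> 1 * real k" using assms by (intro mult_right_mono) auto
  have 2: "(k + \<alpha>)\<^sup>2 = k * k + 2 * (\<alpha> * k) + \<alpha>\<^sup>2"
    "(k + 1) * (k + \<alpha> + 1/2) = k * k + \<alpha> * k + (3/2) * k + \<alpha> + 1/2"
    by (simp_all add: power2_eq_square field_simps)
  have "(k + \<alpha>)\<^sup>2 \<le> (k + 1) * (k + \<alpha> + 1/2)"
    unfolding 2 using 1 assms \<open>\<alpha>\<^sup>2 \<le> 1\<close> by linarith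
  then have "(k + \<alpha>)\<^sup>2 / ((k + 1) * (k + \<alpha> + 1/2)) \<le> 1" using assms by (simp add: divide_le_eq_1)
  then have "gauss_coeff \<alpha> k * ((k + \<alpha>)\<^sup>2 / ((k + 1) * (k + \<alpha> + 1/2))) \<le> 1"
    using Suc assms by (intro mult_le_one) (auto intro: divide_nonneg_nonneg)
  then show ?case by (simp add: add.commute)
qed simp

declare gauss_coeff.simps(2) [simp del]

definition gauss_series :: "real \<Rightarrow> real \<Rightarrow> real" where
  "gauss_series \<alpha> z = (\<Sum>k. gauss_coeff \<alpha> k * z ^ k)"

definition gauss_series1 :: "real \<Rightarrow> real \<Rightarrow> real" where
  "gauss_series1 \<alpha> z = (\<Sum>k. diffs (gauss_coeff \<alpha>) k * z ^ k)"

definition gauss_series2 :: "real \<Rightarrow> real \<Rightarrow> real" where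
  "gauss_series2 \<alpha> z = (\<Sum>k. diffs (diffs (gauss_coeff \<alpha>)) k * z ^ k)"

context
  fixes \<alpha> :: real
  assumes \<alpha>: "1/2 \<le> \<alpha>" "\<alpha> \<le> 1"
begin

lemma gauss_summable: "\<bar>z\<bar> < 1 \<Longrightarrow> summable (\<lambda>k. gauss_coeff \<alpha> k * z ^ k)"
proof (rule summable_comparison_test')
  show "norm (gauss_coeff \<alpha> k * z ^ k) \<le> \<bar>z\<bar> ^ k" for k
    using gauss_coeff_le_1[OF \<alpha>, of k] gauss_coeff_pos[of \<alpha> k] \<alpha>
    by (simp add: abs_mult power_abs mult_left_le_one_le)
qed (simp add: summable_geometric)

lemma gauss_summable1: "\<bar>z\<bar> < 1 \<Longrightarrow> summable (\<lambda>k. diffs (gauss_coeff \<alpha>) k * z ^ k)"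
  by (rule termdiff_converges[where K = 1]) (auto intro: gauss_summable)

lemma gauss_summable2: "\<bar>z\<bar> < 1 \<Longrightarrow> summable (\<lambda>k. diffs (diffs (gauss_coeff \<alpha>)) k * z ^ k)"
  by (rule termdiff_converges[where K = 1]) (auto intro: gauss_summable1)

lemma gauss_series_deriv:
  "\<bar>z\<bar> < 1 \<Longrightarrow> (gauss_series \<alpha> has_real_derivative gauss_series1 \<alpha> z) (at z)"
  unfolding gauss_series_def[abs_def] gauss_series1_def
  by (rule termdiffs_strong'[where K = 1]) (auto intro: gauss_summable)

lemma gauss_series1_deriv:
  "\<bar>z\<bar> < 1 \<Longrightarrow> (gauss_series1 \<alpha> has_real_derivative gauss_series2 \<alpha> z) (at z)"
  unfolding gauss_series2_def gauss_series1_def[abs_def]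
  by (rule termdiffs_strong'[where K = 1]) (auto intro: gauss_summable1)

text \<open>Comparison of coefficients of \<open>z ^ k\<close> reduces the hypergeometric equation
  to the recurrence that defines \<open>gauss_coeff\<close>.\<close>

lemma gauss_ode:
  assumes z: "\<bar>z\<bar> < 1"
  shows "z * (1 - z) * gauss_series2 \<alpha> z + (\<alpha> + 1/2 - (2 * \<alpha> + 1) * z) * gauss_series1 \<alpha> z - \<alpha>\<^sup>2 * gauss_series \<alpha> z = 0"
proof -
  let ?a = "gauss_coeff \<alpha>"
  have shift: "(\<lambda>k. (if k = 0 then 0 else f (k - 1)) * z ^ k) sums (z * s)" if "(\<lambda>k. f k * z ^ k) sums s" for f s
  proof -
    have "(\<lambda>k. z * (f k * z ^ k)) sums (z * s)" by (rule sums_mult[OF that])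
    then have "(\<lambda>k. (if Suc k = 0 then 0 else f (Suc k - 1)) * z ^ Suc k) sums (z * s)" by (simp add: mult_ac)
    then show ?thesis by (subst (asm) sums_Suc_iff) simp
  qed
  note s0 = summable_sums[OF gauss_summable[OF z], folded gauss_series_def]
  note s1 = summable_sums[OF gauss_summable1[OF z], folded gauss_series1_def]
  note s2 = summable_sums[OF gauss_summable2[OF z], folded gauss_series2_def]
  \<comment> \<open>Multiplication by z shifts the coefficients by one place; the value 0 at index 0
    stands for the missing term.\<close>
  define g2 where "g2 k = (if k = 0 then 0 else diffs (diffs ?a) (k - 1))" for k
  define g1 where "g1 k = (if k = 0 then 0 else diffs ?a (k - 1))" for k
  have t2: "(\<lambda>k. g2 k * z ^ k) sums (z * gauss_series2 \<alpha> z)" unfolding g2_def by (rule shift[OF s2])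
  have t22: "(\<lambda>k. (if k = 0 then 0 else g2 (k - 1)) * z ^ k) sums (z * (z * gauss_series2 \<alpha> z))" by (rule shift[OF t2])
  have t1: "(\<lambda>k. g1 k * z ^ k) sums (z * gauss_series1 \<alpha> z)" unfolding g1_def by (rule shift[OF s1])
  have rec: "(k + 1) * (k + \<alpha> + 1/2) * ?a (Suc k) = (k + \<alpha>)\<^sup>2 * ?a k" for k
  proof -
    have "(real k + 1) * (k + \<alpha> + 1/2) \<noteq> 0" using \<alpha> by auto
    moreover have "D * (a * X / D) = X * a" if "D \<noteq> 0" for D a X :: real using that by simp
    ultimately show ?thesis unfolding gauss_coeff.simps by (metis of_nat_1 of_nat_add)
  qed
  have coeff: "g2 k - (if k = 0 then 0 else g2 (k - 1)) + (\<alpha> + 1/2) * diffs ?a k - (2 * \<alpha> + 1) * g1 k - \<alpha>\<^sup>2 * ?a k = 0" for k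
  proof (cases k)
    case 0
    then show ?thesis using rec[of 0] by (simp add: g2_def g1_def diffs_def)
  next
    case (Suc j)
    have g: "g2 k = real k * (real k + 1) * ?a (Suc k)" "diffs ?a k = (real k + 1) * ?a (Suc k)" "g1 k = real k * ?a k"
      by (simp_all add: Suc g2_def g1_def diffs_def algebra_simps)
    have g': "g2 (k - 1) = real j * real k * ?a k"
      by (cases j) (simp_all add: Suc g2_def diffs_def algebra_simps)
    have j: "real j = real k - 1" by (simp add: Suc)
    have "g2 k - g2 (k - 1) + (\<alpha> + 1/2) * diffs ?a k - (2 * \<alpha> + 1) * g1 k - \<alpha>\<^sup>2 * ?a k
      = (k + 1) * (k + \<alpha> + 1/2) * ?a (Suc k) - (k + \<alpha>)\<^sup>2 * ?a k"
      unfolding g g' j by (simp add: power2_eq_square field_simps)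
    also have "\<dots> = 0" using rec[of k] by (simp add: add.commute)
    finally show ?thesis using Suc by simp
  qed
  have "(\<lambda>k. g2 k * z ^ k - (if k = 0 then 0 else g2 (k - 1)) * z ^ k + (\<alpha> + 1/2) * (diffs ?a k * z ^ k)
       - (2 * \<alpha> + 1) * (g1 k * z ^ k) - \<alpha>\<^sup>2 * (?a k * z ^ k)) sums
     (z * gauss_series2 \<alpha> z - z * (z * gauss_series2 \<alpha> z) + (\<alpha> + 1/2) * gauss_series1 \<alpha> z
       - (2 * \<alpha> + 1) * (z * gauss_series1 \<alpha> z) - \<alpha>\<^sup>2 * gauss_series \<alpha> z)"
    by (intro sums_add sums_diff sums_mult t2 t22 t1 s0 s1)
  moreover have "(\<lambda>k. g2 k * z ^ k - (if k = 0 then 0 else g2 (k - 1)) * z ^ k + (\<alpha> + 1/2) * (diffs ?a k * z ^ k)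
       - (2 * \<alpha> + 1) * (g1 k * z ^ k) - \<alpha>\<^sup>2 * (?a k * z ^ k)) = (\<lambda>k. 0)"
  proof
    fix k
    have "g2 k * z ^ k - (if k = 0 then 0 else g2 (k - 1)) * z ^ k + (\<alpha> + 1/2) * (diffs ?a k * z ^ k)
       - (2 * \<alpha> + 1) * (g1 k * z ^ k) - \<alpha>\<^sup>2 * (?a k * z ^ k)
      = (g2 k - (if k = 0 then 0 else g2 (k - 1)) + (\<alpha> + 1/2) * diffs ?a k - (2 * \<alpha> + 1) * g1 k - \<alpha>\<^sup>2 * ?a k) * z ^ k"
      by (simp add: algebra_simps)
    then show "g2 k * z ^ k - (if k = 0 then 0 else g2 (k - 1)) * z ^ k + (\<alpha> + 1/2) * (diffs ?a k * z ^ k)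
       - (2 * \<alpha> + 1) * (g1 k * z ^ k) - \<alpha>\<^sup>2 * (?a k * z ^ k) = 0" unfolding coeff by simp
  qed
  ultimately have "(\<lambda>k. 0) sums (z * gauss_series2 \<alpha> z - z * (z * gauss_series2 \<alpha> z) + (\<alpha> + 1/2) * gauss_series1 \<alpha> z
       - (2 * \<alpha> + 1) * (z * gauss_series1 \<alpha> z) - \<alpha>\<^sup>2 * gauss_series \<alpha> z)" by (simp only:)
  then have "z * gauss_series2 \<alpha> z - z * (z * gauss_series2 \<alpha> z) + (\<alpha> + 1/2) * gauss_series1 \<alpha> z
       - (2 * \<alpha> + 1) * (z * gauss_series1 \<alpha> z) - \<alpha>\<^sup>2 * gauss_series \<alpha> z = 0"
    by (rule sums_unique2[OF _ sums_zero])
  then show ?thesis by (simp add: algebra_simps)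
qed

lemma gauss_series1_pos:
  assumes "0 \<le> z" "z < 1"
  shows "gauss_series1 \<alpha> z > 0"
  unfolding gauss_series1_def
proof (rule suminf_pos2[where i = 0])
  show "0 \<le> diffs (gauss_coeff \<alpha>) n * z ^ n" for n
    unfolding diffs_def using gauss_coeff_pos[of \<alpha> "Suc n"] \<alpha> assms by simp
  show "0 < diffs (gauss_coeff \<alpha>) 0 * z ^ 0" unfolding diffs_def using gauss_coeff_pos[of \<alpha> 1] \<alpha> by simp
  show "summable (\<lambda>k. diffs (gauss_coeff \<alpha>) k * z ^ k)" using assms by (intro gauss_summable1) simp
qed

lemma gauss_series_pos:
  assumes "0 \<le> z" "z < 1"
  shows "gauss_series \<alpha> z > 0"
  unfolding gauss_series_def
proof (rule suminf_pos2[where i = 0])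
  show "0 \<le> gauss_coeff \<alpha> n * z ^ n" for n
    using gauss_coeff_pos[of \<alpha> n] \<alpha> assms by simp
  show "summable (\<lambda>k. gauss_coeff \<alpha> k * z ^ k)" using assms by (intro gauss_summable) simp
qed simp

lemma gauss_series_mono:
  assumes "0 \<le> z" "z \<le> y" "y < 1"
  shows "gauss_series \<alpha> z \<le> gauss_series \<alpha> y"
proof (rule DERIV_nonneg_imp_nondecreasing[OF assms(2)])
  fix x assume "z \<le> x" "x \<le> y"
  then have "0 \<le> x" "x < 1" "\<bar>x\<bar> < 1" using assms by auto
  then show "\<exists>d. (gauss_series \<alpha> has_real_derivative d) (at x) \<and> 0 \<le> d"
    using gauss_series_deriv[of x] gauss_series1_pos[of x] by (meson less_imp_le)
qed

text \<open>The logarithmic derivative of \<open>edge_solution\<close>, written out. At pi/2 it is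
  half of F'(1/2)/F(1/2), which by Gauss's second summation theorem equals 2
  (\<Gamma>((\<alpha>+1)/2) / \<Gamma>(\<alpha>/2))^2. The slope condition used below is thus the
  transcendental equation for the constant, read as an inequality.\<close>

definition edge_log_deriv :: "real \<Rightarrow> real" where
  "edge_log_deriv \<theta> = \<alpha> * (cos \<theta> / sin \<theta>) + sin \<theta> / 2 * (gauss_series1 \<alpha> ((1 - cos \<theta>) / 2) / gauss_series \<alpha> ((1 - cos \<theta>) / 2))"

definition edge_solution :: "real \<Rightarrow> real" where
  "edge_solution \<theta> = sin \<theta> powr \<alpha> * gauss_series \<alpha> ((1 - cos \<theta>) / 2)"

lemma half_angle_range:
  assumes "0 < \<theta>" "\<theta> < pi"
  shows "0 \<le> (1 - cos \<theta>) / 2" "(1 - cos \<theta>) / 2 < 1" "\<bar>(1 - cos \<theta>) / 2\<bar> < 1"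
proof -
  have "cos pi < cos \<theta>" using assms by (intro cos_monotone_0_pi) auto
  then show "0 \<le> (1 - cos \<theta>) / 2" "(1 - cos \<theta>) / 2 < 1" "\<bar>(1 - cos \<theta>) / 2\<bar> < 1" using cos_le_one[of \<theta>] by auto
qed

lemma edge_solution_pos: "0 < \<theta> \<Longrightarrow> \<theta> < pi \<Longrightarrow> edge_solution \<theta> > 0"
  unfolding edge_solution_def
  using half_angle_range[of \<theta>] sin_gt_zero[of \<theta>] by (intro mult_pos_pos gauss_series_pos) auto

lemma edge_solution_deriv:
  assumes "0 < \<theta>" "\<theta> < pi"
  shows "(edge_solution has_real_derivative edge_log_deriv \<theta> * edge_solution \<theta>) (at \<theta>)"
proof -
  have s: "sin \<theta> > 0" using assms by (simp add: sin_gt_zero)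
  define z where "z = (1 - cos \<theta>) / 2"
  have f: "gauss_series \<alpha> z > 0" unfolding z_def using half_angle_range[OF assms] by (intro gauss_series_pos)
  have dz: "((\<lambda>\<theta>. (1 - cos \<theta>) / 2) has_real_derivative sin \<theta> / 2) (at \<theta>)"
    by (auto intro!: derivative_eq_intros)
  have d1: "((\<lambda>\<theta>. gauss_series \<alpha> ((1 - cos \<theta>) / 2)) has_real_derivative gauss_series1 \<alpha> z * (sin \<theta> / 2)) (at \<theta>)"
    unfolding z_def by (rule DERIV_chain2[OF gauss_series_deriv[OF half_angle_range(3)[OF assms]] dz])
  have d2: "((\<lambda>\<theta>. sin \<theta> powr \<alpha>) has_real_derivative sin \<theta> powr \<alpha> * (\<alpha> * (cos \<theta> / sin \<theta>))) (at \<theta>)"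
    using s by (auto intro!: derivative_eq_intros simp: powr_diff field_simps)
  have "edge_log_deriv \<theta> * edge_solution \<theta> = sin \<theta> powr \<alpha> * (gauss_series1 \<alpha> z * (sin \<theta> / 2)) + sin \<theta> powr \<alpha> * (\<alpha> * (cos \<theta> / sin \<theta>)) * gauss_series \<alpha> z"
    unfolding edge_log_deriv_def edge_solution_def z_def[symmetric] using f by (simp add: algebra_simps)
  then show ?thesis unfolding edge_solution_def[abs_def] using DERIV_mult[OF d2 d1] by (simp add: z_def algebra_simps)
qed

text \<open>The second-order equation of the edge solution in Riccati form; the hypergeometric
  equation serves to eliminate the second derivative of the series.\<close>

lemma edge_log_deriv_riccati:
  assumes "0 < \<theta>" "\<theta> < pi"
  shows "(edge_log_deriv has_real_derivative - (edge_log_deriv \<theta>)\<^sup>2 - \<alpha> * (1 - \<alpha>) / (sin \<theta>)\<^sup>2) (at \<theta>)"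
proof -
  have s: "sin \<theta> > 0" using assms by (simp add: sin_gt_zero)
  define z where "z = (1 - cos \<theta>) / 2"
  note r = half_angle_range[OF assms, folded z_def]
  have f: "gauss_series \<alpha> z > 0" using r by (intro gauss_series_pos)
  have dz: "((\<lambda>\<theta>. (1 - cos \<theta>) / 2) has_real_derivative sin \<theta> / 2) (at \<theta>)"
    by (auto intro!: derivative_eq_intros)
  have d0: "((\<lambda>\<theta>. gauss_series \<alpha> ((1 - cos \<theta>) / 2)) has_real_derivative gauss_series1 \<alpha> z * (sin \<theta> / 2)) (at \<theta>)"
    unfolding z_def by (rule DERIV_chain2[OF gauss_series_deriv[OF half_angle_range(3)[OF assms]] dz])
  have d1: "((\<lambda>\<theta>. gauss_series1 \<alpha> ((1 - cos \<theta>) / 2)) has_real_derivative gauss_series2 \<alpha> z * (sin \<theta> / 2)) (at \<theta>)"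
    unfolding z_def by (rule DERIV_chain2[OF gauss_series1_deriv[OF half_angle_range(3)[OF assms]] dz])
  define f0 f1 f2 where "f0 = gauss_series \<alpha> z" and "f1 = gauss_series1 \<alpha> z" and "f2 = gauss_series2 \<alpha> z"
  note fd = f0_def f1_def f2_def
  have dW: "(edge_log_deriv has_real_derivative
     \<alpha> * ((- sin \<theta> * sin \<theta> - cos \<theta> * cos \<theta>) / (sin \<theta> * sin \<theta>)) +
     (cos \<theta> / 2 * (f1 / f0) + ((f2 * (sin \<theta> / 2)) * f0 - f1 * (f1 * (sin \<theta> / 2))) / (f0 * f0) * (sin \<theta> / 2))) (at \<theta>)"
    unfolding edge_log_deriv_def[abs_def] fd
    by (rule derivative_eq_intros d0 d1 refl | (use s f in \<open>simp add: z_def[symmetric]\<close>))+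
  have cz: "cos \<theta> = 1 - 2 * z" by (simp add: z_def field_simps)
  have s2: "(sin \<theta>)\<^sup>2 = 4 * z * (1 - z)" unfolding sin_squared_eq cz by (simp add: power2_eq_square algebra_simps)
  have ode: "z * (1 - z) * f2 = \<alpha>\<^sup>2 * f0 - (\<alpha> + 1/2 - (2 * \<alpha> + 1) * z) * f1"
    using gauss_ode[OF r(3)] unfolding fd by simp
  \<comment> \<open>Here z(1 - z) = sin^2/4 and 1 - 2z = cos \<theta>, which rewrites the
    hypergeometric equation in the angle.\<close>
  have e: "f2 * (sin \<theta>)\<^sup>2 / 4 = \<alpha>\<^sup>2 * f0 - (\<alpha> + 1/2) * cos \<theta> * f1"
  proof -
    have "f2 * (sin \<theta>)\<^sup>2 / 4 = z * (1 - z) * f2" unfolding s2 by simp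
    then show ?thesis unfolding ode by (simp add: cz algebra_simps)
  qed
  have f0: "f0 > 0" using f by (simp add: fd)
  define h where "h = f1 / f0"
  define q where "q = cos \<theta> / sin \<theta>"
  have W: "edge_log_deriv \<theta> = \<alpha> * q + sin \<theta> / 2 * h"
    unfolding edge_log_deriv_def h_def q_def fd z_def ..
  have q2: "1 / (sin \<theta>)\<^sup>2 = 1 + q\<^sup>2" 
    using s by (simp add: q_def field_simps)
  have t1: "\<alpha> * ((- sin \<theta> * sin \<theta> - cos \<theta> * cos \<theta>) / (sin \<theta> * sin \<theta>)) = - \<alpha> * (1 / (sin \<theta>)\<^sup>2)"
  proof -
    have "- sin \<theta> * sin \<theta> - cos \<theta> * cos \<theta> = - 1" using sin_cos_squared_add[of \<theta>] unfolding power2_eq_square by linarith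
    then show ?thesis by (simp only: power2_eq_square)
  qed
  have t2: "((f2 * (sin \<theta> / 2)) * f0 - f1 * (f1 * (sin \<theta> / 2))) / (f0 * f0) * (sin \<theta> / 2) = (f2 * (sin \<theta>)\<^sup>2 / 4) / f0 - (sin \<theta> / 2 * h)\<^sup>2"
    using f0 by (simp add: h_def field_simps power2_eq_square)
  have t3: "(f2 * (sin \<theta>)\<^sup>2 / 4) / f0 = \<alpha>\<^sup>2 - (\<alpha> + 1/2) * cos \<theta> * h"
    unfolding e h_def using f0 by (simp add: field_simps)
  have t4: "cos \<theta> * h = 2 * q * (sin \<theta> / 2 * h)" using s by (simp add: q_def)
  have "\<alpha> * ((- sin \<theta> * sin \<theta> - cos \<theta> * cos \<theta>) / (sin \<theta> * sin \<theta>)) +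
     (cos \<theta> / 2 * (f1 / f0) + ((f2 * (sin \<theta> / 2)) * f0 - f1 * (f1 * (sin \<theta> / 2))) / (f0 * f0) * (sin \<theta> / 2))
     = - \<alpha> * (1 + q\<^sup>2) + \<alpha>\<^sup>2 - \<alpha> * (2 * q * (sin \<theta> / 2 * h)) - (sin \<theta> / 2 * h)\<^sup>2"
  proof -
    define A where "A = sin \<theta> / 2 * h"
    have "cos \<theta> / 2 * h = q * A" "(\<alpha> + 1/2) * cos \<theta> * h = (2 * \<alpha> + 1) * (q * A)"
      using t4 unfolding A_def[symmetric] by (simp_all add: field_simps)
    then show ?thesis unfolding h_def[symmetric] t1 t2 t3 q2 A_def[symmetric] by (simp add: algebra_simps)
  qed
  also have "\<dots> = - (edge_log_deriv \<theta>)\<^sup>2 - \<alpha> * (1 - \<alpha>) * (1 + q\<^sup>2)"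
    unfolding W by (simp add: power2_eq_square algebra_simps)
  also have "\<dots> = - (edge_log_deriv \<theta>)\<^sup>2 - \<alpha> * (1 - \<alpha>) / (sin \<theta>)\<^sup>2" unfolding q2[symmetric] by simp
  finally show ?thesis using dW by simp
qed

lemma edge_log_deriv_half_pi: "edge_log_deriv (pi/2) > 0"
  using gauss_series1_pos[of "1/2"] gauss_series_pos[of "1/2"] by (simp add: edge_log_deriv_def)

text \<open>The decay like \<theta>^\<alpha> at the edge is what later pays for cutting the solution
  off there.\<close>

lemma edge_solution_le:
  assumes "0 < \<theta>" "\<theta> \<le> pi/2"
  shows "edge_solution \<theta> \<le> gauss_series \<alpha> (1/2) * \<theta> powr \<alpha>"
proof -
  have 1: "0 \<le> cos \<theta>" using assms by (intro cos_ge_zero) auto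
  have "sin \<theta> powr \<alpha> \<le> \<theta> powr \<alpha>"
    using assms \<alpha> sin_x_le_x[of \<theta>] sin_gt_zero[of \<theta>] by (intro powr_mono2) auto
  moreover have "gauss_series \<alpha> ((1 - cos \<theta>) / 2) \<le> gauss_series \<alpha> (1/2)"
    using 1 cos_le_one[of \<theta>] by (intro gauss_series_mono) auto
  moreover have "0 \<le> gauss_series \<alpha> ((1 - cos \<theta>) / 2)"
    using half_angle_range[of \<theta>] assms pi_gt_zero by (intro less_imp_le[OF gauss_series_pos]) auto
  ultimately have "sin \<theta> powr \<alpha> * gauss_series \<alpha> ((1 - cos \<theta>) / 2) \<le> \<theta> powr \<alpha> * gauss_series \<alpha> (1/2)"
    by (intro mult_mono) auto
  then show ?thesis by (simp add: edge_solution_def mult.commute)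
qed

end

text \<open>A Riccati solution lying below the one of the edge solution: \<open>w\<close> is the logarithmic derivative of
  \<open>\<psi> (1 + C \<integral> \<psi>\<^sup>-\<^sup>2)\<close> for the edge solution \<open>\<psi>\<close>, and \<open>C\<close> tunes its value at \<open>\<pi>/2\<close>.\<close>

lemma edge_riccati_below:
  fixes \<alpha> w0 :: real
  assumes \<alpha>: "1/2 \<le> \<alpha>" "\<alpha> \<le> 1" and w0: "0 \<le> w0" "w0 \<le> edge_log_deriv \<alpha> (pi/2)"
  obtains w where "\<And>\<theta>. 0 < \<theta> \<Longrightarrow> \<theta> \<le> pi/2 \<Longrightarrow> (w has_real_derivative - (w \<theta>)\<^sup>2 - \<alpha> * (1 - \<alpha>) / (sin \<theta>)\<^sup>2) (at \<theta>)"
    "w (pi/2) = w0" "\<And>\<theta>. 0 < \<theta> \<Longrightarrow> \<theta> \<le> pi/2 \<Longrightarrow> 0 \<le> w \<theta>"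
proof -
  define \<psi> where "\<psi> = edge_solution \<alpha>"
  define W where "W = edge_log_deriv \<alpha>"
  have \<psi>pos: "\<psi> \<theta> > 0" if "0 < \<theta>" "\<theta> < pi" for \<theta> unfolding \<psi>_def by (rule edge_solution_pos[OF \<alpha> that])
  have d\<psi>: "(\<psi> has_real_derivative W \<theta> * \<psi> \<theta>) (at \<theta>)" if "0 < \<theta>" "\<theta> < pi" for \<theta>
    unfolding \<psi>_def W_def by (rule edge_solution_deriv[OF \<alpha> that])
  have dW: "(W has_real_derivative - (W \<theta>)\<^sup>2 - \<alpha> * (1 - \<alpha>) / (sin \<theta>)\<^sup>2) (at \<theta>)" if "0 < \<theta>" "\<theta> < pi" for \<theta>
    unfolding W_def by (rule edge_log_deriv_riccati[OF \<alpha> that])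
  have cont: "isCont (\<lambda>\<theta>. - 1 / (\<psi> \<theta>)\<^sup>2) \<theta>" if "0 < \<theta>" "\<theta> < pi" for \<theta>
    using \<psi>pos[OF that] DERIV_isCont[OF d\<psi>[OF that]] by (intro continuous_intros) auto
  have "\<exists>F. \<forall>x::real. ereal 0 < ereal x \<longrightarrow> ereal x < ereal pi \<longrightarrow> (F has_vector_derivative (- 1 / (\<psi> x)\<^sup>2)) (at x)"
    by (rule einterval_antiderivative) (use cont pi_gt_zero in auto)
  then obtain F where F: "\<And>x. 0 < x \<Longrightarrow> x < pi \<Longrightarrow> (F has_real_derivative (- 1 / (\<psi> x)\<^sup>2)) (at x)"
    unfolding has_real_derivative_iff_has_vector_derivative by auto
  \<comment> \<open>\<open>I\<close> is the integral of \<psi>^(-2) from \<theta> to pi/2. The minus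
    sign sits in the derivative of \<open>F\<close>, so \<open>I\<close> is nonnegative to the left
    of pi/2.\<close>
  define I where "I \<theta> = F \<theta> - F (pi/2)" for \<theta>
  have dI: "(I has_real_derivative (- 1 / (\<psi> \<theta>)\<^sup>2)) (at \<theta>)" if "0 < \<theta>" "\<theta> < pi" for \<theta>
    unfolding I_def[abs_def] using F[OF that] by (auto intro!: derivative_eq_intros)
  have I0: "I \<theta> \<ge> 0" if "0 < \<theta>" "\<theta> \<le> pi/2" for \<theta>
  proof -
    have "I (pi/2) \<le> I \<theta>"
    proof (rule DERIV_nonpos_imp_nonincreasing[OF that(2)])
      fix x assume "\<theta> \<le> x" "x \<le> pi/2"
      then have "0 < x" "x < pi" using that pi_gt_zero by linarith+
      then show "\<exists>y. (I has_real_derivative y) (at x) \<and> y \<le> 0" using dI by (intro exI[of _ "- 1 / (\<psi> x)\<^sup>2"]) auto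
    qed
    then show ?thesis by (simp add: I_def)
  qed
  define C where "C = (W (pi/2) - w0) * (\<psi> (pi/2))\<^sup>2"
  have C: "C \<ge> 0" using w0 by (simp add: C_def W_def)
  \<comment> \<open>\<open>- s\<close> is the logarithmic derivative of 1 + C I, so
    \<open>W - s\<close> belongs to the second solution \<psi> (1 + C I). As \<open>I\<close>
    vanishes at pi/2, the choice of \<open>C\<close> gives exactly \<open>w0\<close> there.\<close>
  define s where "s \<theta> = C / ((\<psi> \<theta>)\<^sup>2 * (1 + C * I \<theta>))" for \<theta>
  define w where "w \<theta> = W \<theta> - s \<theta>" for \<theta>
  have ds: "(s has_real_derivative (s \<theta>)\<^sup>2 - 2 * W \<theta> * s \<theta>) (at \<theta>)" if "0 < \<theta>" "\<theta> \<le> pi/2" for \<theta>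
  proof -
    have \<theta>: "0 < \<theta>" "\<theta> < pi" using that pi_gt_zero by linarith+
    have p: "\<psi> \<theta> > 0" "1 + C * I \<theta> > 0" using \<psi>pos[OF \<theta>] C I0[OF that] by (auto intro: add_pos_nonneg)
    define D where "D = (\<psi> \<theta>)\<^sup>2 * (1 + C * I \<theta>)"
    have D: "D > 0" using p by (simp add: D_def)
    have "((\<lambda>\<theta>. (\<psi> \<theta>)\<^sup>2 * (1 + C * I \<theta>)) has_real_derivative
        (2 * \<psi> \<theta> * (W \<theta> * \<psi> \<theta>)) * (1 + C * I \<theta>) + (C * (- 1 / (\<psi> \<theta>)\<^sup>2)) * (\<psi> \<theta>)\<^sup>2) (at \<theta>)"
    proof (rule DERIV_mult)
      show "((\<lambda>\<theta>. (\<psi> \<theta>)\<^sup>2) has_real_derivative 2 * \<psi> \<theta> * (W \<theta> * \<psi> \<theta>)) (at \<theta>)"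
        using DERIV_power[OF d\<psi>[OF \<theta>], of 2] by (simp add: mult_ac)
      show "((\<lambda>\<theta>. 1 + C * I \<theta>) has_real_derivative C * (- 1 / (\<psi> \<theta>)\<^sup>2)) (at \<theta>)"
        using DERIV_add[OF DERIV_const DERIV_cmult[OF dI[OF \<theta>]]] by simp
    qed
    moreover have "(2 * \<psi> \<theta> * (W \<theta> * \<psi> \<theta>)) * (1 + C * I \<theta>) + (C * (- 1 / (\<psi> \<theta>)\<^sup>2)) * (\<psi> \<theta>)\<^sup>2 = 2 * W \<theta> * D - C"
      using p by (simp add: D_def power2_eq_square)
    ultimately have dD: "((\<lambda>\<theta>. (\<psi> \<theta>)\<^sup>2 * (1 + C * I \<theta>)) has_real_derivative 2 * W \<theta> * D - C) (at \<theta>)" by simp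
    have "(s has_real_derivative (0 * D - C * (2 * W \<theta> * D - C)) / (D * D)) (at \<theta>)"
      unfolding s_def[abs_def] D_def using DERIV_divide[OF DERIV_const dD less_imp_neq[OF D[unfolded D_def], symmetric], of C]
      by (simp only: D_def)
    moreover have "(0 * D - C * (2 * W \<theta> * D - C)) / (D * D) = (s \<theta>)\<^sup>2 - 2 * W \<theta> * s \<theta>"
      unfolding s_def D_def[symmetric] using D by (simp add: field_simps power2_eq_square)
    ultimately show ?thesis by simp
  qed
  have dw: "(w has_real_derivative - (w \<theta>)\<^sup>2 - \<alpha> * (1 - \<alpha>) / (sin \<theta>)\<^sup>2) (at \<theta>)" if "0 < \<theta>" "\<theta> \<le> pi/2" for \<theta>
  proof -
    have \<theta>: "0 < \<theta>" "\<theta> < pi" using that pi_gt_zero by linarith+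
    have "(w has_real_derivative (- (W \<theta>)\<^sup>2 - \<alpha> * (1 - \<alpha>) / (sin \<theta>)\<^sup>2) - ((s \<theta>)\<^sup>2 - 2 * W \<theta> * s \<theta>)) (at \<theta>)"
      unfolding w_def[abs_def] by (intro DERIV_diff dW[OF \<theta>] ds[OF that])
    moreover have "(- (W \<theta>)\<^sup>2 - \<alpha> * (1 - \<alpha>) / (sin \<theta>)\<^sup>2) - ((s \<theta>)\<^sup>2 - 2 * W \<theta> * s \<theta>) = - (w \<theta>)\<^sup>2 - \<alpha> * (1 - \<alpha>) / (sin \<theta>)\<^sup>2"
      by (simp add: w_def power2_eq_square algebra_simps)
    ultimately show ?thesis by simp
  qed
  have w1: "w (pi/2) = w0"
  proof -
    have "\<psi> (pi/2) > 0" using \<psi>pos[of "pi/2"] pi_gt_zero by simp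
    then show ?thesis by (simp add: w_def s_def I_def C_def)
  qed
  \<comment> \<open>The right-hand side of the Riccati equation is nonpositive, so w decreases
    towards its last value w0 \<ge> 0.\<close>
  have "0 \<le> w \<theta>" if "0 < \<theta>" "\<theta> \<le> pi/2" for \<theta>
  proof -
    have "w (pi/2) \<le> w \<theta>"
    proof (rule DERIV_nonpos_imp_nonincreasing[OF that(2)])
      fix x assume x: "\<theta> \<le> x" "x \<le> pi/2"
      have "0 \<le> \<alpha> * (1 - \<alpha>) / (sin x)\<^sup>2" using \<alpha> by (intro divide_nonneg_nonneg mult_nonneg_nonneg) auto
      then have "- (w x)\<^sup>2 - \<alpha> * (1 - \<alpha>) / (sin x)\<^sup>2 \<le> 0" by (smt (verit) zero_le_power2)
      then show "\<exists>y. (w has_real_derivative y) (at x) \<and> y \<le> 0" using dw[of x] x that by force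
    qed
    then show ?thesis using w1 w0 by simp
  qed
  then show ?thesis using that dw w1 by blast
qed

text \<open>Where the gap is 1, the solution odd about \<beta>/2 is k tan(k(\<beta>/2 - \<theta>))
  with k = sqrt c. The slope hypothesis says that its value at pi/2 does not exceed that of the edge
  solution, so a Riccati solution below the latter can be attached on the left; the right part is
  its reflection.\<close>

lemma supersolution_exists:
  fixes \<beta> c \<alpha> :: real
  assumes \<beta>: "pi < \<beta>" "\<beta> \<le> 2 * pi" and \<alpha>: "1/2 \<le> \<alpha>" "\<alpha> \<le> 1" and c: "c = \<alpha> * (1 - \<alpha>)"
    and le: "sqrt c * tan (sqrt c * (\<beta> - pi) / 2) \<le> edge_log_deriv \<alpha> (pi/2)"
  obtains w where "hardy_supersolution \<beta> \<alpha> c w"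
proof -
  have c0: "0 \<le> c" using \<alpha> c by simp
  \<comment> \<open>This gives sqrt c \<le> 1/2. It keeps the arguments of the tangent within pi/4,
    away from the poles, and it will yield the bound on w in the middle.\<close>
  have "c \<le> 1/4"
  proof -
    have "0 \<le> (\<alpha> - 1/2)\<^sup>2" by simp
    then show ?thesis unfolding c by (simp add: power2_eq_square algebra_simps)
  qed
  then have "sqrt c \<le> sqrt ((1/2)\<^sup>2)" by (intro real_sqrt_le_mono) (simp add: power2_eq_square)
  then have k: "0 \<le> sqrt c" "sqrt c \<le> 1/2" using c0 by simp_all
  define k where "k = sqrt c"
  note k = k[folded k_def]
  have kc: "k\<^sup>2 = c" using c0 by (simp add: k_def)
  have arg: "\<bar>k * x\<bar> \<le> pi/4" if "\<bar>x\<bar> \<le> pi/2" for x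
  proof -
    have "\<bar>k * x\<bar> \<le> 1/2 * (pi/2)" unfolding abs_mult using k that by (intro mult_mono) auto
    then show ?thesis by simp
  qed
  define mid where "mid \<theta> = k * tan (k * (\<beta>/2 - \<theta>))" for \<theta>
  have range: "\<bar>\<beta>/2 - \<theta>\<bar> \<le> pi/2" if "pi/2 \<le> \<theta>" "\<theta> \<le> \<beta> - pi/2" for \<theta> using that \<beta> by linarith
  have dmid: "(mid has_real_derivative - (mid \<theta>)\<^sup>2 - c) (at \<theta>)" if "pi/2 \<le> \<theta>" "\<theta> \<le> \<beta> - pi/2" for \<theta>
  proof -
    have "\<bar>k * (\<beta>/2 - \<theta>)\<bar> < pi/2" using arg[OF range[OF that]] pi_gt_zero by linarith
    then have "cos (k * (\<beta>/2 - \<theta>)) > 0" unfolding abs_less_iff by (intro cos_gt_zero_pi) linarith+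
    then have cz: "cos (k * (\<beta>/2 - \<theta>)) \<noteq> 0" by simp
    have "(mid has_real_derivative k * (inverse ((cos (k * (\<beta>/2 - \<theta>)))\<^sup>2) * (- k))) (at \<theta>)"
      unfolding mid_def[abs_def]
      by (rule derivative_eq_intros cz refl | simp add: cz)+
    moreover have "inverse ((cos (k * (\<beta>/2 - \<theta>)))\<^sup>2) = 1 + (tan (k * (\<beta>/2 - \<theta>)))\<^sup>2"
      using tan_sec[OF cz] by (simp add: power_inverse)
    moreover have "k * ((1 + (tan (k * (\<beta>/2 - \<theta>)))\<^sup>2) * (- k)) = - (mid \<theta>)\<^sup>2 - c"
      unfolding mid_def kc[symmetric] by (simp add: power2_eq_square algebra_simps)
    ultimately show ?thesis by simp
  qed
  have mid_symm: "mid (\<beta> - \<theta>) = - mid \<theta>" for \<theta>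
  proof -
    have "k * (\<beta>/2 - (\<beta> - \<theta>)) = - (k * (\<beta>/2 - \<theta>))" by (simp add: field_simps)
    then show ?thesis unfolding mid_def by (simp only: tan_minus mult_minus_right)
  qed
  have mid0: "mid \<theta> \<ge> 0" if "pi/2 \<le> \<theta>" "\<theta> \<le> \<beta>/2" for \<theta>
  proof -
    have "0 \<le> k * (\<beta>/2 - \<theta>)" using k that by simp
    moreover have "k * (\<beta>/2 - \<theta>) < pi/2" using arg[OF range[of \<theta>]] that \<beta> pi_gt_zero by auto
    ultimately have "0 \<le> tan (k * (\<beta>/2 - \<theta>))" by (rule tan_pos_pi2_le)
    then show ?thesis using k by (simp add: mid_def)
  qed
  have "mid (pi/2) = sqrt c * tan (sqrt c * (\<beta> - pi) / 2)"
    by (simp add: mid_def k_def field_simps)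
  then have "0 \<le> mid (pi/2)" "mid (pi/2) \<le> edge_log_deriv \<alpha> (pi/2)"
    using mid0[of "pi/2"] le \<beta> by auto
  then obtain l where l: "\<And>\<theta>. 0 < \<theta> \<Longrightarrow> \<theta> \<le> pi/2 \<Longrightarrow> (l has_real_derivative - (l \<theta>)\<^sup>2 - \<alpha> * (1 - \<alpha>) / (sin \<theta>)\<^sup>2) (at \<theta>)"
    "l (pi/2) = mid (pi/2)" "\<And>\<theta>. 0 < \<theta> \<Longrightarrow> \<theta> \<le> pi/2 \<Longrightarrow> 0 \<le> l \<theta>"
    using edge_riccati_below[OF \<alpha>] by metis
  define w where "w \<theta> = (if \<theta> \<le> pi/2 then l \<theta> else if \<theta> \<le> \<beta> - pi/2 then mid \<theta> else - l (\<beta> - \<theta>))" for \<theta>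
  have dw: "(w has_real_derivative - (w \<theta>)\<^sup>2 - c / (sector_gap \<beta> \<theta>)\<^sup>2) (at \<theta>)" if \<theta>: "0 < \<theta>" "\<theta> < \<beta>" for \<theta>
  proof -
    define r' where "r' \<theta> = - (l (\<beta> - \<theta>))\<^sup>2 - c / (sin (\<beta> - \<theta>))\<^sup>2" for \<theta>
    define m' where "m' \<theta> = - (mid \<theta>)\<^sup>2 - c" for \<theta>
    define l' where "l' \<theta> = - (l \<theta>)\<^sup>2 - c / (sin \<theta>)\<^sup>2" for \<theta>
    have dr: "((\<lambda>\<theta>. - l (\<beta> - \<theta>)) has_real_derivative r' \<theta>) (at \<theta>)" if "\<beta> - pi/2 \<le> \<theta>"
    proof -
      have "(l has_real_derivative - (l (\<beta> - \<theta>))\<^sup>2 - c / (sin (\<beta> - \<theta>))\<^sup>2) (at (\<beta> - \<theta>))" unfolding c using that \<theta> by (intro l) auto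
      moreover have "((\<lambda>\<theta>. \<beta> - \<theta>) has_real_derivative - 1) (at \<theta>)" by (auto intro!: derivative_eq_intros)
      ultimately have "((\<lambda>\<theta>. l (\<beta> - \<theta>)) has_real_derivative (- (l (\<beta> - \<theta>))\<^sup>2 - c / (sin (\<beta> - \<theta>))\<^sup>2) * (- 1)) (at \<theta>)"
        by (rule DERIV_chain2)
      from DERIV_minus[OF this] show ?thesis unfolding r'_def by (simp add: algebra_simps)
    qed
    have symm_l: "l (pi/2) = - mid (\<beta> - pi/2)" using mid_symm[of "pi/2"] l(2) by simp
    have inner: "((\<lambda>\<theta>. if \<theta> \<le> \<beta> - pi/2 then mid \<theta> else - l (\<beta> - \<theta>)) has_real_derivative
        (if \<theta> \<le> \<beta> - pi/2 then m' \<theta> else r' \<theta>)) (at \<theta>)" if "pi/2 \<le> \<theta>"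
      using that by (intro DERIV_if_glue dr) (auto simp: symm_l m'_def r'_def intro: dmid)
    have "(w has_real_derivative (if \<theta> \<le> pi/2 then l' \<theta> else if \<theta> \<le> \<beta> - pi/2 then m' \<theta> else r' \<theta>)) (at \<theta>)"
      unfolding w_def[abs_def]
      by (rule DERIV_if_glue[where f' = l' and g' = "\<lambda>\<theta>. if \<theta> \<le> \<beta> - pi/2 then m' \<theta> else r' \<theta>", OF _ inner])
         (use \<theta> \<beta> l in \<open>auto simp: l'_def m'_def c\<close>)
    moreover have "(if \<theta> \<le> pi/2 then l' \<theta> else if \<theta> \<le> \<beta> - pi/2 then m' \<theta> else r' \<theta>) = - (w \<theta>)\<^sup>2 - c / (sector_gap \<beta> \<theta>)\<^sup>2"
      by (simp add: w_def sector_gap_def l'_def m'_def r'_def)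
    ultimately show ?thesis by simp
  qed
  have "hardy_supersolution \<beta> \<alpha> c w"
  proof
    show "0 \<le> w \<theta>" if "0 < \<theta>" "\<theta> \<le> \<beta>/2" for \<theta>
      using that l(3)[of \<theta>] mid0[of \<theta>] \<beta> by (auto simp: w_def)
    show "w \<theta> \<le> tan ((\<beta>/2 - \<theta>) / 2) / 2" if \<theta>: "pi/2 \<le> \<theta>" "\<theta> \<le> \<beta>/2" for \<theta>
    proof -
      have w: "w \<theta> = mid \<theta>"
      proof (cases "\<theta> = pi/2")
        case True
        show ?thesis unfolding True w_def using l(2) by simp
      next
        case False
        then have "pi/2 < \<theta>" using \<theta>(1) by linarith
        then show ?thesis using \<theta> \<beta> by (simp add: w_def)
      qed
      have x: "0 \<le> \<beta>/2 - \<theta>" "\<beta>/2 - \<theta> \<le> pi/2" using \<theta> \<beta> by auto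
      have "(\<beta>/2 - \<theta>) / 2 \<le> (pi/2) / 2" using x(2) by (rule divide_right_mono) simp
      also have "\<dots> < pi/2" by simp
      finally have lt: "(\<beta>/2 - \<theta>) / 2 < pi/2" .
      \<comment> \<open>Both factors of k tan(k x) increase with k, and k \<le> 1/2.\<close>
      have "k * (\<beta>/2 - \<theta>) \<le> 1/2 * (\<beta>/2 - \<theta>)" using k x by (intro mult_right_mono)
      moreover have "- (pi/2) < k * (\<beta>/2 - \<theta>)" by (rule less_le_trans[of _ 0]) (use k x in auto)
      ultimately have "tan (k * (\<beta>/2 - \<theta>)) \<le> tan ((\<beta>/2 - \<theta>) / 2)"
        using x lt by (intro tan_mono_le) simp_all
      moreover have "0 \<le> tan ((\<beta>/2 - \<theta>) / 2)" using x lt by (intro tan_pos_pi2_le) simp_all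
      moreover have "0 \<le> tan (k * (\<beta>/2 - \<theta>))"
        using mid0[OF \<theta>] k unfolding mid_def by (cases "k = 0") (simp_all add: zero_le_mult_iff)
      ultimately have "k * tan (k * (\<beta>/2 - \<theta>)) \<le> 1/2 * tan ((\<beta>/2 - \<theta>) / 2)"
        using k by (intro mult_mono) auto
      then show ?thesis unfolding w mid_def by simp
    qed
    show "w (\<beta> - \<theta>) = - w \<theta>" if "0 < \<theta>" "\<theta> < \<beta>" for \<theta>
    proof -
      consider "\<theta> < pi/2" | "\<theta> = pi/2" | "\<theta> > pi/2" "\<theta> < \<beta> - pi/2" | "\<theta> = \<beta> - pi/2" | "\<theta> > \<beta> - pi/2" by linarith
      then show ?thesis
      proof cases
        case 2
        show ?thesis unfolding 2 w_def using \<beta> mid_symm[of "pi/2"] l(2) by simp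
      next
        case 4
        have "\<beta> - \<theta> = pi/2" using 4 by simp
        then show ?thesis unfolding w_def 4 using \<beta> mid_symm[of "pi/2"] l(2) by simp
      qed (use \<beta> mid_symm in \<open>simp_all add: w_def\<close>)
    qed
  qed (use assms dw in auto)
  then show ?thesis using that by blast
qed

section \<open>The one-dimensional Hardy inequality\<close>

text \<open>The class is C1 because the trial functions below are glued from pieces. Their supports
  lie in a compact interval inside (0, \<beta>), where the singular potential is bounded.\<close>

definition one_dim_hardy :: "real \<Rightarrow> real \<Rightarrow> bool" where
  "one_dim_hardy \<beta> c \<longleftrightarrow> (\<forall>A A' a b. 0 < a \<and> b < \<beta> \<and> (\<forall>\<theta>. (A has_real_derivative A' \<theta>) (at \<theta>)) \<and>
     continuous_on UNIV A' \<and> (\<forall>\<theta>. \<theta> \<notin> {a..b} \<longrightarrow> A \<theta> = 0) \<longrightarrow>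
     c * (LINT \<theta>|lborel. (A \<theta>)\<^sup>2 / (sector_gap \<beta> \<theta>)\<^sup>2) \<le> (LINT \<theta>|lborel. (A' \<theta>)\<^sup>2))"

lemma one_dim_hardyD:
  assumes "one_dim_hardy \<beta> c" "0 < a" "b < \<beta>" "\<And>\<theta>. (A has_real_derivative A' \<theta>) (at \<theta>)"
    "continuous_on UNIV A'" "\<And>\<theta>. \<theta> \<notin> {a..b} \<Longrightarrow> A \<theta> = 0"
  shows "c * (LINT \<theta>|lborel. (A \<theta>)\<^sup>2 / (sector_gap \<beta> \<theta>)\<^sup>2) \<le> (LINT \<theta>|lborel. (A' \<theta>)\<^sup>2)"
  using assms unfolding one_dim_hardy_def by blast

lemma lborel_integral_interval:
  fixes f :: "real \<Rightarrow> real"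
  assumes "continuous_on {a..b} f" "\<And>x. x \<notin> {a..b} \<Longrightarrow> f x = 0"
  shows "integrable lborel f" "(LINT x|lborel. f x) = integral {a..b} f"
proof -
  show i: "integrable lborel f"
    by (rule integrable_compact_support[OF compact_Icc assms])
  have "integral UNIV f = integral UNIV (\<lambda>x. if x \<in> {a..b} then f x else 0)"
    using assms(2) by (intro arg_cong2[where f = integral]) auto
  then show "(LINT x|lborel. f x) = integral {a..b} f"
    using integral_lborel[OF i] integral_restrict_UNIV[of "{a..b}" f] by (simp only:)
qed

lemma derivative_zero_outside:
  fixes A A' :: "real \<Rightarrow> real"
  assumes "\<And>\<theta>. (A has_real_derivative A' \<theta>) (at \<theta>)" "\<And>\<theta>. \<theta> \<notin> {a..b} \<Longrightarrow> A \<theta> = 0" "\<theta> \<notin> {a..b}"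
  shows "A' \<theta> = 0"
proof -
  have "\<forall>\<^sub>F x in nhds \<theta>. x \<in> - {a..b}" using assms(3) by (intro eventually_nhds_in_open) auto
  then have "\<forall>\<^sub>F x in nhds \<theta>. A x = 0" by eventually_elim (use assms(2) in auto)
  from DERIV_cong_ev[OF refl this refl] have "(A has_real_derivative 0) (at \<theta>)" by simp
  then show ?thesis using DERIV_unique assms(1) by blast
qed

lemma one_dim_hardy_mono:
  assumes "one_dim_hardy \<beta> c" "0 \<le> c'" "c' \<le> c"
  shows "one_dim_hardy \<beta> c'"
  unfolding one_dim_hardy_def
proof (intro allI impI, elim conjE)
  fix A A' a b
  assume "0 < a" "b < \<beta>" "\<forall>\<theta>. (A has_real_derivative A' \<theta>) (at \<theta>)" "continuous_on UNIV A'" "\<forall>\<theta>. \<theta> \<notin> {a..b} \<longrightarrow> A \<theta> = 0"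
  then have "c * (LINT \<theta>|lborel. (A \<theta>)\<^sup>2 / (sector_gap \<beta> \<theta>)\<^sup>2) \<le> (LINT \<theta>|lborel. (A' \<theta>)\<^sup>2)"
    using one_dim_hardyD[OF assms(1)] by blast
  moreover have "c' * (LINT \<theta>|lborel. (A \<theta>)\<^sup>2 / (sector_gap \<beta> \<theta>)\<^sup>2) \<le> c * (LINT \<theta>|lborel. (A \<theta>)\<^sup>2 / (sector_gap \<beta> \<theta>)\<^sup>2)"
    using assms by (intro mult_right_mono integral_nonneg_AE) auto
  ultimately show "c' * (LINT \<theta>|lborel. (A \<theta>)\<^sup>2 / (sector_gap \<beta> \<theta>)\<^sup>2) \<le> (LINT \<theta>|lborel. (A' \<theta>)\<^sup>2)" by simp
qed

text \<open>The trial function \<open>\<surd>\<theta> sin\<^sup>2(mu ln \<theta>)\<close>, cut off at two zeros of the sine, concentrates at the edge \<open>\<theta> = 0\<close>.\<close>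

lemma one_dim_hardy_le_quarter:
  assumes \<beta>: "pi < \<beta>" "\<beta> \<le> 2 * pi" and hardy: "one_dim_hardy \<beta> c"
  shows "c \<le> 1/4"
proof (rule ccontr)
  assume "\<not> c \<le> 1/4"
  then have c: "c > 1/4" by simp
  \<comment> \<open>The final balance compares 4 mu^2/8 with 3(c - 1/4)/8, and this frequency makes
    the first smaller. The cut points are two consecutive zeros, at phases -pi and 0; squaring the
    sine makes the derivative vanish there as well, so that A is C1.\<close>
  define mu where "mu = sqrt (c - 1/4) / 2"
  have mu: "mu > 0" using c by (simp add: mu_def)
  have mu2: "4 * mu\<^sup>2 = c - 1/4" using c by (simp add: mu_def power_divide)
  define a where "a = exp (- pi / mu)"
  have a: "0 < a" "a < 1" using mu by (simp_all add: a_def)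
  define x where "x \<theta> = mu * ln \<theta>" for \<theta>
  have xa: "x a = - pi" "x 1 = 0" using mu by (simp_all add: x_def a_def)
  define f where "f \<theta> = sqrt \<theta> * (sin (x \<theta>))\<^sup>2" for \<theta>
  define f' where "f' \<theta> = (sin (x \<theta>))\<^sup>2 / (2 * sqrt \<theta>) + 2 * mu * sin (x \<theta>) * cos (x \<theta>) / sqrt \<theta>" for \<theta>
  have dx: "(x has_real_derivative mu / \<theta>) (at \<theta>)" if "\<theta> > 0" for \<theta>
    unfolding x_def[abs_def] using that by (auto intro!: derivative_eq_intros)
  have df: "(f has_real_derivative f' \<theta>) (at \<theta>)" if "\<theta> > 0" for \<theta>
  proof -
    have s: "\<theta> = sqrt \<theta> * sqrt \<theta>" "sqrt \<theta> > 0" using that by simp_all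
    have ds: "((\<lambda>\<theta>. (sin (x \<theta>))\<^sup>2) has_real_derivative 2 * sin (x \<theta>) * (cos (x \<theta>) * (mu / \<theta>))) (at \<theta>)"
      using DERIV_power[OF DERIV_chain2[OF DERIV_sin dx[OF that]], of 2] by (simp add: mult_ac)
    have "(f has_real_derivative (inverse (sqrt \<theta>) / 2) * (sin (x \<theta>))\<^sup>2 + 2 * sin (x \<theta>) * (cos (x \<theta>) * (mu / \<theta>)) * sqrt \<theta>) (at \<theta>)"
      unfolding f_def[abs_def] by (rule DERIV_mult[OF DERIV_real_sqrt[OF that] ds])
    moreover have "(inverse (sqrt \<theta>) / 2) * (sin (x \<theta>))\<^sup>2 + 2 * sin (x \<theta>) * (cos (x \<theta>) * (mu / \<theta>)) * sqrt \<theta> = f' \<theta>"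
      unfolding f'_def using s by (subst (2) s(1)) (simp add: field_simps)
    ultimately show ?thesis by simp
  qed
  define A where "A \<theta> = (if \<theta> \<le> a then 0 else if \<theta> \<le> 1 then f \<theta> else 0)" for \<theta>
  define A' where "A' \<theta> = (if \<theta> \<le> a then 0 else if \<theta> \<le> 1 then f' \<theta> else 0)" for \<theta>
  have ends: "f a = 0" "f' a = 0" "f 1 = 0" "f' 1 = 0" by (simp_all add: f_def f'_def xa)
  have dA: "(A has_real_derivative A' \<theta>) (at \<theta>)" for \<theta>
  proof -
    have inner: "((\<lambda>\<theta>. if \<theta> \<le> 1 then f \<theta> else 0) has_real_derivative (if \<theta> \<le> 1 then f' \<theta> else 0)) (at \<theta>)" if "a \<le> \<theta>"
      using that a ends by (intro DERIV_if_glue) (auto intro!: df)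
    show ?thesis unfolding A_def[abs_def] A'_def
      by (rule DERIV_if_glue[where f' = "\<lambda>_. 0" and g' = "\<lambda>\<theta>. if \<theta> \<le> 1 then f' \<theta> else 0", OF _ inner]) (use a ends in auto)
  qed
  have cx: "continuous_on {a..1} x"
    using a by (intro continuous_at_imp_continuous_on ballI DERIV_isCont[OF dx]) auto
  have cf': "continuous_on {a..1} f'"
    unfolding f'_def[abs_def] using a by (intro continuous_intros cx) auto
  have cA': "continuous_on UNIV A'"
  proof -
    have "A' = (\<lambda>\<theta>. f' (max a (min \<theta> 1)))" using a ends by (auto simp: A'_def fun_eq_iff max_def min_def)
    moreover have "continuous_on UNIV (\<lambda>\<theta>. f' (max a (min \<theta> 1)))"
      by (rule continuous_on_compose2[OF cf']) (use a in \<open>auto intro!: continuous_intros\<close>)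
    ultimately show ?thesis by simp
  qed
  have A0: "A \<theta> = 0" if "\<theta> \<notin> {a..1}" for \<theta> using that ends by (auto simp: A_def)
  have A'0: "A' \<theta> = 0" if "\<theta> \<notin> {a..1}" for \<theta> by (rule derivative_zero_outside[OF dA A0 that])
  have cA: "continuous_on UNIV A" using dA by (auto intro!: continuous_at_imp_continuous_on DERIV_isCont)
  have pi1: "(1::real) < pi / 2" using pi_gt3 by simp
  \<comment> \<open>On (0, 1] the gap is sin \<theta> \<le> \<theta>, so replacing it by \<theta>
    only decreases the potential.\<close>
  have gap: "0 < sector_gap \<beta> \<theta>" "sector_gap \<beta> \<theta> \<le> \<theta>" if "\<theta> \<in> {a..1}" for \<theta>
    using that a \<beta> pi1 sin_x_le_x[of \<theta>] sin_gt_zero[of \<theta>] by (auto simp: sector_gap_def)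
  have cg: "continuous_on {a..1} (\<lambda>\<theta>. (A \<theta>)\<^sup>2 / (sector_gap \<beta> \<theta>)\<^sup>2)"
    using gap by (intro continuous_on_divide continuous_on_power continuous_on_subset[OF cA] continuous_on_subset[OF continuous_on_sector_gap[OF \<beta>]]) force+
  have c2: "continuous_on {a..1} (\<lambda>\<theta>. (A \<theta>)\<^sup>2 / \<theta>\<^sup>2)"
    using a by (intro continuous_on_divide continuous_on_power continuous_on_subset[OF cA] continuous_on_id) force+
  have cA2: "continuous_on {a..1} (\<lambda>\<theta>. (A' \<theta>)\<^sup>2)"
    by (intro continuous_on_power continuous_on_subset[OF cA']) auto
  have "c * (LINT \<theta>|lborel. (A \<theta>)\<^sup>2 / (sector_gap \<beta> \<theta>)\<^sup>2) \<le> (LINT \<theta>|lborel. (A' \<theta>)\<^sup>2)"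
    by (rule one_dim_hardyD[OF hardy a(1) _ dA cA' A0]) (use \<beta> pi_gt3 in auto)
  then have "c * integral {a..1} (\<lambda>\<theta>. (A \<theta>)\<^sup>2 / (sector_gap \<beta> \<theta>)\<^sup>2) \<le> integral {a..1} (\<lambda>\<theta>. (A' \<theta>)\<^sup>2)"
    using lborel_integral_interval(2)[OF cg] lborel_integral_interval(2)[OF cA2] A0 A'0 by simp
  moreover have gapI: "integral {a..1} (\<lambda>\<theta>. (A \<theta>)\<^sup>2 / \<theta>\<^sup>2) \<le> integral {a..1} (\<lambda>\<theta>. (A \<theta>)\<^sup>2 / (sector_gap \<beta> \<theta>)\<^sup>2)"
  proof (intro integral_le integrable_continuous_real c2 cg)
    fix \<theta> assume "\<theta> \<in> {a..1}"
    then show "(A \<theta>)\<^sup>2 / \<theta>\<^sup>2 \<le> (A \<theta>)\<^sup>2 / (sector_gap \<beta> \<theta>)\<^sup>2"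
      using gap[of \<theta>] a by (intro divide_left_mono power_mono mult_pos_pos) auto
  qed
  ultimately have le: "c * integral {a..1} (\<lambda>\<theta>. (A \<theta>)\<^sup>2 / \<theta>\<^sup>2) \<le> integral {a..1} (\<lambda>\<theta>. (A' \<theta>)\<^sup>2)"
    using mult_left_mono[OF gapI, of c] c by linarith
  \<comment> \<open>In the phase variable the integrand combines sin^3 cos, sin^2 cos^2 and sin^4;
    these three functions supply the antiderivatives.\<close>
  define E1 where "E1 y = y - sin y * cos y" for y :: real
  define E2 where "E2 y = (sin y)^3 * cos y" for y :: real
  define E3 where "E3 y = (sin y)^4" for y :: real
  define G where "G \<theta> = E3 (x \<theta>) / 2 + 4 * mu * (E1 (x \<theta>) / 8 + E2 (x \<theta>) / 4)
      - (c - 1/4) / mu * (3/8 * E1 (x \<theta>) - E2 (x \<theta>) / 4)" for \<theta>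
  have dE1: "(E1 has_real_derivative 2 * (sin y)\<^sup>2) (at y)" for y
    unfolding E1_def[abs_def] by (rule derivative_eq_intros refl)+ (use sin_cos_squared_add[of y] in \<open>simp add: power2_eq_square algebra_simps\<close>)
  have dE2: "(E2 has_real_derivative 3 * (sin y)\<^sup>2 * (cos y)\<^sup>2 - (sin y)^4) (at y)" for y
    unfolding E2_def[abs_def] by (rule derivative_eq_intros refl)+ (simp add: power2_eq_square power3_eq_cube power4_eq_xxxx)
  have dE3: "(E3 has_real_derivative 4 * (sin y)^3 * cos y) (at y)" for y
    unfolding E3_def[abs_def] by (rule derivative_eq_intros refl)+ simp
  have dG: "(G has_real_derivative (A' \<theta>)\<^sup>2 - c * ((A \<theta>)\<^sup>2 / \<theta>\<^sup>2)) (at \<theta>)" if \<theta>: "\<theta> \<in> {a<..<1}" for \<theta>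
  proof -
    have p: "\<theta> > 0" "sqrt \<theta> > 0" using \<theta> a by auto
    define s k where "s = sin (x \<theta>)" and "k = cos (x \<theta>)"
    have k2: "k\<^sup>2 = 1 - s\<^sup>2" by (simp add: s_def k_def cos_squared_eq)
    note ch = DERIV_chain2[OF _ dx[OF p(1)]]
    have "(G has_real_derivative (4 * s^3 * k * (mu/\<theta>)) / 2 + 4 * mu * (2 * s\<^sup>2 * (mu/\<theta>) / 8 + (3 * s\<^sup>2 * k\<^sup>2 - s^4) * (mu/\<theta>) / 4)
       - (c - 1/4) / mu * (3/8 * (2 * s\<^sup>2 * (mu/\<theta>)) - (3 * s\<^sup>2 * k\<^sup>2 - s^4) * (mu/\<theta>) / 4)) (at \<theta>)"
      unfolding G_def[abs_def] s_def k_def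
      by (intro DERIV_add DERIV_diff DERIV_cmult DERIV_cdivide ch[OF dE1] ch[OF dE2] ch[OF dE3])
    also have "(4 * s^3 * k * (mu/\<theta>)) / 2 + 4 * mu * (2 * s\<^sup>2 * (mu/\<theta>) / 8 + (3 * s\<^sup>2 * k\<^sup>2 - s^4) * (mu/\<theta>) / 4)
       - (c - 1/4) / mu * (3/8 * (2 * s\<^sup>2 * (mu/\<theta>)) - (3 * s\<^sup>2 * k\<^sup>2 - s^4) * (mu/\<theta>) / 4)
      = (2 * s^3 * k * mu + 4 * mu\<^sup>2 * (s\<^sup>2 / 4 + (3 * s\<^sup>2 * k\<^sup>2 - s^4) / 4) - (c - 1/4) * (3/4 * s\<^sup>2 - (3 * s\<^sup>2 * k\<^sup>2 - s^4) / 4)) / \<theta>"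
    proof -
      define z where "z = (3 * s\<^sup>2 * k\<^sup>2 - s^4)"
      define y where "y = s^3 * k"
      show ?thesis unfolding z_def[symmetric] mult.assoc[of _ "s^3" k] y_def[symmetric] using p mu by (simp add: field_simps power2_eq_square)
    qed
    also have "\<dots> = (2 * s^3 * k * mu + 4 * mu\<^sup>2 * (s\<^sup>2 * k\<^sup>2) - (c - 1/4) * s^4) / \<theta>"
    proof -
      have "s\<^sup>2 / 4 + (3 * s\<^sup>2 * k\<^sup>2 - s^4) / 4 = s\<^sup>2 * k\<^sup>2" "3/4 * s\<^sup>2 - (3 * s\<^sup>2 * k\<^sup>2 - s^4) / 4 = s^4"
        unfolding k2 by (simp_all add: field_simps power2_eq_square power4_eq_xxxx)
      then show ?thesis by (simp only:)
    qed
    also have "\<dots> = (A' \<theta>)\<^sup>2 - c * ((A \<theta>)\<^sup>2 / \<theta>\<^sup>2)"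
    proof -
      define q where "q = sqrt \<theta>"
      have q: "q > 0" "\<theta> = q\<^sup>2" using p by (simp_all add: q_def)
      have e: "A' \<theta> = s\<^sup>2 / (2 * q) + 2 * mu * s * k / q" "A \<theta> = q * s\<^sup>2"
        using \<theta> by (simp_all add: A'_def A_def f'_def f_def s_def k_def q_def)
      show ?thesis unfolding e unfolding q(2) using q(1) by (simp add: field_simps power2_eq_square power3_eq_cube power4_eq_xxxx)
    qed
    finally show ?thesis .
  qed
  have "((\<lambda>\<theta>. (A' \<theta>)\<^sup>2 - c * ((A \<theta>)\<^sup>2 / \<theta>\<^sup>2)) has_integral (G 1 - G a)) {a..1}"
  proof (rule fundamental_theorem_of_calculus_interior)
    show "continuous_on {a..1} G" unfolding G_def[abs_def] E1_def E2_def E3_def using mu by (intro continuous_intros cx) auto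
  qed (use a dG in \<open>auto simp: has_real_derivative_iff_has_vector_derivative\<close>)
  then have "integral {a..1} (\<lambda>\<theta>. (A' \<theta>)\<^sup>2 - c * ((A \<theta>)\<^sup>2 / \<theta>\<^sup>2)) = G 1 - G a" by (rule integral_unique)
  moreover have "integral {a..1} (\<lambda>\<theta>. (A' \<theta>)\<^sup>2 - c * ((A \<theta>)\<^sup>2 / \<theta>\<^sup>2)) = integral {a..1} (\<lambda>\<theta>. (A' \<theta>)\<^sup>2) - c * integral {a..1} (\<lambda>\<theta>. (A \<theta>)\<^sup>2 / \<theta>\<^sup>2)"
  proof -
    have "integral {a..1} (\<lambda>\<theta>. (A' \<theta>)\<^sup>2 - c * ((A \<theta>)\<^sup>2 / \<theta>\<^sup>2)) = integral {a..1} (\<lambda>\<theta>. (A' \<theta>)\<^sup>2) - integral {a..1} (\<lambda>\<theta>. c * ((A \<theta>)\<^sup>2 / \<theta>\<^sup>2))"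
      by (intro integral_diff integrable_continuous_real cA2 continuous_on_mult continuous_on_const c2)
    then show ?thesis by (simp only: integral_mult_right)
  qed
  ultimately have "G a \<le> G 1" using le by simp
  moreover have "G 1 - G a = pi / mu * ((4 * mu\<^sup>2) / 8 - 3/8 * (c - 1/4))"
    unfolding G_def xa E1_def E2_def E3_def using mu by (simp add: field_simps power2_eq_square)
  moreover have "pi / mu * ((4 * mu\<^sup>2) / 8 - 3/8 * (c - 1/4)) < 0"
    unfolding mu2 using c mu by (intro mult_pos_neg) auto
  ultimately show False by simp
qed

text \<open>A cubic cut-off, C1 at both joints, which is all the regularity that
  \<open>one_dim_hardy\<close> asks of a trial function.\<close>

definition smoothstep :: "real \<Rightarrow> real" where
  "smoothstep x = (if x \<le> 0 then 0 else if x \<le> 1 then x\<^sup>2 * (3 - 2 * x) else 1)"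

definition smoothstep_deriv :: "real \<Rightarrow> real" where
  "smoothstep_deriv x = (if x \<le> 0 then 0 else if x \<le> 1 then 6 * x * (1 - x) else 0)"

lemma smoothstep_has_deriv: "(smoothstep has_real_derivative smoothstep_deriv x) (at x)"
proof -
  have 0: "((\<lambda>x. x\<^sup>2 * (3 - 2 * x)) has_real_derivative 6 * x * (1 - x)) (at x)" for x :: real
    by (rule derivative_eq_intros refl)+ (simp add: power2_eq_square algebra_simps)
  have 1: "((\<lambda>x. if x \<le> 1 then x\<^sup>2 * (3 - 2 * x) else 1) has_real_derivative (if x \<le> 1 then 6 * x * (1 - x) else 0)) (at x)"
    by (intro DERIV_if_glue 0) auto
  show ?thesis unfolding smoothstep_def[abs_def] smoothstep_deriv_def
    by (rule DERIV_if_glue[where f' = "\<lambda>_. 0" and g' = "\<lambda>x. if x \<le> 1 then 6 * x * (1 - x) else 0", OF _ 1]) auto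
qed

lemma continuous_smoothstep_deriv: "continuous_on UNIV smoothstep_deriv"
proof -
  have e: "smoothstep_deriv = (\<lambda>x. 6 * max 0 (min x 1) * (1 - max 0 (min x 1)))"
    by (auto simp: smoothstep_deriv_def fun_eq_iff max_def min_def)
  show ?thesis by (subst e) (intro continuous_intros)
qed

lemma smoothstep_range: "0 \<le> smoothstep x" "smoothstep x \<le> 1"
proof -
  have d: "0 \<le> smoothstep_deriv x" for x by (auto simp: smoothstep_deriv_def)
  have mono: "smoothstep x \<le> smoothstep y" if "x \<le> y" for x y
    using smoothstep_has_deriv d by (intro DERIV_nonneg_imp_nondecreasing[OF that]) blast
  show "0 \<le> smoothstep x" using mono[of "min x 0" x] by (simp add: smoothstep_def[of "min x 0"])
  have "smoothstep (max x 2) = 1" by (simp add: smoothstep_def)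
  then show "smoothstep x \<le> 1" using mono[of x "max x 2"] by simp
qed

lemma smoothstep_deriv_range: "0 \<le> smoothstep_deriv x" "smoothstep_deriv x \<le> 2"
proof -
  show "0 \<le> smoothstep_deriv x" by (auto simp: smoothstep_deriv_def)
  have "6 * x * (1 - x) = 3/2 - 6 * (x - 1/2)\<^sup>2" by (simp add: power2_eq_square field_simps)
  then have "6 * x * (1 - x) \<le> 3/2" by simp
  then show "smoothstep_deriv x \<le> 2" by (auto simp: smoothstep_deriv_def)
qed

text \<open>If the slope of the edge solution at \<open>\<pi>/2\<close> were too small, it could be continued by a cosine of smaller frequency
  \<open>\<kappa> < \<surd>c\<close>; cutting off this function near the two edges costs only \<open>O(\<epsilon>\<^bsup>2\<alpha>-1\<^esup>)\<close>.\<close>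

lemma one_dim_hardy_slope:
  fixes \<alpha> \<beta> c :: real
  assumes \<beta>: "pi < \<beta>" "\<beta> \<le> 2 * pi" and \<alpha>: "1/2 < \<alpha>" "\<alpha> < 1" and c: "c = \<alpha> * (1 - \<alpha>)" and hardy: "one_dim_hardy \<beta> c"
  shows "sqrt c * tan (sqrt c * (\<beta> - pi) / 2) \<le> edge_log_deriv \<alpha> (pi/2)"
proof (rule ccontr)
  assume neg: "\<not> ?thesis"
  note \<alpha>' = less_imp_le[OF \<alpha>(1)] less_imp_le[OF \<alpha>(2)]
  have c0: "0 < c" using \<alpha> c by simp
  have "c \<le> 1/4"
  proof -
    have "0 \<le> (\<alpha> - 1/2)\<^sup>2" by simp
    then show ?thesis unfolding c by (simp add: power2_eq_square algebra_simps)
  qed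
  then have "sqrt c \<le> sqrt ((1/2)\<^sup>2)" by (intro real_sqrt_le_mono) (simp add: power2_eq_square)
  then have sc: "0 < sqrt c" "sqrt c \<le> 1/2" using c0 by simp_all
  define b where "b = (\<beta> - pi) / 2"
  have b: "0 < b" "b \<le> pi/2" using \<beta> by (simp_all add: b_def)
  have arg: "\<bar>k * y\<bar> < pi/2" if "0 \<le> k" "k \<le> sqrt c" "\<bar>y\<bar> \<le> b" for k y
  proof -
    have "\<bar>k * y\<bar> \<le> 1/2 * (pi/2)" unfolding abs_mult using that sc b by (intro mult_mono) auto
    then show ?thesis using pi_gt_zero by linarith
  qed
  have cospos: "0 < cos (k * y)" if "0 \<le> k" "k \<le> sqrt c" "\<bar>y\<bar> \<le> b" for k y
    using arg[OF that] unfolding abs_less_iff by (intro cos_gt_zero_pi) linarith+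
  define w1 where "w1 = edge_log_deriv \<alpha> (pi/2)"
  have w1: "0 < w1" unfolding w1_def by (rule edge_log_deriv_half_pi[OF \<alpha>'])
  \<comment> \<open>The frequency whose cosine, symmetric about \<beta>/2, continues the edge
    solution in C1 fashion at pi/2. The intermediate value theorem finds it below sqrt c: the slope
    is positive and, by the assumption to be refuted, smaller than the value at sqrt c.\<close>
  obtain \<kappa> where \<kappa>: "0 \<le> \<kappa>" "\<kappa> \<le> sqrt c" "\<kappa> * tan (\<kappa> * b) = w1"
  proof -
    have "\<exists>x\<ge>0. x \<le> sqrt c \<and> x * tan (x * b) = w1"
    proof (rule IVT')
      show "0 * tan (0 * b) \<le> w1" using w1 by simp
      show "w1 \<le> sqrt c * tan (sqrt c * b)" using neg unfolding w1_def b_def by simp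
      show "continuous_on {0..sqrt c} (\<lambda>x. x * tan (x * b))"
        using cospos[of _ b] b by (intro continuous_intros ballI) (force dest: less_imp_neq)
    qed (use sc in simp)
    then show ?thesis using that by blast
  qed
  have \<kappa>lt: "\<kappa>\<^sup>2 < c"
  proof -
    have "\<kappa> \<noteq> sqrt c" using \<kappa>(3) neg unfolding w1_def b_def by auto
    then have "\<kappa> < sqrt c" using \<kappa> by simp
    then have "\<kappa>\<^sup>2 < (sqrt c)\<^sup>2" using \<kappa> by (intro power_strict_mono) auto
    then show ?thesis using c0 by simp
  qed
  define \<psi> where "\<psi> = edge_solution \<alpha>"
  define W where "W = edge_log_deriv \<alpha>"
  have d\<psi>: "(\<psi> has_real_derivative W \<theta> * \<psi> \<theta>) (at \<theta>)" if "0 < \<theta>" "\<theta> < pi" for \<theta>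
    unfolding \<psi>_def W_def by (rule edge_solution_deriv[OF \<alpha>' that])
  have dW\<psi>: "((\<lambda>\<theta>. W \<theta> * \<psi> \<theta>) has_real_derivative - (c / (sin \<theta>)\<^sup>2) * \<psi> \<theta>) (at \<theta>)" if "0 < \<theta>" "\<theta> < pi" for \<theta>
  proof -
    have "((\<lambda>\<theta>. W \<theta> * \<psi> \<theta>) has_real_derivative (- (W \<theta>)\<^sup>2 - \<alpha> * (1 - \<alpha>) / (sin \<theta>)\<^sup>2) * \<psi> \<theta> + W \<theta> * \<psi> \<theta> * W \<theta>) (at \<theta>)"
      using DERIV_mult[OF edge_log_deriv_riccati[OF \<alpha>' that] d\<psi>[OF that]] unfolding W_def .
    then show ?thesis unfolding c by (simp add: algebra_simps power2_eq_square)
  qed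
  define p0 where "p0 = \<psi> (pi/2)"
  have p0: "0 < p0" unfolding p0_def \<psi>_def using edge_solution_pos[OF \<alpha>', of "pi/2"] pi_gt_zero by simp
  have cb: "0 < cos (\<kappa> * b)" using cospos[of \<kappa> b] \<kappa> b by simp
  define q where "q = p0 / cos (\<kappa> * b)"
  have q: "0 < q" using p0 cb by (simp add: q_def)
  define mid where "mid \<theta> = q * cos (\<kappa> * (\<beta>/2 - \<theta>))" for \<theta>
  define mid' where "mid' \<theta> = q * (\<kappa> * sin (\<kappa> * (\<beta>/2 - \<theta>)))" for \<theta>
  have dmid: "(mid has_real_derivative mid' \<theta>) (at \<theta>)" for \<theta>
    unfolding mid_def[abs_def] mid'_def by (auto intro!: derivative_eq_intros)
  have dmid': "(mid' has_real_derivative - \<kappa>\<^sup>2 * mid \<theta>) (at \<theta>)" for \<theta>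
    unfolding mid'_def[abs_def] mid_def by (auto intro!: derivative_eq_intros simp: power2_eq_square)
  have bb: "\<beta>/2 - pi/2 = b" "\<beta>/2 - (\<beta> - pi/2) = - b" "\<beta> - (\<beta> - pi/2) = pi/2" by (simp_all add: b_def field_simps)
  have j1: "mid (pi/2) = \<psi> (pi/2)" "mid' (pi/2) = W (pi/2) * \<psi> (pi/2)"
    using cb \<kappa>(3) unfolding mid_def mid'_def bb q_def p0_def W_def w1_def by (simp_all add: tan_def field_simps)
  have j2: "mid (\<beta> - pi/2) = \<psi> (\<beta> - (\<beta> - pi/2))" "mid' (\<beta> - pi/2) = - (W (\<beta> - (\<beta> - pi/2)) * \<psi> (\<beta> - (\<beta> - pi/2)))"
    using j1 unfolding bb mid_def mid'_def by simp_all
  \<comment> \<open>P is C1 and solves P'' = -V P, where V = c/gap^2 near the edges but only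
    \<kappa>^2 < c in the middle. \<open>P2\<close> is the second derivative away from the two
    joints.\<close>
  define P where "P \<theta> = (if \<theta> \<le> pi/2 then \<psi> \<theta> else if \<theta> \<le> \<beta> - pi/2 then mid \<theta> else \<psi> (\<beta> - \<theta>))" for \<theta>
  define P' where "P' \<theta> = (if \<theta> \<le> pi/2 then W \<theta> * \<psi> \<theta> else if \<theta> \<le> \<beta> - pi/2 then mid' \<theta> else - (W (\<beta> - \<theta>) * \<psi> (\<beta> - \<theta>)))" for \<theta>
  define P2 where "P2 \<theta> = (if \<theta> \<le> pi/2 then - (c / (sin \<theta>)\<^sup>2) * \<psi> \<theta> else if \<theta> \<le> \<beta> - pi/2 then - \<kappa>\<^sup>2 * mid \<theta> else - (c / (sin (\<beta> - \<theta>))\<^sup>2) * \<psi> (\<beta> - \<theta>))" for \<theta>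
  have dflip: "((\<lambda>\<theta>. \<beta> - \<theta>) has_real_derivative - 1) (at \<theta>)" for \<theta> by (auto intro!: derivative_eq_intros)
  have dright: "((\<lambda>\<theta>. \<psi> (\<beta> - \<theta>)) has_real_derivative - (W (\<beta> - \<theta>) * \<psi> (\<beta> - \<theta>))) (at \<theta>)"
      "((\<lambda>\<theta>. - (W (\<beta> - \<theta>) * \<psi> (\<beta> - \<theta>))) has_real_derivative - (c / (sin (\<beta> - \<theta>))\<^sup>2) * \<psi> (\<beta> - \<theta>)) (at \<theta>)"
    if "\<beta> - pi/2 \<le> \<theta>" "\<theta> < \<beta>" for \<theta>
  proof -
    have r: "0 < \<beta> - \<theta>" "\<beta> - \<theta> < pi" using that pi_gt_zero by linarith+
    show "((\<lambda>\<theta>. \<psi> (\<beta> - \<theta>)) has_real_derivative - (W (\<beta> - \<theta>) * \<psi> (\<beta> - \<theta>))) (at \<theta>)"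
      using DERIV_chain2[OF d\<psi>[OF r] dflip] by simp
    show "((\<lambda>\<theta>. - (W (\<beta> - \<theta>) * \<psi> (\<beta> - \<theta>))) has_real_derivative - (c / (sin (\<beta> - \<theta>))\<^sup>2) * \<psi> (\<beta> - \<theta>)) (at \<theta>)"
      using DERIV_minus[OF DERIV_chain2[OF dW\<psi>[OF r] dflip]] by simp
  qed
  have dP: "(P has_real_derivative P' \<theta>) (at \<theta>)" if \<theta>: "0 < \<theta>" "\<theta> < \<beta>" for \<theta>
  proof -
    have inner: "((\<lambda>\<theta>. if \<theta> \<le> \<beta> - pi/2 then mid \<theta> else \<psi> (\<beta> - \<theta>)) has_real_derivative
       (if \<theta> \<le> \<beta> - pi/2 then mid' \<theta> else - (W (\<beta> - \<theta>) * \<psi> (\<beta> - \<theta>)))) (at \<theta>)"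
      by (rule DERIV_if_glue[OF dmid dright(1)[OF _ \<theta>(2)] j2])
    show ?thesis unfolding P_def[abs_def] P'_def
      by (rule DERIV_if_glue[where f' = "\<lambda>\<theta>. W \<theta> * \<psi> \<theta>" and g' = "\<lambda>\<theta>. if \<theta> \<le> \<beta> - pi/2 then mid' \<theta> else - (W (\<beta> - \<theta>) * \<psi> (\<beta> - \<theta>))", OF _ inner])
         (use \<theta> \<beta> j1 pi_gt_zero in \<open>auto intro: d\<psi>\<close>)
  qed
  have dP': "(P' has_real_derivative P2 \<theta>) (at \<theta>)" if \<theta>: "0 < \<theta>" "\<theta> < \<beta>" "\<theta> \<noteq> pi/2" "\<theta> \<noteq> \<beta> - pi/2" for \<theta>
  proof -
    have inner: "((\<lambda>\<theta>. if \<theta> \<le> \<beta> - pi/2 then mid' \<theta> else - (W (\<beta> - \<theta>) * \<psi> (\<beta> - \<theta>))) has_real_derivative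
       (if \<theta> \<le> \<beta> - pi/2 then - \<kappa>\<^sup>2 * mid \<theta> else - (c / (sin (\<beta> - \<theta>))\<^sup>2) * \<psi> (\<beta> - \<theta>))) (at \<theta>)"
      by (rule DERIV_if_glue[where f = mid' and f' = "\<lambda>\<theta>. - \<kappa>\<^sup>2 * mid \<theta>" and g' = "\<lambda>\<theta>. - (c / (sin (\<beta> - \<theta>))\<^sup>2) * \<psi> (\<beta> - \<theta>)",
           OF dmid' dright(2)[OF _ \<theta>(2)]]) (use \<theta> in auto)
    show ?thesis unfolding P'_def[abs_def] P2_def
      by (rule DERIV_if_glue[where f' = "\<lambda>\<theta>. - (c / (sin \<theta>)\<^sup>2) * \<psi> \<theta>" and g' = "\<lambda>\<theta>. if \<theta> \<le> \<beta> - pi/2 then - \<kappa>\<^sup>2 * mid \<theta> else - (c / (sin (\<beta> - \<theta>))\<^sup>2) * \<psi> (\<beta> - \<theta>)", OF _ inner])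
         (use \<theta> \<beta> pi_gt_zero in \<open>auto intro: dW\<psi>[simplified]\<close>)
  qed
  have cP: "continuous_on {0<..<\<beta>} P" by (intro continuous_at_imp_continuous_on ballI DERIV_isCont[OF dP]) auto
  have cP': "continuous_on {0<..<\<beta>} P'"
    unfolding P'_def[abs_def]
  proof (intro continuous_on_cases_le continuous_on_id)
    have "isCont (\<lambda>\<theta>. W \<theta> * \<psi> \<theta>) \<theta>" if "0 < \<theta>" "\<theta> \<le> pi/2" for \<theta>
    proof -
      have "\<theta> < pi" using that pi_gt_zero by linarith
      then show ?thesis using DERIV_isCont[OF dW\<psi>] that by blast
    qed
    then show "continuous_on {t \<in> {0<..<\<beta>}. t \<le> pi/2} (\<lambda>\<theta>. W \<theta> * \<psi> \<theta>)"
      by (intro continuous_at_imp_continuous_on ballI) auto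
    show "continuous_on {t \<in> {t \<in> {0<..<\<beta>}. pi/2 \<le> t}. t \<le> \<beta> - pi/2} mid'"
      by (intro continuous_at_imp_continuous_on ballI DERIV_isCont[OF dmid'])
    show "continuous_on {t \<in> {t \<in> {0<..<\<beta>}. pi/2 \<le> t}. \<beta> - pi/2 \<le> t} (\<lambda>\<theta>. - (W (\<beta> - \<theta>) * \<psi> (\<beta> - \<theta>)))"
      by (intro continuous_at_imp_continuous_on ballI DERIV_isCont[OF dright(2)]) auto
    show "W t * \<psi> t = (if t \<le> \<beta> - pi/2 then mid' t else - (W (\<beta> - t) * \<psi> (\<beta> - t)))" if "t \<in> {0<..<\<beta>}" "t = pi/2" for t
      unfolding that(2) using j1 \<beta> by simp
    show "mid' t = - (W (\<beta> - t) * \<psi> (\<beta> - t))" if "t \<in> {t \<in> {0<..<\<beta>}. pi/2 \<le> t}" "t = \<beta> - pi/2" for t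
      unfolding that(2) by (rule j2(2))
  qed
  define G0 where "G0 = gauss_series \<alpha> (1/2)"
  have Psmall: "\<bar>P \<theta>\<bar> \<le> G0 * \<theta> powr \<alpha>" "\<bar>P (\<beta> - \<theta>)\<bar> \<le> G0 * \<theta> powr \<alpha>" if "0 < \<theta>" "\<theta> < pi/2" for \<theta>
  proof -
    have "\<bar>\<psi> \<theta>\<bar> \<le> G0 * \<theta> powr \<alpha>"
      using edge_solution_pos[OF \<alpha>', of \<theta>] edge_solution_le[OF \<alpha>', of \<theta>] that unfolding \<psi>_def G0_def by simp
    then show "\<bar>P \<theta>\<bar> \<le> G0 * \<theta> powr \<alpha>" "\<bar>P (\<beta> - \<theta>)\<bar> \<le> G0 * \<theta> powr \<alpha>" using that \<beta> by (simp_all add: P_def)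
  qed
  \<comment> \<open>Without the cut-off, the quadratic form of P would be -(c - \<kappa>^2)
    \<open>M0\<close>; this deficit has to be strictly positive.\<close>
  define M0 where "M0 = integral {pi/2..\<beta> - pi/2} (\<lambda>\<theta>. (mid \<theta>)\<^sup>2)"
  have cmid: "continuous_on S mid" for S by (intro continuous_at_imp_continuous_on ballI DERIV_isCont[OF dmid])
  have M0: "0 < M0"
  proof -
    have "0 \<le> M0" unfolding M0_def by (intro integral_nonneg integrable_continuous_real continuous_on_power cmid) auto
    moreover have "M0 \<noteq> 0"
    proof
      assume "M0 = 0"
      then have "(mid (\<beta>/2))\<^sup>2 = 0"
        unfolding M0_def using \<beta> by (subst (asm) integral_eq_0_iff) (auto intro!: continuous_on_power cmid)
      then show False using q by (simp add: mid_def)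
    qed
    ultimately show ?thesis by simp
  qed
  have main: "(c - \<kappa>\<^sup>2) * M0 \<le> 32 * G0\<^sup>2 * \<epsilon> powr (2 * \<alpha> - 1)" if \<epsilon>: "0 < \<epsilon>" "\<epsilon> < 1/4" for \<epsilon>
  proof -
    have e2: "2 * \<epsilon> < pi/2" "2 * \<epsilon> < \<beta> - 2 * \<epsilon>" using \<epsilon> pi_gt3 \<beta> by linarith+
    define u v where "u \<theta> = \<theta> / \<epsilon> - 1" and "v \<theta> = (\<beta> - \<theta>) / \<epsilon> - 1" for \<theta>
    define \<zeta> where "\<zeta> \<theta> = smoothstep (u \<theta>) * smoothstep (v \<theta>)" for \<theta>
    define \<zeta>' where "\<zeta>' \<theta> = smoothstep_deriv (u \<theta>) * (1 / \<epsilon>) * smoothstep (v \<theta>) + smoothstep_deriv (v \<theta>) * (- (1 / \<epsilon>)) * smoothstep (u \<theta>)" for \<theta>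
    have du: "(u has_real_derivative 1 / \<epsilon>) (at \<theta>)" "(v has_real_derivative - (1 / \<epsilon>)) (at \<theta>)" for \<theta>
      unfolding u_def[abs_def] v_def[abs_def] using \<epsilon>(1) by (auto intro!: derivative_eq_intros)
    have d\<zeta>: "(\<zeta> has_real_derivative \<zeta>' \<theta>) (at \<theta>)" for \<theta>
      unfolding \<zeta>_def[abs_def] \<zeta>'_def
      by (rule DERIV_mult[OF DERIV_chain2[OF smoothstep_has_deriv du(1)] DERIV_chain2[OF smoothstep_has_deriv du(2)]])
    have csm: "continuous_on UNIV smoothstep" using smoothstep_has_deriv by (intro continuous_at_imp_continuous_on ballI DERIV_isCont)
    have cuv: "continuous_on UNIV u" "continuous_on UNIV v" unfolding u_def[abs_def] v_def[abs_def] by (intro continuous_at_imp_continuous_on ballI DERIV_isCont[OF du(1)[unfolded u_def[abs_def]]] DERIV_isCont[OF du(2)[unfolded v_def[abs_def]]])+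
    have c\<zeta>: "continuous_on S \<zeta>" for S using d\<zeta> by (intro continuous_at_imp_continuous_on ballI DERIV_isCont)
    have c\<zeta>': "continuous_on UNIV \<zeta>'" unfolding \<zeta>'_def[abs_def]
      by (intro continuous_on_add continuous_on_mult continuous_on_const continuous_on_compose2[OF csm] cuv
          continuous_on_compose2[OF continuous_smoothstep_deriv]; simp)
    have z0: "\<zeta> \<theta> = 0 \<and> \<zeta>' \<theta> = 0" if "\<theta> \<notin> {\<epsilon><..<\<beta> - \<epsilon>}" for \<theta>
    proof -
      have "u \<theta> \<le> 0 \<or> v \<theta> \<le> 0" using that \<epsilon> by (auto simp: u_def v_def divide_le_eq)
      then show ?thesis by (auto simp: \<zeta>_def \<zeta>'_def smoothstep_def smoothstep_deriv_def)
    qed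
    have z1: "\<zeta> \<theta> = 1 \<and> \<zeta>' \<theta> = 0" if "\<theta> \<in> {2 * \<epsilon>..\<beta> - 2 * \<epsilon>}" for \<theta>
    proof -
      have "u \<theta> \<ge> 1 \<and> v \<theta> \<ge> 1" using that \<epsilon> by (auto simp: u_def v_def le_divide_eq)
      then show ?thesis by (auto simp: \<zeta>_def \<zeta>'_def smoothstep_def smoothstep_deriv_def)
    qed
    have zb: "\<bar>\<zeta>' \<theta>\<bar> \<le> 2 / \<epsilon>" if "\<theta> \<le> 2 * \<epsilon> \<or> \<beta> - 2 * \<epsilon> \<le> \<theta>" for \<theta>
    proof -
      have s: "\<bar>smoothstep_deriv x * k * smoothstep y\<bar> \<le> 2 / \<epsilon>" if "\<bar>k\<bar> = 1 / \<epsilon>" for x y k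
      proof -
        have "\<bar>smoothstep_deriv x * k * smoothstep y\<bar> \<le> 2 * (1 / \<epsilon>) * 1"
          unfolding abs_mult that using smoothstep_deriv_range[of x] smoothstep_range[of y] \<epsilon> by (intro mult_mono) auto
        then show ?thesis by simp
      qed
      have "smoothstep_deriv (u \<theta>) = 0 \<or> smoothstep_deriv (v \<theta>) = 0"
      proof (cases "\<theta> \<le> 2 * \<epsilon>")
        case True
        have "1 < v \<theta>" using True \<epsilon> e2 by (simp add: v_def less_divide_eq)
        then show ?thesis by (simp add: smoothstep_deriv_def)
      next
        case False
        have "1 < u \<theta>" using False \<epsilon> by (simp add: u_def less_divide_eq)
        then show ?thesis by (simp add: smoothstep_deriv_def)
      qed
      then show ?thesis unfolding \<zeta>'_def using s[of "1 / \<epsilon>" "u \<theta>" "v \<theta>"] s[of "- (1 / \<epsilon>)" "v \<theta>" "u \<theta>"] \<epsilon> by auto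
    qed
    define I where "I = {\<epsilon>..\<beta> - \<epsilon>}"
    have I\<theta>: "0 < \<theta>" "\<theta> < \<beta>" if "\<theta> \<in> I" for \<theta> using that \<epsilon> by (auto simp: I_def)
    have Isub: "I \<subseteq> {0<..<\<beta>}" using I\<theta> by auto
    define A where "A \<theta> = \<zeta> \<theta> * P \<theta>" for \<theta>
    define A' where "A' \<theta> = \<zeta>' \<theta> * P \<theta> + P' \<theta> * \<zeta> \<theta>" for \<theta>
    have A0: "A \<theta> = 0" "A' \<theta> = 0" if "\<theta> \<notin> I" for \<theta> using z0[of \<theta>] that by (auto simp: A_def A'_def I_def)
    have dA: "(A has_real_derivative A' \<theta>) (at \<theta>)" for \<theta>
    proof (cases "\<theta> \<in> I")
      case True
      show ?thesis unfolding A_def[abs_def] A'_def by (rule DERIV_mult[OF d\<zeta> dP[OF I\<theta>[OF True]]])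
    next
      case False
      have "\<forall>\<^sub>F x in nhds \<theta>. x \<in> - I" using False by (intro eventually_nhds_in_open) (auto simp: I_def)
      then have "\<forall>\<^sub>F x in nhds \<theta>. A x = 0" by eventually_elim (use A0 in auto)
      from DERIV_cong_ev[OF refl this refl] show ?thesis using A0(2)[OF False] by simp
    qed
    have cAI: "continuous_on {0<..<\<beta>} A" "continuous_on {0<..<\<beta>} A'" unfolding A_def[abs_def] A'_def[abs_def]
      by (intro continuous_on_add continuous_on_mult c\<zeta> continuous_on_subset[OF c\<zeta>'] cP cP'; simp)+
    have cA': "continuous_on UNIV A'"
      by (rule continuous_zero_extend[OF _ _ Isub cAI(2) A0(2)]) (auto simp: I_def)
    have gap: "0 < sector_gap \<beta> \<theta>" if "\<theta> \<in> I" for \<theta> using sector_gap_pos[OF \<beta> I\<theta>[OF that]] .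
    have cg: "continuous_on I (\<lambda>\<theta>. (A \<theta>)\<^sup>2 / (sector_gap \<beta> \<theta>)\<^sup>2)"
      using gap by (intro continuous_on_divide continuous_on_power continuous_on_subset[OF cAI(1) Isub] continuous_on_subset[OF continuous_on_sector_gap[OF \<beta>]]) force+
    have cA2: "continuous_on I (\<lambda>\<theta>. (A' \<theta>)\<^sup>2)" by (intro continuous_on_power continuous_on_subset[OF cAI(2) Isub])
    have cz2: "continuous_on I (\<lambda>\<theta>. (\<zeta>' \<theta>)\<^sup>2 * (P \<theta>)\<^sup>2)"
      by (intro continuous_on_mult continuous_on_power continuous_on_subset[OF c\<zeta>'] continuous_on_subset[OF cP Isub]) simp
    have "c * (LINT \<theta>|lborel. (A \<theta>)\<^sup>2 / (sector_gap \<beta> \<theta>)\<^sup>2) \<le> (LINT \<theta>|lborel. (A' \<theta>)\<^sup>2)"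
      by (rule one_dim_hardyD[OF hardy \<epsilon>(1) _ dA cA']) (use A0 \<epsilon> in \<open>auto simp: I_def\<close>)
    then have h: "c * integral I (\<lambda>\<theta>. (A \<theta>)\<^sup>2 / (sector_gap \<beta> \<theta>)\<^sup>2) \<le> integral I (\<lambda>\<theta>. (A' \<theta>)\<^sup>2)"
      using lborel_integral_interval(2)[OF cg[unfolded I_def]] lborel_integral_interval(2)[OF cA2[unfolded I_def]] A0 by (simp add: I_def)
    define mid_part where "mid_part \<theta> = (if \<theta> \<in> {pi/2..\<beta> - pi/2} then (mid \<theta>)\<^sup>2 else 0)" for \<theta>
    define D where "D \<theta> = (A' \<theta>)\<^sup>2 - (\<zeta>' \<theta>)\<^sup>2 * (P \<theta>)\<^sup>2 - c * ((A \<theta>)\<^sup>2 / (sector_gap \<beta> \<theta>)\<^sup>2)" for \<theta>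
    \<comment> \<open>The boundary term of the integration by parts: its derivative is A'^2 -
      \<zeta>'^2 P^2 + \<zeta>^2 P P''. Thus the cut-off costs only the integral of \<zeta>'^2
      P^2.\<close>
    define F where "F \<theta> = (\<zeta> \<theta>)\<^sup>2 * (P \<theta> * P' \<theta>)" for \<theta>
    have dF: "(F has_real_derivative D \<theta> + (c - \<kappa>\<^sup>2) * mid_part \<theta>) (at \<theta>)" if "\<theta> \<in> {\<epsilon><..<\<beta> - \<epsilon>} - {pi/2, \<beta> - pi/2}" for \<theta>
    proof -
      have \<theta>: "0 < \<theta>" "\<theta> < \<beta>" "\<theta> \<noteq> pi/2" "\<theta> \<noteq> \<beta> - pi/2" using that \<epsilon> by auto
      have dz: "((\<lambda>\<theta>. (\<zeta> \<theta>)\<^sup>2) has_real_derivative 2 * \<zeta> \<theta> * \<zeta>' \<theta>) (at \<theta>)"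
        using DERIV_power[OF d\<zeta>[of \<theta>], of 2] by (simp add: mult_ac)
      have "(F has_real_derivative 2 * \<zeta> \<theta> * \<zeta>' \<theta> * (P \<theta> * P' \<theta>) + (P' \<theta> * P' \<theta> + P2 \<theta> * P \<theta>) * (\<zeta> \<theta>)\<^sup>2) (at \<theta>)"
        unfolding F_def[abs_def] by (rule DERIV_mult[OF dz DERIV_mult[OF dP[OF \<theta>(1,2)] dP'[OF \<theta>]]])
      also have "2 * \<zeta> \<theta> * \<zeta>' \<theta> * (P \<theta> * P' \<theta>) + (P' \<theta> * P' \<theta> + P2 \<theta> * P \<theta>) * (\<zeta> \<theta>)\<^sup>2
        = (A' \<theta>)\<^sup>2 - (\<zeta>' \<theta>)\<^sup>2 * (P \<theta>)\<^sup>2 + P2 \<theta> * P \<theta> * (\<zeta> \<theta>)\<^sup>2"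
        by (simp add: A'_def power2_eq_square algebra_simps)
      also have "P2 \<theta> * P \<theta> * (\<zeta> \<theta>)\<^sup>2 = (c - \<kappa>\<^sup>2) * mid_part \<theta> - c * ((A \<theta>)\<^sup>2 / (sector_gap \<beta> \<theta>)\<^sup>2)"
      proof -
        consider "\<theta> < pi/2" | "pi/2 < \<theta>" "\<theta> < \<beta> - pi/2" | "\<beta> - pi/2 < \<theta>" using \<theta> by linarith
        then show ?thesis
        proof cases
          case 2
          then have "\<zeta> \<theta> = 1" using z1[of \<theta>] e2 by simp
          then show ?thesis using 2 by (simp add: P2_def P_def mid_part_def A_def sector_gap_def power2_eq_square algebra_simps)
        qed (use \<beta> in \<open>simp_all add: P2_def P_def mid_part_def A_def sector_gap_def power_mult_distrib power2_eq_square\<close>)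
      qed
      finally show ?thesis by (simp add: D_def algebra_simps)
    qed
    have cF: "continuous_on I F" unfolding F_def[abs_def]
      by (intro continuous_on_mult continuous_on_power c\<zeta> continuous_on_subset[OF cP Isub] continuous_on_subset[OF cP' Isub])
    have ends: "F \<epsilon> = 0" "F (\<beta> - \<epsilon>) = 0" using z0 by (simp_all add: F_def)
    have FTC: "((\<lambda>\<theta>. D \<theta> + (c - \<kappa>\<^sup>2) * mid_part \<theta>) has_integral 0) I"
    proof -
      have "((\<lambda>\<theta>. D \<theta> + (c - \<kappa>\<^sup>2) * mid_part \<theta>) has_integral (F (\<beta> - \<epsilon>) - F \<epsilon>)) {\<epsilon>..\<beta> - \<epsilon>}"
        by (rule fundamental_theorem_of_calculus_interior_strong[where S = "{pi/2, \<beta> - pi/2}"])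
           (use cF dF e2 \<epsilon> in \<open>auto simp: I_def has_real_derivative_iff_has_vector_derivative\<close>)
      then show ?thesis unfolding ends I_def by simp
    qed
    note ii = integrable_continuous_real
    have mp: "(mid_part has_integral M0) I"
    proof -
      have "((\<lambda>\<theta>. (mid \<theta>)\<^sup>2) has_integral M0) {pi/2..\<beta> - pi/2}"
        unfolding M0_def by (intro integrable_integral ii continuous_on_power cmid)
      then show ?thesis unfolding mid_part_def[abs_def] I_def using e2 \<epsilon>
        by (subst has_integral_restrict) auto
    qed
    have ID: "integral I D = - ((c - \<kappa>\<^sup>2) * M0)"
    proof -
      have "((\<lambda>\<theta>. (D \<theta> + (c - \<kappa>\<^sup>2) * mid_part \<theta>) - (c - \<kappa>\<^sup>2) * mid_part \<theta>) has_integral (0 - (c - \<kappa>\<^sup>2) * M0)) I"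
        by (rule has_integral_diff[OF FTC has_integral_mult_right[OF mp]])
      then show ?thesis by (simp add: integral_unique)
    qed
    have "integral I D = integral I (\<lambda>\<theta>. (A' \<theta>)\<^sup>2) - integral I (\<lambda>\<theta>. (\<zeta>' \<theta>)\<^sup>2 * (P \<theta>)\<^sup>2) - c * integral I (\<lambda>\<theta>. (A \<theta>)\<^sup>2 / (sector_gap \<beta> \<theta>)\<^sup>2)"
      unfolding D_def[abs_def] I_def
      by (subst integral_diff integral_mult_right; (intro ii continuous_on_diff continuous_on_mult continuous_on_const cg[unfolded I_def] cA2[unfolded I_def] cz2[unfolded I_def])?)+ simp
    then have l: "(c - \<kappa>\<^sup>2) * M0 \<le> integral I (\<lambda>\<theta>. (\<zeta>' \<theta>)\<^sup>2 * (P \<theta>)\<^sup>2)" using ID h by simp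
    \<comment> \<open>From |\<zeta>'| \<le> 2/\<epsilon> and |P| \<le> G0 (2\<epsilon>)^\<alpha>;
      the function to be integrated lives on two intervals of length \<epsilon>.\<close>
    define K where "K = (2 / \<epsilon>)\<^sup>2 * (G0 * (2 * \<epsilon>) powr \<alpha>)\<^sup>2"
    define h where "h \<theta> = (\<zeta>' \<theta>)\<^sup>2 * (P \<theta>)\<^sup>2" for \<theta>
    have G00: "0 \<le> G0" unfolding G0_def using gauss_series_pos[OF \<alpha>', of "1/2"] by simp
    have hK: "h \<theta> \<le> K" if "\<theta> \<in> {\<epsilon>..2 * \<epsilon>} \<or> \<theta> \<in> {\<beta> - 2 * \<epsilon>..\<beta> - \<epsilon>}" for \<theta>
    proof -
      have z: "\<bar>\<zeta>' \<theta>\<bar> \<le> 2 / \<epsilon>" using that by (intro zb) auto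
      obtain t where t: "0 < t" "t \<le> 2 * \<epsilon>" "\<bar>P \<theta>\<bar> \<le> G0 * t powr \<alpha>"
      proof (cases "\<theta> \<in> {\<epsilon>..2 * \<epsilon>}")
        case True
        then show ?thesis using that[of \<theta>] Psmall(1)[of \<theta>] \<epsilon> e2 by auto
      next
        case False
        then have "\<theta> \<in> {\<beta> - 2 * \<epsilon>..\<beta> - \<epsilon>}" using \<open>_ \<or> _\<close> by blast
        then show ?thesis using that[of "\<beta> - \<theta>"] Psmall(2)[of "\<beta> - \<theta>"] \<epsilon> e2 by auto
      qed
      have "G0 * t powr \<alpha> \<le> G0 * (2 * \<epsilon>) powr \<alpha>" using t \<alpha> G00 by (intro mult_left_mono powr_mono2) auto
      then have "\<bar>P \<theta>\<bar> \<le> G0 * (2 * \<epsilon>) powr \<alpha>" using t by linarith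
      then have "\<bar>\<zeta>' \<theta>\<bar>\<^sup>2 * \<bar>P \<theta>\<bar>\<^sup>2 \<le> K" unfolding K_def using z \<epsilon> by (intro mult_mono power_mono) auto
      then show ?thesis by (simp add: h_def)
    qed
    have hi: "h integrable_on J" if "J \<subseteq> I" "J = {x..y}" for J x y
      unfolding that(2) h_def[abs_def] by (intro ii continuous_on_subset[OF cz2]) (use that in auto)
    have "integral I h = integral {\<epsilon>..2 * \<epsilon>} h + (integral {2 * \<epsilon>..\<beta> - 2 * \<epsilon>} h + integral {\<beta> - 2 * \<epsilon>..\<beta> - \<epsilon>} h)"
    proof -
      have 1: "integral {2 * \<epsilon>..\<beta> - 2 * \<epsilon>} h + integral {\<beta> - 2 * \<epsilon>..\<beta> - \<epsilon>} h = integral {2 * \<epsilon>..\<beta> - \<epsilon>} h"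
        by (rule Henstock_Kurzweil_Integration.integral_combine) (use e2 \<epsilon> in \<open>auto intro!: hi simp: I_def\<close>)
      have 2: "integral {\<epsilon>..2 * \<epsilon>} h + integral {2 * \<epsilon>..\<beta> - \<epsilon>} h = integral {\<epsilon>..\<beta> - \<epsilon>} h"
        by (rule Henstock_Kurzweil_Integration.integral_combine) (use e2 \<epsilon> in \<open>auto intro!: hi simp: I_def\<close>)
      show ?thesis unfolding 1 2 I_def ..
    qed
    also have "integral {2 * \<epsilon>..\<beta> - 2 * \<epsilon>} h = 0"
      by (subst Henstock_Kurzweil_Integration.integral_cong[of _ _ "\<lambda>_. 0"]) (use z1 in \<open>auto simp: h_def\<close>)
    also have "integral {\<epsilon>..2 * \<epsilon>} h \<le> integral {\<epsilon>..2 * \<epsilon>} (\<lambda>_. K)"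
      by (intro integral_le hi[OF _ refl] hK) (use e2 \<epsilon> in \<open>auto simp: I_def\<close>)
    also have "integral {\<beta> - 2 * \<epsilon>..\<beta> - \<epsilon>} h \<le> integral {\<beta> - 2 * \<epsilon>..\<beta> - \<epsilon>} (\<lambda>_. K)"
      by (intro integral_le hi[OF _ refl] hK) (use e2 \<epsilon> in \<open>auto simp: I_def\<close>)
    also have "integral {\<epsilon>..2 * \<epsilon>} (\<lambda>_. K) + (0 + integral {\<beta> - 2 * \<epsilon>..\<beta> - \<epsilon>} (\<lambda>_. K)) = 2 * \<epsilon> * K"
      using \<epsilon> by simp
    also have "2 * \<epsilon> * K = 8 * G0\<^sup>2 * (2 powr \<alpha>)\<^sup>2 * \<epsilon> powr (2 * \<alpha> - 1)"
    proof -
      have "(\<epsilon> powr \<alpha>)\<^sup>2 = \<epsilon> powr (2 * \<alpha> - 1) * \<epsilon>"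
        using \<epsilon> by (simp add: powr_diff power2_eq_square powr_add[symmetric])
      then show ?thesis unfolding K_def using \<epsilon> by (simp add: powr_mult power_mult_distrib power_divide field_simps power2_eq_square)
    qed
    also have "\<dots> \<le> 8 * G0\<^sup>2 * 4 * \<epsilon> powr (2 * \<alpha> - 1)"
    proof -
      have "2 powr \<alpha> \<le> 2 powr 1" using \<alpha> by (intro powr_mono) auto
      then have "(2 powr \<alpha>)\<^sup>2 \<le> (2::real)\<^sup>2" by (intro power_mono) auto
      then show ?thesis by (intro mult_right_mono mult_left_mono) auto
    qed
    finally show ?thesis using l unfolding h_def[abs_def] by simp
  qed
  \<comment> \<open>For \<alpha> > 1/2 the exponent is positive, so the cost tends to 0 while the
    deficit stays fixed.\<close>
  have "((\<lambda>\<epsilon>. 32 * G0\<^sup>2 * \<epsilon> powr (2 * \<alpha> - 1)) \<longlongrightarrow> 32 * G0\<^sup>2 * 0) (at_right 0)"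
  proof (intro tendsto_mult tendsto_const)
    show "((\<lambda>\<epsilon>. \<epsilon> powr (2 * \<alpha> - 1)) \<longlongrightarrow> 0) (at_right 0)" using \<alpha> by real_asymp
  qed
  then have "(c - \<kappa>\<^sup>2) * M0 \<le> 32 * G0\<^sup>2 * 0"
  proof (rule tendsto_lowerbound)
    show "\<forall>\<^sub>F \<epsilon> in at_right 0. (c - \<kappa>\<^sup>2) * M0 \<le> 32 * G0\<^sup>2 * \<epsilon> powr (2 * \<alpha> - 1)"
      unfolding eventually_at_right_field using main by (intro exI[of _ "1/4"]) auto
  qed simp
  then show False using M0 \<kappa>lt by (simp add: mult_le_0_iff)
qed

section \<open>Hardy inequalities for \<open>C\<^sup>1\<close> functions\<close>

definition hardy_valid :: "(real^2) set \<Rightarrow> real \<Rightarrow> bool" where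
  "hardy_valid \<Omega> c \<longleftrightarrow> (\<forall>u\<in>test_functions \<Omega>.
     (LINT x:\<Omega>|lborel. grad_sq u x) \<ge> c * (LINT x:\<Omega>|lborel. (u x)\<^sup>2 / (bdist \<Omega> x)\<^sup>2))"

definition grad :: "(real^2 \<Rightarrow> real) \<Rightarrow> real^2 \<Rightarrow> real^2" where
  "grad u x = vector [frechet_derivative u (at x) (axis 1 1), frechet_derivative u (at x) (axis 2 1)]"

lemma grad_sq_eq: "grad_sq u x = (norm (grad u x))\<^sup>2"
  unfolding grad_sq_def sum_Basis_real2 grad_def power2_norm_eq_inner vector2_inner
  by (simp add: power2_eq_square)

lemma has_derivative_grad:
  assumes "u differentiable at x"
  shows "(u has_derivative (\<lambda>h. grad u x \<bullet> h)) (at x)"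
proof -
  have d: "(u has_derivative frechet_derivative u (at x)) (at x)" using assms by (simp add: frechet_derivative_works)
  then have l: "linear (frechet_derivative u (at x))" by (rule has_derivative_linear)
  have "frechet_derivative u (at x) h = grad u x \<bullet> h" for h
  proof -
    have "h = h$1 *\<^sub>R axis 1 1 + h$2 *\<^sub>R axis 2 1" unfolding vector2_eq_sum[symmetric] vector2_eta ..
    then have "frechet_derivative u (at x) h = frechet_derivative u (at x) (h$1 *\<^sub>R axis 1 1 + h$2 *\<^sub>R axis 2 1)" by simp
    also have "\<dots> = grad u x \<bullet> h" unfolding linear_add[OF l] linear_scale[OF l] grad_def vector2_inner by (simp add: mult.commute)
    finally show ?thesis .
  qed
  then have "frechet_derivative u (at x) = (\<lambda>h. grad u x \<bullet> h)" by (rule ext)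
  with d show ?thesis by (simp only:)
qed

lemma grad_eqI:
  assumes "(u has_derivative (\<lambda>h. D \<bullet> h)) (at x)"
  shows "grad u x = D"
proof -
  have "frechet_derivative u (at x) = (\<lambda>h. D \<bullet> h)" using frechet_derivative_at[OF assms] by simp
  then show ?thesis by (simp add: grad_def vec_eq_iff forall_2 inner_axis)
qed

lemma smooth_fun_differentiable:
  assumes "smooth_fun u"
  shows "u differentiable at x" "continuous_on UNIV (grad u)"
proof -
  show "u differentiable at x" using assms unfolding smooth_fun_def by (metis empty_iff empty_set iter_pderiv.simps(1) subsetI)
  have "(\<lambda>x. frechet_derivative u (at x) b) differentiable at x" if "b \<in> Basis" for b x
    using assms that unfolding smooth_fun_def by (auto dest: spec[of _ "[b]"])
  then have "continuous_on UNIV (\<lambda>x. frechet_derivative u (at x) b)" if "b \<in> Basis" for b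
    using that by (intro continuous_at_imp_continuous_on ballI differentiable_imp_continuous_within) auto
  then show "continuous_on UNIV (grad u)"
    unfolding grad_def[abs_def] by (intro continuous_on_vector2) (auto simp: Basis_real2)
qed

text \<open>Invariance principle: a class of differentiable functions closed under partial
  derivatives consists of smooth functions. It replaces formulas for iterated derivatives of
  mollified functions.\<close>

lemma smooth_fun_coinduct:
  assumes "u \<in> S" "\<And>f x. f \<in> S \<Longrightarrow> f differentiable at x"
    "\<And>f b. f \<in> S \<Longrightarrow> b \<in> Basis \<Longrightarrow> (\<lambda>x. frechet_derivative f (at x) b) \<in> S"
  shows "smooth_fun u"
proof -
  have "iter_pderiv bs u \<in> S" if "set bs \<subseteq> Basis" for bs
    using that by (induction bs) (use assms in auto)
  then show ?thesis using assms(2) by (simp add: smooth_fun_def)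
qed

lemma set_integral_support:
  fixes f :: "'a \<Rightarrow> real"
  assumes "\<And>x. x \<notin> S \<Longrightarrow> f x = 0"
  shows "(LINT x:S|M. f x) = (LINT x|M. f x)"
proof -
  have "(\<lambda>x. indicator S x *\<^sub>R f x) = f" using assms by (auto simp: indicator_def fun_eq_iff)
  then show ?thesis by (simp add: set_lebesgue_integral_def)
qed

lemma continuous_bdist: "continuous_on S (bdist \<Omega>)"
  unfolding bdist_def[abs_def] by (intro continuous_on_infdist continuous_on_id)

lemma test_functionD:
  assumes "u \<in> test_functions \<Omega>"
  shows "smooth_fun u" "compact (closure {x. u x \<noteq> 0})" "closure {x. u x \<noteq> 0} \<subseteq> \<Omega>"
    "\<And>x. x \<notin> closure {x. u x \<noteq> 0} \<Longrightarrow> u x = 0 \<and> grad u x = 0"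
proof -
  show "smooth_fun u" "compact (closure {x. u x \<noteq> 0})" "closure {x. u x \<noteq> 0} \<subseteq> \<Omega>"
    using assms by (auto simp: test_functions_def)
  fix x assume x: "x \<notin> closure {x. u x \<noteq> 0}"
  then have u0: "u x = 0" using closure_subset[of "{x. u x \<noteq> 0}"] by auto
  have "(u has_derivative (\<lambda>h. 0 \<bullet> h)) (at x)"
  proof (rule has_derivative_transform_within_open[of "\<lambda>_. 0" _ _ _ "- closure {x. u x \<noteq> 0}"])
    show "((\<lambda>_. 0) has_derivative (\<lambda>h. 0 \<bullet> h)) (at x)" by simp
    show "0 = u y" if "y \<in> - closure {x. u x \<noteq> 0}" for y
    proof (rule ccontr)
      assume "0 \<noteq> u y"
      then have "y \<in> {x. u x \<noteq> 0}" by simp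
      then show False using that closure_subset by (metis ComplD subsetD)
    qed
  qed (use x in \<open>simp_all add: open_Compl\<close>)
  then show "u x = 0 \<and> grad u x = 0" using u0 grad_eqI[of u 0 x] by simp
qed

section \<open>Bumps and kernels closed under differentiation\<close>

definition flat :: "real poly \<Rightarrow> real \<Rightarrow> real" where
  "flat p t = (if t > 0 then poly p (1 / t) * exp (- (1 / t)) else 0)"

lemma poly_exp_decay: "((\<lambda>x. poly p x * exp (- x)) \<longlongrightarrow> 0) (at_top :: real filter)"
proof -
  have "((\<lambda>x. \<Sum>i\<le>degree p. coeff p i * (x ^ i / exp x)) \<longlongrightarrow> (\<Sum>i\<le>degree p. coeff p i * 0)) at_top"
    by (intro tendsto_sum tendsto_mult tendsto_const tendsto_power_div_exp_0)
  then show ?thesis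
    by (simp add: poly_altdef sum_distrib_right exp_minus divide_inverse mult.assoc)
qed

text \<open>Differentiating p(1/t) exp(-1/t) gives the same form with x^2 (p - p') in place of p. A
  statement about first derivatives, for all p at once, therefore contains smoothness.\<close>

lemma flat_has_deriv: "(flat p has_real_derivative flat ([:0, 0, 1:] * (p - pderiv p)) t) (at t)"
proof -
  consider "t > 0" | "t < 0" | "t = 0" by linarith
  then show ?thesis
  proof cases
    case 1
    have d: "((\<lambda>t. poly p (1 / t) * exp (- (1 / t))) has_real_derivative
       poly (pderiv p) (1 / t) * (- 1 / t\<^sup>2) * exp (- (1 / t)) + exp (- (1 / t)) * (1 / t\<^sup>2) * poly p (1 / t)) (at t)"
    proof (rule DERIV_mult)
      have i: "((\<lambda>t. 1 / t) has_real_derivative - 1 / t\<^sup>2) (at t)"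
        using 1 by (auto intro!: derivative_eq_intros simp: power2_eq_square)
      show "((\<lambda>t. poly p (1 / t)) has_real_derivative poly (pderiv p) (1 / t) * (- 1 / t\<^sup>2)) (at t)"
        by (rule DERIV_chain2[OF poly_DERIV i])
      show "((\<lambda>t. exp (- (1 / t))) has_real_derivative exp (- (1 / t)) * (1 / t\<^sup>2)) (at t)"
        using DERIV_chain2[OF DERIV_exp DERIV_minus[OF i]] by simp
    qed
    have "\<forall>\<^sub>F s in nhds t. s \<in> {0<..}" using 1 by (intro eventually_nhds_in_open) auto
    then have ev: "\<forall>\<^sub>F s in nhds t. poly p (1 / s) * exp (- (1 / s)) = flat p s" by eventually_elim (simp add: flat_def)
    have "poly (pderiv p) (1 / t) * (- 1 / t\<^sup>2) * exp (- (1 / t)) + exp (- (1 / t)) * (1 / t\<^sup>2) * poly p (1 / t) = flat ([:0, 0, 1:] * (p - pderiv p)) t"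
      using 1 by (simp add: flat_def power2_eq_square algebra_simps)
    then show ?thesis using d DERIV_cong_ev[OF refl ev refl] by simp
  next
    case 2
    have "\<forall>\<^sub>F s in nhds t. s \<in> {..<0}" using 2 by (intro eventually_nhds_in_open) auto
    then have ev: "\<forall>\<^sub>F s in nhds t. 0 = flat p s" by eventually_elim (simp add: flat_def)
    from DERIV_cong_ev[OF refl ev refl, of 0] have "(flat p has_real_derivative 0) (at t)" by simp
    then show ?thesis using 2 by (simp add: flat_def[of _ t])
  next
    case 3
    have "((\<lambda>h. flat p h / h) \<longlongrightarrow> 0) (at_left 0)"
      by (rule tendsto_eventually) (auto simp: eventually_at_left_field flat_def intro!: exI[of _ "-1"])
    \<comment> \<open>Dividing by h multiplies the polynomial by x, and a polynomial times exp(-x)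
      still tends to 0.\<close>
    moreover have "((\<lambda>h. flat p h / h) \<longlongrightarrow> 0) (at_right 0)"
    proof -
      have "((\<lambda>h. poly ([:0, 1:] * p) (inverse h) * exp (- inverse h)) \<longlongrightarrow> 0) (at_right 0)"
        by (rule filterlim_compose[OF poly_exp_decay filterlim_inverse_at_top_right])
      then show ?thesis
        by (rule Lim_transform_eventually)
           (auto simp: eventually_at_right_field flat_def divide_inverse mult_ac intro!: exI[of _ 1])
    qed
    ultimately have "((\<lambda>h. flat p h / h) \<longlongrightarrow> 0) (at 0)" by (simp add: filterlim_at_split)
    then show ?thesis unfolding 3 DERIV_def by (simp add: flat_def)
  qed
qed

text \<open>Products of two flat functions are supported in [-1, 1]. Sums are included because of
  the product rule; signs and factors are absorbed by the polynomials.\<close>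

inductive_set bumps :: "(real \<Rightarrow> real) set" where
  base: "(\<lambda>t. flat p (1 + t) * flat q (1 - t)) \<in> bumps"
| add: "f \<in> bumps \<Longrightarrow> g \<in> bumps \<Longrightarrow> (\<lambda>t. f t + g t) \<in> bumps"

lemma bumps_deriv: "f \<in> bumps \<Longrightarrow> \<exists>f'\<in>bumps. \<forall>t. (f has_real_derivative f' t) (at t)"
proof (induction rule: bumps.induct)
  case (base p q)
  define p' q' where "p' = [:0, 0, 1:] * (p - pderiv p)" and "q' = [:0, 0, 1:] * (q - pderiv q)"
  have neg: "flat (- q') s = - flat q' s" for s by (simp add: flat_def)
  have "((\<lambda>t. flat p (1 + t) * flat q (1 - t)) has_real_derivative flat p' (1 + t) * flat q (1 - t) + flat p (1 + t) * flat (- q') (1 - t)) (at t)" for t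
  proof -
    have 1: "((\<lambda>t. flat p (1 + t)) has_real_derivative flat p' (1 + t) * 1) (at t)"
      unfolding p'_def by (rule DERIV_chain2[OF flat_has_deriv]) (auto intro!: derivative_eq_intros)
    have 2: "((\<lambda>t. flat q (1 - t)) has_real_derivative flat q' (1 - t) * (- 1)) (at t)"
      unfolding q'_def by (rule DERIV_chain2[OF flat_has_deriv]) (auto intro!: derivative_eq_intros)
    show ?thesis using DERIV_mult[OF 1 2] by (simp add: neg mult.commute)
  qed
  then show ?case by (intro bexI[where x = "\<lambda>t. flat p' (1 + t) * flat q (1 - t) + flat p (1 + t) * flat (- q') (1 - t)"] bumps.intros allI)
next
  case (add f g)
  then obtain f' g' where "f' \<in> bumps" "g' \<in> bumps" "\<forall>t. (f has_real_derivative f' t) (at t)" "\<forall>t. (g has_real_derivative g' t) (at t)" by blast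
  then show ?case by (intro bexI[where x = "\<lambda>t. f' t + g' t"] bumps.intros allI DERIV_add) auto
qed

lemma bumps_zero: "f \<in> bumps \<Longrightarrow> \<bar>t\<bar> \<ge> 1 \<Longrightarrow> f t = 0"
  by (induction rule: bumps.induct) (auto simp: flat_def)

text \<open>The prefactor absorbs the factor \<open>n\<close> produced by each partial derivative,
  so the class stays closed; 1/n is the width of the kernel.\<close>

definition kernels :: "real \<Rightarrow> (real^2 \<Rightarrow> real) set" where
  "kernels n = {\<lambda>x. k * (f (n * x$1) * g (n * x$2)) |k f g. f \<in> bumps \<and> g \<in> bumps}"

lemma kernels_deriv:
  assumes "K \<in> kernels n"
  obtains K1 K2 where "K1 \<in> kernels n" "K2 \<in> kernels n" "\<And>x. (K has_derivative (\<lambda>h. vector [K1 x, K2 x] \<bullet> h)) (at x)"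
proof -
  from assms obtain k f g where K: "K = (\<lambda>x. k * (f (n * x$1) * g (n * x$2)))" "f \<in> bumps" "g \<in> bumps" by (auto simp: kernels_def)
  obtain f' g' where d: "f' \<in> bumps" "g' \<in> bumps" "\<And>t. (f has_real_derivative f' t) (at t)" "\<And>t. (g has_real_derivative g' t) (at t)"
    using bumps_deriv K by meson
  define K1 where "K1 x = (k * n) * (f' (n * x$1) * g (n * x$2))" for x :: "real^2"
  define K2 where "K2 x = (k * n) * (f (n * x$1) * g' (n * x$2))" for x :: "real^2"
  have "(K has_derivative (\<lambda>h. vector [K1 x, K2 x] \<bullet> h)) (at x)" for x
  proof -
    have 1: "((\<lambda>x::real^2. f (n * x$1)) has_derivative (\<lambda>h. f' (n * x$1) * (n * h$1))) (at x)"
      by (rule has_derivative_compose[OF _ d(3)[unfolded has_field_derivative_def]]) 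
         (auto intro!: derivative_eq_intros bounded_linear.has_derivative[OF bounded_linear_vec_nth])
    have 2: "((\<lambda>x::real^2. g (n * x$2)) has_derivative (\<lambda>h. g' (n * x$2) * (n * h$2))) (at x)"
      by (rule has_derivative_compose[OF _ d(4)[unfolded has_field_derivative_def]]) 
         (auto intro!: derivative_eq_intros bounded_linear.has_derivative[OF bounded_linear_vec_nth])
    show ?thesis unfolding K(1) vector2_inner K1_def K2_def
      by (rule has_derivative_eq_rhs[OF has_derivative_mult_right[OF has_derivative_mult[OF 1 2]]]) (simp add: fun_eq_iff algebra_simps)
  qed
  moreover have "K1 \<in> kernels n" "K2 \<in> kernels n" unfolding kernels_def K1_def[abs_def] K2_def[abs_def] using K d by blast+
  ultimately show ?thesis using that by blast
qed

lemma kernels_continuous: "K \<in> kernels n \<Longrightarrow> continuous_on S K"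
proof -
  assume "K \<in> kernels n"
  then obtain K1 K2 where "\<And>x. (K has_derivative (\<lambda>h. vector [K1 x, K2 x] \<bullet> h)) (at x)"
    using kernels_deriv by metis
  then show ?thesis by (intro continuous_at_imp_continuous_on ballI has_derivative_continuous)
qed

lemma kernels_zero:
  assumes "K \<in> kernels n" "n > 0" "norm x \<ge> 2 / n"
  shows "K x = 0"
proof -
  have "\<bar>n * x$1\<bar> \<ge> 1 \<or> \<bar>n * x$2\<bar> \<ge> 1"
  proof (rule ccontr)
    assume "\<not> ?thesis"
    then have "n * \<bar>x$1\<bar> < 1" "n * \<bar>x$2\<bar> < 1" using assms(2) by (simp_all add: abs_mult)
    then have "\<bar>x$1\<bar> < 1 / n" "\<bar>x$2\<bar> < 1 / n" using assms(2) by (simp_all add: less_divide_eq mult.commute)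
    moreover have "norm x \<le> \<bar>x$1\<bar> + \<bar>x$2\<bar>" using norm_le_l1_cart[of x] by (simp add: sum_2)
    ultimately show False using assms(3) by (simp add: field_simps)
  qed
  moreover obtain k f g where "K = (\<lambda>x. k * (f (n * x$1) * g (n * x$2)))" "f \<in> bumps" "g \<in> bumps"
    using assms(1) by (auto simp: kernels_def)
  ultimately show ?thesis using bumps_zero by auto
qed

section \<open>Mollification\<close>

definition mollify :: "(real^2 \<Rightarrow> real) \<Rightarrow> (real^2) \<Rightarrow> real^2 \<Rightarrow> (real^2 \<Rightarrow> real) \<Rightarrow> real^2 \<Rightarrow> real" where
  "mollify g a b K x = integral (cbox a b) (\<lambda>y. g y * K (x - y))"

text \<open>Leibniz rule on a fixed box: the derivative falls on the kernel, which is smooth, while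
  g is merely continuous.\<close>

lemma mollify_deriv:
  assumes g: "continuous_on UNIV g" and K: "K \<in> kernels n" and K12: "K1 \<in> kernels n" "K2 \<in> kernels n"
    and dK: "\<And>x. (K has_derivative (\<lambda>h. vector [K1 x, K2 x] \<bullet> h)) (at x)"
  shows "(mollify g a b K has_derivative (\<lambda>h. vector [mollify g a b K1 x, mollify g a b K2 x] \<bullet> h)) (at x)"
proof -
  define fx where "fx x y = g y *\<^sub>R blinfun_inner_right (vector [K1 (x - y), K2 (x - y)] :: real^2)" for x y :: "real^2"
  have gS: "continuous_on S g" for S using g continuous_on_subset by blast
  have comp: "continuous_on S (\<lambda>y. K' (x - y))" if "K' \<in> kernels n" for K' x S
    by (rule continuous_on_compose2[OF kernels_continuous[OF that, of UNIV]]) (auto intro!: continuous_intros)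
  have cfx: "continuous_on (UNIV \<times> cbox a b) (\<lambda>(x, y). fx x y)"
  proof -
    have "continuous_on (UNIV \<times> cbox a b) (\<lambda>p. g (snd p) *\<^sub>R blinfun_inner_right (vector [K1 (fst p - snd p), K2 (fst p - snd p)] :: real^2))"
      by (intro continuous_intros continuous_on_compose2[OF g] continuous_on_compose2[OF kernels_continuous[OF K12(1), of UNIV]]
         continuous_on_compose2[OF kernels_continuous[OF K12(2), of UNIV]] bounded_linear.continuous_on[OF bounded_linear_blinfun_inner_right]) auto
    then show ?thesis by (simp add: fx_def case_prod_unfold)
  qed
  have "((\<lambda>x. integral (cbox a b) (\<lambda>y. g y * K (x - y))) has_derivative blinfun_apply (integral (cbox a b) (fx x))) (at x within UNIV)"
  proof (rule leibniz_rule[OF _ _ cfx])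
    show "((\<lambda>x. g y * K (x - y)) has_derivative blinfun_apply (fx x y)) (at x within UNIV)" for x y
    proof -
      have "((\<lambda>x. K (x - y)) has_derivative (\<lambda>h. vector [K1 (x - y), K2 (x - y)] \<bullet> h)) (at x)"
        by (rule has_derivative_compose[OF _ dK, of "\<lambda>x. x - y" "\<lambda>h. h", simplified]) (auto intro!: derivative_eq_intros)
      moreover have "blinfun_apply (fx x y) = (\<lambda>h. g y * (vector [K1 (x - y), K2 (x - y)] \<bullet> h))"
        by (rule ext) (simp add: fx_def blinfun.scaleR_left)
      ultimately show ?thesis using has_derivative_mult_right by auto
    qed
    show "(\<lambda>y. g y * K (x - y)) integrable_on cbox a b" for x
      by (intro integrable_continuous continuous_intros gS comp K)
  qed auto
  moreover have "blinfun_apply (integral (cbox a b) (fx x)) = (\<lambda>h. vector [mollify g a b K1 x, mollify g a b K2 x] \<bullet> h)"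
  proof
    fix h
    have "fx x integrable_on cbox a b"
      unfolding fx_def by (intro integrable_continuous continuous_intros gS comp K12 bounded_linear.continuous_on[OF bounded_linear_blinfun_inner_right])
    then have "blinfun_apply (integral (cbox a b) (fx x)) h = integral (cbox a b) (\<lambda>y. blinfun_apply (fx x y) h)"
      by (rule blinfun_apply_integral)
    also have "\<dots> = integral (cbox a b) (\<lambda>y. h$1 * (g y * K1 (x - y)) + h$2 * (g y * K2 (x - y)))"
      by (simp add: fx_def blinfun.scaleR_left vector2_inner algebra_simps)
    also have "\<dots> = integral (cbox a b) (\<lambda>y. h$1 * (g y * K1 (x - y))) + integral (cbox a b) (\<lambda>y. h$2 * (g y * K2 (x - y)))"
      by (intro Henstock_Kurzweil_Integration.integral_add integrable_continuous continuous_intros gS comp K12)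
    also have "\<dots> = vector [mollify g a b K1 x, mollify g a b K2 x] \<bullet> h"
      by (simp add: vector2_inner mollify_def mult.commute)
    finally show "blinfun_apply (integral (cbox a b) (fx x)) h = vector [mollify g a b K1 x, mollify g a b K2 x] \<bullet> h" .
  qed
  ultimately show ?thesis unfolding mollify_def[abs_def] by simp
qed

lemma mollify_smooth:
  assumes g: "continuous_on UNIV g" and K: "K \<in> kernels n"
  shows "smooth_fun (mollify g a b K)"
proof (rule smooth_fun_coinduct[where S = "mollify g a b ` kernels n"])
  show "mollify g a b K \<in> mollify g a b ` kernels n" using K by simp
  fix f assume "f \<in> mollify g a b ` kernels n"
  then obtain L where L: "L \<in> kernels n" "f = mollify g a b L" by auto
  then obtain L1 L2 where L12: "L1 \<in> kernels n" "L2 \<in> kernels n" "\<And>x. (L has_derivative (\<lambda>h. vector [L1 x, L2 x] \<bullet> h)) (at x)"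
    using kernels_deriv by metis
  have d: "(f has_derivative (\<lambda>h. vector [mollify g a b L1 x, mollify g a b L2 x] \<bullet> h)) (at x)" for x
    unfolding L(2) by (rule mollify_deriv[OF g L(1) L12])
  then show "f differentiable at x" for x by (auto simp: differentiable_def)
  show "(\<lambda>x. frechet_derivative f (at x) e) \<in> mollify g a b ` kernels n" if "e \<in> Basis" for e
  proof -
    have "(\<lambda>x. frechet_derivative f (at x) e) = (\<lambda>x. vector [mollify g a b L1 x, mollify g a b L2 x] \<bullet> e)"
      by (rule ext) (simp add: frechet_derivative_at[OF d, symmetric])
    moreover have "e = axis 1 1 \<or> e = axis 2 1" using that by (auto simp: Basis_real2)
    ultimately have "(\<lambda>x. frechet_derivative f (at x) e) = mollify g a b L1 \<or> (\<lambda>x. frechet_derivative f (at x) e) = mollify g a b L2"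
      by (auto simp: inner_axis fun_eq_iff)
    then show ?thesis using L12 by auto
  qed
qed

lemma lborel_integral_shift:
  fixes f :: "'a::euclidean_space \<Rightarrow> real"
  assumes "f \<in> borel_measurable borel"
  shows "(LINT x|lborel. f (x + y)) = (LINT x|lborel. f x)"
proof -
  have m: "(\<lambda>x. y + x) \<in> lborel \<rightarrow>\<^sub>M (borel :: 'a measure)" by simp
  have d: "distr lborel borel (\<lambda>x. y + x) = (lborel :: 'a measure)" by (simp add: lborel_distr_plus)
  show ?thesis using integral_distr[OF m assms] d by (simp add: add.commute)
qed

lemma has_derivative_direction:
  fixes f :: "real^2 \<Rightarrow> real"
  assumes "(f has_derivative (\<lambda>h. D \<bullet> h)) (at x)"
  shows "((\<lambda>s. f (x + s *\<^sub>R e)) has_real_derivative D \<bullet> e) (at 0)"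
proof -
  have "((\<lambda>s. x + s *\<^sub>R e) has_derivative (\<lambda>s. s *\<^sub>R e)) (at 0)" by (auto intro!: derivative_eq_intros)
  moreover have "(f has_derivative (\<lambda>h. D \<bullet> h)) (at (x + 0 *\<^sub>R e))" using assms by simp
  ultimately have "((\<lambda>s. f (x + s *\<^sub>R e)) has_derivative (\<lambda>s. D \<bullet> (s *\<^sub>R e))) (at 0)"
    by (rule has_derivative_compose)
  moreover have "(\<lambda>s. D \<bullet> (s *\<^sub>R e)) = (*) (D \<bullet> e)" by (rule ext) simp
  ultimately show ?thesis by (simp only: has_field_derivative_def)
qed

definition mollifier :: "real \<Rightarrow> (real^2 \<Rightarrow> real) \<Rightarrow> bool" where
  "mollifier n K \<longleftrightarrow> K \<in> kernels n \<and> (\<forall>x. K x \<ge> 0) \<and> (\<forall>x. K (- x) = K x) \<and> (LINT x|lborel. K x) = 1"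

text \<open>A product of two bumps, normalised: being continuous, nonnegative and positive at 0, it
  has nonzero integral. Evenness lets K(x - y) be integrated over y by translation alone.\<close>

lemma mollifier_exists:
  assumes n: "n > 0"
  shows "\<exists>K. mollifier n K"
proof -
  define B where "B t = flat 1 (1 + t) * flat 1 (1 - t)" for t
  define K0 where "K0 x = 1 * (B (n * x$1) * B (n * x$2))" for x :: "real^2"
  have B: "B \<in> bumps" unfolding B_def[abs_def] by (rule bumps.base)
  have B0: "B t \<ge> 0" "B (- t) = B t" "B 0 > 0" for t by (simp_all add: B_def flat_def)
  have K0k: "K0 \<in> kernels n" unfolding K0_def[abs_def] kernels_def using B by blast
  have K0: "K0 x \<ge> 0" "K0 (- x) = K0 x" "K0 0 > 0" for x
    using B0 by (simp_all add: K0_def)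
  define R where "R = 2 / n"
  have R: "R > 0" using n by (simp add: R_def)
  have z: "K0 x = 0" if "norm x \<ge> R" for x using kernels_zero[OF K0k n] that by (simp add: R_def)
  have cK0: "continuous_on S K0" for S by (rule kernels_continuous[OF K0k])
  have iK0: "integrable lborel K0"
    by (rule integrable_compact_support[of "cball 0 R"]) (use cK0 z in auto)
  define I where "I = (LINT x|lborel. K0 x)"
  have "I \<noteq> 0"
  proof
    assume "I = 0"
    define a b :: "real^2" where "a = vector [- R, - R]" and "b = vector [R, R]"
    have box: "x \<in> cbox a b \<longleftrightarrow> \<bar>x$1\<bar> \<le> R \<and> \<bar>x$2\<bar> \<le> R" for x
      by (auto simp: a_def b_def mem_box_cart forall_2)
    have zz: "K0 x = 0" if "x \<notin> cbox a b" for x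
      using that component_le_norm_cart[of x 1] component_le_norm_cart[of x 2] by (intro z) (auto simp: box)
    have "(K0 has_integral I) UNIV" using has_integral_integral_lborel[OF iK0] by (simp add: I_def)
    moreover have "K0 = (\<lambda>x. if x \<in> cbox a b then K0 x else 0)" using zz by auto
    ultimately have "(K0 has_integral 0) (cbox a b)" using \<open>I = 0\<close> has_integral_restrict_UNIV by metis
    moreover have "0 \<in> box a b" using R by (auto simp: a_def b_def mem_box_cart forall_2)
    ultimately have "K0 0 = 0"
      using has_integral_0_cbox_imp_0[of a b K0 0] cK0 K0(1) box_subset_cbox by blast
    then show False using K0(3) by simp
  qed
  moreover have "I \<ge> 0" unfolding I_def using K0(1) by (intro integral_nonneg_AE) auto
  ultimately have I: "I > 0" by simp
  define K where "K x = (1 / I) * (B (n * x$1) * B (n * x$2))" for x :: "real^2"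
  have KI: "K x = K0 x / I" for x by (simp add: K_def K0_def)
  have "K \<in> kernels n" unfolding K_def[abs_def] kernels_def using B by blast
  moreover have "(LINT x|lborel. K x) = 1"
  proof -
    have "(LINT x|lborel. K x) = I / I" unfolding KI by (simp add: I_def)
    then show ?thesis using I by simp
  qed
  moreover have "K x \<ge> 0" "K (- x) = K x" for x using I K0 by (simp_all add: KI)
  ultimately have "mollifier n K" unfolding mollifier_def by blast
  then show ?thesis by blast
qed

lemma mollifier_reflect_integral:
  assumes K: "mollifier n K" and n: "n > 0"
  shows "integrable lborel (\<lambda>y. K (x - y))" "(LINT y|lborel. K (x - y)) = 1"
proof -
  have Kk: "K \<in> kernels n" "\<And>x. K (- x) = K x" "(LINT x|lborel. K x) = 1" using K by (auto simp: mollifier_def)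
  have sw: "K (x - y) = K (y + (- x))" for y using Kk(2)[of "x - y"] by simp
  have c: "continuous_on S K" for S by (rule kernels_continuous[OF Kk(1)])
  show "integrable lborel (\<lambda>y. K (x - y))"
  proof (rule integrable_compact_support[of "cball x (2 / n)"])
    show "continuous_on (cball x (2/n)) (\<lambda>y. K (x - y))"
      by (rule continuous_on_compose2[OF c[of UNIV]]) (auto intro!: continuous_intros)
    show "K (x - y) = 0" if "y \<notin> cball x (2 / n)" for y
      using kernels_zero[OF Kk(1) n] that by (simp add: dist_norm)
  qed simp
  show "(LINT y|lborel. K (x - y)) = 1"
    unfolding sw using lborel_integral_shift[of K "- x"] c Kk(3) by (simp add: borel_measurable_continuous_onI)
qed

text \<open>Uniform continuity: a kernel of mass 1 averages h over a disc of radius 2/n. The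
  estimate is uniform in the point and in the kernel.\<close>

lemma mollifier_approx:
  fixes h :: "real^2 \<Rightarrow> real"
  assumes h: "continuous_on UNIV h" and C: "compact C" "\<And>x. x \<notin> C \<Longrightarrow> h x = 0" and e: "e > 0"
  obtains N where "N > 0" "\<And>n K x. n \<ge> N \<Longrightarrow> mollifier n K \<Longrightarrow> \<bar>(LINT y|lborel. h y * K (x - y)) - h x\<bar> \<le> e"
proof -
  obtain R where R: "\<And>x. x \<in> C \<Longrightarrow> norm x \<le> R" using compact_imp_bounded[OF C(1)] unfolding bounded_iff by auto
  have "uniformly_continuous_on (cball 0 (R + 1)) h"
    by (intro compact_uniformly_continuous continuous_on_subset[OF h]) auto
  then obtain d where d: "d > 0" "\<And>x y. x \<in> cball 0 (R + 1) \<Longrightarrow> y \<in> cball 0 (R + 1) \<Longrightarrow> dist x y < d \<Longrightarrow> dist (h x) (h y) < e"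
    unfolding uniformly_continuous_on_def using e by metis
  define r where "r = min d 1"
  have near: "\<bar>h y - h x\<bar> \<le> e" if "norm (x - y) < r" for x y
  proof (cases "norm x \<le> R + 1 \<and> norm y \<le> R + 1")
    case True
    then show ?thesis using d(2)[of x y] that by (simp add: r_def dist_norm dist_real_def abs_minus_commute)
  next
    case False
    have "\<bar>norm x - norm y\<bar> < 1" using norm_triangle_ineq3[of x y] that by (simp add: r_def)
    then have "norm x > R" "norm y > R" using False by linarith+
    then have "x \<notin> C" "y \<notin> C" using R by force+
    then show ?thesis using C(2) e by simp
  qed
  have r: "r > 0" using d by (simp add: r_def)
  show ?thesis
  proof (rule that[of "2 / r"])
    show "2 / r > 0" using r by simp
    fix n K x assume n: "n \<ge> 2 / r" and K: "mollifier n K"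
    have n0: "n > 0" using n r by (smt (verit) divide_pos_pos)
    have "2 / n \<le> r" using n n0 r by (simp add: field_simps)
    then have Kz: "K (x - y) = 0" if "norm (x - y) \<ge> r" for y
      using kernels_zero[of K n "x - y"] K n0 that by (simp add: mollifier_def)
    note iK = mollifier_reflect_integral[OF K n0, of x]
    have cK: "continuous_on S (\<lambda>y. K (x - y))" for S
      by (rule continuous_on_compose2[OF kernels_continuous[of K n UNIV]]) (use K in \<open>auto intro!: continuous_intros simp: mollifier_def\<close>)
    have ih: "integrable lborel (\<lambda>y. h y * K (x - y))"
      by (rule integrable_compact_support[OF C(1)]) (use C(2) in \<open>auto intro!: continuous_intros cK continuous_on_subset[OF h]\<close>)
    have "(LINT y|lborel. h y * K (x - y)) - h x = (LINT y|lborel. h y * K (x - y)) - (LINT y|lborel. h x * K (x - y))"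
      using iK by simp
    also have "\<dots> = (LINT y|lborel. h y * K (x - y) - h x * K (x - y))"
      by (rule Bochner_Integration.integral_diff[symmetric]) (use ih iK in auto)
    finally have eq: "(LINT y|lborel. h y * K (x - y)) - h x = (LINT y|lborel. h y * K (x - y) - h x * K (x - y))" .
    have "\<bar>LINT y|lborel. h y * K (x - y) - h x * K (x - y)\<bar> \<le> (LINT y|lborel. e * K (x - y))"
    proof (rule integral_abs_bound_integral)
      show "integrable lborel (\<lambda>y. h y * K (x - y) - h x * K (x - y))" "integrable lborel (\<lambda>y. e * K (x - y))"
        using ih iK by auto
      show "\<bar>h y * K (x - y) - h x * K (x - y)\<bar> \<le> e * K (x - y)" for y
      proof (cases "norm (x - y) < r")
        case True
        have "\<bar>h y - h x\<bar> * \<bar>K (x - y)\<bar> \<le> e * \<bar>K (x - y)\<bar>" by (intro mult_right_mono near[OF True]) auto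
        then show ?thesis using K by (simp add: mollifier_def left_diff_distrib[symmetric] abs_mult)
      qed (use Kz in simp)
    qed
    also have "\<dots> = e" using iK by simp
    finally show "\<bar>(LINT y|lborel. h y * K (x - y)) - h x\<bar> \<le> e" unfolding eq .
  qed
qed

lemma mollify_eq_lborel:
  assumes h: "continuous_on UNIV h" and C: "C \<subseteq> cbox a b" "compact C" "\<And>x. x \<notin> C \<Longrightarrow> h x = 0" and K: "K \<in> kernels n"
  shows "mollify h a b K x = (LINT y|lborel. h y * K (x - y))"
proof -
  have cK: "continuous_on S (\<lambda>y. K (x - y))" for S
    by (rule continuous_on_compose2[OF kernels_continuous[OF K, of UNIV]]) (auto intro!: continuous_intros)
  have ih: "integrable lborel (\<lambda>y. h y * K (x - y))"
    by (rule integrable_compact_support[OF C(2)]) (use C(3) in \<open>auto intro!: continuous_intros cK continuous_on_subset[OF h]\<close>)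
  have "(\<lambda>y. h y * K (x - y)) = (\<lambda>y. if y \<in> cbox a b then h y * K (x - y) else 0)"
  proof
    show "h y * K (x - y) = (if y \<in> cbox a b then h y * K (x - y) else 0)" for y using C(1) C(3)[of y] by auto
  qed
  then have "integral UNIV (\<lambda>y. h y * K (x - y)) = integral UNIV (\<lambda>y. if y \<in> cbox a b then h y * K (x - y) else 0)"
    by (rule arg_cong)
  also have "\<dots> = integral (cbox a b) (\<lambda>y. h y * K (x - y))" by (rule integral_restrict_UNIV)
  finally have "integral UNIV (\<lambda>y. h y * K (x - y)) = integral (cbox a b) (\<lambda>y. h y * K (x - y))" .
  then show ?thesis unfolding mollify_def using integral_lborel[OF ih] by simp
qed

text \<open>Mollifications of g are test functions, converge uniformly together with their
  gradients, and live on one compact set \<open>C1\<close> on which the distance is bounded below;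
  dominated convergence transfers the inequality. A nonempty frontier keeps the distance positive,
  since \<open>infdist\<close> to the empty set is 0 by convention.\<close>

lemma hardy_valid_C1:
  fixes g :: "real^2 \<Rightarrow> real" and D :: "real^2 \<Rightarrow> real^2"
  assumes valid: "hardy_valid \<Omega> c" and front: "frontier \<Omega> \<noteq> {}"
    and C: "compact C" "C \<subseteq> interior \<Omega>"
    and der: "\<And>x. (g has_derivative (\<lambda>h. D x \<bullet> h)) (at x)" and cD: "continuous_on UNIV D"
    and g0: "\<And>x. x \<notin> C \<Longrightarrow> g x = 0"
  shows "c * (LINT x|lborel. (g x)\<^sup>2 / (bdist \<Omega> x)\<^sup>2) \<le> (LINT x|lborel. (norm (D x))\<^sup>2)"
proof -
  have cg: "continuous_on S g" for S
    using der by (intro continuous_at_imp_continuous_on ballI has_derivative_continuous)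
  have D0: "D x = 0" if "x \<notin> C" for x
  proof -
    have "(g has_derivative (\<lambda>h. 0 \<bullet> h)) (at x)"
    proof (rule has_derivative_transform_within_open[of "\<lambda>_. 0" _ _ _ "- C"])
      show "((\<lambda>_. 0) has_derivative (\<lambda>h. 0 \<bullet> h)) (at x)" by simp
    qed (use that g0 C(1) in \<open>auto simp: compact_imp_closed open_Compl\<close>)
    from grad_eqI[OF this] grad_eqI[OF der[of x]] show ?thesis by simp
  qed
  have cDi: "continuous_on UNIV (\<lambda>x. D x \<bullet> e)" for e by (intro continuous_intros cD)
  obtain r0 where r0: "r0 > 0" "(\<Union>x\<in>C. ball x r0) \<subseteq> interior \<Omega>"
    by (rule compact_subset_open_imp_ball_epsilon_subset[OF C(1) open_interior C(2)]) blast
  \<comment> \<open>The closed neighbourhood of C with half the available radius; it holds the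
    supports of the mollified functions once 2 / (k + 1) \<le> r0/2.\<close>
  define C1 where "C1 = {x + y |x y. x \<in> C \<and> y \<in> cball 0 (r0 / 2)}"
  have C1: "compact C1" unfolding C1_def by (intro compact_sums C) simp
  have C1sub: "C1 \<subseteq> interior \<Omega>"
  proof
    fix z assume "z \<in> C1"
    then obtain x y where "z = x + y" "x \<in> C" "norm y \<le> r0 / 2" by (auto simp: C1_def)
    then have "z \<in> ball x r0" using r0(1) by (simp add: dist_norm)
    then show "z \<in> interior \<Omega>" using r0(2) \<open>x \<in> C\<close> by blast
  qed
  obtain a where a: "C \<subseteq> cbox (- a) a" using bounded_subset_cbox_symmetric[OF compact_imp_bounded[OF C(1)]] by blast
  define K where "K k = (SOME K. mollifier (real (Suc k)) K)" for k
  have K: "mollifier (real (Suc k)) (K k)" for k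
    unfolding K_def by (rule someI_ex[OF mollifier_exists]) simp
  then have Kk: "K k \<in> kernels (real (Suc k))" for k by (simp add: mollifier_def)
  define u where "u k = mollify g (- a) a (K k)" for k
  have u_eq: "u k x = (LINT y|lborel. g y * K k (x - y))" for k x
    unfolding u_def by (rule mollify_eq_lborel[OF cg a C(1) g0 Kk])
  \<comment> \<open>Integration by parts moves the derivative from the kernel back to g. The
    gradient is thus itself a mollification, of D, and converges by the same estimate.\<close>
  have grad_u: "grad (u k) x \<bullet> e = (LINT y|lborel. (D y \<bullet> e) * K k (x - y))" if e: "e = axis 1 1 \<or> e = axis 2 1" for k x e
  proof -
    obtain K1 K2 where K12: "K1 \<in> kernels (real (Suc k))" "K2 \<in> kernels (real (Suc k))" "\<And>x. (K k has_derivative (\<lambda>h. vector [K1 x, K2 x] \<bullet> h)) (at x)"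
      by (rule kernels_deriv[OF Kk[of k]]) (rule that; assumption)
    have cK: "continuous_on S (\<lambda>y. L (x - y))" if "L \<in> kernels (real (Suc k))" for L S
      by (rule continuous_on_compose2[OF kernels_continuous[OF that, of UNIV]]) (auto intro!: continuous_intros)
    define Ke where "Ke y = vector [K1 y, K2 y] \<bullet> e" for y
    have Ke: "Ke \<in> kernels (real (Suc k))" using e K12 by (auto simp: Ke_def[abs_def] inner_axis)
    have gu: "grad (u k) x \<bullet> e = mollify g (- a) a Ke x"
    proof -
      have "(u k has_derivative (\<lambda>h. vector [mollify g (- a) a K1 x, mollify g (- a) a K2 x] \<bullet> h)) (at x)"
        unfolding u_def by (rule mollify_deriv[OF cg Kk K12])
      then show ?thesis using e by (auto simp: grad_eqI Ke_def[abs_def] inner_axis)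
    qed
    define f' where "f' y = (D y \<bullet> e) * K k (x - y) + - Ke (x - y) * g y" for y
    have "(LINT y|lborel. f' y) = 0"
    proof (rule integral_directional_derivative_0[where f = "\<lambda>y. g y * K k (x - y)" and e = e and C = C])
      show "continuous_on UNIV (\<lambda>y. g y * K k (x - y))" by (intro continuous_intros cg cK Kk)
      show "continuous_on UNIV f'" unfolding f'_def[abs_def] by (intro continuous_intros cg cK Kk Ke cD)
      show "((\<lambda>s. g (y + s *\<^sub>R e) * K k (x - (y + s *\<^sub>R e))) has_real_derivative f' y) (at 0)" for y
      proof -
        have "((\<lambda>y. K k (x - y)) has_derivative (\<lambda>h. (- vector [K1 (x - y), K2 (x - y)]) \<bullet> h)) (at y)"
          by (rule has_derivative_eq_rhs[OF has_derivative_compose[OF _ K12(3), of "\<lambda>y. x - y" "\<lambda>h. - h"]])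
             (auto intro!: derivative_eq_intros)
        from DERIV_mult[OF has_derivative_direction[OF der] has_derivative_direction[OF this]]
        show ?thesis by (simp add: f'_def Ke_def)
      qed
    qed (use C g0 D0 in \<open>auto simp: f'_def\<close>)
    moreover have "integrable lborel (\<lambda>y. (D y \<bullet> e) * K k (x - y))"
      by (rule integrable_compact_support[OF C(1)]) (use D0 in \<open>auto intro!: continuous_intros cK Kk continuous_on_subset[OF cD]\<close>)
    moreover have "integrable lborel (\<lambda>y. g y * Ke (x - y))"
      by (rule integrable_compact_support[OF C(1)]) (use g0 in \<open>auto intro!: continuous_intros cK Ke cg\<close>)
    ultimately have "(LINT y|lborel. (D y \<bullet> e) * K k (x - y)) = (LINT y|lborel. g y * Ke (x - y))"
      unfolding f'_def by (simp add: mult.commute)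
    then show ?thesis using gu mollify_eq_lborel[OF cg a C(1) g0 Ke, of x] by simp
  qed
  have uz: "u k x = 0" if k: "2 / real (Suc k) \<le> r0 / 2" and x: "x \<notin> C1" for k x
  proof -
    have "g y * K k (x - y) = 0" for y
    proof (cases "y \<in> C")
      case True
      have "\<not> norm (x - y) \<le> r0 / 2"
      proof
        assume "norm (x - y) \<le> r0 / 2"
        then have "x = y + (x - y) \<and> y \<in> C \<and> x - y \<in> cball 0 (r0 / 2)" using True by simp
        then show False using x unfolding C1_def by blast
      qed
      then show ?thesis using kernels_zero[OF Kk, of k "x - y"] k by simp
    qed (use g0 in simp)
    then show ?thesis unfolding u_eq by (simp only: Bochner_Integration.integral_zero)
  qed
  have utest: "u k \<in> test_functions \<Omega>" and cl: "closure {x. u k x \<noteq> 0} \<subseteq> C1" if k: "2 / real (Suc k) \<le> r0 / 2" for k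
  proof -
    show cl: "closure {x. u k x \<noteq> 0} \<subseteq> C1"
      by (rule closure_minimal) (use uz[OF k] C1 compact_imp_closed in auto)
    moreover have "compact (closure {x. u k x \<noteq> 0})"
      using compact_Int_closed[OF C1 closed_closure, of "{x. u k x \<noteq> 0}"] unfolding inf.absorb2[OF cl] .
    moreover have "smooth_fun (u k)" unfolding u_def by (rule mollify_smooth[OF cg Kk])
    ultimately show "u k \<in> test_functions \<Omega>" using C1sub interior_subset by (auto simp: test_functions_def)
  qed
  have ugrad0: "u k x = 0 \<and> grad (u k) x = 0" if k: "2 / real (Suc k) \<le> r0 / 2" and "x \<notin> C1" for k x
    using test_functionD(4)[OF utest[OF k], of x] cl[OF k] that by blast
  have ev_large: "\<forall>\<^sub>F k in sequentially. real (Suc k) \<ge> N" for N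
  proof -
    have "filterlim (\<lambda>k. real (Suc k)) at_top sequentially"
      by (rule filterlim_compose[OF filterlim_real_sequentially filterlim_Suc])
    then show ?thesis by (simp add: filterlim_at_top)
  qed
  have ev0: "\<forall>\<^sub>F k in sequentially. 2 / real (Suc k) \<le> r0 / 2"
    using ev_large[of "4 / r0"] by eventually_elim (use r0 in \<open>simp add: field_simps\<close>)
  have conv: "\<forall>\<^sub>F k in sequentially. \<forall>x. \<bar>u k x - g x\<bar> \<le> e" if e: "e > 0" for e
  proof -
    obtain N where "N > 0" and N: "\<And>n K x. n \<ge> N \<Longrightarrow> mollifier n K \<Longrightarrow> \<bar>(LINT y|lborel. g y * K (x - y)) - g x\<bar> \<le> e"
      by (rule mollifier_approx[OF cg C(1) g0 e]) blast+
    show ?thesis using ev_large[of N] by eventually_elim (use N K in \<open>auto simp: u_eq\<close>)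
  qed
  have convD: "\<forall>\<^sub>F k in sequentially. \<forall>x. \<bar>grad (u k) x \<bullet> b - D x \<bullet> b\<bar> \<le> e" if e: "e > 0" and b: "b = axis 1 1 \<or> b = axis 2 1" for e b
  proof -
    obtain N where "N > 0" and N: "\<And>n K x. n \<ge> N \<Longrightarrow> mollifier n K \<Longrightarrow> \<bar>(LINT y|lborel. (D y \<bullet> b) * K (x - y)) - D x \<bullet> b\<bar> \<le> e"
    proof (rule mollifier_approx[OF cDi[of b] C(1) _ e])
      show "D x \<bullet> b = 0" if "x \<notin> C" for x using D0[OF that] by simp
    qed blast
    show ?thesis using ev_large[of N] by eventually_elim (use N K in \<open>auto simp: grad_u[OF b]\<close>)
  qed
  have lim: "(\<lambda>k. u k x) \<longlonglongrightarrow> g x" for x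
  proof (rule tendstoI)
    fix e :: real assume e: "e > 0"
    then have "\<forall>\<^sub>F k in sequentially. \<forall>x. \<bar>u k x - g x\<bar> \<le> e / 2" by (intro conv) simp
    then show "\<forall>\<^sub>F k in sequentially. dist (u k x) (g x) < e"
    proof eventually_elim
      case (elim k)
      then have "\<bar>u k x - g x\<bar> \<le> e / 2" by blast
      then show ?case using e by (simp add: dist_real_def)
    qed
  qed
  have limDb: "(\<lambda>k. grad (u k) x \<bullet> b) \<longlonglongrightarrow> D x \<bullet> b" if b: "b = axis 1 1 \<or> b = axis 2 1" for x b
  proof (rule tendstoI)
    fix e :: real assume e: "e > 0"
    then have "\<forall>\<^sub>F k in sequentially. \<forall>x. \<bar>grad (u k) x \<bullet> b - D x \<bullet> b\<bar> \<le> e / 2" by (intro convD b) simp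
    then show "\<forall>\<^sub>F k in sequentially. dist (grad (u k) x \<bullet> b) (D x \<bullet> b) < e"
    proof eventually_elim
      case (elim k)
      then have "\<bar>grad (u k) x \<bullet> b - D x \<bullet> b\<bar> \<le> e / 2" by blast
      then show ?case using e by (simp add: dist_real_def)
    qed
  qed
  have norm2: "(norm z)\<^sup>2 = (z \<bullet> axis 1 1)\<^sup>2 + (z \<bullet> axis 2 1)\<^sup>2" for z :: "real^2"
  proof -
    have "z \<bullet> z = z$1 * z$1 + z$2 * z$2" unfolding inner_vec_def sum_2 by simp
    moreover have "z \<bullet> axis 1 1 = z$1" "z \<bullet> axis 2 1 = z$2" by (simp_all add: inner_axis)
    ultimately show ?thesis unfolding power2_norm_eq_inner by (simp only: power2_eq_square)
  qed
  have limD: "(\<lambda>k. (norm (grad (u k) x))\<^sup>2) \<longlonglongrightarrow> (norm (D x))\<^sup>2" for x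
    unfolding norm2 by (intro tendsto_intros limDb) auto
  obtain Bg where Bg: "\<And>x. \<bar>g x\<bar> \<le> Bg" "Bg \<ge> 0"
  proof -
    have "bounded (g ` C)" by (intro compact_imp_bounded compact_continuous_image C cg)
    then obtain M where "\<And>x. x \<in> C \<Longrightarrow> \<bar>g x\<bar> \<le> M" unfolding bounded_iff by auto
    then have "\<bar>g x\<bar> \<le> max M 0" for x by (cases "x \<in> C") (auto simp: g0 le_max_iff_disj)
    then show ?thesis using that[of "max M 0"] by simp
  qed
  obtain Bd where Bd: "\<And>x. norm (D x) \<le> Bd" "Bd \<ge> 0"
  proof -
    have "bounded (D ` C)" by (intro compact_imp_bounded compact_continuous_image C continuous_on_subset[OF cD]) simp
    then obtain M where "\<And>x. x \<in> C \<Longrightarrow> norm (D x) \<le> M" unfolding bounded_iff by auto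
    then have "norm (D x) \<le> max M 0" for x by (cases "x \<in> C") (auto simp: D0 le_max_iff_disj)
    then show ?thesis using that[of "max M 0"] by simp
  qed
  have "\<forall>\<^sub>F k in sequentially. 2 / real (Suc k) \<le> r0 / 2 \<and> (\<forall>x. \<bar>u k x - g x\<bar> \<le> 1) \<and>
     (\<forall>x. \<bar>grad (u k) x \<bullet> axis 1 1 - D x \<bullet> axis 1 1\<bar> \<le> 1) \<and> (\<forall>x. \<bar>grad (u k) x \<bullet> axis 2 1 - D x \<bullet> axis 2 1\<bar> \<le> 1)"
    by (intro eventually_conj ev0 conv convD) auto
  then obtain k0 where k0: "\<And>k. k \<ge> k0 \<Longrightarrow> 2 / real (Suc k) \<le> r0 / 2" "\<And>k x. k \<ge> k0 \<Longrightarrow> \<bar>u k x - g x\<bar> \<le> 1"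
     "\<And>k x. k \<ge> k0 \<Longrightarrow> \<bar>grad (u k) x \<bullet> axis 1 1 - D x \<bullet> axis 1 1\<bar> \<le> 1" "\<And>k x. k \<ge> k0 \<Longrightarrow> \<bar>grad (u k) x \<bullet> axis 2 1 - D x \<bullet> axis 2 1\<bar> \<le> 1"
    unfolding eventually_sequentially by blast
  \<comment> \<open>Discarding the first k0 terms makes the uniform bounds hold for every
    index.\<close>
  define v where "v k = u (k + k0)" for k
  have vtest: "v k \<in> test_functions \<Omega>" and v0: "x \<notin> C1 \<Longrightarrow> v k x = 0 \<and> grad (v k) x = 0" for k x
    unfolding v_def using utest[OF k0(1)] ugrad0[OF k0(1)] by auto
  have vB: "(v k x)\<^sup>2 \<le> (Bg + 1)\<^sup>2" for k x
  proof -
    have "\<bar>v k x\<bar> \<le> Bg + 1" using k0(2)[of "k + k0" x] Bg(1)[of x] unfolding v_def by linarith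
    then show ?thesis by (simp add: abs_le_square_iff[symmetric] Bg)
  qed
  have vD: "(norm (grad (v k) x))\<^sup>2 \<le> 2 * (Bd + 1)\<^sup>2" for k x
  proof -
    have D12: "\<bar>D x \<bullet> axis 1 1\<bar> \<le> Bd" "\<bar>D x \<bullet> axis 2 1\<bar> \<le> Bd"
      using component_le_norm_cart[of "D x" 1] component_le_norm_cart[of "D x" 2] Bd(1)[of x] by (auto simp: inner_axis)
    have "\<bar>grad (v k) x \<bullet> axis 1 1\<bar> \<le> \<bar>Bd + 1\<bar>" "\<bar>grad (v k) x \<bullet> axis 2 1\<bar> \<le> \<bar>Bd + 1\<bar>"
      using k0(3,4)[of "k + k0" x] D12 unfolding v_def by linarith+
    then have "(grad (v k) x \<bullet> axis 1 1)\<^sup>2 \<le> (Bd + 1)\<^sup>2" "(grad (v k) x \<bullet> axis 2 1)\<^sup>2 \<le> (Bd + 1)\<^sup>2"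
      by (simp_all only: abs_le_square_iff)
    then show ?thesis unfolding norm2 by linarith
  qed
  have cont_v: "continuous_on UNIV (v k)" "continuous_on UNIV (grad (v k))" for k
    using smooth_fun_differentiable[OF test_functionD(1)[OF vtest]]
    by (auto intro!: continuous_at_imp_continuous_on differentiable_imp_continuous_within)
  have ineq: "c * (LINT x|lborel. (v k x)\<^sup>2 / (bdist \<Omega> x)\<^sup>2) \<le> (LINT x|lborel. (norm (grad (v k) x))\<^sup>2)" for k
  proof -
    have v\<Omega>: "x \<notin> \<Omega> \<Longrightarrow> v k x = 0 \<and> grad (v k) x = 0" for x using v0[of x k] C1sub interior_subset[of \<Omega>] by blast
    have "c * (LINT x:\<Omega>|lborel. (v k x)\<^sup>2 / (bdist \<Omega> x)\<^sup>2) \<le> (LINT x:\<Omega>|lborel. grad_sq (v k) x)"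
      using valid vtest[of k] unfolding hardy_valid_def by blast
    moreover have "(LINT x:\<Omega>|lborel. (v k x)\<^sup>2 / (bdist \<Omega> x)\<^sup>2) = (LINT x|lborel. (v k x)\<^sup>2 / (bdist \<Omega> x)\<^sup>2)"
      by (rule set_integral_support) (simp add: v\<Omega>)
    moreover have "(LINT x:\<Omega>|lborel. grad_sq (v k) x) = (LINT x|lborel. grad_sq (v k) x)"
      by (rule set_integral_support) (simp add: v\<Omega> grad_sq_eq)
    ultimately show ?thesis by (simp add: grad_sq_eq)
  qed
  have bpos: "bdist \<Omega> x > 0" if "x \<in> C1" for x
  proof -
    have "x \<notin> frontier \<Omega>" using that C1sub by (auto simp: frontier_def)
    then have "infdist x (frontier \<Omega>) \<noteq> 0" using in_closed_iff_infdist_zero[OF frontier_closed front] by blast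
    then show ?thesis using infdist_nonneg[of x "frontier \<Omega>"] by (simp add: bdist_def)
  qed
  obtain M where M: "\<And>x. x \<in> C1 \<Longrightarrow> 1 / (bdist \<Omega> x)\<^sup>2 \<le> M" "M \<ge> 0"
  proof -
    have "continuous_on C1 (\<lambda>x. 1 / (bdist \<Omega> x)\<^sup>2)"
      by (intro continuous_on_divide continuous_on_power continuous_on_const continuous_bdist) (use bpos in force)
    then have "bounded ((\<lambda>x. 1 / (bdist \<Omega> x)\<^sup>2) ` C1)" by (intro compact_imp_bounded compact_continuous_image C1)
    then obtain M where "\<And>x. x \<in> C1 \<Longrightarrow> \<bar>1 / (bdist \<Omega> x)\<^sup>2\<bar> \<le> M" unfolding bounded_iff by auto
    then have "\<And>x. x \<in> C1 \<Longrightarrow> 1 / (bdist \<Omega> x)\<^sup>2 \<le> max M 0" by (meson abs_le_D1 le_max_iff_disj)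
    then show ?thesis using that[of "max M 0"] by simp
  qed
  have iC1: "integrable lborel (\<lambda>x. B * indicator C1 x)" for B :: real
    by (rule integrable_compact_support[OF C1 continuous_on_eq[OF continuous_on_const[of C1 B]]]) auto
  have mb: "bdist \<Omega> \<in> borel_measurable borel" by (rule borel_measurable_continuous_onI[OF continuous_bdist])
  have L1: "(\<lambda>k. LINT x|lborel. (v k x)\<^sup>2 / (bdist \<Omega> x)\<^sup>2) \<longlonglongrightarrow> (LINT x|lborel. (g x)\<^sup>2 / (bdist \<Omega> x)\<^sup>2)"
  proof (rule integral_dominated_convergence[where w = "\<lambda>x. (Bg + 1)\<^sup>2 * M * indicator C1 x"])
    show "AE x in lborel. (\<lambda>k. (v k x)\<^sup>2 / (bdist \<Omega> x)\<^sup>2) \<longlonglongrightarrow> (g x)\<^sup>2 / (bdist \<Omega> x)\<^sup>2"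
    proof (rule AE_I2)
      fix x
      have "(\<lambda>k. v k x) \<longlonglongrightarrow> g x" unfolding v_def by (rule LIMSEQ_ignore_initial_segment[OF lim])
      then have "(\<lambda>k. (v k x)\<^sup>2 * inverse ((bdist \<Omega> x)\<^sup>2)) \<longlonglongrightarrow> (g x)\<^sup>2 * inverse ((bdist \<Omega> x)\<^sup>2)" by (intro tendsto_intros)
      then show "(\<lambda>k. (v k x)\<^sup>2 / (bdist \<Omega> x)\<^sup>2) \<longlonglongrightarrow> (g x)\<^sup>2 / (bdist \<Omega> x)\<^sup>2" by (simp add: divide_inverse)
    qed
    show "AE x in lborel. norm ((v k x)\<^sup>2 / (bdist \<Omega> x)\<^sup>2) \<le> (Bg + 1)\<^sup>2 * M * indicator C1 x" for k
    proof (rule AE_I2)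
      fix x
      show "norm ((v k x)\<^sup>2 / (bdist \<Omega> x)\<^sup>2) \<le> (Bg + 1)\<^sup>2 * M * indicator C1 x"
      proof (cases "x \<in> C1")
        case True
        have "(v k x)\<^sup>2 * (1 / (bdist \<Omega> x)\<^sup>2) \<le> (Bg + 1)\<^sup>2 * M" by (intro mult_mono vB M True) auto
        then show ?thesis using True by simp
      qed (use v0 in simp)
    qed
    show "(\<lambda>x. (v k x)\<^sup>2 / (bdist \<Omega> x)\<^sup>2) \<in> borel_measurable lborel" for k
      using mb borel_measurable_continuous_onI[OF cont_v(1)[of k]] by simp
    show "(\<lambda>x. (g x)\<^sup>2 / (bdist \<Omega> x)\<^sup>2) \<in> borel_measurable lborel"
      using mb borel_measurable_continuous_onI[OF cg] by simp
  qed (rule iC1)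
  have L2: "(\<lambda>k. LINT x|lborel. (norm (grad (v k) x))\<^sup>2) \<longlonglongrightarrow> (LINT x|lborel. (norm (D x))\<^sup>2)"
  proof (rule integral_dominated_convergence[where w = "\<lambda>x. (2 * (Bd + 1)\<^sup>2) * indicator C1 x"])
    show "AE x in lborel. (\<lambda>k. (norm (grad (v k) x))\<^sup>2) \<longlonglongrightarrow> (norm (D x))\<^sup>2"
      unfolding v_def by (intro AE_I2 LIMSEQ_ignore_initial_segment[OF limD])
    show "AE x in lborel. norm ((norm (grad (v k) x))\<^sup>2) \<le> (2 * (Bd + 1)\<^sup>2) * indicator C1 x" for k
    proof (rule AE_I2)
      fix x
      show "norm ((norm (grad (v k) x))\<^sup>2) \<le> (2 * (Bd + 1)\<^sup>2) * indicator C1 x"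
        using vD[of k x] v0[of x k] by (cases "x \<in> C1") auto
    qed
    show "(\<lambda>x. (norm (grad (v k) x))\<^sup>2) \<in> borel_measurable lborel" for k
      using borel_measurable_continuous_onI[OF cont_v(2)[of k]] by simp
    show "(\<lambda>x. (norm (D x))\<^sup>2) \<in> borel_measurable lborel"
      using borel_measurable_continuous_onI[OF cD] by simp
  qed (rule iC1)
  show ?thesis
    by (rule LIMSEQ_le[OF tendsto_mult_left[OF L1] L2]) (use ineq in blast)
qed

section \<open>From the truncated sector to dimension one\<close>

lemma lborel_integral_pos:
  fixes f :: "'a::euclidean_space \<Rightarrow> real"
  assumes f: "continuous_on UNIV f" "\<And>x. f x \<ge> 0" "\<And>x. x \<notin> cbox a b \<Longrightarrow> f x = 0" and x: "x \<in> box a b" "f x > 0"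
  shows "(LINT x|lborel. f x) > 0"
proof -
  have cS: "continuous_on S f" for S using f(1) continuous_on_subset by blast
  have i: "integrable lborel f" by (rule integrable_compact_support[OF compact_cbox cS f(3)])
  have "(LINT x|lborel. f x) \<noteq> 0"
  proof
    assume z: "(LINT x|lborel. f x) = 0"
    have "(f has_integral 0) UNIV" using has_integral_integral_lborel[OF i] z by simp
    moreover have "f = (\<lambda>x. if x \<in> cbox a b then f x else 0)" using f(3) by auto
    ultimately have "((\<lambda>x. if x \<in> cbox a b then f x else 0) has_integral 0) UNIV" by simp
    then have "(f has_integral 0) (cbox a b)" by (simp only: has_integral_restrict_UNIV)
    then have "f x = 0" using has_integral_0_cbox_imp_0[of a b f x] cS f(2) x box_subset_cbox by blast
    then show False using x(2) by simp
  qed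
  moreover have "(LINT x|lborel. f x) \<ge> 0" using f(2) by (intro integral_nonneg_AE) auto
  ultimately show ?thesis by simp
qed

lemma lborel_integral_product:
  fixes f h :: "real \<Rightarrow> real"
  assumes f: "continuous_on UNIV f" "\<And>x. x \<notin> {a..b} \<Longrightarrow> f x = 0" and h: "continuous_on {a'..b'} h" "\<And>x. x \<notin> {a'..b'} \<Longrightarrow> h x = 0"
  shows "integrable lborel (\<lambda>p. f (fst p) * h (snd p))"
    and "(LINT p|lborel. f (fst p) * h (snd p)) = (LINT t|lborel. f t) * (LINT t|lborel. h t)"
proof -
  show i: "integrable lborel (\<lambda>p. f (fst p) * h (snd p))"
  proof (rule integrable_compact_support[of "{a..b} \<times> {a'..b'}"])
    show "continuous_on ({a..b} \<times> {a'..b'}) (\<lambda>p. f (fst p) * h (snd p))"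
      by (intro continuous_on_mult continuous_on_compose2[OF f(1)] continuous_on_compose2[OF h(1)] continuous_intros) auto
    show "f (fst p) * h (snd p) = 0" if "p \<notin> {a..b} \<times> {a'..b'}" for p
      using that f(2)[of "fst p"] h(2)[of "snd p"] by (cases p) auto
  qed (intro compact_Times compact_Icc)
  have "(LINT p|lborel. f (fst p) * h (snd p)) = (LINT p|(lborel \<Otimes>\<^sub>M lborel). f (fst p) * h (snd p))"
    by (simp add: lborel_prod)
  also have "\<dots> = (LINT t|lborel. LINT s|lborel. f t * h s)"
    using lborel_pair.integral_fst'[of "\<lambda>p. f (fst p) * h (snd p)"] i by (simp add: lborel_prod)
  also have "\<dots> = (LINT t|lborel. f t) * (LINT t|lborel. h t)" by simp
  finally show "(LINT p|lborel. f (fst p) * h (snd p)) = (LINT t|lborel. f t) * (LINT t|lborel. h t)" .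
qed

section \<open>The log-polar chart and its inverse\<close>

definition dirp :: "real \<Rightarrow> real^2" where "dirp a = dir (a + pi/2)"

lemma dir_frame:
  "dir a \<bullet> dir a = 1" "dirp a \<bullet> dirp a = 1" "dir a \<bullet> dirp a = 0" "dirp a \<bullet> dir a = 0"
  by (simp_all add: dirp_def inner_dir)

lemma dir_expand: "x = (x \<bullet> dir a) *\<^sub>R dir a + (x \<bullet> dirp a) *\<^sub>R dirp a"
proof -
  have cs: "cos a * (cos a * y) + sin a * (sin a * y) = y" for y
  proof -
    have "cos a * (cos a * y) + sin a * (sin a * y) = (cos a * cos a + sin a * sin a) * y" by (simp only: distrib_right mult.assoc)
    then show ?thesis by simp
  qed
  show ?thesis using cs[of "x$1"] cs[of "x$2"]
    unfolding dirp_def dir_quarter unfolding dir_def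
    by (simp add: vec_eq_iff forall_2 inner_commute[of x] vector2_inner algebra_simps)
qed

definition chart :: "real^2 \<Rightarrow> real \<Rightarrow> real^2 \<Rightarrow> real^2" where
  "chart v \<phi> p = logpolar v \<phi> (p$1) (p$2)"

definition strip :: "real \<Rightarrow> (real^2) set" where
  "strip \<beta> = {p. 0 < p$2 \<and> p$2 < \<beta>}"

lemma chart_image: "chart v \<phi> ` strip \<beta> = sector v \<phi> \<beta>"
proof -
  have "strip \<beta> = (\<lambda>p. vector [fst p, snd p]) ` (UNIV \<times> {0<..<\<beta>})"
    by (force simp: strip_def image_iff vec_eq_iff forall_2 vector2_eta intro!: exI)
  then show ?thesis by (simp add: sector_eq_logpolar image_image chart_def)
qed

lemma open_strip: "open (strip \<beta>)"
  unfolding strip_def by (intro open_Collect_conj open_Collect_less continuous_intros)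

lemma chart_inj: "\<beta> \<le> 2 * pi \<Longrightarrow> inj_on (chart v \<phi>) (strip \<beta>)"
proof (rule inj_onI)
  fix x y assume "\<beta> \<le> 2 * pi" "x \<in> strip \<beta>" "y \<in> strip \<beta>" "chart v \<phi> x = chart v \<phi> y"
  then show "x = y"
    using logpolar_inj[of v \<phi> "x$1" "x$2" "y$1" "y$2"] by (auto simp: strip_def chart_def vec_eq_iff forall_2)
qed

lemma chart_deriv:
  "(chart v \<phi> has_derivative (\<lambda>h. exp (p$1) *\<^sub>R (h$1 *\<^sub>R dir (\<phi> + p$2) + h$2 *\<^sub>R dirp (\<phi> + p$2)))) (at p)"
  unfolding chart_def[abs_def] dirp_def
  by (rule has_derivative_logpolar) (auto intro!: derivative_eq_intros bounded_linear.has_derivative[OF bounded_linear_vec_nth])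

text \<open>Trial functions are built on the strip and carried to the sector by the inverse chart.
  Its derivative is \<open>exp (- t)\<close> times the coordinates in an orthonormal frame, which
  gives the unweighted identity for the squared gradients.\<close>

lemma push_forward_C1:
  fixes h h1 h2 :: "real^2 \<Rightarrow> real"
  assumes \<beta>: "\<beta> \<le> 2 * pi" and C: "compact C" "C \<subseteq> strip \<beta>"
    and dh: "\<And>p. (h has_derivative (\<lambda>k. vector [h1 p, h2 p] \<bullet> k)) (at p)"
    and ch: "continuous_on UNIV h1" "continuous_on UNIV h2"
    and h0: "\<And>p. p \<notin> C \<Longrightarrow> h p = 0 \<and> h1 p = 0 \<and> h2 p = 0"
  obtains g D where "\<And>x. (g has_derivative (\<lambda>k. D x \<bullet> k)) (at x)" "continuous_on UNIV D"
    "\<And>x. x \<notin> chart v \<phi> ` C \<Longrightarrow> g x = 0 \<and> D x = 0"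
    "\<And>p. p \<in> strip \<beta> \<Longrightarrow> g (chart v \<phi> p) = h p \<and> exp (2 * p$1) * (norm (D (chart v \<phi> p)))\<^sup>2 = (h1 p)\<^sup>2 + (h2 p)\<^sup>2"
proof -
  let ?G = "chart v \<phi>"
  define inv where "inv = the_inv_into (strip \<beta>) ?G"
  have invG: "inv (?G p) = p" if "p \<in> strip \<beta>" for p
    unfolding inv_def by (rule the_inv_into_f_f[OF chart_inj[OF \<beta>] that])
  define Dp where "Dp p = exp (- p$1) *\<^sub>R (h1 p *\<^sub>R dir (\<phi> + p$2) + h2 p *\<^sub>R dirp (\<phi> + p$2))" for p
  define g where "g x = (if x \<in> ?G ` C then h (inv x) else 0)" for x
  define D where "D x = (if x \<in> ?G ` C then Dp (inv x) else 0)" for x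
  have cG: "continuous_on S ?G" for S using chart_deriv by (intro continuous_at_imp_continuous_on ballI has_derivative_continuous)
  have oS: "open (?G ` strip \<beta>)" by (rule invariance_of_domain[OF cG open_strip chart_inj[OF \<beta>]])
  have mem: "?G p \<in> ?G ` C \<longleftrightarrow> p \<in> C" if "p \<in> strip \<beta>" for p
    using that C(2) chart_inj[OF \<beta>, of v \<phi>] by (auto dest: inj_onD)
  have gG: "g (?G p) = h p" "D (?G p) = Dp p" if "p \<in> strip \<beta>" for p
    using that h0[of p] by (auto simp: g_def D_def mem invG Dp_def)
  \<comment> \<open>The frame is orthonormal, so the derivative of the chart is inverted by taking
    inner products with it and rescaling.\<close>
  have dinv: "(inv has_derivative (\<lambda>k. exp (- p$1) *\<^sub>R vector [k \<bullet> dir (\<phi> + p$2), k \<bullet> dirp (\<phi> + p$2)])) (at (?G p))" if p: "p \<in> strip \<beta>" for p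
  proof (rule has_derivative_inverse_strong[OF open_strip p cG invG chart_deriv])
    show "(\<lambda>h. exp (p$1) *\<^sub>R (h$1 *\<^sub>R dir (\<phi> + p$2) + h$2 *\<^sub>R dirp (\<phi> + p$2))) \<circ>
       (\<lambda>k. exp (- p$1) *\<^sub>R (vector [k \<bullet> dir (\<phi> + p$2), k \<bullet> dirp (\<phi> + p$2)] :: real^2)) = id"
    proof
      fix k
      have "exp (p$1) * exp (- p$1) = 1" by (simp add: exp_minus)
      then show "((\<lambda>h. exp (p$1) *\<^sub>R (h$1 *\<^sub>R dir (\<phi> + p$2) + h$2 *\<^sub>R dirp (\<phi> + p$2))) \<circ>
       (\<lambda>k. exp (- p$1) *\<^sub>R (vector [k \<bullet> dir (\<phi> + p$2), k \<bullet> dirp (\<phi> + p$2)] :: real^2))) k = id k"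
        using dir_expand[of k "\<phi> + p$2"] by (simp add: scaleR_add_right mult.assoc[symmetric])
    qed
  qed auto
  have cinv: "continuous_on (?G ` strip \<beta>) inv"
    using dinv by (intro continuous_at_imp_continuous_on ballI) (auto dest: has_derivative_continuous)
  have cC: "compact (?G ` C)" by (intro compact_continuous_image cG C)
  have der: "(g has_derivative (\<lambda>k. D x \<bullet> k)) (at x)" for x
  proof (cases "x \<in> ?G ` strip \<beta>")
    case True
    then obtain p where p: "p \<in> strip \<beta>" "x = ?G p" by auto
    have "((\<lambda>x. h (inv x)) has_derivative (\<lambda>k. vector [h1 p, h2 p] \<bullet> (exp (- p$1) *\<^sub>R (vector [k \<bullet> dir (\<phi> + p$2), k \<bullet> dirp (\<phi> + p$2)] :: real^2)))) (at x)"
      unfolding p(2) by (rule has_derivative_compose[OF dinv[OF p(1)]]) (simp add: invG[OF p(1)] dh)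
    moreover have "(\<lambda>k. vector [h1 p, h2 p] \<bullet> (exp (- p$1) *\<^sub>R (vector [k \<bullet> dir (\<phi> + p$2), k \<bullet> dirp (\<phi> + p$2)] :: real^2))) = (\<lambda>k. D x \<bullet> k)"
      unfolding p(2) gG(2)[OF p(1)] Dp_def
      by (rule ext) (simp add: vector2_inner inner_add_left inner_commute algebra_simps)
    ultimately have "((\<lambda>x. h (inv x)) has_derivative (\<lambda>k. D x \<bullet> k)) (at x)" by simp
    then show ?thesis
      by (rule has_derivative_transform_within_open[OF _ oS True]) (auto simp: gG invG)
  next
    case False
    then have x: "x \<in> - (?G ` C)" using C(2) by auto
    have "((\<lambda>_. 0) has_derivative (\<lambda>k. D x \<bullet> k)) (at x)" using x by (simp add: D_def)
    then show ?thesis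
      by (rule has_derivative_transform_within_open[OF _ _ x]) (use cC in \<open>auto simp: g_def compact_imp_closed open_Compl\<close>)
  qed
  have cD: "continuous_on UNIV D"
  proof (rule continuous_zero_extend[OF cC oS])
    show "?G ` C \<subseteq> ?G ` strip \<beta>" using C(2) by auto
    have cDp: "continuous_on UNIV Dp" unfolding Dp_def[abs_def] dirp_def by (intro continuous_intros ch)
    have "continuous_on (?G ` strip \<beta>) (\<lambda>x. Dp (inv x))" by (rule continuous_on_compose2[OF cDp cinv]) simp
    then show "continuous_on (?G ` strip \<beta>) D" by (rule continuous_on_eq) (auto simp: gG invG)
  qed (simp add: D_def)
  have nD: "exp (2 * p$1) * (norm (D (?G p)))\<^sup>2 = (h1 p)\<^sup>2 + (h2 p)\<^sup>2" if "p \<in> strip \<beta>" for p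
  proof -
    have "(norm (D (?G p)))\<^sup>2 = (exp (- p$1))\<^sup>2 * ((h1 p)\<^sup>2 + (h2 p)\<^sup>2)"
      unfolding gG(2)[OF that] Dp_def power2_norm_eq_inner
      by (simp add: inner_add_left inner_add_right dir_frame power2_eq_square algebra_simps)
    moreover have "exp (2 * p$1) * (exp (- p$1))\<^sup>2 = 1" by (simp add: exp_double[symmetric] exp_minus power_inverse)
    ultimately show ?thesis by (simp add: mult.assoc[symmetric])
  qed
  show ?thesis
    by (rule that[of g D]) (use der cD gG nD in \<open>auto simp: g_def D_def\<close>)
qed

text \<open>Both edges, including the vertex at r = 0, are limits of points of the sector without
  belonging to it. For \<beta> = 2 pi the two edges are the same ray.\<close>

lemma sector_rays:
  assumes \<beta>: "0 < \<beta>" "\<beta> \<le> 2 * pi" and r: "0 \<le> r" and e: "e = 0 \<or> e = \<beta>"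
  shows "v + r *\<^sub>R dir (\<phi> + e) \<in> closure (sector v \<phi> \<beta>)" "v + r *\<^sub>R dir (\<phi> + e) \<notin> sector v \<phi> \<beta>"
proof -
  have sec: "v + s *\<^sub>R dir (\<phi> + \<theta>) \<in> sector v \<phi> \<beta>" if "s > 0" "0 < \<theta>" "\<theta> < \<beta>" for s \<theta>
    unfolding sector_eq_logpolar using that by (intro image_eqI[of _ _ "(ln s, \<theta>)"]) (auto simp: logpolar_def)
  define s where "s = (if e = 0 then 1 else - 1 :: real)"
  \<comment> \<open>The angle moves into the sector, with the sign given by \<open>s\<close>, while
    the radius grows at the same time; so the vertex, too, is approached through points of positive
    radius.\<close>
  have lim: "((\<lambda>d. v + (r + d) *\<^sub>R dir (\<phi> + (e + s * d))) \<longlongrightarrow> v + (r + 0) *\<^sub>R dir (\<phi> + (e + s * 0))) (at_right 0)"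
    unfolding dir_def vector2_eq_sum by (intro tendsto_intros)
  show "v + r *\<^sub>R dir (\<phi> + e) \<in> closure (sector v \<phi> \<beta>)"
  proof (rule Lim_in_closed_set[OF closed_closure _ _ lim[simplified]])
    have "v + (r + d) *\<^sub>R dir (\<phi> + (e + s * d)) \<in> sector v \<phi> \<beta>" if "0 < d" "d < \<beta>" for d
      using e r that by (intro sec) (auto simp: s_def)
    then show "\<forall>\<^sub>F d in at_right 0. v + (r + d) *\<^sub>R dir (\<phi> + (e + s * d)) \<in> closure (sector v \<phi> \<beta>)"
      unfolding eventually_at_right_field using \<beta> closure_subset by (intro exI[of _ \<beta>]) blast
  qed simp
  show "v + r *\<^sub>R dir (\<phi> + e) \<notin> sector v \<phi> \<beta>"
  proof
    assume "v + r *\<^sub>R dir (\<phi> + e) \<in> sector v \<phi> \<beta>"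
    then obtain t \<theta> where t: "v + r *\<^sub>R dir (\<phi> + e) = logpolar v \<phi> t \<theta>" "0 < \<theta>" "\<theta> < \<beta>" unfolding sector_eq_logpolar by auto
    then have "norm (r *\<^sub>R dir (\<phi> + e)) = norm (exp t *\<^sub>R dir (\<phi> + \<theta>))" by (simp add: logpolar_def)
    then have "r = exp t" using r by simp
    then have "logpolar v \<phi> t e = logpolar v \<phi> t \<theta>" using t by (simp add: logpolar_def)
    then show False using logpolar_inj[of v \<phi> t e t \<theta>] t e \<beta> by auto
  qed
qed

text \<open>Near v the edges belong to the frontier of the truncated sector. The perpendicular foot
  on an edge, or the vertex if there is none, is no farther from v than the point itself, hence
  inside the ball. An upper bound on the distance is the useful direction: it bounds the potential
  from below.\<close>

lemma bdist_near_vertex: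
  assumes \<beta>: "pi < \<beta>" "\<beta> \<le> 2 * pi" and \<rho>: "ball v \<rho> \<subseteq> K" and t: "exp t < \<rho>" and \<theta>: "0 < \<theta>" "\<theta> < \<beta>"
  shows "bdist (K \<inter> sector v \<phi> \<beta>) (logpolar v \<phi> t \<theta>) \<le> exp t * sector_gap \<beta> \<theta>"
proof -
  let ?\<Omega> = "K \<inter> sector v \<phi> \<beta>"
  have ray: "v + r *\<^sub>R dir (\<phi> + e) \<in> frontier ?\<Omega>" if "0 \<le> r" "r < \<rho>" "e = 0 \<or> e = \<beta>" for r e
  proof -
    have b0: "0 < \<beta>" using \<beta> pi_gt_zero by linarith
    note sr = sector_rays[OF b0 \<beta>(2) that(1,3), of v \<phi>]
    have "v + r *\<^sub>R dir (\<phi> + e) \<in> ball v \<rho> \<inter> closure (sector v \<phi> \<beta>)" using sr that by (simp add: dist_norm)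
    then have "v + r *\<^sub>R dir (\<phi> + e) \<in> closure (ball v \<rho> \<inter> sector v \<phi> \<beta>)" using open_Int_closure_subset[OF open_ball] by blast
    moreover have "closure (ball v \<rho> \<inter> sector v \<phi> \<beta>) \<subseteq> closure ?\<Omega>" using \<rho> by (intro closure_mono) auto
    moreover have "v + r *\<^sub>R dir (\<phi> + e) \<notin> interior ?\<Omega>" using sr interior_subset by blast
    ultimately show ?thesis by (auto simp: frontier_def)
  qed
  have dd: "bdist ?\<Omega> (logpolar v \<phi> t \<theta>) \<le> d" if "y \<in> frontier ?\<Omega>" "dist (logpolar v \<phi> t \<theta>) y \<le> d" for y d
    using infdist_le[OF that(1), of "logpolar v \<phi> t \<theta>"] that(2) by (simp add: bdist_def)
  have foot: "dist (logpolar v \<phi> t \<theta>) (v + (exp t * cos (\<theta> - e)) *\<^sub>R dir (\<phi> + e)) = exp t * \<bar>sin (\<theta> - e)\<bar>" for e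
  proof -
    have "(norm (dir (\<phi> + \<theta>) - cos (\<theta> - e) *\<^sub>R dir (\<phi> + e)))\<^sup>2 = 1 - (cos (\<theta> - e))\<^sup>2"
      unfolding power2_norm_eq_inner
      by (simp add: inner_diff_left inner_diff_right inner_dir power2_eq_square inner_commute[of "dir (\<phi> + e)"] cos_diff mult.commute)
    also have "\<dots> = (sin (\<theta> - e))\<^sup>2" by (simp add: sin_squared_eq)
    finally have "norm (dir (\<phi> + \<theta>) - cos (\<theta> - e) *\<^sub>R dir (\<phi> + e)) = \<bar>sin (\<theta> - e)\<bar>"
      using abs_norm_cancel power2_eq_iff_nonneg by (smt (verit) norm_ge_zero power2_abs power2_eq_iff)
    moreover have "logpolar v \<phi> t \<theta> - (v + (exp t * cos (\<theta> - e)) *\<^sub>R dir (\<phi> + e)) = exp t *\<^sub>R (dir (\<phi> + \<theta>) - cos (\<theta> - e) *\<^sub>R dir (\<phi> + e))"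
      by (simp add: logpolar_def scaleR_diff_right)
    ultimately show ?thesis by (simp add: dist_norm)
  qed
  have cosle: "exp t * cos (\<theta> - e) < \<rho>" for e
  proof -
    have "exp t * cos (\<theta> - e) \<le> exp t * 1" by (intro mult_left_mono cos_le_one) simp
    then show ?thesis using t by linarith
  qed
  consider "\<theta> \<le> pi/2" | "pi/2 < \<theta>" "\<theta> \<le> \<beta> - pi/2" | "\<beta> - pi/2 < \<theta>" "pi/2 < \<theta>" by linarith
  then show ?thesis
  proof cases
    case 1
    have c: "0 \<le> cos (\<theta> - 0)" "0 \<le> sin \<theta>" using 1 \<theta> pi_gt_zero by (auto intro!: cos_ge_zero sin_ge_zero)
    have "bdist ?\<Omega> (logpolar v \<phi> t \<theta>) \<le> exp t * \<bar>sin (\<theta> - 0)\<bar>"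
      by (rule dd[OF ray[where e = 0, OF _ cosle[of 0]]]) (use c foot[of 0] in auto)
    then show ?thesis using 1 c by (simp add: sector_gap_def)
  next
    case 2
    have "bdist ?\<Omega> (logpolar v \<phi> t \<theta>) \<le> exp t"
      by (rule dd[OF ray[of 0 0]]) (use t in \<open>auto simp: logpolar_def dist_norm intro: less_trans[OF exp_gt_zero]\<close>)
    then show ?thesis using 2 by (simp add: sector_gap_def)
  next
    case 3
    have c: "0 \<le> cos (\<theta> - \<beta>)" using 3 \<theta> by (intro cos_ge_zero) auto
    have s: "0 \<le> sin (\<beta> - \<theta>)" using 3 \<theta> pi_gt_zero by (intro sin_ge_zero) linarith+
    have "sin (\<theta> - \<beta>) = - sin (\<beta> - \<theta>)" by (metis minus_diff_eq sin_minus)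
    then have "\<bar>sin (\<theta> - \<beta>)\<bar> = sin (\<beta> - \<theta>)" using s by simp
    moreover have "bdist ?\<Omega> (logpolar v \<phi> t \<theta>) \<le> exp t * \<bar>sin (\<theta> - \<beta>)\<bar>"
      by (rule dd[OF ray[where e = \<beta>, OF _ cosle[of \<beta>]]]) (use c foot[of \<beta>] in auto)
    ultimately show ?thesis using 3 by (simp add: sector_gap_def)
  qed
qed

text \<open>Guards against the default value of \<open>infdist\<close> for an empty set, which would
  make the boundary distance 0 everywhere.\<close>

lemma frontier_truncated_sector:
  assumes \<beta>: "pi < \<beta>" "\<beta> \<le> 2 * pi" and v: "v \<in> interior K"
  shows "frontier (K \<inter> sector v \<phi> \<beta>) \<noteq> {}"
proof
  obtain \<rho> where \<rho>: "0 < \<rho>" "ball v \<rho> \<subseteq> K" using v mem_interior by blast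
  have b0: "0 < \<beta>" using \<beta> pi_gt_zero by linarith
  let ?\<Omega> = "K \<inter> sector v \<phi> \<beta>"
  assume "frontier ?\<Omega> = {}"
  then have "?\<Omega> = {} \<or> ?\<Omega> = UNIV" by (simp add: frontier_eq_empty)
  moreover have "v \<notin> ?\<Omega>" using sector_rays(2)[OF b0 \<beta>(2), of 0 0 v \<phi>] by simp
  moreover have "logpolar v \<phi> (ln (\<rho>/2)) (\<beta>/2) \<in> ?\<Omega>"
  proof
    show "logpolar v \<phi> (ln (\<rho>/2)) (\<beta>/2) \<in> K" using \<rho> by (intro subsetD[OF \<rho>(2)]) (simp add: logpolar_def dist_norm)
    show "logpolar v \<phi> (ln (\<rho>/2)) (\<beta>/2) \<in> sector v \<phi> \<beta>" unfolding sector_eq_logpolar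
      by (rule image_eqI[of _ _ "(ln (\<rho>/2), \<beta>/2)"]) (use b0 in auto)
  qed
  ultimately show False by blast
qed

text \<open>The radial factor is stretched by 1/\<epsilon>. Relative to the angular part, its
  derivative contributes only order \<epsilon>^2, so the one-dimensional inequality is what remains
  as \<epsilon> tends to 0.\<close>

lemma hardy_valid_imp_one_dim:
  assumes \<beta>: "pi < \<beta>" "\<beta> \<le> 2 * pi" and v: "v \<in> interior K" and c: "c \<ge> 0"
    and valid: "hardy_valid (K \<inter> sector v \<phi> \<beta>) c"
  shows "one_dim_hardy \<beta> c"
  unfolding one_dim_hardy_def
proof (intro allI impI, elim conjE)
  fix A A' a b
  assume ab: "0 < a" "b < \<beta>" and dA: "\<forall>\<theta>. (A has_real_derivative A' \<theta>) (at \<theta>)" and cA': "continuous_on UNIV A'"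
    and A0: "\<forall>\<theta>. \<theta> \<notin> {a..b} \<longrightarrow> A \<theta> = 0"
  let ?\<Omega> = "K \<inter> sector v \<phi> \<beta>"
  obtain \<rho> where \<rho>: "0 < \<rho>" "ball v \<rho> \<subseteq> K" using v mem_interior by blast
  note front = frontier_truncated_sector[OF \<beta> v, of \<phi>]
  have A'0: "A' \<theta> = 0" if "\<theta> \<notin> {a..b}" for \<theta>
    using derivative_zero_outside[of A A' a b \<theta>] dA A0 that by blast
  have cA: "continuous_on S A" for S using dA by (intro continuous_at_imp_continuous_on ballI DERIV_isCont) auto
  have cA'S: "continuous_on S A'" for S using cA' continuous_on_subset by blast
  define X where "X t = flat 1 (1 + t) * flat 1 (1 - t)" for t
  have Xb: "X \<in> bumps" unfolding X_def[abs_def] by (rule bumps.base)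
  obtain X' where X': "X' \<in> bumps" "\<And>t. (X has_real_derivative X' t) (at t)" using bumps_deriv[OF Xb] by blast
  have bump_cont: "continuous_on S f" if "f \<in> bumps" for f S
    using bumps_deriv[OF that] by (auto intro!: continuous_at_imp_continuous_on DERIV_isCont)
  have X0: "X t = 0" "X' t = 0" if "t \<notin> {-1..1}" for t
    using bumps_zero[OF Xb, of t] bumps_zero[OF X'(1), of t] that by auto
  have gap: "0 < sector_gap \<beta> \<theta>" if "\<theta> \<in> {a..b}" for \<theta> using that ab by (intro sector_gap_pos[OF \<beta>]) auto
  define x0 x1 where "x0 = (LINT t|lborel. (X t)\<^sup>2)" and "x1 = (LINT t|lborel. (X' t)\<^sup>2)"
  define i0 i1 ig where "i0 = (LINT t|lborel. (A t)\<^sup>2)" and "i1 = (LINT t|lborel. (A' t)\<^sup>2)" and "ig = (LINT t|lborel. (A t)\<^sup>2 / (sector_gap \<beta> t)\<^sup>2)"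
  have x0: "x0 > 0" unfolding x0_def
  proof (rule lborel_integral_pos[of _ "-1" 1 0])
    show "continuous_on UNIV (\<lambda>t. (X t)\<^sup>2)" by (intro continuous_on_power bump_cont Xb)
    show "0 < (X 0)\<^sup>2" by (simp add: X_def flat_def)
  qed (use X0 in \<open>auto simp: cbox_interval\<close>)
  have main: "c * (x0 * ig) \<le> \<epsilon>\<^sup>2 * (x1 * i0) + x0 * i1" if \<epsilon>: "\<epsilon> > 0" for \<epsilon>
  proof -
    \<comment> \<open>With this shift the support of \<open>Y\<close> ends at t = ln \<rho> - 1, so
      the trial function lives in the ball around v that K contains.\<close>
    define \<tau> where "\<tau> = 1 - \<epsilon> * (ln \<rho> - 1)"
    define Y where "Y t = X (\<tau> + \<epsilon> * t)" for t
    define Y' where "Y' t = \<epsilon> * X' (\<tau> + \<epsilon> * t)" for t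
    define t0 t1 where "t0 = (- 1 - \<tau>) / \<epsilon>" and "t1 = (1 - \<tau>) / \<epsilon>"
    have t1: "exp t1 < \<rho>"
    proof -
      have "t1 = ln \<rho> - 1" using \<epsilon> by (simp add: t1_def \<tau>_def)
      then have "exp t1 < exp (ln \<rho>)" by simp
      then show ?thesis using \<rho> by simp
    qed
    have Y0: "Y t = 0" "Y' t = 0" if "t \<notin> {t0..t1}" for t
    proof -
      have "\<tau> + \<epsilon> * t \<notin> {-1..1}" using that \<epsilon> by (auto simp: t0_def t1_def field_simps)
      then show "Y t = 0" "Y' t = 0" by (simp_all add: Y_def Y'_def X0)
    qed
    have cY: "continuous_on S Y" "continuous_on S Y'" for S
      unfolding Y_def[abs_def] Y'_def[abs_def]
      by (intro continuous_on_mult continuous_on_const continuous_on_compose2[OF bump_cont[OF Xb, of UNIV]]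
          continuous_on_compose2[OF bump_cont[OF X'(1), of UNIV]] continuous_intros; simp)+
    have dY: "(Y has_real_derivative Y' t) (at t)" for t
    proof -
      have "((\<lambda>t. \<tau> + \<epsilon> * t) has_real_derivative \<epsilon>) (at t)" by (auto intro!: derivative_eq_intros)
      from DERIV_chain2[OF X'(2) this] show ?thesis by (simp add: Y_def[abs_def] Y'_def mult.commute)
    qed
    have scale: "(LINT t|lborel. f (\<tau> + \<epsilon> * t)) = (1 / \<epsilon>) * (LINT t|lborel. f t)" for f :: "real \<Rightarrow> real"
      using lborel_integral_real_affine[of \<epsilon> f \<tau>] \<epsilon> by simp
    have y0: "(LINT t|lborel. (Y t)\<^sup>2) = x0 / \<epsilon>" unfolding Y_def x0_def using scale[of "\<lambda>t. (X t)\<^sup>2"] by simp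
    have y1: "(LINT t|lborel. (Y' t)\<^sup>2) = \<epsilon> * x1"
      unfolding Y'_def x1_def power_mult_distrib using scale[of "\<lambda>t. (X' t)\<^sup>2"] \<epsilon> by (simp add: power2_eq_square)
    define h where "h p = Y (p$1) * A (p$2)" for p :: "real^2"
    define h1 where "h1 p = Y' (p$1) * A (p$2)" for p :: "real^2"
    define h2 where "h2 p = Y (p$1) * A' (p$2)" for p :: "real^2"
    define C where "C = cbox (vector [t0, a]) (vector [t1, b] :: real^2)"
    have C: "p \<in> C \<longleftrightarrow> p$1 \<in> {t0..t1} \<and> p$2 \<in> {a..b}" for p by (auto simp: C_def mem_box_cart forall_2)
    have Cs: "C \<subseteq> strip \<beta>" using ab by (auto simp: C strip_def)
    have dh: "(h has_derivative (\<lambda>k. vector [h1 p, h2 p] \<bullet> k)) (at p)" for p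
    proof -
      have 1: "((\<lambda>p::real^2. Y (p$1)) has_derivative (\<lambda>k. Y' (p$1) * k$1)) (at p)"
        by (rule has_derivative_compose[OF _ dY[unfolded has_field_derivative_def]])
           (rule bounded_linear.has_derivative[OF bounded_linear_vec_nth has_derivative_ident])
      have 2: "((\<lambda>p::real^2. A (p$2)) has_derivative (\<lambda>k. A' (p$2) * k$2)) (at p)"
        by (rule has_derivative_compose[OF _ dA[rule_format, unfolded has_field_derivative_def]])
           (rule bounded_linear.has_derivative[OF bounded_linear_vec_nth has_derivative_ident])
      show ?thesis unfolding h_def[abs_def] h1_def h2_def vector2_inner
        by (rule has_derivative_eq_rhs[OF has_derivative_mult[OF 1 2]]) (simp add: fun_eq_iff algebra_simps)
    qed
    have ch: "continuous_on UNIV h1" "continuous_on UNIV h2"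
      unfolding h1_def[abs_def] h2_def[abs_def]
      by (intro continuous_on_mult continuous_on_compose2[OF cY(1)[of UNIV]] continuous_on_compose2[OF cY(2)[of UNIV]]
         continuous_on_compose2[OF cA[of UNIV]] continuous_on_compose2[OF cA'] continuous_intros; simp)+
    have h0: "h p = 0 \<and> h1 p = 0 \<and> h2 p = 0" if "p \<notin> C" for p
    proof (cases "p$1 \<in> {t0..t1}")
      case True
      then have "p$2 \<notin> {a..b}" using that C by blast
      then show ?thesis using A0 A'0 by (simp add: h_def h1_def h2_def)
    qed (simp add: h_def h1_def h2_def Y0)
    have cC: "compact C" unfolding C_def by simp
    obtain g D where g: "\<And>x. (g has_derivative (\<lambda>k. D x \<bullet> k)) (at x)" "continuous_on UNIV D"
      "\<And>x. x \<notin> chart v \<phi> ` C \<Longrightarrow> g x = 0 \<and> D x = 0"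
      "\<And>p. p \<in> strip \<beta> \<Longrightarrow> g (chart v \<phi> p) = h p \<and> exp (2 * p$1) * (norm (D (chart v \<phi> p)))\<^sup>2 = (h1 p)\<^sup>2 + (h2 p)\<^sup>2"
      by (rule push_forward_C1[where v = v and \<phi> = \<phi>, OF \<beta>(2) cC Cs dh ch h0]) blast+
    define C' where "C' = chart v \<phi> ` C"
    have cC': "compact C'" unfolding C'_def
      using chart_deriv by (intro compact_continuous_image cC continuous_at_imp_continuous_on ballI has_derivative_continuous)
    have C'sec: "C' \<subseteq> sector v \<phi> \<beta>" unfolding C'_def chart_image[symmetric] using Cs by blast
    have C'int: "C' \<subseteq> interior ?\<Omega>"
    proof -
      have "C' \<subseteq> ball v \<rho>"
      proof
        fix x assume "x \<in> C'"
        then obtain p where p: "p \<in> C" "x = chart v \<phi> p" by (auto simp: C'_def)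
        have "exp (p$1) \<le> exp t1" using p C by simp
        then have "exp (p$1) < \<rho>" using t1 by linarith
        then show "x \<in> ball v \<rho>" using p by (simp add: chart_def logpolar_def dist_norm)
      qed
      then have "C' \<subseteq> ball v \<rho> \<inter> sector v \<phi> \<beta>" using C'sec by blast
      also have "\<dots> \<subseteq> interior ?\<Omega>" using \<rho> by (intro interior_maximal open_Int open_sector \<beta>) auto
      finally show ?thesis .
    qed
    have ineq: "c * (LINT x|lborel. (g x)\<^sup>2 / (bdist ?\<Omega> x)\<^sup>2) \<le> (LINT x|lborel. (norm (D x))\<^sup>2)"
      by (rule hardy_valid_C1[OF valid front cC' C'int g(1,2)]) (use g(3) in \<open>auto simp: C'_def\<close>)
    have bpos: "bdist ?\<Omega> x > 0" if "x \<in> C'" for x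
    proof -
      have "x \<notin> frontier ?\<Omega>" using that C'int by (auto simp: frontier_def)
      then have "infdist x (frontier ?\<Omega>) \<noteq> 0" using in_closed_iff_infdist_zero[OF frontier_closed front] by blast
      then show ?thesis using infdist_nonneg[of x "frontier ?\<Omega>"] by (simp add: bdist_def)
    qed
    have cg: "continuous_on S g" for S using g(1) by (intro continuous_at_imp_continuous_on ballI has_derivative_continuous)
    have int1: "integrable lborel (\<lambda>x. (g x)\<^sup>2 / (bdist ?\<Omega> x)\<^sup>2)"
      by (rule integrable_compact_support[OF cC'])
         (use g(3) bpos in \<open>force intro!: continuous_on_divide continuous_on_power cg continuous_bdist simp: C'_def\<close>)+
    have int2: "integrable lborel (\<lambda>x. (norm (D x))\<^sup>2)"
      by (rule integrable_compact_support[OF cC'])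
         (use g(3) in \<open>auto intro!: continuous_on_power continuous_on_norm continuous_on_subset[OF g(2)] simp: C'_def\<close>)
    have z: "g x = 0 \<and> D x = 0" if "x \<notin> sector v \<phi> \<beta>" for x using g(3)[of x] that C'sec unfolding C'_def by blast
    have z1: "(g x)\<^sup>2 / (bdist ?\<Omega> x)\<^sup>2 = 0" and z2: "(norm (D x))\<^sup>2 = 0" if "x \<notin> sector v \<phi> \<beta>" for x using z[OF that] by auto
    note L1 = logpolar_integral[where f = "\<lambda>x. (g x)\<^sup>2 / (bdist ?\<Omega> x)\<^sup>2" and v = v and \<phi> = \<phi>, OF \<beta>(2) int1 z1]
    note L2 = logpolar_integral[where f = "\<lambda>x. (norm (D x))\<^sup>2" and v = v and \<phi> = \<phi>, OF \<beta>(2) int2 z2]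
    let ?S = "UNIV \<times> {0<..<\<beta>} :: (real \<times> real) set"
    have pt: "vector [fst p, snd p] \<in> strip \<beta>" "chart v \<phi> (vector [fst p, snd p]) = logpolar v \<phi> (fst p) (snd p)" if "p \<in> ?S" for p
      using that by (auto simp: strip_def chart_def)
    have outside: "Y (fst p) = 0 \<or> snd p \<notin> {a..b}" if "vector [fst p, snd p] \<notin> C" for p
      using that Y0(1)[of "fst p"] by (auto simp: C)
    have cg2: "continuous_on {a..b} (\<lambda>t. (A t)\<^sup>2 / (sector_gap \<beta> t)\<^sup>2)"
      using gap by (intro continuous_on_divide continuous_on_power cA continuous_on_subset[OF continuous_on_sector_gap[OF \<beta>]]) force+
    have P1: "integrable lborel (\<lambda>p. (Y (fst p))\<^sup>2 * ((A (snd p))\<^sup>2 / (sector_gap \<beta> (snd p))\<^sup>2))"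
       "(LINT p|lborel. (Y (fst p))\<^sup>2 * ((A (snd p))\<^sup>2 / (sector_gap \<beta> (snd p))\<^sup>2)) = (LINT t|lborel. (Y t)\<^sup>2) * ig"
      using lborel_integral_product[of "\<lambda>t. (Y t)\<^sup>2" t0 t1 a b "\<lambda>t. (A t)\<^sup>2 / (sector_gap \<beta> t)\<^sup>2"] cg2 Y0 A0 cY(1)[of UNIV]
      unfolding ig_def by (auto intro: continuous_on_power)
    have P2: "integrable lborel (\<lambda>p. (Y' (fst p))\<^sup>2 * (A (snd p))\<^sup>2)"
       "(LINT p|lborel. (Y' (fst p))\<^sup>2 * (A (snd p))\<^sup>2) = (LINT t|lborel. (Y' t)\<^sup>2) * i0"
      using lborel_integral_product[of "\<lambda>t. (Y' t)\<^sup>2" t0 t1 a b "\<lambda>t. (A t)\<^sup>2"] cA[of "{a..b}"] Y0 A0 cY(2)[of UNIV]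
      unfolding i0_def by (auto intro: continuous_on_power)
    have P3: "integrable lborel (\<lambda>p. (Y (fst p))\<^sup>2 * (A' (snd p))\<^sup>2)"
       "(LINT p|lborel. (Y (fst p))\<^sup>2 * (A' (snd p))\<^sup>2) = (LINT t|lborel. (Y t)\<^sup>2) * i1"
      using lborel_integral_product[of "\<lambda>t. (Y t)\<^sup>2" t0 t1 a b "\<lambda>t. (A' t)\<^sup>2"] cA'S[of "{a..b}"] Y0 A'0 cY(1)[of UNIV]
      unfolding i1_def by (auto intro: continuous_on_power)
    \<comment> \<open>The Jacobian \<open>exp (2 * t)\<close> cancels the squared scale of the
      distance, so the bound near the vertex separates the variables.\<close>
    have "(LINT p|lborel. (Y (fst p))\<^sup>2 * ((A (snd p))\<^sup>2 / (sector_gap \<beta> (snd p))\<^sup>2)) \<le> (LINT x|lborel. (g x)\<^sup>2 / (bdist ?\<Omega> x)\<^sup>2)"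
    proof (subst L1(2), assumption, rule integral_mono[OF P1(1) L1(1)], assumption)
      fix p :: "real \<times> real"
      define t \<theta> where "t = fst p" and "\<theta> = snd p"
      let ?x = "logpolar v \<phi> t \<theta>"
      show "(Y (fst p))\<^sup>2 * ((A (snd p))\<^sup>2 / (sector_gap \<beta> (snd p))\<^sup>2)
        \<le> indicator ?S p * (exp (2 * fst p) * ((g (logpolar v \<phi> (fst p) (snd p)))\<^sup>2 / (bdist ?\<Omega> (logpolar v \<phi> (fst p) (snd p)))\<^sup>2))"
      proof (cases "vector [fst p, snd p] \<in> C")
        case True
        have tt: "t \<in> {t0..t1}" "\<theta> \<in> {a..b}" using True by (auto simp: C t_def \<theta>_def)
        have pS: "p \<in> ?S" using tt ab by (cases p) (auto simp: \<theta>_def)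
        have gx: "g ?x = Y t * A \<theta>" using g(4)[OF pt(1)[OF pS]] pt(2)[OF pS] by (simp add: h_def t_def \<theta>_def)
        have "exp t < \<rho>" using tt t1 by (intro le_less_trans[OF _ t1]) auto
        then have le: "bdist ?\<Omega> ?x \<le> exp t * sector_gap \<beta> \<theta>" using tt ab by (intro bdist_near_vertex[OF \<beta> \<rho>(2)]) auto
        have pos: "bdist ?\<Omega> ?x > 0" using bpos[of ?x] True pt(2)[OF pS] unfolding C'_def t_def \<theta>_def by (metis imageI)
        have "(Y t)\<^sup>2 * ((A \<theta>)\<^sup>2 / (sector_gap \<beta> \<theta>)\<^sup>2) = exp (2 * t) * ((g ?x)\<^sup>2 / (exp t * sector_gap \<beta> \<theta>)\<^sup>2)"
          unfolding gx power_mult_distrib exp_double[symmetric] using gap[OF tt(2)] by (simp add: exp_double[symmetric])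
        also have "\<dots> \<le> exp (2 * t) * ((g ?x)\<^sup>2 / (bdist ?\<Omega> ?x)\<^sup>2)"
          using pos le gap[OF tt(2)] by (intro mult_left_mono divide_left_mono power_mono mult_pos_pos zero_less_power) auto
        finally show ?thesis using pS by (simp add: t_def \<theta>_def)
      next
        case False
        then have "(Y (fst p))\<^sup>2 * ((A (snd p))\<^sup>2 / (sector_gap \<beta> (snd p))\<^sup>2) = 0" using outside[of p] A0 by auto
        then show ?thesis by (simp only:) (simp add: indicator_def)
      qed
    qed
    then have l: "c * (x0 / \<epsilon> * ig) \<le> c * (LINT x|lborel. (g x)\<^sup>2 / (bdist ?\<Omega> x)\<^sup>2)"
      unfolding P1(2) y0 using c by (intro mult_left_mono)
    have "(LINT x|lborel. (norm (D x))\<^sup>2) = (LINT p|lborel. (Y' (fst p))\<^sup>2 * (A (snd p))\<^sup>2 + (Y (fst p))\<^sup>2 * (A' (snd p))\<^sup>2)"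
    proof (subst L2(2), assumption, rule Bochner_Integration.integral_cong[OF refl])
      fix p :: "real \<times> real"
      show "indicator ?S p * (exp (2 * fst p) * (norm (D (logpolar v \<phi> (fst p) (snd p))))\<^sup>2) = (Y' (fst p))\<^sup>2 * (A (snd p))\<^sup>2 + (Y (fst p))\<^sup>2 * (A' (snd p))\<^sup>2"
      proof (cases "p \<in> ?S")
        case True
        show ?thesis using g(4)[OF pt(1)[OF True]] True unfolding pt(2)[OF True] by (simp add: h1_def h2_def power_mult_distrib)
      next
        case False
        then have "snd p \<notin> {a..b}" using ab by (cases p) auto
        then show ?thesis using False A0 A'0 by simp
      qed
    qed
    also have "\<dots> = \<epsilon> * x1 * i0 + x0 / \<epsilon> * i1" using P2 P3 y0 y1 by simp
    finally have "c * (x0 / \<epsilon> * ig) \<le> \<epsilon> * x1 * i0 + x0 / \<epsilon> * i1" using l ineq by linarith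
    then have "\<epsilon> * (c * (x0 / \<epsilon> * ig)) \<le> \<epsilon> * (\<epsilon> * x1 * i0 + x0 / \<epsilon> * i1)" using \<epsilon> by (intro mult_left_mono) auto
    then show ?thesis using \<epsilon> by (simp add: power2_eq_square algebra_simps)
  qed
  have "((\<lambda>\<epsilon>. \<epsilon>\<^sup>2 * (x1 * i0) + x0 * i1) \<longlongrightarrow> 0\<^sup>2 * (x1 * i0) + x0 * i1) (at_right 0)" by (intro tendsto_intros)
  then have "c * (x0 * ig) \<le> 0\<^sup>2 * (x1 * i0) + x0 * i1"
    by (rule tendsto_lowerbound) (auto simp: eventually_at_right_field intro!: exI[of _ 1] main)
  then have "x0 * (c * ig) \<le> x0 * i1" by (simp add: mult_ac)
  then show "c * (LINT \<theta>|lborel. (A \<theta>)\<^sup>2 / (sector_gap \<beta> \<theta>)\<^sup>2) \<le> (LINT \<theta>|lborel. (A' \<theta>)\<^sup>2)"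
    using x0 unfolding ig_def i1_def by simp
qed

section \<open>From dimension one to the truncated sector\<close>

text \<open>Apart from v, the complement of the sector consists of the rays with angles in
  [\<beta> - 2 pi, 0]. A point at radius \<open>exp t\<close> that makes an angle \<omega> with a
  ray is at distance at least \<open>exp t\<close> |sin \<omega>| from it, and at least
  \<open>exp t\<close> if cos \<omega> \<le> 0.\<close>

lemma gap_le_dist:
  assumes \<beta>: "pi < \<beta>" "\<beta> \<le> 2 * pi" and \<theta>: "0 < \<theta>" "\<theta> < \<beta>" and y: "y \<notin> sector v \<phi> \<beta>"
  shows "exp t * sector_gap \<beta> \<theta> \<le> dist (logpolar v \<phi> t \<theta>) y"
proof (cases "y = v")
  case True
  have "exp t * sector_gap \<beta> \<theta> \<le> exp t * 1" by (intro mult_left_mono sector_gap_le_1[OF \<beta>]) simp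
  then show ?thesis using True by (simp add: logpolar_def dist_norm)
next
  case False
  then obtain s \<eta> where s: "y = logpolar v \<phi> s \<eta>" "\<beta> - 2 * pi \<le> \<eta>" "\<eta> < \<beta> - 2 * pi + 2 * pi"
    by (rule logpolar_polar[of y v \<phi> "\<beta> - 2 * pi"])
  have \<eta>: "\<eta> \<le> 0"
  proof (rule ccontr)
    assume "\<not> \<eta> \<le> 0"
    then have "y \<in> sector v \<phi> \<beta>" unfolding sector_eq_logpolar s(1) using s(3) by (intro image_eqI[of _ _ "(s, \<eta>)"]) auto
    then show False using y by simp
  qed
  define \<omega> where "\<omega> = \<theta> - \<eta>"
  have \<omega>: "\<theta> \<le> \<omega>" "\<omega> \<le> \<theta> - \<beta> + 2 * pi" using s \<eta> by (simp_all add: \<omega>_def)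
  have g0: "0 \<le> sector_gap \<beta> \<theta>" using sector_gap_pos[OF \<beta> \<theta>] by simp
  define E F where "E = exp t" and "F = exp s"
  have EF: "0 < E" "0 < F" by (simp_all add: E_def F_def)
  have dd: "logpolar v \<phi> t \<theta> - y = E *\<^sub>R dir (\<phi> + \<theta>) - F *\<^sub>R dir (\<phi> + \<eta>)" by (simp add: s(1) logpolar_def E_def F_def)
  have ce: "cos (\<eta> - \<theta>) = cos (\<theta> - \<eta>)" by (metis cos_minus minus_diff_eq)
  have d: "(dist (logpolar v \<phi> t \<theta>) y)\<^sup>2 = E\<^sup>2 + F\<^sup>2 - 2 * E * F * cos \<omega>"
    unfolding dist_norm dd power2_norm_eq_inner
    by (simp add: inner_diff_left inner_diff_right inner_dir \<omega>_def power2_eq_square ce algebra_simps)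
  have "(E * sector_gap \<beta> \<theta>)\<^sup>2 \<le> (dist (logpolar v \<phi> t \<theta>) y)\<^sup>2"
  proof (cases "cos \<omega> \<le> 0")
    case True
    have "E * sector_gap \<beta> \<theta> \<le> E * 1" using EF by (intro mult_left_mono sector_gap_le_1[OF \<beta>]) simp
    then have "(E * sector_gap \<beta> \<theta>)\<^sup>2 \<le> (E * 1)\<^sup>2" using EF g0 by (intro power_mono) auto
    moreover have "2 * E * F * cos \<omega> \<le> 0" using True EF by (simp add: mult_nonneg_nonpos)
    ultimately show ?thesis unfolding d mult_1_right using zero_le_power2[of F] by linarith
  next
    case c: False
    have le: "sector_gap \<beta> \<theta> \<le> \<bar>sin \<omega>\<bar>"
    proof -
      consider "\<omega> < pi/2" | "pi/2 \<le> \<omega>" "\<omega> \<le> 3 * pi / 2" | "3 * pi / 2 < \<omega>" by linarith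
      then show ?thesis
      proof cases
        case 1
        have "sin \<theta> \<le> sin \<omega>" using \<omega> \<theta> 1 by (intro sin_monotone_2pi_le) auto
        then show ?thesis using 1 \<omega> by (simp add: sector_gap_def)
      next
        case 2
        have "cos \<omega> = - cos (\<omega> - pi)" by (simp add: cos_diff)
        moreover have "cos (\<omega> - pi) \<ge> 0" using 2 by (intro cos_ge_zero) auto
        ultimately show ?thesis using c by simp
      next
        case 3
        have "sin (\<beta> - \<theta>) \<le> sin (2 * pi - \<omega>)" using \<omega> \<theta> 3 by (intro sin_monotone_2pi_le) auto
        moreover have "sin (2 * pi - \<omega>) = - sin \<omega>" by (simp add: sin_diff)
        moreover have "\<not> \<theta> \<le> pi/2" "\<not> \<theta> \<le> \<beta> - pi/2" using 3 \<omega> \<beta> by linarith+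
        ultimately show ?thesis by (simp add: sector_gap_def)
      qed
    qed
    have "(E * sector_gap \<beta> \<theta>)\<^sup>2 \<le> (E * \<bar>sin \<omega>\<bar>)\<^sup>2" using le EF g0 by (intro power_mono mult_left_mono) auto
    also have "\<dots> = E\<^sup>2 * (1 - (cos \<omega>)\<^sup>2)" by (simp add: power_mult_distrib sin_squared_eq)
    also have "\<dots> \<le> E\<^sup>2 * (1 - (cos \<omega>)\<^sup>2) + (F - E * cos \<omega>)\<^sup>2" by simp
    also have "\<dots> = (dist (logpolar v \<phi> t \<theta>) y)\<^sup>2" unfolding d by (simp add: power2_eq_square algebra_simps)
    finally show ?thesis .
  qed
  then show ?thesis unfolding E_def by (rule power2_le_imp_le) simp
qed

text \<open>Outer normals of \<open>K\<close> make obtuse angles with both edges of the sector, because \<open>K\<close> contains them.\<close>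

lemma supporting_edge:
  assumes \<beta>: "pi < \<beta>" "\<beta> \<le> 2 * pi" and K: "convex K" "v \<in> interior K" "frontier K \<inter> frontier (sector v \<phi> \<beta>) = {}"
    and y: "y \<in> frontier K"
  shows "\<exists>a H. pi/2 \<le> a \<and> a \<le> \<beta> - pi/2 \<and> (\<forall>t \<theta>. logpolar v \<phi> t \<theta> \<in> K \<longrightarrow> exp t * cos (\<theta> - a) \<le> H) \<and>
     (\<forall>t \<theta>. H - exp t * cos (\<theta> - a) \<le> dist (logpolar v \<phi> t \<theta>) y)"
proof -
  have b0: "0 < \<beta>" using \<beta> pi_gt_zero by linarith
  have ri: "rel_interior K = interior K" using K(2) rel_interior_nonempty_interior by blast
  have "y \<in> closure K" "y \<notin> rel_interior K" using y unfolding ri by (auto simp: frontier_def)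
  then obtain q where q: "q \<noteq> 0" "\<And>z. z \<in> closure K \<Longrightarrow> q \<bullet> y \<le> q \<bullet> z" "\<And>z. z \<in> rel_interior K \<Longrightarrow> q \<bullet> y < q \<bullet> z"
    using supporting_hyperplane_relative_frontier[OF K(1)] by metis
  \<comment> \<open>The supporting hyperplane is delivered with an inner normal; \<open>n\<close> is
    the outer unit normal.\<close>
  define n where "n = - (1 / norm q) *\<^sub>R q"
  have n1: "norm n = 1" using q(1) by (simp add: n_def)
  have nle: "n \<bullet> z \<le> n \<bullet> y" if "z \<in> K" for z
    using q(2)[of z] that closure_subset[of K] q(1) by (auto simp: n_def divide_right_mono)
  obtain t a where ta: "v + n = logpolar v \<phi> t a" "0 \<le> a" "a < 0 + 2 * pi"
    by (rule logpolar_polar[of "v + n" v \<phi> 0]) (use n1 in auto)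
  have "n = exp t *\<^sub>R dir (\<phi> + a)" using ta(1) by (simp add: logpolar_def)
  then have nd: "n = dir (\<phi> + a)" using n1 by simp
  define H where "H = n \<bullet> y - n \<bullet> v"
  have nG: "n \<bullet> logpolar v \<phi> t \<theta> = n \<bullet> v + exp t * cos (\<theta> - a)" for t \<theta>
  proof -
    have "cos ((\<phi> + a) - (\<phi> + \<theta>)) = cos (\<theta> - a)" by (metis add_diff_cancel_left cos_minus minus_diff_eq)
    then show ?thesis unfolding nd logpolar_def by (simp add: inner_add_right inner_dir)
  qed
  \<comment> \<open>An edge starts at v inside K and never meets the frontier of K, so by
    connectedness it stays in K. A positive component along \<open>n\<close> would carry it out of
    the supporting half-plane.\<close>
  have ray: "n \<bullet> dir (\<phi> + e) \<le> 0" if e: "e = 0 \<or> e = \<beta>" for e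
  proof (rule ccontr)
    assume pos: "\<not> ?thesis"
    let ?R = "(\<lambda>r. v + r *\<^sub>R dir (\<phi> + e)) ` {0..}"
    have Rf: "?R \<subseteq> frontier (sector v \<phi> \<beta>)"
      using sector_rays[OF b0 \<beta>(2) _ e, of _ v \<phi>] interior_subset[of "sector v \<phi> \<beta>"] by (auto simp: frontier_def)
    have "connected ?R" by (intro connected_continuous_image continuous_intros) (simp add: connected_iff_interval)
    moreover have "v \<in> ?R \<inter> K" using K(2) interior_subset by (auto intro!: image_eqI[of _ _ 0])
    moreover have "?R \<inter> frontier K = {}" using Rf K(3) by blast
    ultimately have RK: "?R \<subseteq> K" using connected_Int_frontier[of ?R K] by blast
    define r where "r = (\<bar>H\<bar> + 1) / (n \<bullet> dir (\<phi> + e))"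
    have "r \<ge> 0" using pos by (simp add: r_def)
    then have "v + r *\<^sub>R dir (\<phi> + e) \<in> K" using RK by auto
    then have "n \<bullet> (v + r *\<^sub>R dir (\<phi> + e)) \<le> n \<bullet> y" by (rule nle)
    then have "r * (n \<bullet> dir (\<phi> + e)) \<le> H" by (simp add: inner_add_right H_def)
    then show False using pos by (simp add: r_def)
  qed
  have c0: "cos a \<le> 0" using ray[of 0] by (simp add: nd inner_dir)
  have c\<beta>: "cos (a - \<beta>) \<le> 0" using ray[of \<beta>] by (simp add: nd inner_dir)
  have a1: "pi/2 \<le> a" using c0 ta(2) cos_gt_zero_pi[of a] pi_gt_zero by (smt (verit) pi_half_gt_zero)
  have a2: "a \<le> 3 * pi / 2"
  proof (rule ccontr)
    assume "\<not> a \<le> 3 * pi / 2"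
    then have "cos (a - 2 * pi) > 0" using ta(3) pi_gt_zero by (intro cos_gt_zero_pi) linarith+
    then show False using c0 by (simp add: cos_diff)
  qed
  \<comment> \<open>Beyond this bound, a \<le> 3 pi/2 places a - \<beta> strictly between -pi/2 and
    pi/2, where the cosine is positive.\<close>
  have a3: "a \<le> \<beta> - pi/2"
  proof (rule ccontr)
    assume "\<not> a \<le> \<beta> - pi/2"
    then have "cos (a - \<beta>) > 0" using a2 \<beta> by (intro cos_gt_zero_pi) linarith+
    then show False using c\<beta> by simp
  qed
  have "exp t * cos (\<theta> - a) \<le> H" if "logpolar v \<phi> t \<theta> \<in> K" for t \<theta>
    using nle[OF that] unfolding nG H_def by simp
  moreover have "H - exp t * cos (\<theta> - a) \<le> dist (logpolar v \<phi> t \<theta>) y" for t \<theta>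
  proof -
    have "H - exp t * cos (\<theta> - a) = n \<bullet> (y - logpolar v \<phi> t \<theta>)" by (simp add: H_def nG inner_diff_right)
    also have "\<dots> \<le> norm n * norm (y - logpolar v \<phi> t \<theta>)" by (rule norm_cauchy_schwarz)
    finally show ?thesis by (simp add: n1 dist_norm norm_minus_commute)
  qed
  ultimately show ?thesis using a1 a3 by blast
qed

text \<open>Of the 4\<epsilon>, two come from covering the support by finitely many discs of radius
  \<epsilon> and using only the nearest boundary points of their centres, one from moving the
  half-planes outward so that the support lies strictly inside, and one from the soft minimum. The
  constant c is not affected, so the shift can be removed in a limit.\<close>

lemma hardy_shifted_distance:
  assumes ss: "hardy_supersolution \<beta> \<alpha> c w"
    and K: "convex K" "v \<in> interior K" "frontier K \<inter> frontier (sector v \<phi> \<beta>) = {}"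
    and u: "u \<in> test_functions (K \<inter> sector v \<phi> \<beta>)" and \<epsilon>: "\<epsilon> > 0"
  shows "c * (LINT x|lborel. (u x)\<^sup>2 / (bdist (K \<inter> sector v \<phi> \<beta>) x + 4 * \<epsilon>)\<^sup>2) \<le> (LINT x|lborel. (norm (grad u x))\<^sup>2)"
proof -
  interpret hardy_supersolution \<beta> \<alpha> c w by (rule ss)
  let ?\<Omega> = "K \<inter> sector v \<phi> \<beta>"
  let ?G = "logpolar v \<phi>"
  have b0: "0 < \<beta>" using \<beta> pi_gt_zero by linarith
  define S where "S = closure {x. u x \<noteq> 0}"
  have S: "compact S" "S \<subseteq> ?\<Omega>" and Sz: "\<And>x. x \<notin> S \<Longrightarrow> u x = 0 \<and> grad u x = 0"
    unfolding S_def by (rule test_functionD(2,3)[OF u])+ (rule test_functionD(4)[OF u])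
  have front: "frontier ?\<Omega> \<noteq> {}" by (rule frontier_truncated_sector[OF \<beta> K(2)])
  have su: "smooth_fun u" by (rule test_functionD(1)[OF u])
  have du: "(u has_derivative (\<lambda>h. grad u x \<bullet> h)) (at x)" for x
    by (rule has_derivative_grad[OF smooth_fun_differentiable(1)[OF su]])
  have cu: "continuous_on UNIV u" using du by (intro continuous_at_imp_continuous_on ballI has_derivative_continuous)
  have cgrad: "continuous_on UNIV (grad u)" by (rule smooth_fun_differentiable(2)[OF su])
  \<comment> \<open>finitely many supporting half-planes determine the distance to \<open>K\<close> up to \<open>3\<epsilon>\<close> on the support\<close>
  define edge where "edge y p \<longleftrightarrow> pi/2 \<le> fst p \<and> fst p \<le> \<beta> - pi/2 \<and> (\<forall>t \<theta>. ?G t \<theta> \<in> K \<longrightarrow> exp t * cos (\<theta> - fst p) \<le> snd p) \<and>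
     (\<forall>t \<theta>. snd p - exp t * cos (\<theta> - fst p) \<le> dist (?G t \<theta>) y)" for y and p :: "real \<times> real"
  define e where "e y = (SOME p. edge y p)" for y
  have edge_e: "edge y (e y)" if yK: "y \<in> frontier K" for y
    unfolding e_def
  proof (rule someI_ex)
    obtain a H where "edge y (a, H)" using supporting_edge[OF \<beta> K yK] unfolding edge_def fst_conv snd_conv by blast
    then show "\<exists>p. edge y p" ..
  qed
  then have e: "\<And>y. y \<in> frontier K \<Longrightarrow> pi/2 \<le> fst (e y) \<and> fst (e y) \<le> \<beta> - pi/2"
     "\<And>y t \<theta>. y \<in> frontier K \<Longrightarrow> ?G t \<theta> \<in> K \<Longrightarrow> exp t * cos (\<theta> - fst (e y)) \<le> snd (e y)"
     "\<And>y t \<theta>. y \<in> frontier K \<Longrightarrow> snd (e y) - exp t * cos (\<theta> - fst (e y)) \<le> dist (?G t \<theta>) y"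
    unfolding edge_def by blast+
  define near where "near x = (SOME y. y \<in> frontier ?\<Omega> \<and> bdist ?\<Omega> x = dist x y)" for x
  have "near x \<in> frontier ?\<Omega> \<and> bdist ?\<Omega> x = dist x (near x)" for x
    unfolding near_def
  proof (rule someI_ex)
    obtain y where "y \<in> frontier ?\<Omega>" "infdist x (frontier ?\<Omega>) = dist x y"
      by (rule infdist_attains_inf[OF frontier_closed front])
    then show "\<exists>y. y \<in> frontier ?\<Omega> \<and> bdist ?\<Omega> x = dist x y" unfolding bdist_def by blast
  qed
  then have near: "near x \<in> frontier ?\<Omega>" "bdist ?\<Omega> x = dist x (near x)" for x by auto
  have "S \<subseteq> \<Union>((\<lambda>x. ball x \<epsilon>) ` S)" using \<epsilon> by auto
  then obtain X where X: "X \<subseteq> S" "finite X" "S \<subseteq> (\<Union>x\<in>X. ball x \<epsilon>)"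
    using compactE_image[OF S(1), of S "\<lambda>x. ball x \<epsilon>"] by auto
  define I where "I = (\<lambda>y. (fst (e y), snd (e y) + \<epsilon>)) ` (near ` X \<inter> frontier K)"
  define \<delta> where "\<delta> p = bdist ?\<Omega> (?G (fst p) (snd p)) + 3 * \<epsilon>" for p :: "real \<times> real"
  have bd0: "0 \<le> bdist ?\<Omega> x" for x by (simp add: bdist_def infdist_nonneg)
  \<comment> \<open>The angular interval is closed so that C is closed; its two end angles drop out
    because the support of u avoids the edges.\<close>
  define C where "C = {p. 0 \<le> snd p \<and> snd p \<le> \<beta> \<and> ?G (fst p) (snd p) \<in> S}"
  have cG: "continuous_on T (\<lambda>p. ?G (fst p) (snd p))" for T :: "(real \<times> real) set" by (intro continuous_intros)
  have Cs: "0 < \<theta> \<and> \<theta> < \<beta>" if "(t, \<theta>) \<in> C" for t \<theta>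
  proof -
    have G: "?G t \<theta> \<in> sector v \<phi> \<beta>" using that S(2) by (auto simp: C_def)
    have "\<theta> \<noteq> 0" "\<theta> \<noteq> \<beta>"
      using G sector_rays(2)[OF b0 \<beta>(2), of "exp t" 0 v \<phi>] sector_rays(2)[OF b0 \<beta>(2), of "exp t" \<beta> v \<phi>] by (auto simp: logpolar_def)
    then show ?thesis using that by (auto simp: C_def)
  qed
  have cC: "compact C"
  proof -
    have "closed C"
    proof -
      have "C = {p. 0 \<le> snd p} \<inter> {p. snd p \<le> \<beta>} \<inter> (\<lambda>p. ?G (fst p) (snd p)) -` S" by (auto simp: C_def)
      also have "closed \<dots>"
        using S(1) by (intro closed_Int closed_Collect_le closed_vimage compact_imp_closed continuous_intros)
      finally show ?thesis .
    qed
    moreover have "bounded C"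
    proof -
      \<comment> \<open>The support keeps a positive distance from the vertex, which bounds the
        logarithm of the radius from below.\<close>
      have vS: "v \<notin> S" using S(2) sector_rays(2)[OF b0 \<beta>(2), of 0 0 v \<phi>] by auto
      then obtain m where m: "m > 0" "\<And>x. x \<in> S \<Longrightarrow> m \<le> dist v x"
        using separate_point_closed[OF compact_imp_closed[OF S(1)]] by blast
      obtain R where R: "\<And>x. x \<in> S \<Longrightarrow> dist v x \<le> R" using compact_imp_bounded[OF S(1)] unfolding bounded_any_center[where a = v] by blast
      have "C \<subseteq> {ln m..ln (max R 1)} \<times> {0..\<beta>}"
      proof
        fix p assume p: "p \<in> C"
        have "dist v (?G (fst p) (snd p)) = exp (fst p)" by (simp add: logpolar_def dist_norm)
        then have 1: "m \<le> exp (fst p)" "exp (fst p) \<le> max R 1" using p m(2) R by (force simp: C_def)+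
        have "ln m \<le> ln (exp (fst p))" using 1 m by (subst ln_le_cancel_iff) auto
        moreover have "ln (exp (fst p)) \<le> ln (max R 1)" using 1 by (subst ln_le_cancel_iff) auto
        ultimately show "p \<in> {ln m..ln (max R 1)} \<times> {0..\<beta>}" using p by (cases p) (auto simp: C_def)
      qed
      then show ?thesis by (rule bounded_subset[rotated]) (intro bounded_Times bounded_closed_interval)
    qed
    ultimately show ?thesis by (simp add: compact_eq_bounded_closed)
  qed
  \<comment> \<open>The log-polar map is periodic in the angle. Restricting to this strip keeps a
    single copy of the support of u.\<close>
  define T where "T = (UNIV :: real set) \<times> {0<..<\<beta>}"
  have oT: "open T" unfolding T_def by (intro open_Times) auto
  have CT: "C \<subseteq> T" using Cs by (auto simp: T_def)
  define U where "U p = (if p \<in> T then u (?G (fst p) (snd p)) else 0)" for p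
  define Ut where "Ut p = (if p \<in> T then exp (fst p) * (grad u (?G (fst p) (snd p)) \<bullet> dir (\<phi> + snd p)) else 0)" for p
  define Us where "Us p = (if p \<in> T then exp (fst p) * (grad u (?G (fst p) (snd p)) \<bullet> dirp (\<phi> + snd p)) else 0)" for p
  have U0: "U p = 0 \<and> Ut p = 0 \<and> Us p = 0" if "p \<notin> C" for p
  proof (cases "p \<in> T")
    case True
    then have "?G (fst p) (snd p) \<notin> S" using that by (auto simp: C_def T_def)
    then show ?thesis by (simp add: U_def Ut_def Us_def Sz)
  qed (simp add: U_def Ut_def Us_def)
  have cU: "continuous_on UNIV U" "continuous_on UNIV Ut" "continuous_on UNIV Us"
  proof -
    have 1: "continuous_on T (\<lambda>p. u (?G (fst p) (snd p)))"
      by (rule continuous_on_compose2[OF cu cG]) simp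
    have 2: "continuous_on T (\<lambda>p. grad u (?G (fst p) (snd p)))"
      by (rule continuous_on_compose2[OF cgrad cG]) simp
    have "continuous_on T U" by (rule continuous_on_eq[OF 1]) (simp add: U_def)
    then show "continuous_on UNIV U" by (rule continuous_zero_extend[OF cC oT CT]) (use U0 in auto)
    have "continuous_on T (\<lambda>p. exp (fst p) * (grad u (?G (fst p) (snd p)) \<bullet> dir (\<phi> + snd p)))" by (intro continuous_intros 2)
    then have "continuous_on T Ut" by (rule continuous_on_eq) (simp add: Ut_def)
    then show "continuous_on UNIV Ut" by (rule continuous_zero_extend[OF cC oT CT]) (use U0 in auto)
    have "continuous_on T (\<lambda>p. exp (fst p) * (grad u (?G (fst p) (snd p)) \<bullet> dirp (\<phi> + snd p)))" unfolding dirp_def by (intro continuous_intros 2)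
    then have "continuous_on T Us" by (rule continuous_on_eq) (simp add: Us_def)
    then show "continuous_on UNIV Us" by (rule continuous_zero_extend[OF cC oT CT]) (use U0 in auto)
  qed
  have ev: "\<forall>\<^sub>F s in nhds (0::real). p + s *\<^sub>R d \<in> W" if "open W" "p \<in> W" for p d and W :: "(real \<times> real) set"
  proof -
    have "open ((\<lambda>s::real. p + s *\<^sub>R d) -` W)" by (intro open_vimage that(1) continuous_intros)
    then have "\<forall>\<^sub>F s in nhds 0. s \<in> (\<lambda>s::real. p + s *\<^sub>R d) -` W" by (rule eventually_nhds_in_open) (use that(2) in simp)
    then show ?thesis by simp
  qed
  have derT: "((\<lambda>s. u (?G (fst p + s * a) (snd p + s * b))) has_real_derivative
     grad u (?G (fst p) (snd p)) \<bullet> (exp (fst p) *\<^sub>R (a *\<^sub>R dir (\<phi> + snd p) + b *\<^sub>R dirp (\<phi> + snd p)))) (at 0)" for p a b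
  proof -
    have 1: "((\<lambda>s. fst p + s * a) has_derivative (\<lambda>s. s * a)) (at 0)" "((\<lambda>s. snd p + s * b) has_derivative (\<lambda>s. s * b)) (at 0)"
      by (auto intro!: derivative_eq_intros)
    note d = has_derivative_logpolar[OF 1, of v \<phi>]
    have "((\<lambda>s. u (?G (fst p + s * a) (snd p + s * b))) has_derivative
      (\<lambda>s. grad u (?G (fst p + 0 * a) (snd p + 0 * b)) \<bullet> (exp (fst p + 0 * a) *\<^sub>R ((s * a) *\<^sub>R dir (\<phi> + (snd p + 0 * b)) + (s * b) *\<^sub>R dir (\<phi> + (snd p + 0 * b) + pi/2))))) (at 0)"
      by (rule has_derivative_compose[OF d du])
    then show ?thesis unfolding has_field_derivative_def
      by (rule has_derivative_eq_rhs) (simp add: fun_eq_iff dirp_def inner_add_right algebra_simps)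
  qed
  have dU: "((\<lambda>s. U (p + s *\<^sub>R (a, b))) has_real_derivative a * Ut p + b * Us p) (at 0)" for p a b
  proof (cases "p \<in> T")
    case True
    have "\<forall>\<^sub>F s in nhds 0. p + s *\<^sub>R (a, b) \<in> T" by (rule ev[OF oT True])
    then have "\<forall>\<^sub>F s in nhds 0. u (?G (fst p + s * a) (snd p + s * b)) = U (p + s *\<^sub>R (a, b))"
      by eventually_elim (simp add: U_def)
    from DERIV_cong_ev[OF refl this refl] derT[of p a b] show ?thesis
      using True by (simp add: Ut_def Us_def inner_add_right algebra_simps)
  next
    case False
    then have pC: "p \<notin> C" using CT by auto
    have "\<forall>\<^sub>F s in nhds 0. p + s *\<^sub>R (a, b) \<in> - C" using pC cC by (intro ev) (auto simp: compact_imp_closed open_Compl)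
    then have "\<forall>\<^sub>F s in nhds 0. 0 = U (p + s *\<^sub>R (a, b))" by eventually_elim (use U0 in auto)
    from DERIV_cong_ev[OF refl this refl, of 0] show ?thesis using U0[OF pC] by simp
  qed
  have "c * (LINT p|lborel. (U p)\<^sup>2 * (exp (2 * fst p) / (\<delta> p + \<epsilon>)\<^sup>2)) \<le> (LINT p|lborel. (Ut p)\<^sup>2 + (Us p)\<^sup>2)"
  proof (rule strip_inequality[of I C])
    show "finite I" unfolding I_def using X(2) by simp
    show "pi/2 \<le> a \<and> a \<le> \<beta> - pi/2" if "(a, H) \<in> I" for a H using that e(1) by (auto simp: I_def)
    show "compact C" by (rule cC)
    show "C \<subseteq> {x. 0 < snd x \<and> snd x < \<beta> \<and> (\<forall>(a, H)\<in>I. exp (fst x) * cos (snd x - a) < H)}"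
    proof safe
      fix t \<theta> assume p: "(t, \<theta>) \<in> C"
      show "0 < snd (t, \<theta>)" "snd (t, \<theta>) < \<beta>" using Cs[OF p] by auto
      fix a H assume "(a, H) \<in> I"
      then obtain y where y: "y \<in> frontier K" "a = fst (e y)" "H = snd (e y) + \<epsilon>" by (auto simp: I_def)
      have "?G t \<theta> \<in> K" using p S(2) by (auto simp: C_def)
      then show "exp (fst (t, \<theta>)) * cos (snd (t, \<theta>) - a) < H" using e(2)[OF y(1), of t \<theta>] \<epsilon> y by simp
    qed
    show "continuous_on UNIV \<delta>" unfolding \<delta>_def[abs_def]
      by (intro continuous_on_add continuous_on_const continuous_on_compose2[OF continuous_bdist[of UNIV] cG]) simp
    show "\<delta> x \<ge> 0" for x using bd0 \<epsilon> by (simp add: \<delta>_def add_nonneg_nonneg)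
    show "((\<lambda>s. U (x + s *\<^sub>R (1, 0))) has_real_derivative Ut x) (at 0)" for x using dU[of x 1 0] by simp
    show "((\<lambda>s. U (x + s *\<^sub>R (0, 1))) has_real_derivative Us x) (at 0)" for x using dU[of x 0 1] by simp
    fix t \<theta> assume p: "(t, \<theta>) \<in> C"
    define z where "z = ?G t \<theta>"
    have zS: "z \<in> S" using p by (simp add: C_def z_def)
    then obtain x where x: "x \<in> X" "dist x z < \<epsilon>" using X(3) by auto
    have "bdist ?\<Omega> x \<le> bdist ?\<Omega> z + dist x z" unfolding bdist_def by (rule infdist_triangle)
    moreover have "dist z (near x) \<le> dist x z + dist x (near x)" by (metis dist_commute dist_triangle)
    \<comment> \<open>Passing from z to the centre x of its disc costs \<epsilon> twice: in the
      distance to the boundary and on the way to the boundary point.\<close>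
    ultimately have dz: "dist z (near x) \<le> bdist ?\<Omega> z + 2 * \<epsilon>" using x(2) near(2)[of x] by linarith
    have "near x \<in> frontier K \<or> near x \<in> frontier (sector v \<phi> \<beta>)"
      using near(1)[of x] frontier_Int_subset[of K "sector v \<phi> \<beta>"] by blast
    then show "exp t * sector_gap \<beta> \<theta> \<le> \<delta> (t, \<theta>) \<or> (\<exists>(a, H)\<in>I. H - exp t * cos (\<theta> - a) \<le> \<delta> (t, \<theta>))"
    proof
      assume k: "near x \<in> frontier K"
      have "(fst (e (near x)), snd (e (near x)) + \<epsilon>) \<in> I" unfolding I_def using x(1) k by blast
      moreover have "snd (e (near x)) + \<epsilon> - exp t * cos (\<theta> - fst (e (near x))) \<le> \<delta> (t, \<theta>)"
        using e(3)[OF k, of t \<theta>] dz by (simp add: \<delta>_def z_def)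
      ultimately show ?thesis by blast
    next
      assume "near x \<in> frontier (sector v \<phi> \<beta>)"
      then have "near x \<notin> sector v \<phi> \<beta>" using interior_open[OF open_sector[OF \<beta>(2)]] by (auto simp: frontier_def)
      then have "exp t * sector_gap \<beta> \<theta> \<le> dist z (near x)" unfolding z_def using Cs[OF p] by (intro gap_le_dist[OF \<beta>]) auto
      then show ?thesis using dz \<epsilon> by (simp add: \<delta>_def z_def)
    qed
  qed (use U0 cU \<epsilon> in auto)
  moreover have "(LINT p|lborel. (U p)\<^sup>2 * (exp (2 * fst p) / (\<delta> p + \<epsilon>)\<^sup>2)) = (LINT x|lborel. (u x)\<^sup>2 / (bdist ?\<Omega> x + 4 * \<epsilon>)\<^sup>2)"
  proof -
    have "integrable lborel (\<lambda>x. (u x)\<^sup>2 / (bdist ?\<Omega> x + 4 * \<epsilon>)\<^sup>2)"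
    proof (rule integrable_compact_support[OF S(1)])
      show "continuous_on S (\<lambda>x. (u x)\<^sup>2 / (bdist ?\<Omega> x + 4 * \<epsilon>)\<^sup>2)"
      proof (intro continuous_on_divide continuous_on_power continuous_on_add continuous_on_const continuous_bdist continuous_on_subset[OF cu] ballI)
        show "(bdist ?\<Omega> x + 4 * \<epsilon>)\<^sup>2 \<noteq> 0" for x using bd0[of x] \<epsilon> by (simp add: add_nonneg_eq_0_iff)
      qed simp
    qed (simp add: Sz)
    then have "(LINT x|lborel. (u x)\<^sup>2 / (bdist ?\<Omega> x + 4 * \<epsilon>)\<^sup>2) = (LINT p|lborel. indicator (UNIV \<times> {0<..<\<beta>}) p *
       (exp (2 * fst p) * ((u (?G (fst p) (snd p)))\<^sup>2 / (bdist ?\<Omega> (?G (fst p) (snd p)) + 4 * \<epsilon>)\<^sup>2)))"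
      by (rule logpolar_integral(2)[OF \<beta>(2)]) (use Sz S(2) in force)
    also have "\<dots> = (LINT p|lborel. (U p)\<^sup>2 * (exp (2 * fst p) / (\<delta> p + \<epsilon>)\<^sup>2))"
      by (intro Bochner_Integration.integral_cong) (auto simp: U_def T_def \<delta>_def algebra_simps)
    finally show ?thesis by simp
  qed
  moreover have "(LINT p|lborel. (Ut p)\<^sup>2 + (Us p)\<^sup>2) = (LINT x|lborel. (norm (grad u x))\<^sup>2)"
  proof -
    have "integrable lborel (\<lambda>x. (norm (grad u x))\<^sup>2)"
      by (rule integrable_compact_support[OF S(1)])
         (use Sz in \<open>auto intro!: continuous_on_power continuous_on_norm continuous_on_subset[OF cgrad]\<close>)
    then have "(LINT x|lborel. (norm (grad u x))\<^sup>2) = (LINT p|lborel. indicator (UNIV \<times> {0<..<\<beta>}) p *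
       (exp (2 * fst p) * (norm (grad u (?G (fst p) (snd p))))\<^sup>2))"
      by (rule logpolar_integral(2)[OF \<beta>(2)]) (use Sz S(2) in force)
    also have "\<dots> = (LINT p|lborel. (Ut p)\<^sup>2 + (Us p)\<^sup>2)"
    proof (intro Bochner_Integration.integral_cong refl)
      fix p :: "real \<times> real"
      have n: "(norm z)\<^sup>2 = (z \<bullet> dir a)\<^sup>2 + (z \<bullet> dirp a)\<^sup>2" for z :: "real^2" and a
      proof -
        have "(norm z)\<^sup>2 = ((z \<bullet> dir a) *\<^sub>R dir a + (z \<bullet> dirp a) *\<^sub>R dirp a) \<bullet> ((z \<bullet> dir a) *\<^sub>R dir a + (z \<bullet> dirp a) *\<^sub>R dirp a)"
          unfolding power2_norm_eq_inner using dir_expand[of z a] by simp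
        then show ?thesis by (simp add: inner_add_left inner_add_right dir_frame power2_eq_square)
      qed
      show "indicator (UNIV \<times> {0<..<\<beta>}) p * (exp (2 * fst p) * (norm (grad u (?G (fst p) (snd p))))\<^sup>2) = (Ut p)\<^sup>2 + (Us p)\<^sup>2"
        unfolding n[of _ "\<phi> + snd p"] by (auto simp: Ut_def Us_def T_def[symmetric] power_mult_distrib exp_double[symmetric] algebra_simps)
    qed
    finally show ?thesis by simp
  qed
  ultimately show ?thesis by simp
qed

text \<open>\<alpha> is the larger root of \<alpha>(1 - \<alpha>) = c. The strict bound c < 1/4 puts
  it above 1/2, as the slope estimate requires.\<close>

lemma one_dim_hardy_supersolution:
  assumes \<beta>: "pi < \<beta>" "\<beta> \<le> 2 * pi" and hardy: "one_dim_hardy \<beta> c" and c: "0 < c" "c < 1/4"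
  obtains \<alpha> w where "hardy_supersolution \<beta> \<alpha> c w"
proof -
  define r where "r = sqrt (1 - 4 * c)"
  have r: "0 < r" "r < 1" "r\<^sup>2 = 1 - 4 * c" using c by (simp_all add: r_def)
  define \<alpha> where "\<alpha> = (1 + r) / 2"
  have \<alpha>: "1/2 < \<alpha>" "\<alpha> < 1" using r by (simp_all add: \<alpha>_def)
  have "\<alpha> * (1 - \<alpha>) = (1 - r\<^sup>2) / 4" by (simp add: \<alpha>_def power2_eq_square field_simps)
  then have ca: "c = \<alpha> * (1 - \<alpha>)" using r(3) by simp
  have "sqrt c * tan (sqrt c * (\<beta> - pi) / 2) \<le> edge_log_deriv \<alpha> (pi/2)"
    by (rule one_dim_hardy_slope[OF \<beta> \<alpha> ca hardy])
  then obtain w where "hardy_supersolution \<beta> \<alpha> c w"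
    by (rule supersolution_exists[OF \<beta> less_imp_le[OF \<alpha>(1)] less_imp_le[OF \<alpha>(2)] ca])
  then show ?thesis by (rule that)
qed

text \<open>A supersolution is available only below 1/4, while c may equal 1/4. So the inequality is
  proved for every c' < c, with the shift of the distance removed by dominated convergence, and then
  c' tends to c.\<close>

lemma one_dim_imp_hardy_valid:
  assumes \<beta>: "pi < \<beta>" "\<beta> \<le> 2 * pi"
    and K: "convex K" "v \<in> interior K" "frontier K \<inter> frontier (sector v \<phi> \<beta>) = {}"
    and c: "0 \<le> c" and hardy: "one_dim_hardy \<beta> c"
  shows "hardy_valid (K \<inter> sector v \<phi> \<beta>) c"
  unfolding hardy_valid_def
proof
  let ?\<Omega> = "K \<inter> sector v \<phi> \<beta>"
  fix u assume u: "u \<in> test_functions ?\<Omega>"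
  note tu = test_functionD[OF u]
  have out: "u x = 0 \<and> grad u x = 0" if "x \<notin> ?\<Omega>" for x using tu(3,4) that by blast
  define Q where "Q = (LINT x|lborel. (norm (grad u x))\<^sup>2)"
  define k where "k x = (u x)\<^sup>2 / (bdist ?\<Omega> x)\<^sup>2" for x
  have Q: "(LINT x:?\<Omega>|lborel. grad_sq u x) = Q"
    unfolding Q_def grad_sq_eq by (rule set_integral_support) (simp add: out)
  have k: "(LINT x:?\<Omega>|lborel. (u x)\<^sup>2 / (bdist ?\<Omega> x)\<^sup>2) = (LINT x|lborel. k x)"
    unfolding k_def by (rule set_integral_support) (simp add: out)
  have Q0: "0 \<le> Q" unfolding Q_def by (intro integral_nonneg_AE) auto
  have cu: "continuous_on UNIV u"
    using smooth_fun_differentiable(1)[OF tu(1)]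
    by (intro continuous_at_imp_continuous_on ballI differentiable_imp_continuous_within)
  have um: "u \<in> borel_measurable borel" by (rule borel_measurable_continuous_onI[OF cu])
  have bm: "bdist ?\<Omega> \<in> borel_measurable borel" by (rule borel_measurable_continuous_onI[OF continuous_bdist])
  have b0: "0 \<le> bdist ?\<Omega> x" for x by (simp add: bdist_def infdist_nonneg)
  have front: "frontier ?\<Omega> \<noteq> {}" by (rule frontier_truncated_sector[OF \<beta> K(2)])
  have bpos: "0 < bdist ?\<Omega> x" if "u x \<noteq> 0" for x
  proof -
    have "open {x. u x \<noteq> 0}" by (intro open_Collect_neq cu continuous_on_const)
    moreover have "{x. u x \<noteq> 0} \<subseteq> ?\<Omega>" using out by blast
    ultimately have "x \<in> interior ?\<Omega>" using that interior_maximal by blast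
    then have "x \<notin> frontier ?\<Omega>" by (simp add: frontier_def)
    then have "infdist x (frontier ?\<Omega>) \<noteq> 0" using in_closed_iff_infdist_zero[OF frontier_closed front] by blast
    then show ?thesis using b0[of x] by (simp add: bdist_def)
  qed
  have sub: "c' * (LINT x|lborel. k x) \<le> Q" if c': "0 < c'" "c' < c" for c'
  proof (cases "integrable lborel k")
    \<comment> \<open>The Bochner integral of a function that is not integrable is 0 by convention,
      so the claim holds trivially; in the other case k is the dominating function.\<close>
    case False
    then show ?thesis using Q0 by (simp add: not_integrable_integral_eq)
  next
    case True
    have "c' < 1/4" using c' one_dim_hardy_le_quarter[OF \<beta> hardy] by simp
    moreover have "one_dim_hardy \<beta> c'" by (rule one_dim_hardy_mono[OF hardy]) (use c' in auto)
    ultimately obtain \<alpha> w where ss: "hardy_supersolution \<beta> \<alpha> c' w"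
      using one_dim_hardy_supersolution[OF \<beta> _ c'(1)] by metis
    define s where "s n = 1 / real (Suc n)" for n
    have s: "s n > 0" for n by (simp add: s_def)
    have s_lim: "s \<longlonglongrightarrow> 0" unfolding s_def by (rule LIMSEQ_Suc[OF lim_1_over_n])
    have lim: "(\<lambda>n. (u x)\<^sup>2 / (bdist ?\<Omega> x + 4 * s n)\<^sup>2) \<longlonglongrightarrow> k x" for x
    proof (cases "u x = 0")
      case False
      have "(\<lambda>n. (u x)\<^sup>2 / (bdist ?\<Omega> x + 4 * s n)\<^sup>2) \<longlonglongrightarrow> (u x)\<^sup>2 / (bdist ?\<Omega> x + 4 * 0)\<^sup>2"
        using bpos[OF False] by (intro tendsto_intros s_lim) auto
      then show ?thesis by (simp add: k_def)
    qed (simp add: k_def)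
    have "(\<lambda>n. LINT x|lborel. (u x)\<^sup>2 / (bdist ?\<Omega> x + 4 * s n)\<^sup>2) \<longlonglongrightarrow> (LINT x|lborel. k x)"
    proof (rule integral_dominated_convergence[where w = k])
      show "AE x in lborel. norm ((u x)\<^sup>2 / (bdist ?\<Omega> x + 4 * s n)\<^sup>2) \<le> k x" for n
      proof (rule AE_I2)
        fix x
        show "norm ((u x)\<^sup>2 / (bdist ?\<Omega> x + 4 * s n)\<^sup>2) \<le> k x"
        proof (cases "u x = 0")
          case False
          have "(u x)\<^sup>2 / (bdist ?\<Omega> x + 4 * s n)\<^sup>2 \<le> (u x)\<^sup>2 / (bdist ?\<Omega> x)\<^sup>2"
            using bpos[OF False] s[of n] by (intro divide_left_mono power_mono mult_pos_pos zero_less_power) auto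
          then show ?thesis by (simp add: k_def)
        qed (simp add: k_def)
      qed
      show "(\<lambda>x. (u x)\<^sup>2 / (bdist ?\<Omega> x + 4 * s n)\<^sup>2) \<in> borel_measurable lborel" for n
        using um bm by simp
    qed (use True lim in auto)
    then have "(\<lambda>n. c' * (LINT x|lborel. (u x)\<^sup>2 / (bdist ?\<Omega> x + 4 * s n)\<^sup>2)) \<longlonglongrightarrow> c' * (LINT x|lborel. k x)"
      by (rule tendsto_mult_left)
    then show ?thesis
      by (rule LIMSEQ_le_const2) (use hardy_shifted_distance[OF ss K u s] in \<open>auto simp: Q_def\<close>)
  qed
  have "c * (LINT x|lborel. k x) \<le> Q"
  proof (cases "c = 0")
    case False
    then have "0 < c" using c by simp
    have "((\<lambda>c'. c' * (LINT x|lborel. k x)) \<longlongrightarrow> c * (LINT x|lborel. k x)) (at_left c)" by (intro tendsto_intros)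
    then show ?thesis
      by (rule tendsto_upperbound) (use \<open>0 < c\<close> sub in \<open>auto simp: eventually_at_left_field intro!: exI[of _ 0]\<close>)
  qed (use Q0 in simp)
  then show "c * (LINT x:?\<Omega>|lborel. (u x)\<^sup>2 / (bdist ?\<Omega> x)\<^sup>2) \<le> (LINT x:?\<Omega>|lborel. grad_sq u x)"
    unfolding Q k .
qed

text \<open>The right-hand side depends on the opening angle alone, so any two truncated sectors
  with the same \<beta> have the same constant.\<close>

lemma hardy_constant_truncated_sector:
  assumes \<beta>: "pi < \<beta>" "\<beta> \<le> 2 * pi"
    and K: "convex K" "v \<in> interior K" "frontier K \<inter> frontier (sector v \<phi> \<beta>) = {}"
  shows "hardy_constant (K \<inter> sector v \<phi> \<beta>) = Sup {c. 0 \<le> c \<and> one_dim_hardy \<beta> c}"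
proof -
  have "hardy_valid (K \<inter> sector v \<phi> \<beta>) c \<longleftrightarrow> one_dim_hardy \<beta> c" if "0 \<le> c" for c
    using hardy_valid_imp_one_dim[OF \<beta> K(2) that] one_dim_imp_hardy_valid[OF \<beta> K that] by blast
  then have "{c. 0 \<le> c \<and> hardy_valid (K \<inter> sector v \<phi> \<beta>) c} = {c. 0 \<le> c \<and> one_dim_hardy \<beta> c}" by blast
  then show ?thesis unfolding hardy_constant_def hardy_valid_def by simp
qed

theorem theorem5:
  fixes \<beta> \<phi> :: real and v :: "real^2" and K :: "(real^2) set"
  assumes "pi < \<beta>" and "\<beta> \<le> 2 * pi"
    and "convex K" and "\<not> bounded K"
    and "v \<in> interior K"
    and "frontier K \<inter> frontier (sector v \<phi> \<beta>) = {}"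
  shows "hardy_constant (K \<inter> sector v \<phi> \<beta>) = c_beta \<beta>"
proof -
  \<comment> \<open>The whole plane is convex with empty frontier, so the model sector is itself a
    truncated sector.\<close>
  have "model_sector \<beta> = UNIV \<inter> sector 0 0 \<beta>"
    by (simp add: sector_def rot2_def vector2_eta)
  then have "c_beta \<beta> = hardy_constant (UNIV \<inter> sector 0 0 \<beta>)" by (simp add: c_beta_def)
  also have "\<dots> = Sup {c. 0 \<le> c \<and> one_dim_hardy \<beta> c}"
    by (rule hardy_constant_truncated_sector[OF assms(1,2)]) simp_all
  also have "\<dots> = hardy_constant (K \<inter> sector v \<phi> \<beta>)"
    by (rule hardy_constant_truncated_sector[OF assms(1,2,3,5,6), symmetric])
  finally show ?thesis ..
qed

end
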